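(* Let $f,g,u_0$ satisfy assumptions (i)–(vi) of the context, let $u$ be the vanishing viscosity solution of Problem $P$, and for $\delta>0$ let $u^\delta$ be the front tracking approximation, i.e. the vanishing viscosity solution of Problem $P^\delta$. Let $u^\Delta$ and $u^{\delta,\Delta}$ be the Godunov approximations of $u$ and $u^\delta$ defined in the context. Assume that for some constant $\mathcal K_3$ independent of $\delta$ and $\Delta$, $$\mathrm{TV}(u^\Delta(\cdot,t)),\ \mathrm{TV}(u^{\delta,\Delta}(\cdot,t)),\ \mathrm{TV}(u(\cdot,t)),\ \mathrm{TV}(u^\delta(\cdot,t))\le\mathcal K_3,\qquad t\in[0,T].$$ Then for all $t\in[0,T]$ $$\|u(\cdot,t)-u^\delta(\cdot,t)\|_{L^1(\mathbb R)}\le 2(Y\mathcal K_3\mathcal C_1)^{1/2}\,\delta+\delta\,\mathrm{TV}(u_0)+\|u_0-u_0^\delta\|_{L^1(\mathbb R)},$$ where $Y=X+2T\max(L_f,L_g)$ and $\mathcal C_1=1+\tfrac18T\max(\|f''\|_\infty,\|g''\|_\infty)$. If moreover $u_0^\delta$ is constructed by the cell-average construction (R) of the context, then the estimate holds without the final two terms $\delta\,\mathrm{TV}(u_0)+\|u_0-u_0^\delta\|_{L^1(\mathbb R)}$ on the right side.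
   Context: **Data.** $\underline u<\overline u$ are real, $T>0$. $f,g:[\underline u,\overline u]\to\mathbb R$ and $u_0:\mathbb R\to\mathbb R$ satisfy: (i) $g(\underline u)=f(\underline u)$, $g(\overline u)=f(\overline u)$; (ii) $f,g\in C^2([\underline u,\overline u])$; (iii) $f$ and $g$ are not linear on any nondegenerate interval; (iv) $f(u)\ne g(u)$ for $u\in(\underline u,\overline u)$ except for finitely many (possibly zero) flux crossings in $(\underline u,\overline u)$, where $u_\chi$ is a flux crossing if $f(u_\chi)=g(u_\chi)$ and for some $\epsilon>0$, $(g(a)-f(a))(g(b)-f(b))<0$ for all $a\in(u_\chi-\epsilon,u_\chi)$, $b\in(u_\chi,u_\chi+\epsilon)$; (v) $u_0\in L^\infty(\mathbb R)$ has finite total variation $\mathrm{TV}(u_0)$, and $u_0(x)\in[\underline u,\overline u]$ for all $x$; (vi) for some $X>0$ and constants $u_L,u_R$, $u_0(x)=u_L$ for $x\le -X$ and $u_0(x)=u_R$ for $x\ge X$. $L_f,L_g$ are Lipschitz constants of $f,g$ on $[\underline u,\overline u]$, and $\|q\|_\infty=\max_{[\underline u,\overline u]}|q|$. **Problem $P$.** With $H$ the Heaviside function, $\mathcal F(x,u)=H(-x)g(u)+H(x)f(u)$ and $\Pi_T=\mathbb R\times(0,T)$: $u_t+\mathcal F(x,u)_x=0$ in $\Pi_T$, $u(x,0)=u_0(x)$. **Front tracking data.** For each $\delta>0$ choose breakpoints $\underline u=\mathsf u_0<\mathsf u_1<\dots<\mathsf u_K=\overline u$ with $\mathsf u_{k+1}-\mathsf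 u_k\le\delta$; $f^\delta,g^\delta$ are the continuous piecewise linear interpolants of $f,g$ at these breakpoints. $u_0^\delta$ is piecewise constant with finitely many jumps, takes values in $[\underline u,\overline u]$, satisfies $\mathrm{TV}(u_0^\delta)\le\mathrm{TV}(u_0)$, equals $u_L$ for $x\le -X$ and $u_R$ for $x\ge X$ (same $X$ as in (vi)), and $\|u_0^\delta-u_0\|_{L^1(\mathbb R)}=O(\delta)$ as $\delta\to0$. Problem $P^\delta$ is Problem $P$ with $f,g,u_0$ replaced by $f^\delta,g^\delta,u_0^\delta$. The front tracking algorithm computes exactly the vanishing viscosity solution $u^\delta$ of $P^\delta$. Standing assumption: for every $t\in[0,T]$, $u^\delta(\cdot,t)$ is piecewise constant with finitely many discontinuities. **Construction (R).** $u_0^\delta=u_L$ for $x<-X$, $u_0^\delta=u_R$ for $x\ge X$; and for some partition $-X=z_0<z_1<\dots<z_{\mathcal M}=X$ with $z_i-z_{i-1}\le\delta$ and total variation of $u_0$ on $(z_{i-1},z_i)$ at most $\delta$ for each $i=1,\dots,\mathcal M$, $u_0^\delta$ is constant on $[z_{i-1},z_i)$ with value $\frac1{z_i-z_{i-1}}\int_{z_{i-1}}^{z_i}u_0\,dx$. **Vanishing viscosity solution of $P$.** A measurable $u:\Pi_T\to\mathbb R$ such that: (1) $u\in L^\infty(\Pi_T)$, $u\in[\underline u,\overline u]$ a.e.; (2) for all $\phi\in C_c^\infty(\mathbb R\times[0,T))$, $\iint_{\Pi_T}(u\phi_t+\mathcal F(x,u)\phi_x)\,dx\,dt+\int_{\mathbb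 R}u_0\phi(x,0)\,dx=0$; (3) for every $0\le\phi\in C_c^\infty(\mathbb R\times[0,T))$ vanishing for $x\ge0$ and every $c\in[\underline u,\overline u]$, $\iint_{\Pi_T}(|u-c|\phi_t+\mathrm{sgn}(u-c)(g(u)-g(c))\phi_x)\,dx\,dt+\int_{\mathbb R}|u_0-c|\phi(x,0)\,dx\ge0$, and for every such $\phi$ vanishing instead for $x\le0$ the same inequality holds with $g$ replaced by $f$; (4) for a.e. $t\in(0,T)$ the one-sided traces $u_-=\operatorname{ess\,lim}_{x\uparrow0}u(x,t)$, $u_+=\operatorname{ess\,lim}_{x\downarrow0}u(x,t)$ exist and satisfy the $\Gamma$ condition: $g(u_-)=f(u_+)$, and there is $u_\Gamma$ in the closed interval between $u_-$ and $u_+$ such that $(u_+-u_\Gamma)(f(z)-f(u_+))\ge0$ for all $z$ between $u_+$ and $u_\Gamma$ (inclusive) and $(u_\Gamma-u_-)(g(z)-g(u_-))\ge0$ for all $z$ between $u_-$ and $u_\Gamma$ (inclusive). The definition for $P^\delta$ is the same with $f^\delta,g^\delta,u_0^\delta$. Problems $P$ and $P^\delta$ each have a unique vanishing viscosity solution, $u$ and $u^\delta$ respectively, and the representatives in $C([0,T];L^1_{\mathrm{loc}}(\mathbb R))$ are used. **Godunov scheme.** Let $\Delta=(\Delta x,\Delta t)$, $\lambda=\Delta t/\Delta x$ fixed with $\lambda\max(L_f,L_g)\le1/2$, $x_j=j\Delta x$, $x_{j\pm1/2}=x_j\pm\Delta x/2$, $t^n=n\Delta t$, $0\le n\le N$ with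 $N\Delta t\in[T,T+\Delta t)$. For Lipschitz $q$ put $\bar q(v,u)=\min_{[u,v]}q$ if $u\le v$ and $\bar q(v,u)=\max_{[v,u]}q$ if $u>v$. Set $h_{j+1/2}=\bar g$ if $x_{j+1/2}<0$ and $h_{j+1/2}=\bar f$ if $x_{j+1/2}>0$. Then $U_j^0=\frac1{\Delta x}\int_{x_{j-1/2}}^{x_{j+1/2}}u_0\,dx$ and $U_j^{n+1}=U_j^n-\lambda\bigl(h_{j+1/2}(U_{j+1}^n,U_j^n)-h_{j-1/2}(U_j^n,U_{j-1}^n)\bigr)$; $u^\Delta(x,t)=U_j^n$ for $x\in(x_{j-1/2},x_{j+1/2}]$, $t\in[t^n,t^{n+1})$. $U_j^{\delta,n}$ and $u^{\delta,\Delta}$ are defined in the same way from $f^\delta,g^\delta,u_0^\delta$. *)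

theory Defs
  imports "HOL-Analysis.Analysis"
begin

section \<open>Norms and total variation\<close>

text \<open>Functions that are only determined almost everywhere are represented by functions
  on \<open>real\<close>.  All integrals are taken over the complete measure \<^term>\<open>lebesgue\<close>, so that
  the fluxes, which are only meaningful on \<open>{lo..hi}\<close>, may be arbitrary elsewhere without
  destroying measurability of \<open>f (u x t)\<close> when \<open>u\<close> leaves \<open>{lo..hi}\<close> on a null set.\<close>

definition L1_norm :: "(real \<Rightarrow> real) \<Rightarrow> ennreal"
  where "L1_norm v = (\<integral>\<^sup>+ x. ennreal \<bar>v x\<bar> \<partial>lebesgue)"

definition pointwise_variation :: "real set \<Rightarrow> (real \<Rightarrow> real) \<Rightarrow> ennreal"
  where "pointwise_variation I v =
    (SUP xs \<in> {xs. sorted xs \<and> set xs \<subseteq> I}.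
       \<Sum>i<length xs - 1. ennreal \<bar>v (xs ! Suc i) - v (xs ! i)\<bar>)"

text \<open>The total variation of an \<open>L\<^sup>1\<close>-class on an interval: the least pointwise variation among
  the representatives of the class.\<close>

definition TV_on :: "real set \<Rightarrow> (real \<Rightarrow> real) \<Rightarrow> ennreal"
  where "TV_on I v =
    (INF w \<in> {w. AE x in lebesgue. x \<in> I \<longrightarrow> w x = v x}. pointwise_variation I w)"

abbreviation TV :: "(real \<Rightarrow> real) \<Rightarrow> ennreal"
  where "TV v \<equiv> TV_on UNIV v"

definition sup_norm_on :: "real set \<Rightarrow> (real \<Rightarrow> real) \<Rightarrow> real"
  where "sup_norm_on I q = (SUP x\<in>I. \<bar>q x\<bar>)"

definition deriv_on :: "real set \<Rightarrow> (real \<Rightarrow> real) \<Rightarrow> real \<Rightarrow> real"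
  where "deriv_on I q x = vector_derivative q (at x within I)"

definition C2_on :: "real set \<Rightarrow> (real \<Rightarrow> real) \<Rightarrow> bool"
  where "C2_on I q \<longleftrightarrow>
    q differentiable_on I \<and> deriv_on I q differentiable_on I \<and>
    continuous_on I (deriv_on I (deriv_on I q))"

section \<open>Data of the problem\<close>

text \<open>``Linear'' means of the form \<open>m * x + c\<close>.\<close>

definition nowhere_linear_on :: "real \<Rightarrow> real \<Rightarrow> (real \<Rightarrow> real) \<Rightarrow> bool"
  where "nowhere_linear_on lo hi q \<longleftrightarrow>
    \<not> (\<exists>a b m c. lo \<le> a \<and> a < b \<and> b \<le> hi \<and> (\<forall>x\<in>{a..b}. q x = m * x + c))"

definition flux_crossing :: "real \<Rightarrow> real \<Rightarrow> (real \<Rightarrow> real) \<Rightarrow> (real \<Rightarrow> real) \<Rightarrow> real \<Rightarrow> bool"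
  where "flux_crossing lo hi f g c \<longleftrightarrow>
    f c = g c \<and>
    (\<exists>\<epsilon>>0. lo \<le> c - \<epsilon> \<and> c + \<epsilon> \<le> hi \<and>
       (\<forall>a\<in>{c - \<epsilon><..<c}. \<forall>b\<in>{c<..<c + \<epsilon>}. (g a - f a) * (g b - f b) < 0))"

definition admissible_fluxes :: "real \<Rightarrow> real \<Rightarrow> (real \<Rightarrow> real) \<Rightarrow> (real \<Rightarrow> real) \<Rightarrow> bool"
  where "admissible_fluxes lo hi f g \<longleftrightarrow>
    g lo = f lo \<and> g hi = f hi \<and>
    C2_on {lo..hi} f \<and> C2_on {lo..hi} g \<and>
    nowhere_linear_on lo hi f \<and> nowhere_linear_on lo hi g \<and>
    finite {c \<in> {lo<..<hi}. f c = g c} \<and>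
    (\<forall>c\<in>{lo<..<hi}. f c = g c \<longrightarrow> flux_crossing lo hi f g c)"

definition admissible_initial_data ::
    "real \<Rightarrow> real \<Rightarrow> real \<Rightarrow> real \<Rightarrow> real \<Rightarrow> (real \<Rightarrow> real) \<Rightarrow> bool"
  where "admissible_initial_data lo hi X uL uR u0 \<longleftrightarrow>
    u0 \<in> borel_measurable lebesgue \<and> TV u0 < \<infinity> \<and> (\<forall>x. u0 x \<in> {lo..hi}) \<and>
    X > 0 \<and> (\<forall>x\<le>-X. u0 x = uL) \<and> (\<forall>x\<ge>X. u0 x = uR)"

section \<open>Test functions\<close>

definition D_x :: "(real \<times> real \<Rightarrow> real) \<Rightarrow> real \<times> real \<Rightarrow> real"
  where "D_x \<phi> = (\<lambda>(x, t). deriv (\<lambda>y. \<phi> (y, t)) x)"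

definition D_t :: "(real \<times> real \<Rightarrow> real) \<Rightarrow> real \<times> real \<Rightarrow> real"
  where "D_t \<phi> = (\<lambda>(x, t). deriv (\<lambda>s. \<phi> (x, s)) t)"

primrec C_k :: "nat \<Rightarrow> (real \<times> real \<Rightarrow> real) \<Rightarrow> bool"
  where
    "C_k 0 \<phi> \<longleftrightarrow> continuous_on UNIV \<phi>"
  | "C_k (Suc k) \<phi> \<longleftrightarrow> (\<forall>p. \<phi> differentiable (at p)) \<and> C_k k (D_x \<phi>) \<and> C_k k (D_t \<phi>)"

text \<open>A smooth function on \<open>\<real> \<times> [0,T)\<close> with compact support is represented by a smooth
  extension to the plane with compact support in \<open>\<real> \<times> (-\<infinity>,T)\<close>.  Only the values on
  \<open>t \<ge> 0\<close> matter, so sign and vanishing conditions are imposed on \<open>t \<ge> 0\<close> only.\<close>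

definition test_function :: "real \<Rightarrow> (real \<times> real \<Rightarrow> real) \<Rightarrow> bool"
  where "test_function T \<phi> \<longleftrightarrow>
    (\<forall>k. C_k k \<phi>) \<and> compact (closure {p. \<phi> p \<noteq> 0}) \<and>
    closure {p. \<phi> p \<noteq> 0} \<subseteq> UNIV \<times> {..<T}"

definition nonneg_test_function :: "real \<Rightarrow> (real \<times> real \<Rightarrow> real) \<Rightarrow> bool"
  where "nonneg_test_function T \<phi> \<longleftrightarrow>
    test_function T \<phi> \<and> (\<forall>x t. 0 \<le> t \<longrightarrow> 0 \<le> \<phi> (x, t))"

section \<open>Vanishing viscosity solutions\<close>

definition strip :: "real \<Rightarrow> (real \<times> real) set"
  where "strip T = UNIV \<times> {0<..<T}"

definition heaviside :: "real \<Rightarrow> real"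
  where "heaviside x = (if 0 < x then 1 else 0)"

definition flux :: "(real \<Rightarrow> real) \<Rightarrow> (real \<Rightarrow> real) \<Rightarrow> real \<Rightarrow> real \<Rightarrow> real"
  where "flux f g x v = heaviside (- x) * g v + heaviside x * f v"

definition weak_solution ::
    "real \<Rightarrow> (real \<Rightarrow> real) \<Rightarrow> (real \<Rightarrow> real) \<Rightarrow> (real \<Rightarrow> real) \<Rightarrow> (real \<Rightarrow> real \<Rightarrow> real) \<Rightarrow> bool"
  where "weak_solution T f g u0 u \<longleftrightarrow>
    (\<forall>\<phi>. test_function T \<phi> \<longrightarrow>
       (LINT p:strip T|lebesgue. case p of (x, t) \<Rightarrow>
          u x t * D_t \<phi> (x, t) + flux f g x (u x t) * D_x \<phi> (x, t))
       + (LINT x|lebesgue. u0 x * \<phi> (x, 0)) = 0)"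

definition kruzkov_inequality ::
    "real \<Rightarrow> (real \<Rightarrow> real) \<Rightarrow> (real \<Rightarrow> real) \<Rightarrow> (real \<Rightarrow> real \<Rightarrow> real) \<Rightarrow>
     real \<Rightarrow> (real \<times> real \<Rightarrow> real) \<Rightarrow> bool"
  where "kruzkov_inequality T q u0 u c \<phi> \<longleftrightarrow>
    (LINT p:strip T|lebesgue. case p of (x, t) \<Rightarrow>
       \<bar>u x t - c\<bar> * D_t \<phi> (x, t) + sgn (u x t - c) * (q (u x t) - q c) * D_x \<phi> (x, t))
    + (LINT x|lebesgue. \<bar>u0 x - c\<bar> * \<phi> (x, 0)) \<ge> 0"

definition ess_lim_left_0 :: "(real \<Rightarrow> real) \<Rightarrow> real \<Rightarrow> bool"
  where "ess_lim_left_0 v l \<longleftrightarrow>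
    (\<forall>\<epsilon>>0. \<exists>d>0. AE x in lebesgue. x \<in> {-d<..<0} \<longrightarrow> \<bar>v x - l\<bar> < \<epsilon>)"

definition ess_lim_right_0 :: "(real \<Rightarrow> real) \<Rightarrow> real \<Rightarrow> bool"
  where "ess_lim_right_0 v l \<longleftrightarrow>
    (\<forall>\<epsilon>>0. \<exists>d>0. AE x in lebesgue. x \<in> {0<..<d} \<longrightarrow> \<bar>v x - l\<bar> < \<epsilon>)"

definition Gamma_condition :: "(real \<Rightarrow> real) \<Rightarrow> (real \<Rightarrow> real) \<Rightarrow> real \<Rightarrow> real \<Rightarrow> bool"
  where "Gamma_condition f g um up \<longleftrightarrow>
    g um = f up \<and>
    (\<exists>uG\<in>closed_segment um up.
       (\<forall>z\<in>closed_segment up uG. (up - uG) * (f z - f up) \<ge> 0) \<and>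
       (\<forall>z\<in>closed_segment um uG. (uG - um) * (g z - g um) \<ge> 0))"

definition vv_solution ::
    "real \<Rightarrow> real \<Rightarrow> real \<Rightarrow> (real \<Rightarrow> real) \<Rightarrow> (real \<Rightarrow> real) \<Rightarrow> (real \<Rightarrow> real) \<Rightarrow>
     (real \<Rightarrow> real \<Rightarrow> real) \<Rightarrow> bool"
  where "vv_solution lo hi T f g u0 u \<longleftrightarrow>
    (\<lambda>(x, t). u x t) \<in> borel_measurable (lebesgue_on (strip T)) \<and>
    (AE (x, t) in lebesgue. (x, t) \<in> strip T \<longrightarrow> u x t \<in> {lo..hi}) \<and>
    weak_solution T f g u0 u \<and>
    (\<forall>\<phi> c. nonneg_test_function T \<phi> \<and> c \<in> {lo..hi} \<longrightarrow>
       ((\<forall>x t. 0 \<le> x \<and> 0 \<le> t \<longrightarrow> \<phi> (x, t) = 0) \<longrightarrow> kruzkov_inequality T g u0 u c \<phi>) \<and>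
       ((\<forall>x t. x \<le> 0 \<and> 0 \<le> t \<longrightarrow> \<phi> (x, t) = 0) \<longrightarrow> kruzkov_inequality T f u0 u c \<phi>)) \<and>
    (AE t in lebesgue. t \<in> {0<..<T} \<longrightarrow>
       (\<exists>um up. ess_lim_left_0 (\<lambda>x. u x t) um \<and> ess_lim_right_0 (\<lambda>x. u x t) up \<and>
                Gamma_condition f g um up))"

definition continuous_L1_loc :: "real \<Rightarrow> (real \<Rightarrow> real \<Rightarrow> real) \<Rightarrow> bool"
  where "continuous_L1_loc T u \<longleftrightarrow>
    (\<forall>R>0. \<forall>t\<in>{0..T}.
       set_integrable lebesgue {-R..R} (\<lambda>x. u x t) \<and>
       ((\<lambda>s. LINT x:{-R..R}|lebesgue. \<bar>u x s - u x t\<bar>) \<longlongrightarrow> 0) (at t within {0..T}))"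

text \<open>The problem has a unique vanishing viscosity solution (as a class in \<open>L\<^sup>\<infinity>\<close> of the strip),
  and \<open>u\<close> is its representative that is continuous in time.\<close>

definition the_vv_solution ::
    "real \<Rightarrow> real \<Rightarrow> real \<Rightarrow> (real \<Rightarrow> real) \<Rightarrow> (real \<Rightarrow> real) \<Rightarrow> (real \<Rightarrow> real) \<Rightarrow>
     (real \<Rightarrow> real \<Rightarrow> real) \<Rightarrow> bool"
  where "the_vv_solution lo hi T f g u0 u \<longleftrightarrow>
    vv_solution lo hi T f g u0 u \<and>
    (\<forall>v. vv_solution lo hi T f g u0 v \<longrightarrow>
       (AE (x, t) in lebesgue. (x, t) \<in> strip T \<longrightarrow> v x t = u x t)) \<and>
    continuous_L1_loc T u"

section \<open>Front tracking data\<close>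

definition breakpoints :: "real \<Rightarrow> real \<Rightarrow> real \<Rightarrow> nat \<Rightarrow> (nat \<Rightarrow> real) \<Rightarrow> bool"
  where "breakpoints lo hi \<delta> K b \<longleftrightarrow>
    b 0 = lo \<and> b K = hi \<and> (\<forall>k<K. b k < b (Suc k) \<and> b (Suc k) - b k \<le> \<delta>)"

text \<open>For \<open>w\<close> in \<open>{b 0..b K}\<close> the index \<open>k\<close> satisfies \<open>k < K\<close> and \<open>w \<in> {b k..b (Suc k)}\<close>;
  values for \<open>w\<close> outside of this interval are irrelevant.\<close>

definition pl_interpolant :: "(nat \<Rightarrow> real) \<Rightarrow> (real \<Rightarrow> real) \<Rightarrow> real \<Rightarrow> real"
  where "pl_interpolant b q w =
    (let k = (LEAST k. w \<le> b (Suc k))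
     in q (b k) + (q (b (Suc k)) - q (b k)) / (b (Suc k) - b k) * (w - b k))"

definition piecewise_constant :: "(real \<Rightarrow> real) \<Rightarrow> bool"
  where "piecewise_constant v \<longleftrightarrow>
    (\<exists>S. finite S \<and> (\<forall>x y. x < y \<and> {x..y} \<inter> S = {} \<longrightarrow> v x = v y))"

text \<open>The value at the single point \<open>-X\<close> is left free: the cell averages below take there the
  value of the first cell instead of \<open>uL\<close>.\<close>

definition front_tracking_initial_data ::
    "real \<Rightarrow> real \<Rightarrow> real \<Rightarrow> real \<Rightarrow> real \<Rightarrow> (real \<Rightarrow> real) \<Rightarrow> (real \<Rightarrow> real) \<Rightarrow> bool"
  where "front_tracking_initial_data lo hi X uL uR u0 v \<longleftrightarrow>
    piecewise_constant v \<and> (\<forall>x. v x \<in> {lo..hi}) \<and> TV v \<le> TV u0 \<and>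
    (\<forall>x. x < - X \<longrightarrow> v x = uL) \<and> (\<forall>x\<ge>X. v x = uR)"

definition cell_average_data ::
    "real \<Rightarrow> real \<Rightarrow> real \<Rightarrow> (real \<Rightarrow> real) \<Rightarrow> real \<Rightarrow> (real \<Rightarrow> real) \<Rightarrow> bool"
  where "cell_average_data X uL uR u0 \<delta> v \<longleftrightarrow>
    (\<forall>x. x < - X \<longrightarrow> v x = uL) \<and> (\<forall>x\<ge>X. v x = uR) \<and>
    (\<exists>M z. z 0 = -X \<and> z M = X \<and>
       (\<forall>i<M. z i < z (Suc i) \<and> z (Suc i) - z i \<le> \<delta> \<and>
          TV_on {z i<..<z (Suc i)} u0 \<le> ennreal \<delta> \<and>
          (\<forall>x\<in>{z i..<z (Suc i)}.
             v x = 1 / (z (Suc i) - z i) * (LINT y:{z i..z (Suc i)}|lebesgue. u0 y))))"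

section \<open>Godunov scheme\<close>

definition godunov_flux :: "(real \<Rightarrow> real) \<Rightarrow> real \<Rightarrow> real \<Rightarrow> real"
  where "godunov_flux q v u =
    (if u \<le> v then (INF w\<in>{u..v}. q w) else (SUP w\<in>{v..u}. q w))"

text \<open>The flux \<open>h\<close> at the interface \<open>(j + 1/2) \<Delta>x\<close>, which is never the origin.\<close>

definition interface_flux ::
    "real \<Rightarrow> (real \<Rightarrow> real) \<Rightarrow> (real \<Rightarrow> real) \<Rightarrow> int \<Rightarrow> real \<Rightarrow> real \<Rightarrow> real"
  where "interface_flux \<Delta>x f g j =
    (if (of_int j + 1/2) * \<Delta>x < 0 then godunov_flux g else godunov_flux f)"

primrec godunov ::
    "real \<Rightarrow> real \<Rightarrow> (real \<Rightarrow> real) \<Rightarrow> (real \<Rightarrow> real) \<Rightarrow> (real \<Rightarrow> real) \<Rightarrow> nat \<Rightarrow> int \<Rightarrow> real"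
  where
    "godunov lam \<Delta>x f g u0 0 = (\<lambda>j.
       1 / \<Delta>x * (LINT x:{(of_int j - 1/2) * \<Delta>x..(of_int j + 1/2) * \<Delta>x}|lebesgue. u0 x))"
  | "godunov lam \<Delta>x f g u0 (Suc n) = (\<lambda>j. let U = godunov lam \<Delta>x f g u0 n in
       U j - lam * (interface_flux \<Delta>x f g j (U (j + 1)) (U j)
                    - interface_flux \<Delta>x f g (j - 1) (U j) (U (j - 1))))"

text \<open>The ceiling is the index \<open>j\<close> with \<open>x \<in> {(j - 1/2) \<Delta>x<..(j + 1/2) \<Delta>x}\<close>; the time step
  is \<open>lam * \<Delta>x\<close>.\<close>

definition godunov_approx ::
    "real \<Rightarrow> real \<Rightarrow> (real \<Rightarrow> real) \<Rightarrow> (real \<Rightarrow> real) \<Rightarrow> (real \<Rightarrow> real) \<Rightarrow> real \<Rightarrow> real \<Rightarrow> real"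
  where "godunov_approx lam \<Delta>x f g u0 x t =
    godunov lam \<Delta>x f g u0 (nat \<lfloor>t / (lam * \<Delta>x)\<rfloor>) \<lceil>x / \<Delta>x - 1/2\<rceil>"

end

theory Submission
  imports Defs "HOL-Complex_Analysis.Great_Picard"
begin

text \<open>Both solutions are limits of Godunov approximations: the variation bounds and the Lipschitz
  dependence of the spatial primitives on time give compactness, every limit is a vanishing viscosity
  solution, and these are unique.  The primitives of the two Godunov approximations solve monotone
  schemes for Hamilton-Jacobi equations, so the primitive of their difference grows at most like
  \<open>T\<close> times the distance of the fluxes, which is \<open>O(\<delta>\<^sup>2)\<close> by the interpolation error.  Pairing the
  limit difference \<open>w\<close> with its truncation \<open>max (-1) (min 1 (w / s))\<close>, of variation at most \<open>2 * K3 / s\<close>,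
  turns this into an \<open>L\<^sup>1\<close> bound up to \<open>Y * s / 2\<close>, since both solutions equal the constant states
  outside \<open>{-Y..Y}\<close>, and \<open>s\<close> of order \<open>\<delta>\<close> is optimal.  In the general case the scheme with
  interpolated fluxes is first started from \<open>u0\<close> and compared to \<open>u\<^sup>\<delta>\<close> by \<open>L\<^sup>1\<close> contraction; cell averages
  instead change the primitive of the data by only \<open>\<delta>\<^sup>2\<close>.\<close>

section \<open>The Godunov flux\<close>

text \<open>A sup bound on a primitive controls an \<open>L\<^sup>1\<close> norm only through the
  variation and at the cost of a square root. The rate is nevertheless linear because every error in
  the primitive is quadratic in \<delta>: \<open>T * e\<close> with
  \<open>e = max Mf Mg * \<delta>\<^sup>2 / 8\<close> from the fluxes, and
  \<open>\<delta>\<^sup>2\<close> from cell averages. Their sum is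
  \<open>C1 * \<delta>\<^sup>2\<close>. The main obstacle is the interface. Uniqueness holds in a
  class defined by traces at the origin and the \<Gamma> condition, so a limit must be shown to
  belong to it. The variation bound yields traces at almost every time. The \<Gamma> condition comes
  from entropy inequalities against discrete steady states that may jump at the origin; constants
  are not enough, as they need not be steady in the one cell whose two faces carry different fluxes.
  That cell is treated separately wherever a constant is compared with the scheme. Variation is a
  property of classes, so it is used through nearly optimal representatives with a small slack. The
  estimate first holds at almost every time; continuity in time gives it at all times.\<close>

lemma godunov_flux_min:
  assumes "continuous_on {lo..hi} q" "lo \<le> u" "u \<le> v" "v \<le> hi"
  obtains w where "w \<in> {u..v}" "godunov_flux q v u = q w" "\<And>z. z \<in> {u..v} \<Longrightarrow> q w \<le> q z"
proof -
  have "continuous_on {u..v} q"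
    using assms by (auto intro: continuous_on_subset)
  then obtain w where w: "w \<in> {u..v}" "\<And>z. z \<in> {u..v} \<Longrightarrow> q w \<le> q z"
    using continuous_attains_inf[of "{u..v}" q] assms by auto
  have "(INF w\<in>{u..v}. q w) = q w"
    using w by (intro cInf_eq_minimum) auto
  then show thesis
    using w assms that by (auto simp: godunov_flux_def)
qed

lemma godunov_flux_max:
  assumes "continuous_on {lo..hi} q" "lo \<le> v" "v \<le> u" "u \<le> hi"
  obtains w where "w \<in> {v..u}" "godunov_flux q v u = q w" "\<And>z. z \<in> {v..u} \<Longrightarrow> q z \<le> q w"
proof (cases "u = v")
  case True
  then show thesis using that[of v] by (simp add: godunov_flux_def)
next
  case False
  have "continuous_on {v..u} q"
    using assms by (auto intro: continuous_on_subset)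
  then obtain w where w: "w \<in> {v..u}" "\<And>z. z \<in> {v..u} \<Longrightarrow> q z \<le> q w"
    using continuous_attains_sup[of "{v..u}" q] assms by auto
  have "(SUP w\<in>{v..u}. q w) = q w"
    using w by (intro cSup_eq_maximum) auto
  then show thesis
    using w assms that False by (auto simp: godunov_flux_def)
qed

lemma godunov_flux_same [simp]: "godunov_flux q c c = q c"
  by (simp add: godunov_flux_def)

lemma godunov_flux_in_range:
  assumes "continuous_on {lo..hi} q" "u \<in> {lo..hi}" "v \<in> {lo..hi}"
  obtains w where "w \<in> {lo..hi}" "godunov_flux q v u = q w"
proof (cases "u \<le> v")
  case True
  then obtain w where "w \<in> {u..v}" "godunov_flux q v u = q w"
    using godunov_flux_min[OF assms(1), of u v] assms by auto
  then show thesis using assms by (intro that[of w]) auto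
next
  case False
  then obtain w where "w \<in> {v..u}" "godunov_flux q v u = q w"
    using godunov_flux_max[OF assms(1), of v u] assms by auto
  then show thesis using assms by (intro that[of w]) auto
qed

text \<open>In \<open>godunov_flux q v u\<close> the right state comes first. Raising the left state
  shrinks the interval of a minimum or enlarges that of a maximum; if it crosses \<open>v\<close>,
  the value \<open>q v\<close> separates the two.\<close>

lemma godunov_flux_mono_left:
  assumes q: "continuous_on {lo..hi} q" and "u \<in> {lo..hi}" "u' \<in> {lo..hi}" "v \<in> {lo..hi}" "u \<le> u'"
  shows "godunov_flux q v u \<le> godunov_flux q v u'"
proof -
  consider "u' \<le> v" | "u \<le> v" "v \<le> u'" | "v \<le> u" using assms by linarith
  then show ?thesis
  proof cases
    case 1
    obtain w where w: "w \<in> {u..v}" "godunov_flux q v u = q w" "\<And>z. z \<in> {u..v} \<Longrightarrow> q w \<le> q z"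
      using godunov_flux_min[OF q, of u v] assms 1 by auto
    obtain w' where w': "w' \<in> {u'..v}" "godunov_flux q v u' = q w'"
      using godunov_flux_min[OF q, of u' v] assms 1 by auto
    show ?thesis using w w' assms by auto
  next
    case 2
    obtain w where w: "godunov_flux q v u = q w" "\<And>z. z \<in> {u..v} \<Longrightarrow> q w \<le> q z"
      using godunov_flux_min[OF q, of u v] assms 2 by auto
    obtain w' where w': "godunov_flux q v u' = q w'" "\<And>z. z \<in> {v..u'} \<Longrightarrow> q z \<le> q w'"
      using godunov_flux_max[OF q, of v u'] assms 2 by auto
    have "v \<in> {u..v}" "v \<in> {v..u'}" using 2 by auto
    then have "q w \<le> q v" "q v \<le> q w'" using w(2) w'(2) by blast+
    then show ?thesis using w(1) w'(1) by simp
  next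
    case 3
    obtain w where w: "w \<in> {v..u}" "godunov_flux q v u = q w"
      using godunov_flux_max[OF q, of v u] assms 3 by auto
    obtain w' where w': "godunov_flux q v u' = q w'" "\<And>z. z \<in> {v..u'} \<Longrightarrow> q z \<le> q w'"
      using godunov_flux_max[OF q, of v u'] assms 3 by auto
    show ?thesis using w w' assms by auto
  qed
qed

text \<open>Negating the flux and exchanging the states swaps minimum and maximum, so statements
  about the right state follow from those about the left state.\<close>

lemma godunov_flux_reflect:
  "godunov_flux q v u = - godunov_flux (\<lambda>w. - q w) u v"
  by (auto simp: godunov_flux_def Inf_real_def image_image)

lemma godunov_flux_antimono_right:
  assumes q: "continuous_on {lo..hi} q" and "u \<in> {lo..hi}" "v \<in> {lo..hi}" "v' \<in> {lo..hi}" "v \<le> v'"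
  shows "godunov_flux q v' u \<le> godunov_flux q v u"
proof -
  have "continuous_on {lo..hi} (\<lambda>w. - q w)" using q by (rule continuous_on_minus)
  from godunov_flux_mono_left[OF this, of v v' u] assms show ?thesis
    unfolding godunov_flux_reflect[of q] by linarith
qed

text \<open>Only a piece of length at most \<open>u' - u\<close> is added to or removed from the
  interval. An extremum gained or lost with it is within that distance of a point of the common
  interval. A left state that crosses \<open>v\<close> is moved in two stages.\<close>

lemma godunov_flux_lipschitz_left:
  assumes q: "L-lipschitz_on {lo..hi} q"
    and "u \<in> {lo..hi}" "u' \<in> {lo..hi}" "v \<in> {lo..hi}" "u \<le> u'"
  shows "godunov_flux q v u' - godunov_flux q v u \<le> L * (u' - u)"
proof -
  have c: "continuous_on {lo..hi} q" using q by (rule lipschitz_on_continuous_on)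
  have lip: "q y \<le> q x + L * (y - x)" if "x \<in> {lo..hi}" "y \<in> {lo..hi}" "x \<le> y" for x y
    using lipschitz_onD[OF q, of x y] that by (auto simp: dist_real_def)
  have L: "0 \<le> L" using q by (rule lipschitz_on_nonneg)
  have *: "godunov_flux q v b - godunov_flux q v a \<le> L * (b - a)"
    if ab: "a \<in> {lo..hi}" "a \<le> b" "b \<le> v" for a b
  proof -
    obtain w where w: "w \<in> {a..v}" "godunov_flux q v a = q w"
      using godunov_flux_min[OF c, of a v] assms ab by auto
    obtain w' where w': "godunov_flux q v b = q w'" "\<And>z. z \<in> {b..v} \<Longrightarrow> q w' \<le> q z"
      using godunov_flux_min[OF c, of b v] assms ab by auto
    show ?thesis
    proof (cases "w \<ge> b")
      case True
      have "0 \<le> L * (b - a)" using L ab by simp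
      then show ?thesis using True w w' by (smt (verit) atLeastAtMost_iff)
    next
      case False
      have "q w' \<le> q b" using w' ab by auto
      also have "q b \<le> q w + L * (b - w)" using lip[of w b] False w ab assms by auto
      also have "L * (b - w) \<le> L * (b - a)" using w L by (intro mult_left_mono) auto
      finally show ?thesis using w w' by simp
    qed
  qed
  have **: "godunov_flux q v b - godunov_flux q v a \<le> L * (b - a)"
    if ab: "b \<in> {lo..hi}" "a \<le> b" "v \<le> a" for a b
  proof -
    obtain w where w: "w \<in> {v..b}" "godunov_flux q v b = q w"
      using godunov_flux_max[OF c, of v b] assms ab by auto
    obtain w' where w': "godunov_flux q v a = q w'" "\<And>z. z \<in> {v..a} \<Longrightarrow> q z \<le> q w'"
      using godunov_flux_max[OF c, of v a] assms ab by auto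
    show ?thesis
    proof (cases "w \<le> a")
      case True
      have "0 \<le> L * (b - a)" using L ab by simp
      then show ?thesis using True w w' by (smt (verit) atLeastAtMost_iff)
    next
      case False
      have "q w \<le> q a + L * (w - a)" using lip[of a w] False w ab assms by auto
      also have "q a \<le> q w'" using w' ab by auto
      also have "L * (w - a) \<le> L * (b - a)" using w L by (intro mult_left_mono) auto
      finally show ?thesis using w w' by simp
    qed
  qed
  consider "u' \<le> v" | "u \<le> v" "v \<le> u'" | "v \<le> u" using assms by linarith
  then show ?thesis
  proof cases
    case 2
    then show ?thesis using *[of u v] **[of u' v] assms by (auto simp: algebra_simps)
  qed (use * ** assms in auto)
qed

lemma godunov_flux_lipschitz_right:
  assumes q: "L-lipschitz_on {lo..hi} q"
    and "u \<in> {lo..hi}" "v \<in> {lo..hi}" "v' \<in> {lo..hi}" "v \<le> v'"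
  shows "godunov_flux q v u - godunov_flux q v' u \<le> L * (v' - v)"
proof -
  have "L-lipschitz_on {lo..hi} (\<lambda>w. - q w)"
    using q by (simp add: lipschitz_on_def dist_minus)
  from godunov_flux_lipschitz_left[OF this, of v v' u] assms show ?thesis
    unfolding godunov_flux_reflect[of q] by linarith
qed

text \<open>A mean value form: changing one argument at a time, monotonicity and the Lipschitz bound
  put both difference quotients into \<open>{0..L}\<close>. Multiplied by \<open>lam\<close> they
  become the weights of a convex combination in \<open>HJ_bound\<close>.\<close>

lemma godunov_flux_increment:
  assumes q: "L-lipschitz_on {lo..hi} q"
    and "u \<in> {lo..hi}" "v \<in> {lo..hi}" "u' \<in> {lo..hi}" "v' \<in> {lo..hi}"
  obtains a b where "a \<in> {0..L}" "b \<in> {0..L}"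
    "godunov_flux q v u - godunov_flux q v' u' = b * (u - u') - a * (v - v')"
proof -
  have c: "continuous_on {lo..hi} q" using q by (rule lipschitz_on_continuous_on)
  have L: "0 \<le> L" using q by (rule lipschitz_on_nonneg)
  have quot: "\<exists>b\<in>{0..L}. h x - h y = b * (x - y)"
    if "\<And>s t. s \<in> {lo..hi} \<Longrightarrow> t \<in> {lo..hi} \<Longrightarrow> s \<le> t \<Longrightarrow> h s \<le> h t \<and> h t - h s \<le> L * (t - s)"
      and "x \<in> {lo..hi}" "y \<in> {lo..hi}" for h :: "real \<Rightarrow> real" and x y
  proof (cases "x = y")
    case False
    have "0 \<le> (h x - h y) / (x - y) \<and> (h x - h y) / (x - y) \<le> L"
    proof (cases "x < y")
      case True
      then have "h x \<le> h y" "h y - h x \<le> L * (y - x)" using that(1)[of x y] that by auto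
      then show ?thesis using True by (auto simp: divide_simps algebra_simps)
    next
      case F: False
      then have "h y \<le> h x" "h x - h y \<le> L * (x - y)" using that(1)[of y x] that by auto
      then show ?thesis using F False by (auto simp: divide_simps algebra_simps)
    qed
    with False show ?thesis
      by (intro bexI[of _ "(h x - h y) / (x - y)"]) auto
  qed (use L in auto)
  have "\<exists>b\<in>{0..L}. godunov_flux q v u - godunov_flux q v u' = b * (u - u')"
    by (rule quot) (use godunov_flux_mono_left[OF c] godunov_flux_lipschitz_left[OF q] assms in auto)
  then obtain b where b: "b \<in> {0..L}" "godunov_flux q v u - godunov_flux q v u' = b * (u - u')" ..
  have "\<exists>a\<in>{0..L}. - godunov_flux q v u' - - godunov_flux q v' u' = a * (v - v')"
    by (rule quot)
      (use godunov_flux_antimono_right[OF c] godunov_flux_lipschitz_right[OF q] assms in force)+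
  then obtain a where a: "a \<in> {0..L}" "- godunov_flux q v u' - - godunov_flux q v' u' = a * (v - v')" ..
  show thesis using a b by (intro that[of a b]) auto
qed

lemma godunov_flux_lipschitz:
  assumes q: "L-lipschitz_on {lo..hi} q"
    and "u \<in> {lo..hi}" "v \<in> {lo..hi}" "u' \<in> {lo..hi}" "v' \<in> {lo..hi}"
  shows "\<bar>godunov_flux q v u - godunov_flux q v' u'\<bar> \<le> L * (\<bar>u - u'\<bar> + \<bar>v - v'\<bar>)"
proof -
  obtain a b where ab: "a \<in> {0..L}" "b \<in> {0..L}"
    "godunov_flux q v u - godunov_flux q v' u' = b * (u - u') - a * (v - v')"
    using godunov_flux_increment[OF assms] .
  have "\<bar>b * (u - u') - a * (v - v')\<bar> \<le> b * \<bar>u - u'\<bar> + a * \<bar>v - v'\<bar>"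
    using ab abs_triangle_ineq4[of "b * (u - u')" "a * (v - v')"] by (simp add: abs_mult)
  also have "\<dots> \<le> L * \<bar>u - u'\<bar> + L * \<bar>v - v'\<bar>"
    using ab by (intro add_mono mult_right_mono) auto
  finally show ?thesis using ab by (simp add: algebra_simps)
qed

lemma godunov_flux_perturb:
  assumes q: "continuous_on {lo..hi} q" "continuous_on {lo..hi} q'"
    and "u \<in> {lo..hi}" "v \<in> {lo..hi}"
    and e: "\<And>w. w \<in> {lo..hi} \<Longrightarrow> \<bar>q w - q' w\<bar> \<le> e"
  shows "\<bar>godunov_flux q v u - godunov_flux q' v u\<bar> \<le> e"
proof (cases "u \<le> v")
  case True
  obtain w where w: "w \<in> {u..v}" "godunov_flux q v u = q w" "\<And>z. z \<in> {u..v} \<Longrightarrow> q w \<le> q z"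
    using godunov_flux_min[OF q(1), of u v] assms True by auto
  obtain w' where w': "w' \<in> {u..v}" "godunov_flux q' v u = q' w'" "\<And>z. z \<in> {u..v} \<Longrightarrow> q' w' \<le> q' z"
    using godunov_flux_min[OF q(2), of u v] assms True by auto
  have "\<bar>q w - q' w\<bar> \<le> e" "\<bar>q w' - q' w'\<bar> \<le> e" using e w(1) w'(1) assms by auto
  then show ?thesis using w(2) w'(2) w(3)[OF w'(1)] w'(3)[OF w(1)] by linarith
next
  case False
  obtain w where w: "w \<in> {v..u}" "godunov_flux q v u = q w" "\<And>z. z \<in> {v..u} \<Longrightarrow> q z \<le> q w"
    using godunov_flux_max[OF q(1), of v u] assms False by auto
  obtain w' where w': "w' \<in> {v..u}" "godunov_flux q' v u = q' w'" "\<And>z. z \<in> {v..u} \<Longrightarrow> q' z \<le> q' w'"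
    using godunov_flux_max[OF q(2), of v u] assms False by auto
  have "\<bar>q w - q' w\<bar> \<le> e" "\<bar>q w' - q' w'\<bar> \<le> e" using e w(1) w'(1) assms by auto
  then show ?thesis using w(2) w'(2) w(3)[OF w'(1)] w'(3)[OF w(1)] by linarith
qed

text \<open>The two faces have separate fluxes \<open>p\<close> (left) and \<open>q\<close> (right),
  because the cell at the origin has \<open>g\<close> on its left face and \<open>f\<close> on its
  right one.\<close>

definition cell_update ::
    "real \<Rightarrow> (real \<Rightarrow> real) \<Rightarrow> (real \<Rightarrow> real) \<Rightarrow> real \<Rightarrow> real \<Rightarrow> real \<Rightarrow> real"
  where "cell_update lam p q x y z = y - lam * (godunov_flux q z y - godunov_flux p y x)"

text \<open>The middle state enters both face fluxes, each with slope at most \<open>L\<close>, so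
  the update increases in it as long as \<open>lam * (2 * L) \<le> 1\<close>. This is the origin of
  the CFL bound one half.\<close>

lemma cell_update_mono:
  assumes p: "L-lipschitz_on {lo..hi} p" and q: "L-lipschitz_on {lo..hi} q"
    and "0 \<le> lam" "lam * L \<le> 1/2"
    and "{x, y, z, x', y', z'} \<subseteq> {lo..hi}" "x \<le> x'" "y \<le> y'" "z \<le> z'"
  shows "cell_update lam p q x y z \<le> cell_update lam p q x' y' z'"
proof -
  have c: "continuous_on {lo..hi} p" "continuous_on {lo..hi} q"
    using p q lipschitz_on_continuous_on by auto
  have "godunov_flux q z' y \<le> godunov_flux q z y"
    "godunov_flux q z' y' - godunov_flux q z' y \<le> L * (y' - y)"
    "godunov_flux p y x \<le> godunov_flux p y x'"
    "godunov_flux p y x' - godunov_flux p y' x' \<le> L * (y' - y)"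
    using assms by (auto intro!: godunov_flux_mono_left[OF c(1)] godunov_flux_antimono_right[OF c(2)]
        godunov_flux_lipschitz_left godunov_flux_lipschitz_right)
  then have "(godunov_flux q z' y' - godunov_flux p y' x') - (godunov_flux q z y - godunov_flux p y x)
      \<le> 2 * L * (y' - y)"
    by linarith
  then have "lam * ((godunov_flux q z' y' - godunov_flux p y' x') - (godunov_flux q z y - godunov_flux p y x))
      \<le> lam * (2 * L * (y' - y))"
    using assms by (intro mult_left_mono) auto
  also have "\<dots> = (2 * (lam * L)) * (y' - y)" by simp
  also have "\<dots> \<le> 1 * (y' - y)" using assms by (intro mult_right_mono) auto
  finally show ?thesis by (simp add: cell_update_def algebra_simps)
qed

text \<open>The numerical Kruzkov entropy flux of Crandall and Majda. The second pair of states is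
  arbitrary, so that it serves for constants, for steady states and for a second solution of the
  scheme.\<close>

definition entropy_flux :: "(real \<Rightarrow> real) \<Rightarrow> real \<Rightarrow> real \<Rightarrow> real \<Rightarrow> real \<Rightarrow> real"
  where "entropy_flux q v u v' u' =
    godunov_flux q (max v v') (max u u') - godunov_flux q (min v v') (min u u')"

text \<open>By monotonicity both updates lie between the update \<open>m\<close> of the minima and
  the update \<open>M\<close> of the maxima. The difference \<open>M - m\<close> is exactly the
  right side, since \<open>max - min\<close> is the absolute difference.\<close>

lemma cell_update_kato:
  assumes p: "L-lipschitz_on {lo..hi} p" and q: "L-lipschitz_on {lo..hi} q"
    and "0 \<le> lam" "lam * L \<le> 1/2"
    and "{x, y, z, x', y', z'} \<subseteq> {lo..hi}"
  shows "\<bar>cell_update lam p q x y z - cell_update lam p q x' y' z'\<bar>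
    \<le> \<bar>y - y'\<bar> - lam * (entropy_flux q z y z' y' - entropy_flux p y x y' x')"
proof -
  define M where "M = cell_update lam p q (max x x') (max y y') (max z z')"
  define m where "m = cell_update lam p q (min x x') (min y y') (min z z')"
  have "cell_update lam p q x y z \<le> M" "cell_update lam p q x' y' z' \<le> M"
    "m \<le> cell_update lam p q x y z" "m \<le> cell_update lam p q x' y' z'"
    unfolding M_def m_def using assms by (auto intro!: cell_update_mono[OF p q])
  then have "\<bar>cell_update lam p q x y z - cell_update lam p q x' y' z'\<bar> \<le> M - m"
    by linarith
  also have "M - m = \<bar>y - y'\<bar> - lam * (entropy_flux q z y z' y' - entropy_flux p y x y' x')"
    by (simp add: M_def m_def cell_update_def entropy_flux_def algebra_simps max_def min_def)
  finally show ?thesis .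
qed

lemma entropy_flux_abs_le:
  assumes q: "L-lipschitz_on {lo..hi} q" and "{u, v, u', v'} \<subseteq> {lo..hi}"
  shows "\<bar>entropy_flux q v u v' u'\<bar> \<le> L * (\<bar>u - u'\<bar> + \<bar>v - v'\<bar>)"
proof -
  have "\<bar>entropy_flux q v u v' u'\<bar>
      \<le> L * (\<bar>max u u' - min u u'\<bar> + \<bar>max v v' - min v v'\<bar>)"
    unfolding entropy_flux_def using assms by (intro godunov_flux_lipschitz[OF q]) auto
  also have "\<bar>max u u' - min u u'\<bar> + \<bar>max v v' - min v v'\<bar> = \<bar>u - u'\<bar> + \<bar>v - v'\<bar>"
    by auto
  finally show ?thesis .
qed

lemma entropy_flux_consistent:
  "entropy_flux q u u c c = sgn (u - c) * (q u - q c)"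
  by (auto simp: entropy_flux_def max_def min_def sgn_if)

section \<open>Total variation and translations\<close>

text \<open>A real bound replaces the \<open>ennreal\<close> supremum. Besides intervals,
  \<open>E\<close> will be a set of full measure on which a limit is known pointwise.\<close>

definition variation_le :: "real set \<Rightarrow> (real \<Rightarrow> real) \<Rightarrow> real \<Rightarrow> bool"
  where "variation_le E w V \<longleftrightarrow>
    (\<forall>xs. sorted xs \<and> set xs \<subseteq> E \<longrightarrow> (\<Sum>i<length xs - 1. \<bar>w (xs ! Suc i) - w (xs ! i)\<bar>) \<le> V)"

lemma variation_leD:
  "variation_le E w V \<Longrightarrow> sorted xs \<Longrightarrow> set xs \<subseteq> E \<Longrightarrow>
    (\<Sum>i<length xs - 1. \<bar>w (xs ! Suc i) - w (xs ! i)\<bar>) \<le> V"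
  unfolding variation_le_def by blast

lemma variation_le_nonneg: "variation_le E w V \<Longrightarrow> 0 \<le> V"
  using variation_leD[of E w V "[]"] by simp

lemma variation_le_diff:
  assumes "variation_le E v V" "variation_le E w W"
  shows "variation_le E (\<lambda>x. v x - w x) (V + W)"
  unfolding variation_le_def
proof (intro allI impI, elim conjE)
  fix xs :: "real list" assume xs: "sorted xs" "set xs \<subseteq> E"
  have "(\<Sum>i<length xs - 1. \<bar>(v (xs ! Suc i) - w (xs ! Suc i)) - (v (xs ! i) - w (xs ! i))\<bar>)
      \<le> (\<Sum>i<length xs - 1. \<bar>v (xs ! Suc i) - v (xs ! i)\<bar> + \<bar>w (xs ! Suc i) - w (xs ! i)\<bar>)"
    by (intro sum_mono) linarith
  also have "\<dots> \<le> V + W"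
    using variation_leD[OF assms(1) xs] variation_leD[OF assms(2) xs] by (simp add: sum.distrib)
  finally show "(\<Sum>i<length xs - 1. \<bar>(v (xs ! Suc i) - w (xs ! Suc i)) - (v (xs ! i) - w (xs ! i))\<bar>) \<le> V + W" .
qed

lemma variation_le_compose:
  assumes "variation_le E w V" "\<And>x y. \<bar>\<phi> x - \<phi> y\<bar> \<le> L * \<bar>x - y\<bar>" "0 \<le> L"
  shows "variation_le E (\<lambda>x. \<phi> (w x)) (L * V)"
  unfolding variation_le_def
proof (intro allI impI, elim conjE)
  fix xs :: "real list" assume xs: "sorted xs" "set xs \<subseteq> E"
  have "(\<Sum>i<length xs - 1. \<bar>\<phi> (w (xs ! Suc i)) - \<phi> (w (xs ! i))\<bar>)
      \<le> (\<Sum>i<length xs - 1. L * \<bar>w (xs ! Suc i) - w (xs ! i)\<bar>)"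
    by (intro sum_mono assms(2))
  also have "\<dots> \<le> L * V"
    using variation_leD[OF assms(1) xs] assms(3) by (simp add: sum_distrib_left[symmetric] mult_left_mono)
  finally show "(\<Sum>i<length xs - 1. \<bar>\<phi> (w (xs ! Suc i)) - \<phi> (w (xs ! i))\<bar>) \<le> L * V" .
qed

text \<open>The infimum over representatives is approached up to the slack \<open>e\<close>, which
  later tends to zero or is absorbed into a larger constant.\<close>

lemma TV_on_representative:
  assumes "TV_on I v \<le> ennreal K" "0 \<le> K" "0 < e"
  obtains w where "AE x in lborel. x \<in> I \<longrightarrow> w x = v x" "variation_le I w (K + e)"
proof -
  have "TV_on I v < ennreal (K + e)"
    using assms by (auto intro: le_less_trans simp: ennreal_less_iff)
  then obtain w where w: "AE x in lebesgue. x \<in> I \<longrightarrow> w x = v x"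
    "pointwise_variation I w < ennreal (K + e)"
    unfolding TV_on_def Inf_less_iff by auto
  have "variation_le I w (K + e)"
    unfolding variation_le_def
  proof (intro allI impI)
    fix xs :: "real list" assume "sorted xs \<and> set xs \<subseteq> I"
    then have "(\<Sum>i<length xs - 1. ennreal \<bar>w (xs ! Suc i) - w (xs ! i)\<bar>) \<le> pointwise_variation I w"
      unfolding pointwise_variation_def by (intro SUP_upper) auto
    also have "\<dots> \<le> ennreal (K + e)" using w by (intro less_imp_le)
    finally have "ennreal (\<Sum>i<length xs - 1. \<bar>w (xs ! Suc i) - w (xs ! i)\<bar>) \<le> ennreal (K + e)"
      by (subst (asm) sum_ennreal) auto
    moreover have "0 \<le> K + e" using assms by simp
    ultimately show "(\<Sum>i<length xs - 1. \<bar>w (xs ! Suc i) - w (xs ! i)\<bar>) \<le> K + e"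
      by (simp only: ennreal_le_iff)
  qed
  then show thesis using w by (intro that[of w]) (auto simp: AE_completion_iff)
qed

section \<open>Translation estimates in the mean\<close>

lemma AE_lborel_translate:
  fixes c :: "'a::euclidean_space"
  assumes "AE x in lborel. P x"
  shows "AE x in lborel. P (c + x)"
proof -
  have "AE x in distr lborel borel ((+) c). P x"
    by (subst lborel_distr_plus) (rule assms)
  then obtain N where N: "{x. \<not> P x} \<subseteq> N" "N \<in> sets borel" "emeasure (distr lborel borel ((+) c)) N = 0"
    by (auto elim!: AE_E)
  have "emeasure lborel ((+) c -` N) = 0"
    using N(2,3) by (subst (asm) emeasure_distr) auto
  moreover have "(+) c -` N \<in> sets borel"
    using measurable_sets_borel[OF _ N(2), of "(+) c"] by simp
  ultimately show ?thesis
    using N(1) by (intro AE_I[of _ _ "(+) c -` N"]) auto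
qed

lemma nn_integral_translate:
  fixes c :: "'a::euclidean_space"
  assumes [measurable]: "f \<in> borel_measurable borel"
  shows "(\<integral>\<^sup>+x. f (x + c) \<partial>lborel) = (\<integral>\<^sup>+x. f x \<partial>lborel)"
  by (subst (2) lborel_distr_plus[of c, symmetric]) (simp add: nn_integral_distr add.commute)

lemma integral_translate:
  fixes c :: "'a::euclidean_space" and f :: "'a \<Rightarrow> real"
  assumes [measurable]: "f \<in> borel_measurable borel"
  shows "(\<integral>x. f (x + c) \<partial>lborel) = (\<integral>x. f x \<partial>lborel)"
  by (subst (2) lborel_distr_plus[of c, symmetric]) (simp add: integral_distr add.commute)

lemma integrable_translate:
  fixes c :: "'a::euclidean_space" and f :: "'a \<Rightarrow> real"
  assumes "integrable lborel f"
  shows "integrable lborel (\<lambda>x. f (x + c))"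
proof -
  have "integrable (distr lborel borel ((+) c)) f" using assms by (simp add: lborel_distr_plus)
  then show ?thesis by (subst (asm) integrable_distr_eq) (use assms in \<open>auto simp: add.commute\<close>)
qed

lemma integrable_bounded_box:
  fixes f :: "'a::euclidean_space \<Rightarrow> real"
  assumes "f \<in> borel_measurable borel" "\<And>x. \<bar>f x\<bar> \<le> M" "\<And>x. x \<notin> cbox a b \<Longrightarrow> f x = 0"
  shows "integrable lborel f"
proof (rule Bochner_Integration.integrable_bound)
  show "integrable lborel (\<lambda>x. indicator (cbox a b) x *\<^sub>R M)"
    by (intro integrable_indicator) (use emeasure_lborel_cbox_finite[of a b] in \<open>auto simp: less_top\<close>)
  show "AE x in lborel. norm (f x) \<le> norm (indicator (cbox a b) x *\<^sub>R M)"
  proof (rule AE_I2)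
    fix x
    have "norm (f x) \<le> norm M" using assms(2)[of x] by simp
    then show "norm (f x) \<le> norm (indicator (cbox a b) x *\<^sub>R M)"
      using assms(3)[of x] by (cases "x \<in> cbox a b") auto
  qed
qed (use assms in simp)

text \<open>The line is cut into intervals of length \<open>h\<close> and all of them are moved onto
  \<open>{0..<h}\<close>. The integrand becomes the sum of the increments of \<open>v\<close> along
  the progression \<open>x + a i\<close>, which is one sampled variation and hence at most
  \<open>V\<close>. Finite windows are exhausted by monotone convergence.\<close>

lemma translation_estimate:
  fixes v w :: "real \<Rightarrow> real"
  assumes [measurable]: "v \<in> borel_measurable borel"
    and vw: "AE x in lborel. w x = v x" and V: "variation_le UNIV w V" and h: "0 < h"
  shows "(\<integral>\<^sup>+x. ennreal \<bar>v (x + h) - v x\<bar> \<partial>lborel) \<le> ennreal (h * V)"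
proof -
  define f where "f x = ennreal \<bar>v (x + h) - v x\<bar>" for x
  have [measurable]: "f \<in> borel_measurable borel" unfolding f_def by measurable
  have V0: "0 \<le> V" using V by (rule variation_le_nonneg)
  have bound: "(\<integral>\<^sup>+x. f x * indicator {- real N * h..<real N * h} x \<partial>lborel) \<le> ennreal (h * V)" for N
  proof -
    define a where "a i = (real i - real N) * h" for i
    have a_Suc: "a (Suc i) = a i + h" for i by (simp add: a_def algebra_simps)
    have a0: "a 0 = - real N * h" by (simp add: a_def)
    have ind: "indicator {- real N * h..<a n} x = (\<Sum>i<n. indicator {a i..<a (Suc i)} x :: ennreal)" for n x
    proof (induction n)
      case (Suc n)
      have "a 0 \<le> a n" using h mult_right_mono[of "- real N" "real n - real N" h] by (simp add: a_def)
      then have "indicator {- real N * h..<a (Suc n)} x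
          = (indicator {- real N * h..<a n} x + indicator {a n..<a (Suc n)} x :: ennreal)"
        using a0 a_Suc[of n] h by (auto split: split_indicator)
      then show ?case using Suc by simp
    qed (simp add: a0)
    have "a (2 * N) = real N * h" by (simp add: a_def)
    then have "(\<integral>\<^sup>+x. f x * indicator {- real N * h..<real N * h} x \<partial>lborel)
        = (\<integral>\<^sup>+x. (\<Sum>i<2*N. f x * indicator {a i..<a (Suc i)} x) \<partial>lborel)"
      using ind[of "2 * N"] by (simp add: sum_distrib_left)
    also have "\<dots> = (\<Sum>i<2*N. \<integral>\<^sup>+x. f x * indicator {a i..<a (Suc i)} x \<partial>lborel)"
      by (intro nn_integral_sum) measurable
    also have "\<dots> = (\<Sum>i<2*N. \<integral>\<^sup>+x. f (x + a i) * indicator {0..<h} x \<partial>lborel)"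
    proof (rule sum.cong[OF refl])
      fix i
      have "(\<integral>\<^sup>+x. f x * indicator {a i..<a (Suc i)} x \<partial>lborel)
          = (\<integral>\<^sup>+x. f (x + a i) * indicator {a i..<a (Suc i)} (x + a i) \<partial>lborel)"
        by (subst nn_integral_translate) auto
      also have "\<dots> = (\<integral>\<^sup>+x. f (x + a i) * indicator {0..<h} x \<partial>lborel)"
        by (intro nn_integral_cong) (auto simp: a_Suc split: split_indicator)
      finally show "(\<integral>\<^sup>+x. f x * indicator {a i..<a (Suc i)} x \<partial>lborel)
          = (\<integral>\<^sup>+x. f (x + a i) * indicator {0..<h} x \<partial>lborel)" .
    qed
    also have "\<dots> = (\<integral>\<^sup>+x. (\<Sum>i<2*N. f (x + a i) * indicator {0..<h} x) \<partial>lborel)"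
      by (intro nn_integral_sum[symmetric]) measurable
    also have "\<dots> \<le> (\<integral>\<^sup>+x. ennreal V * indicator {0..<h} x \<partial>lborel)"
    proof (rule nn_integral_mono_AE)
      \<comment> \<open>The representative must agree with \<open>v\<close> at all sample points of
        the progression simultaneously; these are countably many translates of
        \<open>x\<close>.\<close>
      have "AE x in lborel. \<forall>i. w (a i + x) = v (a i + x)"
        unfolding AE_all_countable using AE_lborel_translate[OF vw] by blast
      then show "AE x in lborel. (\<Sum>i<2*N. f (x + a i) * indicator {0..<h} x) \<le> ennreal V * indicator {0..<h} x"
      proof (eventually_elim)
        case (elim x)
        define xs where "xs = map (\<lambda>i. a i + x) [0..<2*N+1]"
        have len: "length xs = 2 * N + 1" by (simp add: xs_def)
        have nth: "xs ! i = a i + x" if "i < 2 * N + 1" for i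
          using that unfolding xs_def by (subst nth_map) (auto simp del: upt_Suc)
        have "sorted xs"
          unfolding sorted_iff_nth_mono
        proof (intro allI impI)
          fix i j assume "i \<le> j" "j < length xs"
          then show "xs ! i \<le> xs ! j" using nth len h by (simp add: a_def mult_right_mono)
        qed
        then have "(\<Sum>i<2*N. \<bar>w (xs ! Suc i) - w (xs ! i)\<bar>) \<le> V"
          using variation_leD[OF V, of xs] len by simp
        moreover have "\<bar>w (xs ! Suc i) - w (xs ! i)\<bar> = \<bar>v (x + a i + h) - v (x + a i)\<bar>" if "i < 2 * N" for i
          using that nth[of i] nth[of "Suc i"] elim[THEN spec, of i] elim[THEN spec, of "Suc i"]
          by (simp add: a_Suc add_ac)
        ultimately have "(\<Sum>i<2*N. f (x + a i)) \<le> ennreal V"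
          unfolding f_def by (subst sum_ennreal) (auto intro!: ennreal_leI simp: V0)
        moreover have "(\<Sum>i<2*N. f (x + a i) * indicator {0..<h} x)
            = (\<Sum>i<2*N. f (x + a i)) * indicator {0..<h} x"
          by (simp only: sum_distrib_right)
        ultimately show ?case by (cases "x \<in> {0..<h}") auto
      qed
    qed
    also have "\<dots> = ennreal (h * V)"
      using h V0 by (simp add: nn_integral_cmult ennreal_mult mult.commute)
    finally show ?thesis .
  qed
  have mono: "incseq (\<lambda>N x. f x * indicator {- real N * h..<real N * h} x)"
  proof (rule incseq_SucI, rule le_funI)
    fix N x
    have "real N * h \<le> real (Suc N) * h" "- real (Suc N) * h \<le> - real N * h"
      using h mult_right_mono[of "- real (Suc N)" "- real N" h] by simp_all
    then show "f x * indicator {- real N * h..<real N * h} x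
        \<le> f x * indicator {- real (Suc N) * h..<real (Suc N) * h} x"
      by (simp del: of_nat_Suc split: split_indicator)
  qed
  have "(\<integral>\<^sup>+x. (SUP N. f x * indicator {- real N * h..<real N * h} x) \<partial>lborel)
      = (SUP N. \<integral>\<^sup>+x. f x * indicator {- real N * h..<real N * h} x \<partial>lborel)"
    by (intro nn_integral_monotone_convergence_SUP mono) measurable
  also have "\<dots> \<le> ennreal (h * V)"
    by (intro SUP_least bound)
  finally have "(\<integral>\<^sup>+x. (SUP N. f x * indicator {- real N * h..<real N * h} x) \<partial>lborel) \<le> ennreal (h * V)" .
  moreover have "f x \<le> (SUP N. f x * indicator {- real N * h..<real N * h} x)" for x
  proof -
    obtain N :: nat where "\<bar>x\<bar> / h < real N" using reals_Archimedean2 by blast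
    then have "\<bar>x\<bar> < real N * h" using h by (simp add: divide_less_eq)
    then have "f x = f x * indicator {- real N * h..<real N * h} x" by (auto split: split_indicator)
    also have "\<dots> \<le> (SUP N. f x * indicator {- real N * h..<real N * h} x)" by (intro SUP_upper) auto
    finally show ?thesis .
  qed
  then have "(\<integral>\<^sup>+x. f x \<partial>lborel)
      \<le> (\<integral>\<^sup>+x. (SUP N. f x * indicator {- real N * h..<real N * h} x) \<partial>lborel)"
    by (intro nn_integral_mono)
  ultimately show ?thesis unfolding f_def by (rule order_trans[rotated])
qed

lemma translation_estimate_TV:
  fixes v :: "real \<Rightarrow> real"
  assumes v: "v \<in> borel_measurable borel" and TV: "TV v \<le> ennreal K" and K: "0 \<le> K" and h: "0 \<le> h"
  shows "(\<integral>\<^sup>+x. ennreal \<bar>v (x + h) - v x\<bar> \<partial>lborel) \<le> ennreal (h * K)"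
proof (cases "h = 0")
  case False
  then have h: "0 < h" using h by simp
  show ?thesis
  proof (rule ennreal_le_epsilon)
    fix e :: real assume e: "0 < e"
    \<comment> \<open>The slack \<open>e / h\<close> turns into \<open>e\<close> after
      multiplication by the step \<open>h\<close>.\<close>
    obtain w where w: "AE x in lborel. x \<in> UNIV \<longrightarrow> w x = v x" "variation_le UNIV w (K + e / h)"
      using TV_on_representative[OF TV K, of "e / h"] h e by auto
    have "(\<integral>\<^sup>+x. ennreal \<bar>v (x + h) - v x\<bar> \<partial>lborel) \<le> ennreal (h * (K + e / h))"
      using translation_estimate[OF v _ w(2) h] w(1) by simp
    also have "\<dots> = ennreal (h * K) + ennreal e"
      using h e K by (simp add: distrib_left ennreal_plus)
    finally show "(\<integral>\<^sup>+x. ennreal \<bar>v (x + h) - v x\<bar> \<partial>lborel) \<le> ennreal (h * K) + ennreal e" .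
  qed
qed simp

text \<open>The distance to the mean is at most the mean of the distances to the translates by
  \<open>s \<in> {0..h}\<close>, each of which costs \<open>s * K \<le> h * K\<close> after Fubini.
  Such a mean is a difference quotient of the primitive, which is how it enters the compactness
  argument.\<close>

lemma average_estimate_TV:
  fixes v :: "real \<Rightarrow> real"
  assumes v[measurable]: "v \<in> borel_measurable borel" and TV: "TV v \<le> ennreal K" and K: "0 \<le> K"
    and h: "0 < h" and M: "\<And>x. \<bar>v x\<bar> \<le> M"
  shows "(\<integral>\<^sup>+x. ennreal \<bar>v x - (\<integral>s. indicator {0..h} s * v (x + s) \<partial>lborel) / h\<bar> \<partial>lborel) \<le> ennreal (h * K)"
proof -
  have int: "integrable lborel (\<lambda>s. indicator {0..h} s * v (x + s))" for x
    by (rule integrable_bounded_box[of _ M 0 h])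
      (use M order_trans[OF abs_ge_zero M] in \<open>auto simp: abs_mult split: split_indicator\<close>)
  have pt: "ennreal \<bar>v x - (\<integral>s. indicator {0..h} s * v (x + s) \<partial>lborel) / h\<bar>
      \<le> ennreal (1 / h) * (\<integral>\<^sup>+s. indicator {0..h} s * ennreal \<bar>v (x + s) - v x\<bar> \<partial>lborel)" for x
  proof -
    have i0: "integrable lborel (\<lambda>s. indicator {0..h} s * v x)"
      by (rule integrable_bounded_box[of _ "\<bar>v x\<bar>" 0 h]) (auto split: split_indicator)
    have eq: "(\<integral>s. indicator {0..h} s * v (x + s) \<partial>lborel) / h - v x
        = (1 / h) * (\<integral>s. indicator {0..h} s * (v (x + s) - v x) \<partial>lborel)"
    proof -
      have "(\<integral>s. indicator {0..h} s * (v (x + s) - v x) \<partial>lborel)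
          = (\<integral>s. indicator {0..h} s * v (x + s) \<partial>lborel) - (\<integral>s. indicator {0..h} s * v x \<partial>lborel)"
        by (subst Bochner_Integration.integral_diff[OF int i0, symmetric]) (simp add: right_diff_distrib)
      also have "(\<integral>s. indicator {0..h} s * v x \<partial>lborel) = h * v x"
        using h by (simp add: mult.commute)
      finally show ?thesis using h by (simp add: divide_simps)
    qed
    have e1: "\<bar>v x - (\<integral>s. indicator {0..h} s * v (x + s) \<partial>lborel) / h\<bar>
        = (1 / h) * \<bar>\<integral>s. indicator {0..h} s * (v (x + s) - v x) \<partial>lborel\<bar>"
      using h by (subst abs_minus_commute) (simp only: eq abs_mult, simp)
    have e2: "ennreal \<bar>\<integral>s. indicator {0..h} s * (v (x + s) - v x) \<partial>lborel\<bar>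
        \<le> (\<integral>\<^sup>+s. ennreal (norm (indicator {0..h} s * (v (x + s) - v x))) \<partial>lborel)"
    proof -
      have "integrable lborel (\<lambda>s. indicator {0..h} s * (v (x + s) - v x))"
        using Bochner_Integration.integrable_diff[OF int i0] by (simp add: right_diff_distrib)
      from integral_norm_bound_ennreal[OF this] show ?thesis by simp
    qed
    have e3: "(\<integral>\<^sup>+s. ennreal (norm (indicator {0..h} s * (v (x + s) - v x))) \<partial>lborel)
        = (\<integral>\<^sup>+s. indicator {0..h} s * ennreal \<bar>v (x + s) - v x\<bar> \<partial>lborel)"
      by (intro nn_integral_cong) (auto split: split_indicator)
    have "ennreal \<bar>v x - (\<integral>s. indicator {0..h} s * v (x + s) \<partial>lborel) / h\<bar>
        = ennreal (1 / h) * ennreal \<bar>\<integral>s. indicator {0..h} s * (v (x + s) - v x) \<partial>lborel\<bar>"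
      unfolding e1 using h by (intro ennreal_mult) auto
    also have "\<dots> \<le> ennreal (1 / h) * (\<integral>\<^sup>+s. indicator {0..h} s * ennreal \<bar>v (x + s) - v x\<bar> \<partial>lborel)"
      using e2 unfolding e3 by (rule mult_left_mono) simp
    finally show ?thesis .
  qed
  have "(\<integral>\<^sup>+x. ennreal \<bar>v x - (\<integral>s. indicator {0..h} s * v (x + s) \<partial>lborel) / h\<bar> \<partial>lborel)
      \<le> (\<integral>\<^sup>+x. ennreal (1 / h) * (\<integral>\<^sup>+s. indicator {0..h} s * ennreal \<bar>v (x + s) - v x\<bar> \<partial>lborel) \<partial>lborel)"
    by (intro nn_integral_mono pt)
  also have "\<dots> = ennreal (1 / h) * (\<integral>\<^sup>+x. (\<integral>\<^sup>+s. indicator {0..h} s * ennreal \<bar>v (x + s) - v x\<bar> \<partial>lborel) \<partial>lborel)"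
    by (intro nn_integral_cmult) measurable
  also have "(\<integral>\<^sup>+x. (\<integral>\<^sup>+s. indicator {0..h} s * ennreal \<bar>v (x + s) - v x\<bar> \<partial>lborel) \<partial>lborel)
      = (\<integral>\<^sup>+s. (\<integral>\<^sup>+x. indicator {0..h} s * ennreal \<bar>v (x + s) - v x\<bar> \<partial>lborel) \<partial>lborel)"
    by (intro lborel_pair.Fubini') measurable
  also have "\<dots> \<le> (\<integral>\<^sup>+s. ennreal (h * K) * indicator {0..h} s \<partial>lborel)"
  proof (rule nn_integral_mono)
    fix s :: real
    show "(\<integral>\<^sup>+x. indicator {0..h} s * ennreal \<bar>v (x + s) - v x\<bar> \<partial>lborel) \<le> ennreal (h * K) * indicator {0..h} s"
    proof (cases "s \<in> {0..h}")
      case True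
      then have "(\<integral>\<^sup>+x. ennreal \<bar>v (x + s) - v x\<bar> \<partial>lborel) \<le> ennreal (s * K)"
        by (intro translation_estimate_TV[OF v TV K]) auto
      also have "\<dots> \<le> ennreal (h * K)" using True K by (intro ennreal_leI mult_right_mono) auto
      finally show ?thesis using True by simp
    qed simp
  qed
  also have "\<dots> = ennreal (h * K) * ennreal h" using h by (simp add: nn_integral_cmult)
  also have "ennreal (1 / h) * (ennreal (h * K) * ennreal h) = ennreal (h * K)"
    using h K by (simp add: ennreal_mult[symmetric])
  finally show ?thesis using h by (simp add: mult_left_mono)
qed

section \<open>One-sided limits and limits of functions of bounded variation\<close>

lemma AE_lborel_dense:
  fixes a b :: real
  assumes "AE x in lborel. P x" "a < b"
  obtains x where "a < x" "x < b" "P x"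
proof -
  have "\<exists>x. a < x \<and> x < b \<and> P x"
  proof (rule ccontr)
    assume no: "\<not> ?thesis"
    obtain N where N: "{x. \<not> P x} \<subseteq> N" "N \<in> sets lborel" "emeasure lborel N = 0"
      using assms(1) by (auto elim!: AE_E)
    have "{a<..<b} \<subseteq> N" using no N(1) by auto
    then have "emeasure lborel {a<..<b} \<le> 0"
      using emeasure_mono[of "{a<..<b}" N lborel] N by simp
    then show False using assms(2) by simp
  qed
  then show thesis using that by blast
qed

text \<open>Jordan's variation function, with sample points restricted to \<open>E\<close>. It is
  monotone and bounded on the whole line, although \<open>w\<close> is controlled on
  \<open>E\<close> only, so its one-sided limits can be used to control \<open>w\<close>.\<close>

lemma variation_function:
  assumes V: "variation_le E w V"
  obtains g where "mono g" "\<And>x. 0 \<le> g x" "\<And>x. g x \<le> V"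
    "\<And>x y. x \<in> E \<Longrightarrow> y \<in> E \<Longrightarrow> x \<le> y \<Longrightarrow> \<bar>w y - w x\<bar> \<le> g y - g x"
proof -
  define S where "S xs = (\<Sum>i<length xs - 1. \<bar>w (xs ! Suc i) - w (xs ! i)\<bar>)" for xs
  define A where "A x = {xs. sorted xs \<and> set xs \<subseteq> E \<inter> {..x}}" for x
  define g where "g x = (SUP xs\<in>A x. S xs)" for x
  have nil: "[] \<in> A x" for x by (simp add: A_def)
  have S_V: "S xs \<le> V" if "xs \<in> A x" for xs x
    using variation_leD[OF V, of xs] that unfolding S_def A_def by auto
  have bdd: "bdd_above (S ` A x)" for x
    using S_V by (intro bdd_aboveI2) auto
  have S_le: "S xs \<le> g x" if "xs \<in> A x" for xs x
    unfolding g_def using that bdd by (intro cSUP_upper) auto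
  \<comment> \<open>A list ending at or before \<open>x\<close> can be prolonged by \<open>x\<close>
    and \<open>y\<close>. The increment from its last point to \<open>x\<close> is nonnegative and
    may be dropped.\<close>
  have step: "S xs + \<bar>w y - w x\<bar> \<le> g y" if xy: "x \<in> E" "y \<in> E" "x \<le> y" and xs: "xs \<in> A x" for x y xs
  proof -
    define zs where "zs = xs @ [x, y]"
    have zA: "zs \<in> A y"
      using xs xy by (auto simp: A_def zs_def sorted_append)
    have "S xs + \<bar>w y - w x\<bar> \<le> S zs"
    proof (cases xs rule: rev_cases)
      case Nil
      then show ?thesis by (simp add: S_def zs_def)
    next
      case (snoc ys a)
      have len: "length zs - 1 = Suc (Suc (length xs - 1))" by (simp add: zs_def snoc)
      have nth: "zs ! i = xs ! i" if "i < length xs" for i using that by (simp add: zs_def nth_append)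
      have "(\<Sum>i<length xs - 1. \<bar>w (zs ! Suc i) - w (zs ! i)\<bar>) = S xs"
        unfolding S_def by (intro sum.cong) (auto simp: nth)
      moreover have "zs ! Suc (length xs - 1) = x" "zs ! Suc (Suc (length xs - 1)) = y"
        by (simp_all add: zs_def snoc nth_append)
      ultimately show ?thesis unfolding S_def[of zs] len by simp
    qed
    also have "\<dots> \<le> g y" by (rule S_le[OF zA])
    finally show ?thesis .
  qed
  show thesis
  proof (rule that[of g])
    show "mono g"
    proof (rule monoI)
      fix x y :: real assume "x \<le> y"
      then have "A x \<subseteq> A y" by (auto simp: A_def)
      moreover have "A x \<noteq> {}" using nil by blast
      ultimately show "g x \<le> g y" unfolding g_def by (intro cSUP_subset_mono bdd) auto
    qed
    show "0 \<le> g x" for x using S_le[OF nil[of x]] by (simp add: S_def)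
    show "g x \<le> V" for x unfolding g_def using nil S_V by (intro cSUP_least) auto
    show "\<bar>w y - w x\<bar> \<le> g y - g x" if "x \<in> E" "y \<in> E" "x \<le> y" for x y
    proof -
      have "g x \<le> g y - \<bar>w y - w x\<bar>"
        unfolding g_def[of x] using nil[of x] step[OF that] by (intro cSUP_least) (auto simp: algebra_simps)
      then show ?thesis by simp
    qed
  qed
qed

text \<open>\<open>I d\<close> stands for the left or the right neighbourhood of the origin of size
  \<open>d\<close>. Since \<open>E\<close> has full measure it meets each of them, and the
  oscillation bound makes every choice of sample points a Cauchy sequence.\<close>

lemma cauchy_net_limit:
  fixes w :: "real \<Rightarrow> real" and I :: "real \<Rightarrow> real set"
  assumes E: "AE x in lborel. x \<in> E"
    and osc: "\<And>e. 0 < e \<Longrightarrow> \<exists>d>0. \<forall>x\<in>E \<inter> I d. \<forall>y\<in>E \<inter> I d. \<bar>w x - w y\<bar> \<le> e"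
    and I: "\<And>d. 0 < d \<Longrightarrow> \<exists>a b. a < b \<and> {a<..<b} \<subseteq> I d" "\<And>d d'. d \<le> d' \<Longrightarrow> I d \<subseteq> I d'"
  obtains l where "\<And>e. 0 < e \<Longrightarrow> \<exists>d>0. \<forall>x\<in>E \<inter> I d. \<bar>w x - l\<bar> < e"
proof -
  have "\<exists>x. x \<in> E \<inter> I (1 / real (Suc n))" for n
  proof -
    obtain a b where ab: "a < b" "{a<..<b} \<subseteq> I (1 / real (Suc n))"
      using I(1)[of "1 / real (Suc n)"] by auto
    obtain z where "a < z" "z < b" "z \<in> E" by (rule AE_lborel_dense[OF E ab(1)])
    then show ?thesis using ab(2) by auto
  qed
  then obtain x where x: "\<And>n. x n \<in> E \<inter> I (1 / real (Suc n))" by metis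
  have ev: "\<forall>\<^sub>F n in sequentially. 1 / real (Suc n) \<le> d" if "0 < d" for d :: real
  proof -
    have "(\<lambda>n. 1 / real (Suc n)) \<longlonglongrightarrow> 0" by (rule LIMSEQ_Suc) (rule lim_1_over_n)
    then show ?thesis using that by (auto dest!: order_tendstoD(2)[where a=d] elim: eventually_mono)
  qed
  have near: "\<exists>N. \<forall>n\<ge>N. x n \<in> E \<inter> I d" if "0 < d" for d
    using ev[OF that] I(2) x unfolding eventually_sequentially by blast
  have "Cauchy (\<lambda>n. w (x n))"
  proof (rule metric_CauchyI)
    fix e :: real assume "0 < e"
    then obtain d where d: "d > 0" "\<forall>x\<in>E \<inter> I d. \<forall>y\<in>E \<inter> I d. \<bar>w x - w y\<bar> \<le> e / 2"
      using osc[of "e / 2"] by auto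
    obtain N where N: "\<forall>n\<ge>N. x n \<in> E \<inter> I d" using near[OF d(1)] by blast
    have "dist (w (x m)) (w (x n)) < e" if "m \<ge> N" "n \<ge> N" for m n
    proof -
      have "\<bar>w (x m) - w (x n)\<bar> \<le> e / 2" using N d(2) that by blast
      then show ?thesis using \<open>0 < e\<close> by (simp add: dist_real_def)
    qed
    then show "\<exists>M. \<forall>m\<ge>M. \<forall>n\<ge>M. dist (w (x m)) (w (x n)) < e" by blast
  qed
  then obtain l where l: "(\<lambda>n. w (x n)) \<longlonglongrightarrow> l" using Cauchy_convergent convergent_def by blast
  show thesis
  proof (rule that[of l])
    fix e :: real assume "0 < e"
    then obtain d where d: "d > 0" "\<forall>x\<in>E \<inter> I d. \<forall>y\<in>E \<inter> I d. \<bar>w x - w y\<bar> \<le> e / 2"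
      using osc[of "e / 2"] by auto
    obtain N where N: "\<forall>n\<ge>N. x n \<in> E \<inter> I d" using near[OF d(1)] by blast
    have "\<bar>w z - l\<bar> \<le> e / 2" if "z \<in> E \<inter> I d" for z
    proof (rule LIMSEQ_le_const2)
      show "(\<lambda>n. \<bar>w z - w (x n)\<bar>) \<longlonglongrightarrow> \<bar>w z - l\<bar>" by (intro tendsto_intros l)
      show "\<exists>N. \<forall>n\<ge>N. \<bar>w z - w (x n)\<bar> \<le> e / 2" using N d(2) that by blast
    qed
    then show "\<exists>d>0. \<forall>x\<in>E \<inter> I d. \<bar>w x - l\<bar> < e" using d(1) \<open>0 < e\<close> by force
  qed
qed

text \<open>Close to the origin, on either side, the variation function stays within
  \<open>e\<close> of its one-sided limit, and its increments dominate those of \<open>w\<close>. So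
  \<open>w\<close> oscillates by at most \<open>e\<close> there, apart from a null set.\<close>

lemma variation_le_ess_lims:
  assumes E: "AE x in lborel. x \<in> E" and V: "variation_le E w V"
  obtains um up where "ess_lim_left_0 w um" "ess_lim_right_0 w up"
proof -
  obtain g where g: "mono g" "\<And>x. 0 \<le> g x" "\<And>x. g x \<le> V"
    "\<And>x y. x \<in> E \<Longrightarrow> y \<in> E \<Longrightarrow> x \<le> y \<Longrightarrow> \<bar>w y - w x\<bar> \<le> g y - g x"
    using variation_function[OF V] by blast
  have osc: "\<bar>w x - w y\<bar> \<le> e"
    if "x \<in> E" "y \<in> E" "c - e \<le> g x" "g x \<le> c" "c - e \<le> g y" "g y \<le> c" for x y c e
    using g(4)[of x y] g(4)[of y x] that by (cases "x \<le> y") auto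
  obtain um where um: "\<And>e. 0 < e \<Longrightarrow> \<exists>d>0. \<forall>x\<in>E \<inter> {-d<..<0}. \<bar>w x - um\<bar> < e"
  proof (rule cauchy_net_limit[OF E, where I="\<lambda>d. {-d<..<0}" and w=w])
    fix e :: real assume e: "0 < e"
    define c where "c = (SUP x\<in>{..<0}. g x)"
    have bdd: "bdd_above (g ` {..<0})" using g(3) by (intro bdd_aboveI2) auto
    have "c - e < c" using e by simp
    then obtain x0 where x0: "x0 < 0" "c - e < g x0"
      unfolding c_def using less_cSUP_iff[of "{..<0}" g "c - e"] bdd by (auto simp: c_def)
    have "c - e \<le> g x \<and> g x \<le> c" if "x \<in> {x0<..<0}" for x
      using x0 monoD[OF g(1), of x0 x] that bdd unfolding c_def by (auto intro!: cSUP_upper)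
    then have "\<forall>x\<in>E \<inter> {x0<..<0}. \<forall>y\<in>E \<inter> {x0<..<0}. \<bar>w x - w y\<bar> \<le> e"
      using osc by blast
    with x0 show "\<exists>d>0. \<forall>x\<in>E \<inter> {-d<..<0}. \<forall>y\<in>E \<inter> {-d<..<0}. \<bar>w x - w y\<bar> \<le> e"
      using x0 by (intro exI[of _ "-x0"]) auto
    show "\<exists>a b. a < b \<and> {a<..<b} \<subseteq> {- d<..<0}" if "0 < d" for d :: real
      using that by (intro exI[of _ "- d"] exI[of _ 0]) auto
  qed auto
  obtain up where up: "\<And>e. 0 < e \<Longrightarrow> \<exists>d>0. \<forall>x\<in>E \<inter> {0<..<d}. \<bar>w x - up\<bar> < e"
  proof (rule cauchy_net_limit[OF E, where I="\<lambda>d. {0<..<d}" and w=w])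
    fix e :: real assume e: "0 < e"
    define c where "c = (INF x\<in>{0<..}. g x)"
    have bdd: "bdd_below (g ` {0<..})" using g(2) by (intro bdd_belowI2) auto
    have "c < c + e" using e by simp
    then obtain x0 where x0: "0 < x0" "g x0 < c + e"
      unfolding c_def using cINF_less_iff[of "{0<..}" g "c + e"] bdd by (auto simp: c_def)
    have "c + e - e \<le> g x \<and> g x \<le> c + e" if "x \<in> {0<..<x0}" for x
      using x0 monoD[OF g(1), of x x0] that bdd cINF_lower[OF bdd, of x] unfolding c_def by auto
    then have "\<forall>x\<in>E \<inter> {0<..<x0}. \<forall>y\<in>E \<inter> {0<..<x0}. \<bar>w x - w y\<bar> \<le> e"
      using osc by blast
    then show "\<exists>d>0. \<forall>x\<in>E \<inter> {0<..<d}. \<forall>y\<in>E \<inter> {0<..<d}. \<bar>w x - w y\<bar> \<le> e"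
      using x0 by blast
    show "\<exists>a b. a < b \<and> {a<..<b} \<subseteq> {0<..<d}" if "0 < d" for d :: real
      using that by (intro exI[of _ 0] exI[of _ d]) auto
  qed auto
  have E': "AE x in lebesgue. x \<in> E" using E by (rule AE_completion)
  show thesis
  proof (rule that[of um up])
    show "ess_lim_left_0 w um"
      unfolding ess_lim_left_0_def
    proof (intro allI impI)
      fix e :: real assume "0 < e"
      then obtain d where "d > 0" "\<forall>x\<in>E \<inter> {-d<..<0}. \<bar>w x - um\<bar> < e" using um by blast
      then show "\<exists>d>0. AE x in lebesgue. x \<in> {- d<..<0} \<longrightarrow> \<bar>w x - um\<bar> < e"
        using E' by (intro exI[of _ d] conjI) (auto elim!: eventually_mono)
    qed
    show "ess_lim_right_0 w up"
      unfolding ess_lim_right_0_def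
    proof (intro allI impI)
      fix e :: real assume "0 < e"
      then obtain d where "d > 0" "\<forall>x\<in>E \<inter> {0<..<d}. \<bar>w x - up\<bar> < e" using up by blast
      then show "\<exists>d>0. AE x in lebesgue. x \<in> {0<..<d} \<longrightarrow> \<bar>w x - up\<bar> < e"
        using E' by (intro exI[of _ d] conjI) (auto elim!: eventually_mono)
    qed
  qed
qed

text \<open>Variation along a finite list passes to pointwise limits. \<open>E\<close> collects the
  points where all representatives agree with their functions and the convergence holds. The slack
  is fixed to 1, since only finiteness of the variation matters for traces.\<close>

lemma variation_le_AE_limit:
  fixes w :: "real \<Rightarrow> real"
  assumes lim: "AE x in lborel. (\<lambda>n. v n x) \<longlonglongrightarrow> w x" and TV: "\<And>n. TV (v n) \<le> ennreal K" and "0 \<le> K"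
  obtains E where "AE x in lborel. x \<in> E" "variation_le E w (K + 1)"
proof -
  have "\<exists>r. (AE x in lborel. r x = v n x) \<and> variation_le UNIV r (K + 1)" for n
    using TV_on_representative[OF TV[of n] \<open>0 \<le> K\<close>, of 1] by auto
  then obtain r where r: "\<And>n. AE x in lborel. r n x = v n x" "\<And>n. variation_le UNIV (r n) (K + 1)"
    by metis
  define E where "E = {x. (\<forall>n. r n x = v n x) \<and> (\<lambda>n. v n x) \<longlonglongrightarrow> w x}"
  have "AE x in lborel. \<forall>n. r n x = v n x" using r(1) by (simp add: AE_all_countable)
  then have ae: "AE x in lborel. x \<in> E" using lim by eventually_elim (simp add: E_def)
  have "variation_le E w (K + 1)"
    unfolding variation_le_def
  proof (intro allI impI, elim conjE)
    fix xs :: "real list" assume xs: "sorted xs" "set xs \<subseteq> E"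
    have conv: "(\<lambda>n. r n (xs ! i)) \<longlonglongrightarrow> w (xs ! i)" if "i < length xs" for i
    proof -
      have "xs ! i \<in> E" using xs(2) that nth_mem by blast
      then show ?thesis by (simp add: E_def)
    qed
    show "(\<Sum>i<length xs - 1. \<bar>w (xs ! Suc i) - w (xs ! i)\<bar>) \<le> K + 1"
    proof (rule LIMSEQ_le_const2)
      show "(\<lambda>n. \<Sum>i<length xs - 1. \<bar>r n (xs ! Suc i) - r n (xs ! i)\<bar>)
          \<longlonglongrightarrow> (\<Sum>i<length xs - 1. \<bar>w (xs ! Suc i) - w (xs ! i)\<bar>)"
        by (intro tendsto_intros conv) auto
      show "\<exists>N. \<forall>n\<ge>N. (\<Sum>i<length xs - 1. \<bar>r n (xs ! Suc i) - r n (xs ! i)\<bar>) \<le> K + 1"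
        using variation_leD[OF r(2) xs(1)] by auto
    qed
  qed
  with ae show thesis by (rule that)
qed

section \<open>The Godunov scheme\<close>

definition cell_index :: "real \<Rightarrow> real \<Rightarrow> int"
  where "cell_index d x = \<lceil>x / d - 1/2\<rceil>"

definition time_level :: "real \<Rightarrow> real \<Rightarrow> nat"
  where "time_level tau t = nat \<lfloor>t / tau\<rfloor>"

lemma godunov_approx_eq:
  "godunov_approx lam d f g v x t = godunov lam d f g v (time_level (lam * d) t) (cell_index d x)"
  by (simp add: godunov_approx_def cell_index_def time_level_def)

lemma cell_index_add: "0 < d \<Longrightarrow> cell_index d (x + d) = cell_index d x + 1"
proof -
  assume "0 < d"
  then have "(x + d) / d - 1/2 = x / d - 1/2 + 1" by (simp add: add_divide_distrib)
  then show ?thesis unfolding cell_index_def by (simp only: ceiling_add_one)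
qed

lemma cell_index_diff: "0 < d \<Longrightarrow> cell_index d (x - d) = cell_index d x - 1"
  using cell_index_add[of d "x - d"] by simp

lemma cell_index_bounds:
  assumes "0 < d"
  shows "(real_of_int (cell_index d x) - 1/2) * d < x" "x \<le> (real_of_int (cell_index d x) + 1/2) * d"
proof -
  have "real_of_int (cell_index d x) - 1/2 < x / d" "x / d \<le> real_of_int (cell_index d x) + 1/2"
    using ceiling_correct[of "x / d - 1/2"] unfolding cell_index_def by linarith+
  then show "(real_of_int (cell_index d x) - 1/2) * d < x" "x \<le> (real_of_int (cell_index d x) + 1/2) * d"
    using assms by (simp_all only: pos_less_divide_eq pos_divide_le_eq)
qed

lemma measurable_cell_index [measurable]: "cell_index d \<in> measurable borel (count_space UNIV)"
  unfolding cell_index_def by measurable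

lemma measurable_time_level [measurable]: "time_level tau \<in> measurable borel (count_space UNIV)"
  unfolding time_level_def by measurable

lemma time_level_add: "0 < tau \<Longrightarrow> 0 \<le> t \<Longrightarrow> time_level tau (t + tau) = Suc (time_level tau t)"
proof -
  assume "0 < tau" "0 \<le> t"
  then have "(t + tau) / tau = t / tau + 1" by (simp add: add_divide_distrib)
  then have "\<lfloor>(t + tau) / tau\<rfloor> = \<lfloor>t / tau\<rfloor> + 1" by simp
  moreover have "0 \<le> \<lfloor>t / tau\<rfloor>" using \<open>0 < tau\<close> \<open>0 \<le> t\<close> by simp
  ultimately show ?thesis
    unfolding time_level_def by (metis Suc_nat_eq_nat_zadd1 add.commute)
qed

lemma time_level_0: "0 < tau \<Longrightarrow> 0 \<le> t \<Longrightarrow> t < tau \<Longrightarrow> time_level tau t = 0"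
  by (simp add: time_level_def floor_eq_iff)

lemma time_level_bounds:
  assumes "0 < tau" "0 \<le> t"
  shows "real (time_level tau t) * tau \<le> t" "t < (real (time_level tau t) + 1) * tau"
proof -
  have "0 \<le> \<lfloor>t / tau\<rfloor>" using assms by simp
  then have "real (time_level tau t) = of_int \<lfloor>t / tau\<rfloor>" by (simp add: time_level_def)
  then show "real (time_level tau t) * tau \<le> t" "t < (real (time_level tau t) + 1) * tau"
    using floor_correct[of "t / tau"] assms(1)
    by (simp_all only: pos_le_divide_eq[symmetric] pos_divide_less_eq[symmetric], simp_all)
qed

lemma time_level_mono: "0 < tau \<Longrightarrow> s \<le> t \<Longrightarrow> time_level tau s \<le> time_level tau t"
  unfolding time_level_def by (intro nat_mono floor_mono divide_right_mono) auto

text \<open>What \<open>u0\<close> and its approximations have in common. The value at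
  \<open>- X\<close> is left open, since cell averages take the value of the first cell
  there.\<close>

definition initial_data :: "real \<Rightarrow> real \<Rightarrow> real \<Rightarrow> real \<Rightarrow> real \<Rightarrow> (real \<Rightarrow> real) \<Rightarrow> bool"
  where "initial_data lo hi X uL uR v \<longleftrightarrow>
    v \<in> borel_measurable lebesgue \<and> (\<forall>x. v x \<in> {lo..hi}) \<and> 0 < X \<and>
    (\<forall>x. x < - X \<longrightarrow> v x = uL) \<and> (\<forall>x. X \<le> x \<longrightarrow> v x = uR)"

lemma initial_dataD:
  assumes "initial_data lo hi X uL uR v"
  shows "v \<in> borel_measurable lebesgue" "v x \<in> {lo..hi}" "0 < X"
    "x < - X \<Longrightarrow> v x = uL" "X \<le> x \<Longrightarrow> v x = uR"
  using assms by (auto simp: initial_data_def)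

lemma bounded_set_integrable_lebesgue:
  fixes v :: "real \<Rightarrow> real"
  assumes "v \<in> borel_measurable lebesgue" "\<And>x. \<bar>v x\<bar> \<le> M"
  shows "set_integrable lebesgue {a..b} v"
  unfolding set_integrable_def
proof (rule Bochner_Integration.integrable_bound[of _ "\<lambda>x. indicator {a..b} x *\<^sub>R M"])
  show "integrable lebesgue (\<lambda>x. indicator {a..b} x *\<^sub>R M)"
    using emeasure_lborel_cbox_finite[of a b] by (intro integrable_indicator) (auto simp: less_top)
  show "AE x in lebesgue. norm (indicat_real {a..b} x *\<^sub>R v x) \<le> norm (indicat_real {a..b} x *\<^sub>R M)"
    using order_trans[OF assms(2) abs_ge_self] by (intro AE_I2) (auto split: split_indicator)
  show "(\<lambda>x. indicat_real {a..b} x *\<^sub>R v x) \<in> borel_measurable lebesgue"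
    using assms(1) by (intro borel_measurable_scaleR borel_measurable_indicator) auto
qed

lemma set_integral_const_interval:
  fixes c :: real
  assumes "a \<le> b"
  shows "(LINT x:{a..b}|lebesgue. c) = c * (b - a)"
  using assms by (simp add: set_lebesgue_integral_def)

text \<open>The fluxes are merely Lipschitz with one common constant, so that the smooth fluxes and
  their interpolants are both instances.\<close>

locale godunov_scheme =
  fixes lo hi L lam :: real and f g :: "real \<Rightarrow> real"
  assumes lo_less_hi: "lo < hi"
    and f_lipschitz: "L-lipschitz_on {lo..hi} f" and g_lipschitz: "L-lipschitz_on {lo..hi} g"
    and f_lo: "f lo = g lo" and f_hi: "f hi = g hi"
    and lam_pos: "0 < lam" and cfl: "lam * L \<le> 1/2"
begin

definition face_flux :: "int \<Rightarrow> real \<Rightarrow> real"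
  where "face_flux j = (if j < 0 then g else f)"

lemma face_flux_lipschitz: "L-lipschitz_on {lo..hi} (face_flux j)"
  using f_lipschitz g_lipschitz by (simp add: face_flux_def)

lemma face_flux_continuous: "continuous_on {lo..hi} (face_flux j)"
  using face_flux_lipschitz by (rule lipschitz_on_continuous_on)

lemma L_nonneg: "0 \<le> L"
  using f_lipschitz by (rule lipschitz_on_nonneg)

lemma interface_flux_eq:
  assumes "0 < d"
  shows "interface_flux d f g j = godunov_flux (face_flux j)"
proof -
  have "(of_int j + 1/2) * d < 0 \<longleftrightarrow> real_of_int j + 1/2 < 0"
    using assms by (simp add: mult_less_0_iff)
  also have "\<dots> \<longleftrightarrow> j < 0" by linarith
  finally show ?thesis by (simp add: interface_flux_def face_flux_def)
qed

abbreviation step :: "int \<Rightarrow> real \<Rightarrow> real \<Rightarrow> real \<Rightarrow> real"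
  where "step j \<equiv> cell_update lam (face_flux (j - 1)) (face_flux j)"

abbreviation U :: "real \<Rightarrow> (real \<Rightarrow> real) \<Rightarrow> nat \<Rightarrow> int \<Rightarrow> real"
  where "U d v \<equiv> godunov lam d f g v"

lemma godunov_Suc:
  "0 < d \<Longrightarrow> U d v (Suc n) j = step j (U d v n (j - 1)) (U d v n j) (U d v n (j + 1))"
  by (simp add: Let_def interface_flux_eq cell_update_def)

declare godunov.simps(2) [simp del]

lemma step_mono:
  "{x, y, z, x', y', z'} \<subseteq> {lo..hi} \<Longrightarrow> x \<le> x' \<Longrightarrow> y \<le> y' \<Longrightarrow> z \<le> z' \<Longrightarrow>
    step j x y z \<le> step j x' y' z'"
  using cell_update_mono[OF face_flux_lipschitz face_flux_lipschitz, of lam x y z x' y' z' "j - 1" j]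
    lam_pos cfl by auto

text \<open>\<open>lo\<close> and \<open>hi\<close> are steady even in the cell at the origin,
  because \<open>f\<close> and \<open>g\<close> agree there. Monotonicity traps every update between
  these two steady states.\<close>

lemma step_range:
  assumes "{x, y, z} \<subseteq> {lo..hi}"
  shows "step j x y z \<in> {lo..hi}"
proof -
  have "step j lo lo lo = lo" "step j hi hi hi = hi"
    by (auto simp: cell_update_def face_flux_def f_lo f_hi)
  moreover have "step j lo lo lo \<le> step j x y z" "step j x y z \<le> step j hi hi hi"
    using assms lo_less_hi by (auto intro!: step_mono)
  ultimately show ?thesis by simp
qed

text \<open>Away from cell \<open>0\<close> both faces of a cell carry the same flux. In cell
  \<open>0\<close> a constant \<open>c\<close> changes by \<open>lam * (g c - f c)\<close>, which is
  the source of all interface terms.\<close>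

lemma step_const: "j \<noteq> 0 \<Longrightarrow> step j c c c = c"
  by (auto simp: cell_update_def face_flux_def)

lemma cell_average_range:
  assumes v: "initial_data lo hi X uL uR v" and d: "0 < d"
  shows "U d v 0 j \<in> {lo..hi}"
proof -
  let ?a = "(real_of_int j - 1/2) * d" and ?b = "(real_of_int j + 1/2) * d"
  have ab: "?a \<le> ?b" "?b - ?a = d" using d by (auto simp: algebra_simps)
  note D = initial_dataD[OF v]
  have int: "set_integrable lebesgue {?a..?b} v"
  proof (rule bounded_set_integrable_lebesgue[OF D(1)])
    show "\<bar>v x\<bar> \<le> max \<bar>lo\<bar> \<bar>hi\<bar>" for x using initial_dataD(2)[OF v, of x] by auto
  qed
  have cint: "set_integrable lebesgue {?a..?b} (\<lambda>x. c)" for c :: real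
    by (rule bounded_set_integrable_lebesgue[of _ "\<bar>c\<bar>"]) auto
  have "(LINT x:{?a..?b}|lebesgue. lo) \<le> (LINT x:{?a..?b}|lebesgue. v x)"
    "(LINT x:{?a..?b}|lebesgue. v x) \<le> (LINT x:{?a..?b}|lebesgue. hi)"
    using D(2) by (auto intro!: set_integral_mono int cint)
  then have "lo * d \<le> (LINT x:{?a..?b}|lebesgue. v x)" "(LINT x:{?a..?b}|lebesgue. v x) \<le> hi * d"
    using set_integral_const_interval[OF ab(1)] ab(2) by simp_all
  then show ?thesis using d by (simp add: field_simps)
qed

lemma godunov_range:
  assumes "initial_data lo hi X uL uR v" "0 < d"
  shows "U d v n j \<in> {lo..hi}"
proof (induction n arbitrary: j)
  case 0
  then show ?case by (rule cell_average_range[OF assms])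
next
  case (Suc n)
  then show ?case unfolding godunov_Suc[OF assms(2)] by (intro step_range) auto
qed

lemma cell_average_const:
  assumes "0 < d" "AE x in lebesgue. x \<in> {(real_of_int j - 1/2) * d..(real_of_int j + 1/2) * d} \<longrightarrow> v x = c"
    and [measurable]: "v \<in> borel_measurable lebesgue"
  shows "U d v 0 j = c"
proof -
  let ?a = "(real_of_int j - 1/2) * d" and ?b = "(real_of_int j + 1/2) * d"
  have ab: "?a \<le> ?b" "?b - ?a = d" using assms by (auto simp: algebra_simps)
  have "(LINT x:{?a..?b}|lebesgue. v x) = (LINT x:{?a..?b}|lebesgue. c)"
    using assms(2) by (intro set_lebesgue_integral_cong_AE) auto
  also have "\<dots> = c * d" using set_integral_const_interval[OF ab(1)] ab(2) by simp
  finally show ?thesis using assms(1) by simp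
qed

text \<open>In each step the outer state is lost on at most one more cell. The cells concerned lie
  left of the origin, where constants are steady.\<close>

lemma godunov_far_left:
  assumes v: "initial_data lo hi X uL uR v" and d: "0 < d"
    and "(real_of_int j + 1/2 + real n) * d \<le> - X"
  shows "U d v n j = uL"
  using assms(3)
proof (induction n arbitrary: j)
  case 0
  \<comment> \<open>The closed cell may end exactly at \<open>- X\<close>, where the value of
    \<open>v\<close> is unconstrained.\<close>
  have "AE x in lebesgue. x \<noteq> - X" by (intro AE_completion AE_lborel_singleton)
  then have "AE x in lebesgue. x \<in> {(real_of_int j - 1/2) * d..(real_of_int j + 1/2) * d} \<longrightarrow> v x = uL"
    by eventually_elim (use 0 in \<open>auto intro!: initial_dataD(4)[OF v]\<close>)
  then show ?case using cell_average_const[OF d] initial_dataD(1)[OF v] by blast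
next
  case (Suc n)
  have "(real_of_int j + 1/2 + real (Suc n)) * d < 0"
    using Suc.prems initial_dataD(3)[OF v] by linarith
  then have "real_of_int j + 1/2 + real (Suc n) < 0" using d by (simp add: mult_less_0_iff)
  then have "j < 0" by linarith
  have "(real_of_int (j + i) + 1/2 + real n) * d \<le> - X" if "i \<le> 1" for i
  proof -
    have "real_of_int (j + i) + 1/2 + real n \<le> real_of_int j + 1/2 + real (Suc n)" using that by simp
    then show ?thesis using Suc.prems d by (meson less_imp_le mult_right_mono order_trans)
  qed
  then have "U d v n (j + i) = uL" if "i \<le> 1" for i using Suc.IH that by blast
  from this[of "-1"] this[of 0] this[of 1] show ?case
    using step_const[of j uL] \<open>j < 0\<close> by (simp add: godunov_Suc[OF d])
qed

lemma godunov_far_right: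
  assumes v: "initial_data lo hi X uL uR v" and d: "0 < d"
    and "X \<le> (real_of_int j - 1/2 - real n) * d"
  shows "U d v n j = uR"
  using assms(3)
proof (induction n arbitrary: j)
  case 0
  have "AE x in lebesgue. x \<in> {(real_of_int j - 1/2) * d..(real_of_int j + 1/2) * d} \<longrightarrow> v x = uR"
    using 0 by (auto intro!: initial_dataD(5)[OF v])
  then show ?case using cell_average_const[OF d] initial_dataD(1)[OF v] by blast
next
  case (Suc n)
  have "0 < (real_of_int j - 1/2 - real (Suc n)) * d"
    using Suc.prems initial_dataD(3)[OF v] by linarith
  then have "0 < real_of_int j - 1/2 - real (Suc n)" using d by (simp add: zero_less_mult_iff)
  then have "0 < j" by linarith
  have "X \<le> (real_of_int (j + i) - 1/2 - real n) * d" if "- 1 \<le> i" for i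
  proof -
    have "real_of_int j - 1/2 - real (Suc n) \<le> real_of_int (j + i) - 1/2 - real n"
      using that by simp
    then show ?thesis using Suc.prems d by (meson less_imp_le mult_right_mono order_trans)
  qed
  then have "U d v n (j + i) = uR" if "- 1 \<le> i" for i using Suc.IH that by blast
  from this[of "-1"] this[of 0] this[of 1] show ?case
    using step_const[of j uR] \<open>0 < j\<close> by (simp add: godunov_Suc[OF d])
qed

text \<open>The scheme is read as a recursion between functions on the line: neighbouring cells
  become translates by \<open>d\<close>, sums over cells become integrals, and summation by parts
  becomes translation invariance of the integral.\<close>

definition ux :: "real \<Rightarrow> (real \<Rightarrow> real) \<Rightarrow> nat \<Rightarrow> real \<Rightarrow> real"
  where "ux d v n x = U d v n (cell_index d x)"

definition hx :: "real \<Rightarrow> (real \<Rightarrow> real) \<Rightarrow> nat \<Rightarrow> real \<Rightarrow> real"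
  where "hx d v n x = godunov_flux (face_flux (cell_index d x)) (ux d v n (x + d)) (ux d v n x)"

definition qx :: "(int \<Rightarrow> real) \<Rightarrow> real \<Rightarrow> (real \<Rightarrow> real) \<Rightarrow> nat \<Rightarrow> real \<Rightarrow> real"
  where "qx k d v n x = entropy_flux (face_flux (cell_index d x)) (ux d v n (x + d)) (ux d v n x)
    (k (cell_index d x + 1)) (k (cell_index d x))"

lemma ux_measurable [measurable]: "ux d v n \<in> borel_measurable borel"
  unfolding ux_def by measurable

lemma hx_measurable [measurable]: "0 < d \<Longrightarrow> hx d v n \<in> borel_measurable borel"
  unfolding hx_def ux_def by (simp only: cell_index_add) measurable

lemma qx_measurable [measurable]: "0 < d \<Longrightarrow> qx k d v n \<in> borel_measurable borel"
  unfolding qx_def ux_def by (simp only: cell_index_add) measurable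

lemma godunov_approx_ux: "godunov_approx lam d f g v x t = ux d v (time_level (lam * d) t) x"
  by (simp add: godunov_approx_eq ux_def)

lemma ux_range: "initial_data lo hi X uL uR v \<Longrightarrow> 0 < d \<Longrightarrow> ux d v n x \<in> {lo..hi}"
  unfolding ux_def by (rule godunov_range)

lemma ux_far_left:
  assumes v: "initial_data lo hi X uL uR v" and d: "0 < d" and x: "x \<le> - X - (real n + 1) * d"
  shows "ux d v n x = uL"
  unfolding ux_def
proof (rule godunov_far_left[OF v d])
  have "(real_of_int (cell_index d x) + 1/2 + real n) * d
      = (real_of_int (cell_index d x) - 1/2) * d + (real n + 1) * d"
    by (simp add: algebra_simps)
  then show "(real_of_int (cell_index d x) + 1/2 + real n) * d \<le> - X"
    using cell_index_bounds(1)[OF d, of x] x by linarith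
qed

lemma ux_far_right:
  assumes v: "initial_data lo hi X uL uR v" and d: "0 < d" and x: "X + (real n + 1) * d \<le> x"
  shows "ux d v n x = uR"
  unfolding ux_def
proof (rule godunov_far_right[OF v d])
  have "(real_of_int (cell_index d x) - 1/2 - real n) * d
      = (real_of_int (cell_index d x) + 1/2) * d - (real n + 1) * d"
    by (simp add: algebra_simps)
  then show "X \<le> (real_of_int (cell_index d x) - 1/2 - real n) * d"
    using cell_index_bounds(2)[OF d, of x] x by linarith
qed

lemma ux_Suc:
  "0 < d \<Longrightarrow> ux d v (Suc n) x = ux d v n x - lam * (hx d v n x - hx d v n (x - d))"
  by (simp add: ux_def hx_def godunov_Suc cell_update_def cell_index_add cell_index_diff)

text \<open>The Kato inequality against a family \<open>k\<close> that the scheme leaves unchanged.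
  Letting \<open>k\<close> depend on the cell admits steady states with a jump at the origin, from
  which the \<Gamma> condition will be derived.\<close>

lemma ux_kato_steady:
  assumes v: "initial_data lo hi X uL uR v" and d: "0 < d"
    and k: "\<And>j. k j \<in> {lo..hi}"
    and steady: "step (cell_index d x) (k (cell_index d x - 1)) (k (cell_index d x)) (k (cell_index d x + 1))
      = k (cell_index d x)"
  shows "\<bar>ux d v (Suc n) x - k (cell_index d x)\<bar>
    \<le> \<bar>ux d v n x - k (cell_index d x)\<bar> - lam * (qx k d v n x - qx k d v n (x - d))"
proof -
  define j where "j = cell_index d x"
  have "\<bar>step j (U d v n (j - 1)) (U d v n j) (U d v n (j + 1)) - step j (k (j - 1)) (k j) (k (j + 1))\<bar>
     \<le> \<bar>U d v n j - k j\<bar> - lam * (entropy_flux (face_flux j) (U d v n (j + 1)) (U d v n j) (k (j + 1)) (k j)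
        - entropy_flux (face_flux (j - 1)) (U d v n j) (U d v n (j - 1)) (k j) (k (j - 1)))"
    using lam_pos cfl k godunov_range[OF v d]
    by (intro cell_update_kato[OF face_flux_lipschitz face_flux_lipschitz]) auto
  then show ?thesis
    using steady by (simp add: ux_def qx_def godunov_Suc[OF d] cell_index_add[OF d] cell_index_diff[OF d] j_def)
qed

lemma flux_bounded: obtains B where "0 \<le> B" "\<And>w. w \<in> {lo..hi} \<Longrightarrow> \<bar>f w\<bar> \<le> B"
    "\<And>w. w \<in> {lo..hi} \<Longrightarrow> \<bar>g w\<bar> \<le> B"
proof -
  have "bounded (f ` {lo..hi})" "bounded (g ` {lo..hi})"
    using f_lipschitz g_lipschitz
    by (auto intro!: compact_imp_bounded compact_continuous_image lipschitz_on_continuous_on)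
  then obtain a b where "\<forall>w\<in>{lo..hi}. norm (f w) \<le> a" "\<forall>w\<in>{lo..hi}. norm (g w) \<le> b"
    unfolding bounded_iff by auto
  then show thesis by (intro that[of "max 0 (max a b)"]) force+
qed

lemma face_flux_bounded:
  assumes "\<And>w. w \<in> {lo..hi} \<Longrightarrow> \<bar>f w\<bar> \<le> B" "\<And>w. w \<in> {lo..hi} \<Longrightarrow> \<bar>g w\<bar> \<le> B"
    and "a \<in> {lo..hi}" "b \<in> {lo..hi}"
  shows "\<bar>godunov_flux (face_flux j) a b\<bar> \<le> B"
proof -
  obtain w where "w \<in> {lo..hi}" "godunov_flux (face_flux j) a b = face_flux j w"
    using godunov_flux_in_range[OF face_flux_continuous] assms by blast
  then show ?thesis using assms by (simp add: face_flux_def)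
qed

text \<open>Under the integral the flux difference telescopes: only the flux over two end strips of
  width \<open>d\<close> survives, regardless of the length of \<open>{a..x}\<close>. Each strip
  contributes at most \<open>B * d\<close>, so the primitive moves at a bounded rate per time step
  \<open>lam * d\<close>.\<close>

lemma primitive_step:
  assumes v: "initial_data lo hi X uL uR v" and d: "0 < d"
    and B: "\<And>w. w \<in> {lo..hi} \<Longrightarrow> \<bar>f w\<bar> \<le> B" "\<And>w. w \<in> {lo..hi} \<Longrightarrow> \<bar>g w\<bar> \<le> B"
  shows "\<bar>\<integral>y. indicator {a..x} y * (ux d v (Suc n) y - ux d v n y) \<partial>lborel\<bar> \<le> 2 * B * (lam * d)"
proof -
  have hB: "\<bar>hx d v n y\<bar> \<le> B" for y
    unfolding hx_def using ux_range[OF v d] by (intro face_flux_bounded B) auto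
  have [measurable]: "hx d v n \<in> borel_measurable borel" using d by measurable
  have B0: "0 \<le> B" using hB[of 0] by linarith
  have int: "integrable lborel (\<lambda>y. indicator {s..t} y * hx d v n y)" for s t
    using hB B0 by (intro integrable_bounded_box[of _ B s t]) (auto simp: abs_mult split: split_indicator)
  have small: "\<bar>\<integral>y. indicator {t-d..t} y * hx d v n y \<partial>lborel\<bar> \<le> B * d" for t
  proof -
    have "\<bar>\<integral>y. indicator {t-d..t} y * hx d v n y \<partial>lborel\<bar>
        \<le> (\<integral>y. indicator {t-d..t} y * B \<partial>lborel)"
    proof (rule integral_abs_bound_integral)
      show "integrable lborel (\<lambda>y. indicator {t-d..t} y * B)"
        using B0 by (intro integrable_bounded_box[of _ B "t-d" t]) (auto split: split_indicator)
    qed (use int hB in \<open>auto split: split_indicator\<close>)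
    then show ?thesis using d by (simp add: mult.commute)
  qed
  have eq: "(\<integral>y. indicator {a..x} y * (hx d v n y - hx d v n (y - d)) \<partial>lborel)
      = (\<integral>y. indicator {x-d..x} y * hx d v n y \<partial>lborel) - (\<integral>y. indicator {a-d..a} y * hx d v n y \<partial>lborel)"
    if "a \<le> x"
  proof -
    have shift: "(\<integral>y. indicator {a..x} y * hx d v n (y - d) \<partial>lborel)
        = (\<integral>y. indicator {a-d..x-d} y * hx d v n y \<partial>lborel)"
      by (subst integral_translate[of _ "-d", symmetric])
        (auto intro!: Bochner_Integration.integral_cong split: split_indicator)
    have int': "integrable lborel (\<lambda>y. indicator {a..x} y * hx d v n (y - d))"
      using hB B0 by (intro integrable_bounded_box[of _ B a x]) (auto simp: abs_mult split: split_indicator)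
    have "(\<integral>y. indicator {a..x} y * (hx d v n y - hx d v n (y - d)) \<partial>lborel)
        = (\<integral>y. indicator {a..x} y * hx d v n y \<partial>lborel) - (\<integral>y. indicator {a-d..x-d} y * hx d v n y \<partial>lborel)"
      by (subst shift[symmetric], subst Bochner_Integration.integral_diff[OF int int', symmetric])
        (simp add: right_diff_distrib)
    moreover have "(\<integral>y. indicator {a..x} y * hx d v n y \<partial>lborel) + (\<integral>y. indicator {a-d..a} y * hx d v n y \<partial>lborel)
        = (\<integral>y. indicator {a-d..x-d} y * hx d v n y \<partial>lborel) + (\<integral>y. indicator {x-d..x} y * hx d v n y \<partial>lborel)"
    proof -
      have "AE y in lborel. y \<noteq> a" "AE y in lborel. y \<noteq> x - d"
        by (rule AE_lborel_singleton)+
      then have "AE y in lborel. indicator {a..x} y * hx d v n y + indicator {a-d..a} y * hx d v n y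
        = indicator {a-d..x-d} y * hx d v n y + indicator {x-d..x} y * hx d v n y"
        by eventually_elim (use d that in \<open>auto split: split_indicator\<close>)
      then have "(\<integral>y. indicator {a..x} y * hx d v n y + indicator {a-d..a} y * hx d v n y \<partial>lborel)
        = (\<integral>y. indicator {a-d..x-d} y * hx d v n y + indicator {x-d..x} y * hx d v n y \<partial>lborel)"
        by (intro integral_cong_AE) auto
      then show ?thesis by (simp add: Bochner_Integration.integral_add[OF int int])
    qed
    ultimately show ?thesis by linarith
  qed
  show ?thesis
  proof (cases "a \<le> x")
    case True
    have "(\<integral>y. indicator {a..x} y * (ux d v (Suc n) y - ux d v n y) \<partial>lborel)
        = - lam * (\<integral>y. indicator {a..x} y * (hx d v n y - hx d v n (y - d)) \<partial>lborel)"
      by (subst Bochner_Integration.integral_mult_right_zero[symmetric])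
        (auto intro!: Bochner_Integration.integral_cong simp: ux_Suc[OF d] algebra_simps)
    then have "\<bar>\<integral>y. indicator {a..x} y * (ux d v (Suc n) y - ux d v n y) \<partial>lborel\<bar>
        = lam * \<bar>(\<integral>y. indicator {x-d..x} y * hx d v n y \<partial>lborel) - (\<integral>y. indicator {a-d..a} y * hx d v n y \<partial>lborel)\<bar>"
      using lam_pos by (simp add: eq[OF True] abs_mult)
    also have "\<dots> \<le> lam * (B * d + B * d)"
      using lam_pos small[of x] small[of a] by (intro mult_left_mono) linarith+
    finally show ?thesis by (simp add: algebra_simps)
  qed (use B0 d lam_pos in simp)
qed

lemma primitive_steps:
  assumes v: "initial_data lo hi X uL uR v" and d: "0 < d"
    and B: "\<And>w. w \<in> {lo..hi} \<Longrightarrow> \<bar>f w\<bar> \<le> B" "\<And>w. w \<in> {lo..hi} \<Longrightarrow> \<bar>g w\<bar> \<le> B"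
  shows "\<bar>\<integral>y. indicator {a..x} y * (ux d v (n + m) y - ux d v n y) \<partial>lborel\<bar> \<le> 2 * B * (lam * d) * m"
proof (induction m)
  case (Suc m)
  have int: "integrable lborel (\<lambda>y. indicator {a..x} y * (ux d v m' y - ux d v n' y))" for m' n'
  proof (rule integrable_bounded_box[of _ "hi - lo" a x])
    show "\<bar>indicator {a..x} y * (ux d v m' y - ux d v n' y)\<bar> \<le> hi - lo" for y
      using ux_range[OF v d, of m' y] ux_range[OF v d, of n' y] lo_less_hi
      by (auto simp: abs_mult split: split_indicator)
  qed auto
  have "(\<integral>y. indicator {a..x} y * (ux d v (n + Suc m) y - ux d v n y) \<partial>lborel)
      = (\<integral>y. indicator {a..x} y * (ux d v (Suc (n + m)) y - ux d v (n + m) y) \<partial>lborel)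
        + (\<integral>y. indicator {a..x} y * (ux d v (n + m) y - ux d v n y) \<partial>lborel)"
    by (subst Bochner_Integration.integral_add[OF int int, symmetric])
      (auto intro!: Bochner_Integration.integral_cong simp: algebra_simps)
  with Suc primitive_step[OF v d B, of a x "n + m"] show ?case
    by (simp add: algebra_simps)
qed simp

lemma primitive_time_estimate:
  assumes v: "initial_data lo hi X uL uR v" and d: "0 < d"
    and B: "\<And>w. w \<in> {lo..hi} \<Longrightarrow> \<bar>f w\<bar> \<le> B" "\<And>w. w \<in> {lo..hi} \<Longrightarrow> \<bar>g w\<bar> \<le> B"
    and st: "0 \<le> s" "s \<le> t"
  shows "\<bar>\<integral>y. indicator {a..x} y * (ux d v (time_level (lam * d) t) y - ux d v (time_level (lam * d) s) y) \<partial>lborel\<bar>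
    \<le> 2 * B * (t - s + lam * d)"
proof -
  let ?n = "time_level (lam * d) s" and ?n' = "time_level (lam * d) t"
  have tau: "0 < lam * d" using lam_pos d by simp
  have B0: "0 \<le> B" using B(1)[of lo] lo_less_hi by force
  have "?n \<le> ?n'" using st tau by (intro time_level_mono)
  then obtain m where m: "?n' = ?n + m" using le_Suc_ex by blast
  have "real ?n' * (lam * d) \<le> t" "s < (real ?n + 1) * (lam * d)"
    using time_level_bounds[OF tau] st by auto
  \<comment> \<open>Both times are rounded down to time levels, so the number of steps between them
    can exceed \<open>(t - s) / (lam * d)\<close> by at most one; this is the extra
    \<open>lam * d\<close> in the bound.\<close>
  then have "real m * (lam * d) \<le> t - s + lam * d" unfolding m by (simp add: algebra_simps)
  then have "2 * B * (real m * (lam * d)) \<le> 2 * B * (t - s + lam * d)"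
    using B0 by (intro mult_left_mono) auto
  with primitive_steps[OF v d B, of a x ?n m] show ?thesis
    unfolding m by (simp add: algebra_simps)
qed

end

section \<open>Compactness in space and time\<close>

lemma rational_near_in_interval:
  fixes a b x e :: real
  assumes "a < b" "x \<in> {a..b}" "0 < e"
  obtains q where "q \<in> \<rat>" "q \<in> {a..b}" "\<bar>x - q\<bar> < e"
proof -
  have "max a (x - e) < min b (x + e)" using assms by auto
  then obtain q where "q \<in> \<rat>" "max a (x - e) < q" "q < min b (x + e)"
    using Rats_dense_in_real by blast
  then show thesis by (intro that[of q]) auto
qed

lemma borel_measurable_fst_snd [measurable]:
  "(fst :: real \<times> real \<Rightarrow> real) \<in> borel_measurable borel"
  "(snd :: real \<times> real \<Rightarrow> real) \<in> borel_measurable borel"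
  by (auto intro!: borel_measurable_continuous_onI continuous_intros)

text \<open>\<open>P\<close> need not be measurable, so the exceptional set is first enlarged to a
  Borel null set, for which the order of the two quantifiers can be exchanged.\<close>

lemma AE_lborel_prod_swap:
  fixes P :: "real \<Rightarrow> real \<Rightarrow> bool"
  assumes "AE p in lborel. P (fst p) (snd p)"
  shows "AE t in lborel. AE x in lborel. P x t"
proof -
  obtain N where N: "{p. \<not> P (fst p) (snd p)} \<subseteq> N" "N \<in> sets (lborel :: (real \<times> real) measure)" "emeasure lborel N = 0"
    using assms by (auto elim!: AE_E)
  have N': "N \<in> sets (lborel \<Otimes>\<^sub>M lborel)" using N(2) by (simp only: lborel_prod)
  have "AE p in lborel \<Otimes>\<^sub>M lborel. (fst p, snd p) \<notin> N"
    unfolding lborel_prod using N by (intro AE_I[of _ _ N]) auto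
  then have "AE x in lborel. AE t in lborel. (x, t) \<notin> N"
    using lborel_pair.AE_pair[of "\<lambda>p. p \<notin> N"] by simp
  moreover have "(AE x in lborel. AE t in lborel. (x, t) \<notin> N) \<longleftrightarrow> (AE t in lborel. AE x in lborel. (x, t) \<notin> N)"
  proof (rule lborel_pair.AE_commute)
    have "{p \<in> space (lborel \<Otimes>\<^sub>M lborel). (fst p, snd p) \<notin> N} = space (lborel \<Otimes>\<^sub>M lborel) - N" by auto
    then show "{p \<in> space (lborel \<Otimes>\<^sub>M lborel). (fst p, snd p) \<notin> N} \<in> sets (lborel \<Otimes>\<^sub>M lborel)"
      using sets.compl_sets[OF N'] by simp
  qed
  ultimately have "AE t in lborel. AE x in lborel. (x, t) \<notin> N" by blast
  then show ?thesis
  proof (rule eventually_mono)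
    fix t assume "AE x in lborel. (x, t) \<notin> N"
    then show "AE x in lborel. P x t" 
    proof (rule eventually_mono)
      show "P x t" if "(x, t) \<notin> N" for x
        using that subsetD[OF N(1), of "(x, t)"] by auto
    qed
  qed
qed

lemma nn_integral_lborel_prod_swap:
  fixes F :: "real \<times> real \<Rightarrow> ennreal"
  assumes "F \<in> borel_measurable borel"
  shows "(\<integral>\<^sup>+p. F p \<partial>lborel) = (\<integral>\<^sup>+t. (\<integral>\<^sup>+x. F (x, t) \<partial>lborel) \<partial>lborel)"
proof -
  have "F \<in> borel_measurable (lborel \<Otimes>\<^sub>M lborel)"
    using assms by (simp only: lborel_prod measurable_lborel1 measurable_lborel2)
  from lborel_pair.nn_integral_snd[OF this] show ?thesis by (simp only: lborel_prod)
qed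

lemma AE_lborel_pair_snd:
  assumes "AE t in lborel. P t"
  shows "AE p in (lborel :: (real \<times> real) measure). P (snd p)"
proof -
  obtain N where N: "{t. \<not> P t} \<subseteq> N" "N \<in> sets (lborel::real measure)" "emeasure lborel N = 0"
    using assms by (auto elim!: AE_E)
  have [measurable]: "N \<in> sets borel" using N(2) by simp
  have "(\<integral>\<^sup>+p. indicator N (snd p) \<partial>(lborel :: (real \<times> real) measure)) = (\<integral>\<^sup>+t. (\<integral>\<^sup>+x. indicator N t \<partial>(lborel::real measure)) \<partial>lborel)"
    by (subst nn_integral_lborel_prod_swap) auto
  also have "\<dots> = 0"
  proof -
    have "AE t in lborel. t \<notin> N" using N by (intro AE_I[of _ _ N]) auto
    then have "AE t in lborel. (\<integral>\<^sup>+x. indicator N t \<partial>(lborel::real measure)) = 0"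
      by eventually_elim simp
    then show ?thesis by (subst nn_integral_0_iff_AE) auto
  qed
  finally have "AE p in (lborel :: (real \<times> real) measure). indicator N (snd p) = (0::ennreal)"
    by (subst (asm) nn_integral_0_iff_AE) auto
  then show ?thesis by (rule eventually_mono) (use N(1) in \<open>auto split: split_indicator_asm\<close>)
qed

lemma AE_lborel_pair_fst:
  assumes "AE t in lborel. P t"
  shows "AE p in (lborel :: (real \<times> real) measure). P (fst p)"
proof -
  obtain N where N: "{t. \<not> P t} \<subseteq> N" "N \<in> sets (lborel::real measure)" "emeasure lborel N = 0"
    using assms by (auto elim!: AE_E)
  have [measurable]: "N \<in> sets borel" using N(2) by simp
  have "(\<integral>\<^sup>+p. indicator N (fst p) \<partial>(lborel :: (real \<times> real) measure)) = (\<integral>\<^sup>+t. (\<integral>\<^sup>+x. indicator N x \<partial>(lborel::real measure)) \<partial>(lborel::real measure))"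
    by (subst nn_integral_lborel_prod_swap) auto
  also have "\<dots> = 0" using N by simp
  finally have "AE p in (lborel :: (real \<times> real) measure). indicator N (fst p) = (0::ennreal)"
    by (subst (asm) nn_integral_0_iff_AE) auto
  then show ?thesis by (rule eventually_mono) (use N(1) in \<open>auto split: split_indicator_asm\<close>)
qed

lemma dominated_box_convergence:
  fixes F :: "nat \<Rightarrow> 'a::euclidean_space \<Rightarrow> real"
  assumes [measurable]: "\<And>n. F n \<in> borel_measurable borel" "G \<in> borel_measurable borel"
    and "AE p in lborel. (\<lambda>n. F n p) \<longlonglongrightarrow> G p"
    and M: "\<And>n p. \<bar>F n p\<bar> \<le> M" and z: "\<And>n p. p \<notin> cbox a b \<Longrightarrow> F n p = 0"
  shows "(\<lambda>n. \<integral>p. F n p \<partial>lborel) \<longlonglongrightarrow> (\<integral>p. G p \<partial>lborel)"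
proof (rule integral_dominated_convergence[where w="\<lambda>p. indicator (cbox a b) p *\<^sub>R M"])
  show "integrable lborel (\<lambda>p. indicator (cbox a b) p *\<^sub>R M)"
    by (intro integrable_indicator) (use emeasure_lborel_cbox_finite[of a b] in \<open>auto simp: less_top\<close>)
  show "AE p in lborel. norm (F n p) \<le> indicator (cbox a b) p *\<^sub>R M" for n
    using M z by (intro AE_I2) (auto split: split_indicator)
qed (use assms in auto)

lemma cbox_Pair_iff: "p \<in> cbox (a, b) (c, d) \<longleftrightarrow> fst p \<in> {a..c} \<and> snd p \<in> {b..d}" for a b c d :: real
  by (cases p) (auto simp: cbox_Pair_eq)

text \<open>The spatial primitives converge along a diagonal subsequence; the variation bound makes \<open>u k\<close>
  uniformly close to difference quotients of its primitive, hence Cauchy in \<open>L\<^sup>1\<close>.\<close>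

lemma space_time_compactness:
  fixes u :: "nat \<Rightarrow> real \<times> real \<Rightarrow> real"
  assumes meas [measurable]: "\<And>k. u k \<in> borel_measurable borel"
    and range: "\<And>k p. u k p \<in> {lo..hi}"
    and R: "0 < R" and T: "0 < T" and K: "0 \<le> K" and C: "0 \<le> C"
    and far_left: "\<And>k x t. t \<in> {0..T} \<Longrightarrow> x \<le> - R \<Longrightarrow> u k (x, t) = cl"
    and far_right: "\<And>k x t. t \<in> {0..T} \<Longrightarrow> R \<le> x \<Longrightarrow> u k (x, t) = cr"
    and TV: "\<And>k t. t \<in> {0..T} \<Longrightarrow> TV (\<lambda>x. u k (x, t)) \<le> ennreal K"
    and time: "\<And>k x s t. 0 \<le> s \<Longrightarrow> s \<le> t \<Longrightarrow> t \<le> T \<Longrightarrow>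
      \<bar>\<integral>y. indicator {-R..x} y * (u k (y, t) - u k (y, s)) \<partial>lborel\<bar> \<le> C * (t - s + tau k)"
    and tau: "tau \<longlonglongrightarrow> 0"
  obtains r v where "strict_mono r" "v \<in> borel_measurable borel"
    "\<And>p. v p \<in> {lo..hi}"
    "AE p in lborel. snd p \<in> {0..T} \<longrightarrow> (\<lambda>k. u (r k) p) \<longlonglongrightarrow> v p"
proof -
  define M where "M = max \<bar>lo\<bar> \<bar>hi\<bar>"
  have M: "\<bar>u k x\<bar> \<le> M" for k x using range[of k x] by (auto simp: M_def)
  have M0: "0 \<le> M" by (simp add: M_def)
  have sec [measurable]: "(\<lambda>x. u k (x, t)) \<in> borel_measurable borel" for k t by measurable
  define A where "A k x t = (\<integral>y. indicator {-R..x} y * u k (y, t) \<partial>lborel)" for k x t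
  have intA: "integrable lborel (\<lambda>y. indicator {a..b} y * u k (y, t))" for k a b t
    using M M0 by (intro integrable_bounded_box[of _ M a b]) (auto simp: abs_mult split: split_indicator)
  have A_bound: "\<bar>A k x t\<bar> \<le> M * (2 * R + 1)" if "x \<in> {-R..R+1}" for k x t
  proof -
    have "\<bar>A k x t\<bar> \<le> (\<integral>y. indicator {-R..x} y * M \<partial>lborel)"
      unfolding A_def
    proof (rule integral_abs_bound_integral)
      show "integrable lborel (\<lambda>y. indicator {-R..x} y * M)"
        using M0 by (intro integrable_bounded_box[of _ M "-R" x]) (auto split: split_indicator)
    qed (use intA M in \<open>auto split: split_indicator\<close>)
    also have "\<dots> = M * (x + R)" using that by (simp add: mult.commute)
    also have "\<dots> \<le> M * (2 * R + 1)" using that M0 by (intro mult_left_mono) auto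
    finally show ?thesis .
  qed
  \<comment> \<open>This links the two halves of the argument: forward means of \<open>u k\<close>
    are increments of the primitive, for which compactness is available.\<close>
  have A_diff: "A k (x + h) t - A k x t = (\<integral>s. indicator {0..h} s * u k (x + s, t) \<partial>lborel)"
    if "- R \<le> x" "0 \<le> h" for k x h t
  proof -
    have "(\<integral>s. indicator {0..h} s * u k (x + s, t) \<partial>lborel)
        = (\<integral>y. indicator {x..x+h} y * u k (y, t) \<partial>lborel)"
      by (subst integral_translate[of _ x, symmetric])
        (auto intro!: Bochner_Integration.integral_cong simp: add.commute split: split_indicator)
    moreover have "A k (x + h) t = A k x t + (\<integral>y. indicator {x..x+h} y * u k (y, t) \<partial>lborel)"
    proof -
      have "AE y in lborel. y \<noteq> x" by (rule AE_lborel_singleton)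
      then have "AE y in lborel. indicator {-R..x+h} y * u k (y, t)
          = indicator {-R..x} y * u k (y, t) + indicator {x..x+h} y * u k (y, t)"
        by eventually_elim (use that in \<open>auto split: split_indicator\<close>)
      then have "A k (x + h) t = (\<integral>y. indicator {-R..x} y * u k (y, t) + indicator {x..x+h} y * u k (y, t) \<partial>lborel)"
        unfolding A_def by (intro integral_cong_AE) auto
      then show ?thesis unfolding A_def by (simp add: Bochner_Integration.integral_add[OF intA intA])
    qed
    ultimately show ?thesis by simp
  qed
  have A_lip: "\<bar>A k x t - A k x' t\<bar> \<le> M * \<bar>x - x'\<bar>" if "- R \<le> x" "- R \<le> x'" for k x x' t
  proof -
    have *: "\<bar>A k (y + h) t - A k y t\<bar> \<le> M * h" if "- R \<le> y" "0 \<le> h" for y h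
    proof -
      have "\<bar>\<integral>s. indicator {0..h} s * u k (y + s, t) \<partial>lborel\<bar> \<le> (\<integral>s. indicator {0..h} s * M \<partial>lborel)"
      proof (rule integral_abs_bound_integral)
        show "integrable lborel (\<lambda>y. indicator {0..h} y * M)"
          using M0 by (intro integrable_bounded_box[of _ M 0 h]) (auto split: split_indicator)
        show "integrable lborel (\<lambda>s. indicator {0..h} s * u k (y + s, t))"
          using M M0 by (intro integrable_bounded_box[of _ M 0 h]) (auto simp: abs_mult split: split_indicator)
      qed (use M in \<open>auto split: split_indicator\<close>)
      then show ?thesis using A_diff[OF that] that by (simp add: mult.commute)
    qed
    show ?thesis
    proof (cases "x \<le> x'")
      case True
      then show ?thesis using *[of x "x' - x"] that by (simp add: abs_minus_commute)
    next
      case False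
      then show ?thesis using *[of x' "x - x'"] that by simp
    qed
  qed
  have A_time: "\<bar>A k x t - A k x s\<bar> \<le> C * (\<bar>t - s\<bar> + tau k)" if "s \<in> {0..T}" "t \<in> {0..T}" for k x s t
  proof -
    have *: "\<bar>A k x b - A k x a\<bar> \<le> C * (b - a + tau k)" if "0 \<le> a" "a \<le> b" "b \<le> T" for a b
      using time[OF that, of x k] unfolding A_def
      by (subst Bochner_Integration.integral_diff[OF intA intA, symmetric]) (simp add: right_diff_distrib)
    show ?thesis
    proof (cases "s \<le> t")
      case True
      then show ?thesis using *[of s t] that by simp
    next
      case False
      then show ?thesis using *[of t s] that by (simp add: abs_minus_commute)
    qed
  qed
  \<comment> \<open>A countable dense set for the diagonal extraction. It reaches to
    \<open>R + 1\<close> because forward means at points of \<open>{-R..R}\<close> look ahead by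
    \<open>h \<le> 1\<close>.\<close>
  define S where "S = (\<rat> \<inter> {-R..R+1}) \<times> (\<rat> \<inter> {0..T})"
  have "countable S" unfolding S_def by (intro countable_SIGMA countable_Int1 countable_rat)
  then obtain r1 :: "nat \<Rightarrow> nat" where r1: "strict_mono r1"
    "\<And>p. p \<in> S \<Longrightarrow> \<exists>l. (\<lambda>n. A (r1 n) (fst p) (snd p)) \<longlonglongrightarrow> l"
  proof (rule function_convergent_subsequence[of S "\<lambda>n p. A n (fst p) (snd p)" "M * (2 * R + 1)"])
    show "norm (A n (fst p) (snd p)) \<le> M * (2 * R + 1)" if "p \<in> S" for n p
      using A_bound[of "fst p"] that by (auto simp: S_def)
  qed (use that in blast)+
  have tau1: "(\<lambda>n. tau (r1 n)) \<longlonglongrightarrow> 0"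
    using LIMSEQ_subseq_LIMSEQ[OF tau r1(1)] by (simp add: o_def)
  \<comment> \<open>Convergence spreads from the rational points by equicontinuity, which in time
    holds only up to \<open>tau\<close>. Moving in space and in time costs \<open>e / 8\<close>
    each, so two indices differ by less than \<open>e / 4 + 2 * (e / 4)\<close>.\<close>
  have A_cauchy: "Cauchy (\<lambda>n. A (r1 n) x t)" if x: "x \<in> {-R..R+1}" and t: "t \<in> {0..T}" for x t
  proof (rule metric_CauchyI)
    fix e :: real assume e: "0 < e"
    obtain x' where x': "x' \<in> \<rat>" "x' \<in> {-R..R+1}" "\<bar>x - x'\<bar> < e / (8 * (M + 1))"
      using rational_near_in_interval[of "-R" "R+1" x "e / (8 * (M + 1))"] x e R M0 by auto
    obtain t' where t': "t' \<in> \<rat>" "t' \<in> {0..T}" "\<bar>t - t'\<bar> < e / (16 * (C + 1))"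
      using rational_near_in_interval[of 0 T t "e / (16 * (C + 1))"] t e T C by auto
    have "(x', t') \<in> S" using x' t' by (simp add: S_def)
    then obtain l where "(\<lambda>n. A (r1 n) x' t') \<longlonglongrightarrow> l" using r1(2) by fastforce
    then have "Cauchy (\<lambda>n. A (r1 n) x' t')" by (rule LIMSEQ_imp_Cauchy)
    then obtain N1 where N1: "\<And>m n. m \<ge> N1 \<Longrightarrow> n \<ge> N1 \<Longrightarrow> dist (A (r1 m) x' t') (A (r1 n) x' t') < e / 4"
      using metric_CauchyD[of _ "e / 4"] e by fastforce
    have "\<forall>\<^sub>F n in sequentially. tau (r1 n) < e / (16 * (C + 1))"
      using e C by (intro order_tendstoD(2)[OF tau1]) auto
    then obtain N2 where N2: "\<And>n. n \<ge> N2 \<Longrightarrow> tau (r1 n) < e / (16 * (C + 1))"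
      by (auto simp: eventually_sequentially)
    have near: "\<bar>A (r1 n) x t - A (r1 n) x' t'\<bar> \<le> e / 4" if "n \<ge> N2" for n
    proof -
      have "\<bar>A (r1 n) x t - A (r1 n) x' t\<bar> \<le> M * \<bar>x - x'\<bar>" using x x' by (intro A_lip) auto
      also have "\<dots> \<le> (M + 1) * (e / (8 * (M + 1)))" using x' M0 by (intro mult_mono) auto
      also have "\<dots> = e / 8" using M0 by (simp add: field_simps)
      finally have 1: "\<bar>A (r1 n) x t - A (r1 n) x' t\<bar> \<le> e / 8" .
      have "\<bar>A (r1 n) x' t - A (r1 n) x' t'\<bar> \<le> C * (\<bar>t - t'\<bar> + tau (r1 n))" using t t' by (intro A_time) auto
      also have "\<dots> \<le> C * (e / (8 * (C + 1)))"
      proof (rule mult_left_mono[OF _ C])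
        have half: "e / (16 * (C + 1)) = e / (8 * (C + 1)) / 2" by simp
        have "a + b \<le> q" if "a < q / 2" "b < q / 2" for a b q :: real using that by linarith
        then show "\<bar>t - t'\<bar> + tau (r1 n) \<le> e / (8 * (C + 1))"
          using t'(3) N2[OF that] unfolding half by blast
      qed
      also have "\<dots> \<le> (C + 1) * (e / (8 * (C + 1)))" using C e by (intro mult_right_mono) auto
      also have "\<dots> = e / 8" using C by (simp add: field_simps)
      finally show ?thesis using 1 by linarith
    qed
    have "dist (A (r1 m) x t) (A (r1 n) x t) < e" if "m \<ge> max N1 N2" "n \<ge> max N1 N2" for m n
      using N1[of m n] near[of m] near[of n] that unfolding dist_real_def by linarith
    then show "\<exists>N. \<forall>m\<ge>N. \<forall>n\<ge>N. dist (A (r1 m) x t) (A (r1 n) x t) < e" by blast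
  qed
  define Om where "Om = cbox (-R, 0) (R, T)"
  have Om_iff: "p \<in> Om \<longleftrightarrow> fst p \<in> {-R..R} \<and> snd p \<in> {0..T}" for p
    unfolding Om_def by (rule cbox_Pair_iff)
  have [measurable]: "Om \<in> sets borel" by (simp add: Om_def)
  define s where "s n p = indicator Om p * u (r1 n) p" for n p
  have [measurable]: "s n \<in> borel_measurable borel" for n unfolding s_def by measurable
  have s_int: "integrable lborel (s n)" for n
    by (rule integrable_bounded_box[of _ M "(-R, 0)" "(R, T)"])
      (use M M0 in \<open>auto simp: s_def Om_def[symmetric] abs_mult split: split_indicator\<close>)
  have s_cauchy: "\<exists>N. \<forall>i\<ge>N. \<forall>j\<ge>N. (LINT p|lborel. norm (s i p - s j p)) < e" if e: "0 < e" for e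
  proof -
    \<comment> \<open>Chosen so that replacing \<open>u\<close> by its forward mean costs at most
      \<open>h * K * T \<le> e / 8\<close> in \<open>L\<^sup>1\<close>, uniformly in the index; the
      summand 1 keeps the denominator positive when \<open>K = 0\<close>.\<close>
    define h where "h = min 1 (e / (8 * (T * K + 1)))"
    have TK: "0 \<le> T * K" using T K by simp
    have h: "0 < h" "h \<le> 1" using e TK by (auto simp: h_def intro!: divide_pos_pos)
    have "h * (T * K) \<le> e / (8 * (T * K + 1)) * (T * K + 1)"
      using TK e by (intro mult_mono) (auto simp: h_def)
    also have "e / (8 * (T * K + 1)) * (T * K + 1) = e / 8"
    proof -
      have "e / (8 * q) * q = e / 8" if "q \<noteq> 0" for q :: real using that by simp
      then show ?thesis using TK by (metis add_nonneg_pos less_irrefl zero_less_one)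
    qed
    finally have hK: "h * K * T \<le> e / 8" by (simp add: mult_ac)
    define Bk where "Bk n p = (\<integral>s. indicator {0..h} s * u (r1 n) (fst p + s, snd p) \<partial>lborel) / h" for n and p :: "real \<times> real"
    have [measurable]: "Bk n \<in> borel_measurable borel" for n
    proof -
      have "(\<lambda>(p, s). indicator {0..h} s * u (r1 n) (fst p + s, snd p)) \<in> borel_measurable ((borel :: (real \<times> real) measure) \<Otimes>\<^sub>M lborel)"
        by measurable
      from lborel.borel_measurable_lebesgue_integral[OF this] show ?thesis
        unfolding Bk_def by measurable
    qed
    have Bk_bound: "\<bar>Bk n p\<bar> \<le> M" for n p
    proof -
      have "\<bar>\<integral>s. indicator {0..h} s * u (r1 n) (fst p + s, snd p) \<partial>lborel\<bar> \<le> (\<integral>s. indicator {0..h} s * M \<partial>lborel)"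
      proof (rule integral_abs_bound_integral)
        show "integrable lborel (\<lambda>y. indicator {0..h} y * M)"
          using M0 by (intro integrable_bounded_box[of _ M 0 h]) (auto split: split_indicator)
        show "integrable lborel (\<lambda>s. indicator {0..h} s * u (r1 n) (fst p + s, snd p))"
          using M M0 by (intro integrable_bounded_box[of _ M 0 h]) (auto simp: abs_mult split: split_indicator)
      qed (use M in \<open>auto split: split_indicator\<close>)
      then show ?thesis using h unfolding Bk_def by (simp add: divide_le_eq mult.commute)
    qed
    have close: "(\<integral>p. indicator Om p * \<bar>u (r1 n) p - Bk n p\<bar> \<partial>lborel) \<le> e / 8" for n
    proof -
      let ?F = "\<lambda>p. indicator Om p * \<bar>u (r1 n) p - Bk n p\<bar>"
      have "ennreal (\<integral>p. ?F p \<partial>lborel) = (\<integral>\<^sup>+p. ennreal (?F p) \<partial>lborel)"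
      proof (rule nn_integral_eq_integral[symmetric])
        show "integrable lborel ?F"
        proof (rule integrable_bounded_box[of _ "2 * M" "(-R, 0)" "(R, T)"])
          show "\<bar>?F p\<bar> \<le> 2 * M" for p
            using M[of "r1 n" p] Bk_bound[of n p] M0 by (auto simp: abs_mult split: split_indicator)
        qed (auto simp: Om_def)
      qed auto
      also have "\<dots> = (\<integral>\<^sup>+t. (\<integral>\<^sup>+x. ennreal (?F (x, t)) \<partial>lborel) \<partial>lborel)"
        by (rule nn_integral_lborel_prod_swap) auto
      also have "\<dots> \<le> (\<integral>\<^sup>+t. ennreal (h * K) * indicator {0..T} t \<partial>lborel)"
      proof (rule nn_integral_mono)
        fix t :: real
        show "(\<integral>\<^sup>+x. ennreal (?F (x, t)) \<partial>lborel) \<le> ennreal (h * K) * indicator {0..T} t"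
        proof (cases "t \<in> {0..T}")
          case True
          have "(\<integral>\<^sup>+x. ennreal (?F (x, t)) \<partial>lborel)
              \<le> (\<integral>\<^sup>+x. ennreal \<bar>u (r1 n) (x, t) - (\<integral>s. indicator {0..h} s * u (r1 n) (x + s, t) \<partial>lborel) / h\<bar> \<partial>lborel)"
            by (intro nn_integral_mono) (auto simp: Bk_def split: split_indicator)
          also have "\<dots> \<le> ennreal (h * K)"
            using M by (intro average_estimate_TV[OF sec TV[OF True] K h(1)])
          finally show ?thesis using True by simp
        next
          case False
          then have "?F (x, t) = 0" for x by (auto simp: Om_iff split: split_indicator)
          then have "(\<integral>\<^sup>+x. ennreal (?F (x, t)) \<partial>lborel) = (\<integral>\<^sup>+x. 0 \<partial>(lborel::real measure))"
            by (intro nn_integral_cong) (simp only: ennreal_0)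
          then show ?thesis by simp
        qed
      qed
      also have "\<dots> = ennreal (h * K * T)" using T K h by (simp add: nn_integral_cmult ennreal_mult)
      finally show ?thesis using hK T K h by (auto dest: order_trans)
    qed
    \<comment> \<open>For fixed \<open>h\<close> the means converge at every point of the box by
      \<open>A_cauchy\<close>, and then in \<open>L\<^sup>1\<close> by dominated
      convergence.\<close>
    define Bl where "Bl p = lim (\<lambda>n. indicator Om p * Bk n p)" for p
    have Bl: "(\<lambda>n. indicator Om p * Bk n p) \<longlonglongrightarrow> Bl p" for p
    proof (cases "p \<in> Om")
      case True
      then have x: "fst p \<in> {-R..R+1}" "fst p + h \<in> {-R..R+1}" and t: "snd p \<in> {0..T}"
        using h by (auto simp: Om_iff)
      have "Cauchy (\<lambda>n. A (r1 n) (fst p + h) (snd p) - A (r1 n) (fst p) (snd p))"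
        using A_cauchy[OF x(1) t] A_cauchy[OF x(2) t]
        by (intro convergent_Cauchy convergent_diff) (simp_all add: Cauchy_convergent)
      then obtain l where "(\<lambda>n. A (r1 n) (fst p + h) (snd p) - A (r1 n) (fst p) (snd p)) \<longlonglongrightarrow> l"
        using Cauchy_convergent convergent_def by blast
      then have "(\<lambda>n. (A (r1 n) (fst p + h) (snd p) - A (r1 n) (fst p) (snd p)) / h) \<longlonglongrightarrow> l / h"
        by (intro tendsto_divide tendsto_const) (use h in auto)
      moreover have "(A (r1 n) (fst p + h) (snd p) - A (r1 n) (fst p) (snd p)) / h = indicator Om p * Bk n p" for n
        using A_diff[of "fst p" h] x h True by (simp add: Bk_def)
      ultimately have "convergent (\<lambda>n. indicator Om p * Bk n p)" by (auto simp: convergent_def)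
      then show ?thesis unfolding Bl_def by (simp add: convergent_LIMSEQ_iff)
    qed (simp add: Bl_def)
    have [measurable]: "Bl \<in> borel_measurable borel"
      unfolding Bl_def by measurable
    have Bl_bound: "\<bar>Bl p\<bar> \<le> M" for p
    proof (rule LIMSEQ_le_const2)
      show "(\<lambda>n. \<bar>indicator Om p * Bk n p\<bar>) \<longlonglongrightarrow> \<bar>Bl p\<bar>" by (intro tendsto_rabs Bl)
      show "\<exists>N. \<forall>n\<ge>N. \<bar>indicator Om p * Bk n p\<bar> \<le> M"
        using Bk_bound M0 by (auto simp: abs_mult split: split_indicator)
    qed
    have "(\<lambda>n. \<integral>p. indicator Om p * \<bar>indicator Om p * Bk n p - Bl p\<bar> \<partial>lborel) \<longlonglongrightarrow> (\<integral>p. 0 \<partial>(lborel :: (real \<times> real) measure))"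
    proof (rule dominated_box_convergence[where M="2 * M" and a="(-R, 0)" and b="(R, T)"])
      have "(\<lambda>n. indicator Om p * \<bar>indicator Om p * Bk n p - Bl p\<bar>) \<longlonglongrightarrow> indicator Om p * \<bar>Bl p - Bl p\<bar>" for p
        by (intro tendsto_intros Bl)
      then show "AE p in lborel. (\<lambda>n. indicator Om p * \<bar>indicator Om p * Bk n p - Bl p\<bar>) \<longlonglongrightarrow> 0"
        by simp
      show "\<bar>indicator Om p * \<bar>indicator Om p * Bk n p - Bl p\<bar>\<bar> \<le> 2 * M" for n p
        using Bk_bound[of n p] Bl_bound[of p] M0 by (auto simp: abs_mult split: split_indicator)
    qed (auto simp: Om_def)
    then have "\<forall>\<^sub>F n in sequentially. (\<integral>p. indicator Om p * \<bar>indicator Om p * Bk n p - Bl p\<bar> \<partial>lborel) < e / 8"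
      using e by (intro order_tendstoD(2)) auto
    then obtain N where N: "\<And>n. n \<ge> N \<Longrightarrow> (\<integral>p. indicator Om p * \<bar>indicator Om p * Bk n p - Bl p\<bar> \<partial>lborel) < e / 8"
      by (auto simp: eventually_sequentially)
    define F1 where "F1 n p = indicator Om p * \<bar>u (r1 n) p - Bk n p\<bar>" for n p
    define F2 where "F2 n p = indicator Om p * \<bar>indicator Om p * Bk n p - Bl p\<bar>" for n p
    have [measurable]: "F1 n \<in> borel_measurable borel" "F2 n \<in> borel_measurable borel" for n
      unfolding F1_def F2_def by measurable
    have int1: "integrable lborel (F1 n)" for n
    proof (rule integrable_bounded_box[of _ "2 * M" "(-R, 0)" "(R, T)"])
      show "\<bar>F1 n p\<bar> \<le> 2 * M" for p
        using M[of "r1 n" p] Bk_bound[of n p] M0 by (auto simp: F1_def abs_mult split: split_indicator)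
    qed (auto simp: Om_def F1_def)
    have int2: "integrable lborel (F2 n)" for n
    proof (rule integrable_bounded_box[of _ "2 * M" "(-R, 0)" "(R, T)"])
      show "\<bar>F2 n p\<bar> \<le> 2 * M" for p
        using Bk_bound[of n p] Bl_bound[of p] M0 by (auto simp: F2_def abs_mult split: split_indicator)
    qed (auto simp: Om_def F2_def)
    have "(LINT p|lborel. norm (s i p - s j p)) < e" if "i \<ge> N" "j \<ge> N" for i j
    proof -
      have "(LINT p|lborel. norm (s i p - s j p)) \<le> (LINT p|lborel. (F1 i p + F1 j p) + (F2 i p + F2 j p))"
      proof (rule integral_mono)
        show "integrable lborel (\<lambda>p. norm (s i p - s j p))" using s_int by auto
        show "integrable lborel (\<lambda>p. F1 i p + F1 j p + (F2 i p + F2 j p))" using int1 int2 by auto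
        show "norm (s i p - s j p) \<le> F1 i p + F1 j p + (F2 i p + F2 j p)" for p
          unfolding s_def F1_def F2_def by (cases "p \<in> Om") auto
      qed
      also have "\<dots> = ((\<integral>p. F1 i p \<partial>lborel) + (\<integral>p. F1 j p \<partial>lborel)) + ((\<integral>p. F2 i p \<partial>lborel) + (\<integral>p. F2 j p \<partial>lborel))"
        using int1 int2 by simp
      also have "\<dots> < e"
        using close[of i] close[of j] N[OF that(1)] N[OF that(2)] e unfolding F1_def F2_def by linarith
      finally show ?thesis .
    qed
    then show ?thesis by blast
  qed
  obtain r2 where r2: "strict_mono r2" "AE p in lborel. Cauchy (\<lambda>i. s (r2 i) p)"
    using cauchy_L1_AE_cauchy_subseq[OF s_int s_cauchy] by blast
  \<comment> \<open>The \<open>L\<^sup>1\<close> argument covers only the box, so the constant outer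
    states are put in by hand. Clamping gives the range at every point, also where
    \<open>lim\<close> has no meaning.\<close>
  define v where "v p = max lo (min hi (if fst p < -R then cl else if R < fst p then cr else lim (\<lambda>i. s (r2 i) p)))" for p
  show thesis
  proof (rule that[of "r1 \<circ> r2" v])
    show "strict_mono (r1 \<circ> r2)" using r1 r2 by (intro strict_mono_o)
    show "v \<in> borel_measurable borel"
      unfolding v_def by measurable
    have "lo \<le> hi" using range[of 0 undefined] by simp
    then show "v p \<in> {lo..hi}" for p by (auto simp: v_def)
    show "AE p in lborel. snd p \<in> {0..T} \<longrightarrow> (\<lambda>k. u ((r1 \<circ> r2) k) p) \<longlonglongrightarrow> v p"
      using r2(2)
    proof eventually_elim
      case (elim p)
      show ?case
      proof
        assume t: "snd p \<in> {0..T}"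
        obtain l where l: "(\<lambda>k. u (r1 (r2 k)) p) \<longlonglongrightarrow> l"
          "(if fst p < -R then cl else if R < fst p then cr else lim (\<lambda>i. s (r2 i) p)) = l"
        proof (cases "fst p \<in> {-R..R}")
          case True
          then have "p \<in> Om" using t by (simp add: Om_iff)
          have "(\<lambda>i. s (r2 i) p) \<longlonglongrightarrow> lim (\<lambda>i. s (r2 i) p)"
            using elim by (simp add: Cauchy_convergent_iff convergent_LIMSEQ_iff)
          then show ?thesis using True \<open>p \<in> Om\<close> by (intro that[of "lim (\<lambda>i. s (r2 i) p)"]) (auto simp: s_def)
        next
          case False
          have far: "fst p \<le> -R \<Longrightarrow> u k p = cl" "R \<le> fst p \<Longrightarrow> u k p = cr" for k
            using far_left[OF t, of "fst p" k] far_right[OF t, of "fst p" k] by simp_all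
          show ?thesis using False far
            by (intro that[of "if fst p < -R then cl else cr"]) (auto split: if_splits)
        qed
        have "lo \<le> l" using l(1) range by (intro LIMSEQ_le_const[OF l(1)]) auto
        moreover have "l \<le> hi" using l(1) range by (intro LIMSEQ_le_const2[OF l(1)]) auto
        ultimately have "v p = l" using l(2) by (auto simp: v_def)
        then show "(\<lambda>k. u ((r1 \<circ> r2) k) p) \<longlonglongrightarrow> v p" using l(1) by simp
      qed
    qed
  qed
qed

section \<open>Limits of the Godunov scheme\<close>

text \<open>Abel summation as translation invariance: shifting by \<open>(0, tau)\<close> and by
  \<open>(d, 0)\<close> moves the differences onto \<phi>. The shift in time maps
  \<open>{0..}\<close> to \<open>{tau..}\<close>; the missing strip \<open>{0..<tau}\<close> becomes
  the term carrying the initial data.\<close>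

lemma summation_by_parts:
  fixes E Q \<phi> :: "real \<times> real \<Rightarrow> real"
  assumes [measurable]: "E \<in> borel_measurable borel" "Q \<in> borel_measurable borel" "\<phi> \<in> borel_measurable borel"
    and E: "\<And>p. \<bar>E p\<bar> \<le> M" and Q: "\<And>p. \<bar>Q p\<bar> \<le> M" and \<phi>: "\<And>p. \<bar>\<phi> p\<bar> \<le> N"
    and supp: "\<And>p. p \<notin> cbox (-B, -B) (B, B) \<Longrightarrow> \<phi> p = 0" and d: "0 < d" and tau: "0 < tau"
  shows "(\<integral>p. indicator {0..} (snd p) * \<phi> p * (E (fst p, snd p + tau) - E p + lam * (Q p - Q (fst p - d, snd p))) \<partial>lborel)
    = - ((\<integral>p. indicator {0..} (snd p) * (E p * (\<phi> p - \<phi> (fst p, snd p - tau)) + lam * (Q p * (\<phi> (fst p + d, snd p) - \<phi> p))) \<partial>lborel)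
       + (\<integral>p. indicator {0..<tau} (snd p) * (E p * \<phi> (fst p, snd p - tau)) \<partial>lborel))"
proof -
  define B' where "B' = \<bar>B\<bar> + tau + d"
  have M0: "0 \<le> M" "0 \<le> N" using E[of 0] \<phi>[of 0] by linarith+
  have int: "integrable lborel (\<lambda>p. indicator S (snd p) * (H p * \<phi> (fst p + a, snd p + b)))"
    if [measurable]: "H \<in> borel_measurable borel" "S \<in> sets borel" and H: "\<And>p. \<bar>H p\<bar> \<le> M"
      and ab: "\<bar>a\<bar> \<le> d" "\<bar>b\<bar> \<le> tau" for H a b S
  proof (rule integrable_bounded_box[of _ "M * N" "(-B', -B')" "(B', B')"])
    show "(\<lambda>p. indicat_real S (snd p) * (H p * \<phi> (fst p + a, snd p + b))) \<in> borel_measurable borel"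
      by measurable
    fix p
    have "\<bar>H p * \<phi> (fst p + a, snd p + b)\<bar> \<le> M * N"
      unfolding abs_mult using H \<phi> M0 by (intro mult_mono) auto
    then show "\<bar>indicat_real S (snd p) * (H p * \<phi> (fst p + a, snd p + b))\<bar> \<le> M * N"
      using M0 by (auto split: split_indicator)
    assume p: "p \<notin> cbox (-B', -B') (B', B')"
    have "(fst p + a, snd p + b) \<notin> cbox (-B, -B) (B, B)"
      using p ab d tau unfolding cbox_Pair_iff B'_def by auto
    then show "indicat_real S (snd p) * (H p * \<phi> (fst p + a, snd p + b)) = 0" using supp by simp
  qed
  note int = int[where a=0 and b=0, simplified] int[where a=0 and b="-tau", simplified]
    int[where a=d and b=0, simplified] int[where a="-d" and b=0, simplified]
  have E1: "integrable lborel (\<lambda>p. indicator {0..} (snd p) * (E (fst p, snd p + tau) * \<phi> p))"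
    and Q1: "integrable lborel (\<lambda>p. indicator {0..} (snd p) * (Q (fst p - d, snd p) * \<phi> p))"
    using E Q d tau by (auto intro!: int(1))
  have E0: "integrable lborel (\<lambda>p. indicator S (snd p) * (E p * \<phi> p))"
    "integrable lborel (\<lambda>p. indicator S (snd p) * (E p * \<phi> (fst p, snd p - tau)))"
    "integrable lborel (\<lambda>p. indicator S (snd p) * (Q p * \<phi> p))"
    "integrable lborel (\<lambda>p. indicator S (snd p) * (Q p * \<phi> (fst p + d, snd p)))"
    if "S \<in> sets borel" for S
    using that E Q d tau by (auto intro!: int)
  have sE: "(\<integral>p. indicator {0..} (snd p) * (E (fst p, snd p + tau) * \<phi> p) \<partial>lborel)
      = (\<integral>p. indicator {tau..} (snd p) * (E p * \<phi> (fst p, snd p - tau)) \<partial>lborel)"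
    by (subst integral_translate[of _ "(0, tau)", symmetric])
      (auto intro!: Bochner_Integration.integral_cong split: split_indicator)
  have sQ: "(\<integral>p. indicator {0..} (snd p) * (Q (fst p - d, snd p) * \<phi> p) \<partial>lborel)
      = (\<integral>p. indicator {0..} (snd p) * (Q p * \<phi> (fst p + d, snd p)) \<partial>lborel)"
    by (subst integral_translate[of _ "(-d, 0)", symmetric])
      (auto intro!: Bochner_Integration.integral_cong split: split_indicator)
  have split: "(\<integral>p. indicator {0..} (snd p) * (E p * \<phi> (fst p, snd p - tau)) \<partial>lborel)
      = (\<integral>p. indicator {tau..} (snd p) * (E p * \<phi> (fst p, snd p - tau)) \<partial>lborel)
      + (\<integral>p. indicator {0..<tau} (snd p) * (E p * \<phi> (fst p, snd p - tau)) \<partial>lborel)"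
    by (subst Bochner_Integration.integral_add[symmetric])
      (use tau in \<open>auto intro!: E0 Bochner_Integration.integral_cong split: split_indicator\<close>)
  have "(\<integral>p. indicator {0..} (snd p) * \<phi> p * (E (fst p, snd p + tau) - E p + lam * (Q p - Q (fst p - d, snd p))) \<partial>lborel)
     = (\<integral>p. (indicator {0..} (snd p) * (E (fst p, snd p + tau) * \<phi> p) - indicator {0..} (snd p) * (E p * \<phi> p))
         + (lam * (indicator {0..} (snd p) * (Q p * \<phi> p)) - lam * (indicator {0..} (snd p) * (Q (fst p - d, snd p) * \<phi> p))) \<partial>lborel)"
    by (intro Bochner_Integration.integral_cong) (auto simp: algebra_simps)
  also have "\<dots> = (\<integral>p. indicator {0..} (snd p) * (E (fst p, snd p + tau) * \<phi> p) \<partial>lborel)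
      - (\<integral>p. indicator {0..} (snd p) * (E p * \<phi> p) \<partial>lborel)
      + (lam * (\<integral>p. indicator {0..} (snd p) * (Q p * \<phi> p) \<partial>lborel)
      - lam * (\<integral>p. indicator {0..} (snd p) * (Q (fst p - d, snd p) * \<phi> p) \<partial>lborel))"
    using E1 Q1 E0 by simp
  also have "\<dots> = - ((\<integral>p. indicator {0..} (snd p) * (E p * \<phi> p) \<partial>lborel)
      - (\<integral>p. indicator {0..} (snd p) * (E p * \<phi> (fst p, snd p - tau)) \<partial>lborel)
      + (lam * (\<integral>p. indicator {0..} (snd p) * (Q p * \<phi> (fst p + d, snd p)) \<partial>lborel)
      - lam * (\<integral>p. indicator {0..} (snd p) * (Q p * \<phi> p) \<partial>lborel))
      + (\<integral>p. indicator {0..<tau} (snd p) * (E p * \<phi> (fst p, snd p - tau)) \<partial>lborel))"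
    unfolding sE sQ split by (simp add: algebra_simps)
  also have "(\<integral>p. indicator {0..} (snd p) * (E p * \<phi> p) \<partial>lborel)
      - (\<integral>p. indicator {0..} (snd p) * (E p * \<phi> (fst p, snd p - tau)) \<partial>lborel)
      + (lam * (\<integral>p. indicator {0..} (snd p) * (Q p * \<phi> (fst p + d, snd p)) \<partial>lborel)
      - lam * (\<integral>p. indicator {0..} (snd p) * (Q p * \<phi> p) \<partial>lborel))
      = (\<integral>p. (indicator {0..} (snd p) * (E p * \<phi> p) - indicator {0..} (snd p) * (E p * \<phi> (fst p, snd p - tau)))
        + (lam * (indicator {0..} (snd p) * (Q p * \<phi> (fst p + d, snd p))) - lam * (indicator {0..} (snd p) * (Q p * \<phi> p))) \<partial>lborel)"
    using E0 by simp
  also have "\<dots> = (\<integral>p. indicator {0..} (snd p) * (E p * (\<phi> p - \<phi> (fst p, snd p - tau)) + lam * (Q p * (\<phi> (fst p + d, snd p) - \<phi> p))) \<partial>lborel)"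
    by (intro Bochner_Integration.integral_cong) (auto simp: algebra_simps)
  finally show ?thesis .
qed

lemma integral_lborel_product:
  fixes f g :: "real \<Rightarrow> real"
  assumes "integrable lborel (\<lambda>p. f (fst p) * g (snd p))"
  shows "(\<integral>p. f (fst p) * g (snd p) \<partial>lborel) = (\<integral>x. f x \<partial>lborel) * (\<integral>t. g t \<partial>lborel)"
proof -
  have "integrable (lborel \<Otimes>\<^sub>M lborel) (\<lambda>p. f (fst p) * g (snd p))"
    using assms by (simp only: lborel_prod)
  from lborel_pair.integral_fst'[OF this] show ?thesis by (simp add: lborel_prod)
qed

text \<open>What the passage to the limit uses of a test function and its two derivatives. The
  quotients are backward in time and forward in space, exactly as summation by parts produces
  them.\<close>

definition limit_weight :: "real \<Rightarrow> (real \<times> real \<Rightarrow> real) \<Rightarrow> (real \<times> real \<Rightarrow> real) \<Rightarrow> (real \<times> real \<Rightarrow> real) \<Rightarrow> bool"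
  where "limit_weight T \<phi> \<phi>x \<phi>t \<longleftrightarrow>
    \<phi> \<in> borel_measurable borel \<and> \<phi>x \<in> borel_measurable borel \<and> \<phi>t \<in> borel_measurable borel \<and>
    (\<exists>N B T'. T' < T \<and> 0 \<le> B \<and> (\<forall>p. \<bar>\<phi> p\<bar> \<le> N) \<and> (\<forall>p. p \<notin> cbox (-B, -B) (B, B) \<longrightarrow> \<phi> p = 0) \<and>
      (\<forall>p. T' < snd p \<longrightarrow> \<phi> p = 0) \<and>
      (\<forall>x x' t. \<bar>\<phi> (x, t) - \<phi> (x', t)\<bar> \<le> N * \<bar>x - x'\<bar>) \<and>
      (\<forall>x t t'. \<bar>\<phi> (x, t) - \<phi> (x, t')\<bar> \<le> N * \<bar>t - t'\<bar>)) \<and>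
    (\<forall>h. (\<forall>n. 0 < h n) \<longrightarrow> h \<longlonglongrightarrow> 0 \<longrightarrow>
      (AE p in lborel. (\<lambda>n. (\<phi> p - \<phi> (fst p, snd p - h n)) / h n) \<longlonglongrightarrow> \<phi>t p) \<and>
      (AE p in lborel. (\<lambda>n. (\<phi> (fst p + h n, snd p) - \<phi> p) / h n) \<longlonglongrightarrow> \<phi>x p))"

text \<open>The residual of the scheme, tested with \<phi> and divided by the time step, converges
  to minus the weak form. For the scheme itself the residual is zero; for entropies it is
  nonpositive up to interface terms. One limit thus yields both the weak equation and the Kruzkov
  inequalities.\<close>

lemma weak_form_limit:
  fixes E Q :: "nat \<Rightarrow> real \<times> real \<Rightarrow> real"
  assumes w: "limit_weight T \<phi> \<phi>x \<phi>t" and lam: "0 < lam"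
    and d: "\<And>n. 0 < d n" "\<And>n. d n \<le> 1" "d \<longlonglongrightarrow> 0"
    and [measurable]: "\<And>n. E n \<in> borel_measurable borel" "\<And>n. Q n \<in> borel_measurable borel"
      "E' \<in> borel_measurable borel" "Q' \<in> borel_measurable borel" "e' \<in> borel_measurable borel"
    and bnd: "\<And>n p. \<bar>E n p\<bar> \<le> M" "\<And>n p. \<bar>Q n p\<bar> \<le> M"
    and E_lim: "AE p in lborel. snd p \<in> {0..T} \<longrightarrow> (\<lambda>n. E n p) \<longlonglongrightarrow> E' p"
    and Q_lim: "AE p in lborel. snd p \<in> {0..T} \<longrightarrow> (\<lambda>n. Q n p) \<longlonglongrightarrow> Q' p"
    and e: "\<And>n x t. 0 \<le> t \<Longrightarrow> t < lam * d n \<Longrightarrow> E n (x, t) = E n (x, 0)"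
    and e_lim: "AE x in lborel. (\<lambda>n. E n (x, 0)) \<longlonglongrightarrow> e' x"
  shows "(\<lambda>n. (\<integral>p. indicator {0..} (snd p) * \<phi> p *
      (E n (fst p, snd p + lam * d n) - E n p + lam * (Q n p - Q n (fst p - d n, snd p))) \<partial>lborel) / (lam * d n))
    \<longlonglongrightarrow> - ((\<integral>p. indicator (strip T) p * (E' p * \<phi>t p + Q' p * \<phi>x p) \<partial>lborel) + (\<integral>x. e' x * \<phi> (x, 0) \<partial>lborel))"
proof -
  from w have [measurable]: "\<phi> \<in> borel_measurable borel" "\<phi>x \<in> borel_measurable borel" "\<phi>t \<in> borel_measurable borel"
    by (auto simp: limit_weight_def)
  from w obtain N B T' where T': "T' < T" and B: "0 \<le> B" and N: "\<And>p. \<bar>\<phi> p\<bar> \<le> N"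
    and supp: "\<And>p. p \<notin> cbox (-B, -B) (B, B) \<Longrightarrow> \<phi> p = 0" and zero: "\<And>p. T' < snd p \<Longrightarrow> \<phi> p = 0"
    and lip_x: "\<And>x x' t. \<bar>\<phi> (x, t) - \<phi> (x', t)\<bar> \<le> N * \<bar>x - x'\<bar>"
    and lip_t: "\<And>x t t'. \<bar>\<phi> (x, t) - \<phi> (x, t')\<bar> \<le> N * \<bar>t - t'\<bar>"
    unfolding limit_weight_def by blast
  have N0: "0 \<le> N" using N[of 0] by linarith
  have M0: "0 \<le> M" using bnd(1)[of 0 0] by linarith
  define tau where "tau n = lam * d n" for n
  have tau: "0 < tau n" "tau n \<le> lam" for n using lam d(1)[of n] d(2)[of n] by (auto simp: tau_def)
  have tau_lim: "tau \<longlonglongrightarrow> 0" unfolding tau_def using tendsto_mult_right_zero[OF d(3)] by simp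
  have qt: "AE p in lborel. (\<lambda>n. (\<phi> p - \<phi> (fst p, snd p - tau n)) / tau n) \<longlonglongrightarrow> \<phi>t p"
    and qx: "AE p in lborel. (\<lambda>n. (\<phi> (fst p + d n, snd p) - \<phi> p) / d n) \<longlonglongrightarrow> \<phi>x p"
    using w tau tau_lim d unfolding limit_weight_def by blast+
  define F where "F n p = indicator {0..} (snd p) * (E n p * ((\<phi> p - \<phi> (fst p, snd p - tau n)) / tau n)
    + Q n p * ((\<phi> (fst p + d n, snd p) - \<phi> p) / d n))" for n p
  define B' where "B' = B + lam + 1"
  have abs_add_le: "\<bar>a + b\<bar> \<le> 2 * c" if "\<bar>a\<bar> \<le> c" "\<bar>b\<bar> \<le> c" for a b c :: real
    using that by linarith
  have qt_bound: "\<bar>(\<phi> p - \<phi> (fst p, snd p - tau n)) / tau n\<bar> \<le> N" for n p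
    using lip_t[of "fst p" "snd p" "snd p - tau n"] tau(1)[of n] by (simp add: divide_le_eq)
  have qx_bound: "\<bar>(\<phi> (fst p + d n, snd p) - \<phi> p) / d n\<bar> \<le> N" for n p
    using lip_x[of "fst p + d n" "snd p" "fst p"] d(1)[of n] by (simp add: divide_le_eq)
  have F_lim: "(\<lambda>n. \<integral>p. F n p \<partial>lborel) \<longlonglongrightarrow> (\<integral>p. indicator (strip T) p * (E' p * \<phi>t p + Q' p * \<phi>x p) \<partial>lborel)"
  proof (rule dominated_box_convergence[where M="2 * (M * N)" and a="(-B', -B')" and b="(B', B')"])
    show "F n \<in> borel_measurable borel" for n unfolding F_def by measurable
    have [measurable]: "strip T \<in> sets borel" unfolding strip_def by (intro borel_open open_Times) auto
    show "(\<lambda>p. indicat_real (strip T) p * (E' p * \<phi>t p + Q' p * \<phi>x p)) \<in> borel_measurable borel" by measurable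
    show "\<bar>F n p\<bar> \<le> 2 * (M * N)" for n p
    proof -
      have "\<bar>E n p * ((\<phi> p - \<phi> (fst p, snd p - tau n)) / tau n)\<bar> \<le> M * N"
        unfolding abs_mult[of "E n p"] using bnd(1) qt_bound N0 M0 by (intro mult_mono) auto
      moreover have "\<bar>Q n p * ((\<phi> (fst p + d n, snd p) - \<phi> p) / d n)\<bar> \<le> M * N"
        unfolding abs_mult[of "Q n p"] using bnd(2) qx_bound N0 M0 by (intro mult_mono) auto
      ultimately have "\<bar>E n p * ((\<phi> p - \<phi> (fst p, snd p - tau n)) / tau n) + Q n p * ((\<phi> (fst p + d n, snd p) - \<phi> p) / d n)\<bar> \<le> 2 * (M * N)"
        using abs_add_le by blast
      moreover have "0 \<le> M * N" using N0 M0 by simp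
      ultimately show ?thesis unfolding F_def by (auto split: split_indicator)
    qed
    show "F n p = 0" if p: "p \<notin> cbox (-B', -B') (B', B')" for n p
    proof -
      have "p \<notin> cbox (-B, -B) (B, B)" "(fst p, snd p - tau n) \<notin> cbox (-B, -B) (B, B)"
        "(fst p + d n, snd p) \<notin> cbox (-B, -B) (B, B)"
        using p tau[of n] d(1,2)[of n] lam unfolding cbox_Pair_iff B'_def by auto
      then show ?thesis by (simp add: F_def supp)
    qed
    have "AE t in lborel. t \<noteq> (0::real)" by (rule AE_lborel_singleton)
    then have "AE p in lborel. snd (p :: real \<times> real) \<noteq> 0" by (rule AE_lborel_pair_snd)
    then show "AE p in lborel. (\<lambda>n. F n p) \<longlonglongrightarrow> indicator (strip T) p * (E' p * \<phi>t p + Q' p * \<phi>x p)"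
      using E_lim Q_lim qt qx
    proof eventually_elim
      case (elim p)
      consider "snd p < 0" | "0 < snd p" "snd p < T" | "T \<le> snd p" using elim(1) by linarith
      then show ?case
      proof cases
        case 1
        then show ?thesis by (simp add: F_def strip_def mem_Times_iff)
      next
        case 2
        have "(\<lambda>n. F n p) \<longlonglongrightarrow> indicator {0..} (snd p) * (E' p * \<phi>t p + Q' p * \<phi>x p)"
          unfolding F_def using 2 elim by (intro tendsto_intros) auto
        then show ?thesis using 2 by (simp add: strip_def mem_Times_iff)
      next
        case 3
        \<comment> \<open>Nothing is known about \<open>E n\<close> after time \<open>T\<close>.
          Since \<phi> vanishes beyond \<open>T' < T\<close>, so does its shift by
          \<open>tau n\<close> at times \<open>\<ge> T\<close> once \<open>tau n\<close> is
          small.\<close>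
        have "\<forall>\<^sub>F n in sequentially. tau n < T - T'" using T' by (intro order_tendstoD(2)[OF tau_lim]) simp
        then have "\<forall>\<^sub>F n in sequentially. F n p = 0"
        proof eventually_elim
          case (elim n)
          then have "\<phi> p = 0" "\<phi> (fst p, snd p - tau n) = 0" "\<phi> (fst p + d n, snd p) = 0"
            using 3 T' by (auto intro!: zero)
          then show ?case by (simp add: F_def)
        qed
        then have "(\<lambda>n. F n p) \<longlonglongrightarrow> 0" by (rule tendsto_eventually)
        then show ?thesis using 3 by (simp add: strip_def mem_Times_iff)
      qed
    qed
  qed
  \<comment> \<open>\<open>I n\<close> is the mean over the first time step, \<open>J n\<close> the
    same with \<phi> frozen at time zero. \<open>E n\<close> is constant in time on that step and
    \<phi> is Lipschitz, so the two differ by a multiple of \<open>tau n\<close>.\<close>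
  define I where "I n = (\<integral>p. indicator {0..<tau n} (snd p) * (E n p * \<phi> (fst p, snd p - tau n)) \<partial>lborel) / tau n" for n
  define J where "J n = (\<integral>x. E n (x, 0) * \<phi> (x, 0) \<partial>lborel)" for n
  have J_lim: "J \<longlonglongrightarrow> (\<integral>x. e' x * \<phi> (x, 0) \<partial>lborel)"
    unfolding J_def
  proof (rule dominated_box_convergence[where M="M * N" and a="-B" and b=B])
    show "AE x in lborel. (\<lambda>n. E n (x, 0) * \<phi> (x, 0)) \<longlonglongrightarrow> e' x * \<phi> (x, 0)"
      using e_lim by eventually_elim (intro tendsto_intros)
    show "\<bar>E n (x, 0) * \<phi> (x, 0)\<bar> \<le> M * N" for n x
      unfolding abs_mult using bnd(1) N M0 by (intro mult_mono) auto
    show "E n (x, 0) * \<phi> (x, 0) = 0" if "x \<notin> cbox (-B) B" for n x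
      using that supp[of "(x, 0)"] by (auto simp: cbox_Pair_iff)
  qed measurable
  have IJ: "\<bar>I n - J n\<bar> \<le> M * N * (2 * B) * tau n" for n
  proof -
    have int1: "integrable lborel (\<lambda>p. indicator {0..<tau n} (snd p) * (E n p * \<phi> (fst p, snd p - tau n)))"
    proof (rule integrable_bounded_box[of _ "M * N" "(-B', -B')" "(B', B')"])
      show "\<bar>indicator {0..<tau n} (snd p) * (E n p * \<phi> (fst p, snd p - tau n))\<bar> \<le> M * N" for p
      proof -
        have "\<bar>E n p * \<phi> (fst p, snd p - tau n)\<bar> \<le> M * N"
          unfolding abs_mult using bnd(1) N M0 by (intro mult_mono) auto
        moreover have "0 \<le> M * N" using M0 N0 by simp
        ultimately show ?thesis by (auto split: split_indicator)
      qed
      show "indicator {0..<tau n} (snd p) * (E n p * \<phi> (fst p, snd p - tau n)) = 0"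
        if p: "p \<notin> cbox (-B', -B') (B', B')" for p
      proof -
        have "(fst p, snd p - tau n) \<notin> cbox (-B, -B) (B, B)"
          using p tau[of n] lam unfolding cbox_Pair_iff B'_def by auto
        then show ?thesis by (simp add: supp)
      qed
    qed measurable
    have int2: "integrable lborel (\<lambda>p. (E n (fst p, 0) * \<phi> (fst p, 0)) * indicator {0..<tau n} (snd p))"
    proof (rule integrable_bounded_box[of _ "M * N" "(-B', -B')" "(B', B')"])
      show "\<bar>(E n (fst p, 0) * \<phi> (fst p, 0)) * indicator {0..<tau n} (snd p)\<bar> \<le> M * N" for p
      proof -
        have "\<bar>E n (fst p, 0) * \<phi> (fst p, 0)\<bar> \<le> M * N"
          unfolding abs_mult using bnd(1) N M0 by (intro mult_mono) auto
        moreover have "0 \<le> M * N" using M0 N0 by simp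
        ultimately show ?thesis by (auto split: split_indicator)
      qed
      show "(E n (fst p, 0) * \<phi> (fst p, 0)) * indicator {0..<tau n} (snd p) = 0"
        if p: "p \<notin> cbox (-B', -B') (B', B')" for p
      proof (cases "snd p \<in> {0..<tau n}")
        case True
        then have "(fst p, 0) \<notin> cbox (-B, -B) (B, B)"
          using p tau[of n] lam B unfolding cbox_Pair_iff B'_def by auto
        then show ?thesis by (simp add: supp)
      qed simp
    qed measurable
    have "(\<integral>p. (E n (fst p, 0) * \<phi> (fst p, 0)) * indicator {0..<tau n} (snd p) \<partial>lborel) = J n * tau n"
      unfolding J_def using integral_lborel_product[OF int2] tau(1)[of n] by simp
    then have "I n - J n = ((\<integral>p. indicator {0..<tau n} (snd p) * (E n p * \<phi> (fst p, snd p - tau n)) \<partial>lborel)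
        - (\<integral>p. (E n (fst p, 0) * \<phi> (fst p, 0)) * indicator {0..<tau n} (snd p) \<partial>lborel)) / tau n"
      unfolding I_def using tau(1)[of n] by (simp add: diff_divide_distrib)
    also have "\<dots> = (\<integral>p. indicator {0..<tau n} (snd p) * (E n p * \<phi> (fst p, snd p - tau n))
        - (E n (fst p, 0) * \<phi> (fst p, 0)) * indicator {0..<tau n} (snd p) \<partial>lborel) / tau n"
      using int1 int2 by simp
    finally have "\<bar>I n - J n\<bar> = \<bar>\<integral>p. indicator {0..<tau n} (snd p) * (E n p * \<phi> (fst p, snd p - tau n))
        - (E n (fst p, 0) * \<phi> (fst p, 0)) * indicator {0..<tau n} (snd p) \<partial>lborel\<bar> / tau n"
      using tau(1)[of n] by simp
    also have "\<dots> \<le> (\<integral>p. (M * N * tau n * indicator {-B..B} (fst p)) * indicator {0..<tau n} (snd p) \<partial>lborel) / tau n"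
    proof (intro divide_right_mono integral_abs_bound_integral)
      show "integrable lborel (\<lambda>p. (M * N * tau n * indicator {-B..B} (fst p)) * indicator {0..<tau n} (snd p))"
        by (rule integrable_bounded_box[of _ "M * N * tau n" "(-B', -B')" "(B', B')"])
          (use M0 N0 tau[of n] B lam in \<open>auto simp: cbox_Pair_iff B'_def abs_mult split: split_indicator\<close>)
      show "\<bar>indicator {0..<tau n} (snd p) * (E n p * \<phi> (fst p, snd p - tau n))
        - (E n (fst p, 0) * \<phi> (fst p, 0)) * indicator {0..<tau n} (snd p)\<bar>
        \<le> (M * N * tau n * indicator {-B..B} (fst p)) * indicator {0..<tau n} (snd p)" for p
      proof (cases "snd p \<in> {0..<tau n}")
        case True
        then have "E n p = E n (fst p, 0)" using e[of "snd p" n "fst p"] by (simp add: tau_def)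
        then have eq: "\<bar>indicator {0..<tau n} (snd p) * (E n p * \<phi> (fst p, snd p - tau n))
            - (E n (fst p, 0) * \<phi> (fst p, 0)) * indicator {0..<tau n} (snd p)\<bar>
            = \<bar>E n p\<bar> * \<bar>\<phi> (fst p, snd p - tau n) - \<phi> (fst p, 0)\<bar>"
          using True by (simp add: abs_mult[symmetric] right_diff_distrib)
        show ?thesis
        proof (cases "fst p \<in> {-B..B}")
          case x: True
          have "\<bar>\<phi> (fst p, snd p - tau n) - \<phi> (fst p, 0)\<bar> \<le> N * \<bar>snd p - tau n - 0\<bar>" by (rule lip_t)
          also have "\<dots> \<le> N * tau n" using True N0 by (intro mult_left_mono) auto
          finally have "\<bar>E n p\<bar> * \<bar>\<phi> (fst p, snd p - tau n) - \<phi> (fst p, 0)\<bar> \<le> M * (N * tau n)"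
            using bnd(1) M0 by (intro mult_mono) auto
          then show ?thesis unfolding eq using True x by (simp add: mult.assoc)
        next
          case x: False
          then have "\<phi> (fst p, snd p - tau n) = 0" "\<phi> (fst p, 0) = 0"
            by (auto intro!: supp simp: cbox_Pair_iff)
          then show ?thesis unfolding eq using x by simp
        qed
      qed simp
      show "integrable lborel (\<lambda>p. indicator {0..<tau n} (snd p) * (E n p * \<phi> (fst p, snd p - tau n))
        - (E n (fst p, 0) * \<phi> (fst p, 0)) * indicator {0..<tau n} (snd p))"
        using int1 int2 by (rule Bochner_Integration.integrable_diff)
    qed (use tau(1)[of n] in simp)
    also have "\<dots> = M * N * (2 * B) * tau n"
    proof -
      have "integrable lborel (\<lambda>p. (M * N * tau n * indicator {-B..B} (fst p)) * indicator {0..<tau n} (snd p))"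
        by (rule integrable_bounded_box[of _ "M * N * tau n" "(-B', -B')" "(B', B')"])
          (use M0 N0 tau[of n] B lam in \<open>auto simp: cbox_Pair_iff B'_def abs_mult split: split_indicator\<close>)
      from integral_lborel_product[OF this] show ?thesis using tau(1)[of n] B by simp
    qed
    finally show ?thesis .
  qed
  have I_lim: "I \<longlonglongrightarrow> (\<integral>x. e' x * \<phi> (x, 0) \<partial>lborel)"
  proof (rule Lim_transform[OF J_lim])
    show "(\<lambda>n. I n - J n) \<longlonglongrightarrow> 0"
    proof (rule Lim_null_comparison)
      show "\<forall>\<^sub>F n in sequentially. norm (I n - J n) \<le> M * N * (2 * B) * tau n"
        using IJ by simp
      show "(\<lambda>n. M * N * (2 * B) * tau n) \<longlonglongrightarrow> 0" using tendsto_mult_right_zero[OF tau_lim] by simp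
    qed
  qed
  have "(\<integral>p. indicator {0..} (snd p) * \<phi> p *
      (E n (fst p, snd p + lam * d n) - E n p + lam * (Q n p - Q n (fst p - d n, snd p))) \<partial>lborel) / (lam * d n)
     = - ((\<integral>p. F n p \<partial>lborel) + I n)" for n
  proof -
    have "(\<integral>p. indicator {0..} (snd p) * (E n p * (\<phi> p - \<phi> (fst p, snd p - tau n)) + lam * (Q n p * (\<phi> (fst p + d n, snd p) - \<phi> p))) \<partial>lborel)
        = (\<integral>p. tau n * F n p \<partial>lborel)"
      unfolding F_def using tau(1)[of n] d(1)[of n] lam
      by (intro Bochner_Integration.integral_cong) (auto simp: tau_def field_simps)
    then have "(\<integral>p. indicator {0..} (snd p) * \<phi> p *
      (E n (fst p, snd p + tau n) - E n p + lam * (Q n p - Q n (fst p - d n, snd p))) \<partial>lborel)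
      = - (tau n * (\<integral>p. F n p \<partial>lborel) + tau n * I n)"
      using tau(1)[of n] d(1)[of n] bnd N supp
      by (subst summation_by_parts[where M=M and N=N and B=B]) (auto simp: I_def)
    then show ?thesis using tau(1)[of n] unfolding tau_def[symmetric] by (simp add: field_simps)
  qed
  then show ?thesis using tendsto_minus[OF tendsto_add[OF F_lim I_lim]] by simp
qed

lemma difference_quotient_tendsto:
  fixes f :: "real \<Rightarrow> real"
  assumes "(f has_field_derivative D) (at x)" "\<And>n. h n \<noteq> 0" "h \<longlonglongrightarrow> 0"
  shows "(\<lambda>n. (f (x + h n) - f x) / h n) \<longlonglongrightarrow> D"
proof -
  have "filterlim h (at 0) sequentially" using assms by (intro filterlim_atI) auto
  from filterlim_compose[OF DERIV_D[OF assms(1)] this] show ?thesis .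
qed

lemma test_function_limit_weight:
  assumes "test_function T \<phi>"
  shows "limit_weight T \<phi> (D_x \<phi>) (D_t \<phi>)"
proof -
  define S where "S = closure {p. \<phi> p \<noteq> 0}"
  have "C_k (Suc 0) \<phi>" and S: "compact S" "S \<subseteq> UNIV \<times> {..<T}"
    using assms unfolding test_function_def S_def by blast+
  then have diff: "\<And>p. \<phi> differentiable (at p)" and cont: "continuous_on UNIV (D_x \<phi>)" "continuous_on UNIV (D_t \<phi>)"
    by auto
  have cont\<phi>: "continuous_on UNIV \<phi>"
    by (intro continuous_at_imp_continuous_on ballI differentiable_imp_continuous_within diff)
  have dx: "((\<lambda>y. \<phi> (y, t)) has_field_derivative D_x \<phi> (x, t)) (at x)" for x t
  proof -
    have "(\<lambda>y. \<phi> (y, t)) differentiable at x"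
    proof -
      have "(\<lambda>y. (y, t)) differentiable at x"
        unfolding differentiable_def by (rule exI[of _ "\<lambda>h. (h, 0)"]) (auto intro!: derivative_eq_intros)
      from differentiable_chain_at[OF this diff] show ?thesis by (simp only: o_def)
    qed
    then show ?thesis unfolding D_x_def by (simp add: DERIV_deriv_iff_real_differentiable)
  qed
  have dt: "((\<lambda>s. \<phi> (x, s)) has_field_derivative D_t \<phi> (x, t)) (at t)" for x t
  proof -
    have "(\<lambda>s. \<phi> (x, s)) differentiable at t"
    proof -
      have "(\<lambda>s. (x, s)) differentiable at t"
        unfolding differentiable_def by (rule exI[of _ "\<lambda>h. (0, h)"]) (auto intro!: derivative_eq_intros)
      from differentiable_chain_at[OF this diff] show ?thesis by (simp only: o_def)
    qed
    then show ?thesis unfolding D_t_def by (simp add: DERIV_deriv_iff_real_differentiable)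
  qed
  have zero: "\<phi> p = 0" if "p \<notin> S" for p
  proof (rule ccontr)
    assume "\<phi> p \<noteq> 0"
    then have "p \<in> {p. \<phi> p \<noteq> 0}" by simp
    then show False using that closure_subset[of "{p. \<phi> p \<noteq> 0}"] unfolding S_def by (rule_tac notE[OF _ subsetD])
  qed
  have op: "open (- S)" using S(1) by (simp add: compact_imp_closed open_Compl)
  have zero_x: "D_x \<phi> p = 0" if "p \<notin> S" for p
  proof -
    obtain x t where p: "p = (x, t)" by (cases p)
    have "open ((\<lambda>y. (y, t)) -` (- S))" by (intro open_vimage op continuous_intros)
    then have "((\<lambda>y. \<phi> (y, t)) has_field_derivative 0) (at x)"
      by (rule has_field_derivative_transform_within_open[OF DERIV_const[of 0]]) (use that p zero in auto)
    then show ?thesis using dx[of t x] DERIV_unique p by blast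
  qed
  have zero_t: "D_t \<phi> p = 0" if "p \<notin> S" for p
  proof -
    obtain x t where p: "p = (x, t)" by (cases p)
    have "open ((\<lambda>s. (x, s)) -` (- S))" by (intro open_vimage op continuous_intros)
    then have "((\<lambda>s. \<phi> (x, s)) has_field_derivative 0) (at t)"
      by (rule has_field_derivative_transform_within_open[OF DERIV_const[of 0]]) (use that p zero in auto)
    then show ?thesis using dt[of x t] DERIV_unique p by blast
  qed
  have bounded: "\<exists>N. \<forall>p. \<bar>F p\<bar> \<le> N" if "continuous_on UNIV F" "\<And>p. p \<notin> S \<Longrightarrow> F p = 0" for F :: "real \<times> real \<Rightarrow> real"
  proof -
    have "bounded (F ` S)"
      using that(1) S(1) by (intro compact_imp_bounded compact_continuous_image continuous_on_subset[OF that(1)]) auto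
    then obtain N where "\<forall>p\<in>S. \<bar>F p\<bar> \<le> N" unfolding bounded_iff by auto
    then have "\<bar>F p\<bar> \<le> max 0 N" for p using that(2)[of p] by (cases "p \<in> S") force+
    then show ?thesis by blast
  qed
  obtain N0 N1 N2 where N: "\<And>p. \<bar>\<phi> p\<bar> \<le> N0" "\<And>p. \<bar>D_x \<phi> p\<bar> \<le> N1" "\<And>p. \<bar>D_t \<phi> p\<bar> \<le> N2"
    using bounded[OF cont\<phi> zero] bounded[OF cont(1) zero_x] bounded[OF cont(2) zero_t] by blast
  define N' where "N' = max N0 (max N1 N2)"
  have N'_le: "N0 \<le> N'" "N1 \<le> N'" "N2 \<le> N'" by (auto simp: N'_def)
  have N': "\<bar>\<phi> p\<bar> \<le> N'" "\<bar>D_x \<phi> p\<bar> \<le> N'" "\<bar>D_t \<phi> p\<bar> \<le> N'" for p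
    using N(1)[of p] N(2)[of p] N(3)[of p] N'_le by linarith+
  obtain B where B: "\<And>p. p \<in> S \<Longrightarrow> norm p \<le> B"
    using compact_imp_bounded[OF S(1)] unfolding bounded_iff by blast
  have box: "\<phi> p = 0" if "p \<notin> cbox (- max 0 B, - max 0 B) (max 0 B, max 0 B)" for p
  proof (rule zero, rule notI)
    assume "p \<in> S"
    then have "norm p \<le> B" by (rule B)
    then have "norm p \<le> max 0 B" by simp
    then have "\<bar>fst p\<bar> \<le> max 0 B" "\<bar>snd p\<bar> \<le> max 0 B"
      using norm_fst_le[of "fst p" "snd p"] norm_snd_le[of "snd p" "fst p"] by simp_all
    then show False using that by (auto simp: cbox_Pair_iff)
  qed
  obtain T' where T': "T' < T" "\<And>p. p \<in> S \<Longrightarrow> snd p \<le> T'"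
  proof (cases "S = {}")
    case True
    then show ?thesis using that[of "T - 1"] by simp
  next
    case False
    have "continuous_on S snd" by (intro continuous_intros)
    then obtain q where "q \<in> S" "\<forall>p\<in>S. snd p \<le> snd q"
      using continuous_attains_sup[OF S(1) False] by blast
    then show ?thesis using S(2) by (intro that[of "snd q"]) auto
  qed
  have lip_x: "\<bar>\<phi> (x, t) - \<phi> (x', t)\<bar> \<le> N' * \<bar>x - x'\<bar>" for x x' t
    using field_differentiable_bound[of UNIV "\<lambda>y. \<phi> (y, t)" "\<lambda>y. D_x \<phi> (y, t)" N' x x'] dx N' by auto
  have lip_t: "\<bar>\<phi> (x, t) - \<phi> (x, t')\<bar> \<le> N' * \<bar>t - t'\<bar>" for x t t'
    using field_differentiable_bound[of UNIV "\<lambda>y. \<phi> (x, y)" "\<lambda>y. D_t \<phi> (x, y)" N' t t'] dt N' by auto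
  have qx: "(\<lambda>n. (\<phi> (fst p + h n, snd p) - \<phi> p) / h n) \<longlonglongrightarrow> D_x \<phi> p" if "\<forall>n. 0 < h n" "h \<longlonglongrightarrow> 0" for h p
    using difference_quotient_tendsto[OF dx[where x="fst p" and t="snd p"], of h] that by (simp add: less_le)
  have qt: "(\<lambda>n. (\<phi> p - \<phi> (fst p, snd p - h n)) / h n) \<longlonglongrightarrow> D_t \<phi> p" if "\<forall>n. 0 < h n" "h \<longlonglongrightarrow> 0" for h p
  proof -
    have "(\<lambda>n. (\<phi> (fst p, snd p + - h n) - \<phi> (fst p, snd p)) / - h n) \<longlonglongrightarrow> D_t \<phi> (fst p, snd p)"
      using that tendsto_minus[OF that(2)] by (intro difference_quotient_tendsto dt) (auto simp: less_le)
    moreover have "(\<phi> (fst p, snd p + - h n) - \<phi> (fst p, snd p)) / - h n = (\<phi> p - \<phi> (fst p, snd p - h n)) / h n" for n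
      using that(1)[rule_format, of n] by (simp add: field_simps)
    ultimately show ?thesis by simp
  qed
  have "\<exists>N B T'. T' < T \<and> 0 \<le> B \<and> (\<forall>p. \<bar>\<phi> p\<bar> \<le> N) \<and> (\<forall>p. p \<notin> cbox (-B, -B) (B, B) \<longrightarrow> \<phi> p = 0) \<and>
      (\<forall>p. T' < snd p \<longrightarrow> \<phi> p = 0) \<and>
      (\<forall>x x' t. \<bar>\<phi> (x, t) - \<phi> (x', t)\<bar> \<le> N * \<bar>x - x'\<bar>) \<and>
      (\<forall>x t t'. \<bar>\<phi> (x, t) - \<phi> (x, t')\<bar> \<le> N * \<bar>t - t'\<bar>)"
  proof (rule exI[of _ N'], rule exI[of _ "max 0 B"], rule exI[of _ T'], intro conjI allI impI)
    show "\<phi> p = 0" if "T' < snd p" for p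
      using T'(2)[of p] that by (intro zero) auto
  qed (rule T'(1) N' box lip_x lip_t max.cobounded1 | assumption)+
  then show ?thesis
    unfolding limit_weight_def
  proof (intro conjI allI impI)
    fix h :: "nat \<Rightarrow> real" assume h: "\<forall>n. 0 < h n" "h \<longlonglongrightarrow> 0"
    show "AE p in lborel. (\<lambda>n. (\<phi> p - \<phi> (fst p, snd p - h n)) / h n) \<longlonglongrightarrow> D_t \<phi> p"
      "AE p in lborel. (\<lambda>n. (\<phi> (fst p + h n, snd p) - \<phi> p) / h n) \<longlonglongrightarrow> D_x \<phi> p"
      using qx[OF h] qt[OF h] by simp_all
  qed (use cont cont\<phi> in \<open>simp_all add: borel_measurable_continuous_onI\<close>)
qed

text \<open>Translations and Fubini are carried out with Borel functions on \<open>lborel\<close>.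
  Clamping the Borel version and resetting its outer values preserves the pointwise
  requirements.\<close>

lemma initial_data_borel:
  assumes v: "initial_data lo hi X uL uR v"
  obtains v' where "v' \<in> borel_measurable borel" "initial_data lo hi X uL uR v'" "AE x in lborel. v x = v' x"
proof -
  obtain w where w: "w \<in> borel_measurable lborel" "AE x in lborel. v x = w x"
    using completion_ex_borel_measurable_real[OF initial_dataD(1)[OF v]] by blast
  have [measurable]: "w \<in> borel_measurable borel" using w(1) by simp
  define v' where "v' x = (if x < - X then uL else if X \<le> x then uR else max lo (min hi (w x)))" for x
  have range: "v x \<in> {lo..hi}" for x by (rule initial_dataD(2)[OF v])
  have X: "0 < X" by (rule initial_dataD(3)[OF v])
  have meas: "v' \<in> borel_measurable borel" unfolding v'_def by measurable
  have ae: "AE x in lborel. v x = v' x"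
    using w(2)
  proof eventually_elim
    case (elim x)
    then show ?case using range[of x] initial_dataD(4,5)[OF v, of x] by (auto simp: v'_def)
  qed
  have "uL \<in> {lo..hi}" using range[of "- X - 1"] initial_dataD(4)[OF v, of "- X - 1"] by simp
  moreover have "uR \<in> {lo..hi}" using range[of X] initial_dataD(5)[OF v, of X] by simp
  moreover have "lo \<le> hi" using range[of 0] by simp
  ultimately have "initial_data lo hi X uL uR v'"
    using X meas unfolding initial_data_def by (auto simp: v'_def intro: measurable_completion)
  then show thesis using that meas ae by blast
qed

lemma godunov_cong_AE:
  assumes "AE x in lborel. v x = v' x" "v \<in> borel_measurable lebesgue" "v' \<in> borel_measurable lebesgue"
  shows "godunov lam d f g v = godunov lam d f g v'"
proof
  fix n
  have ae: "AE x in lebesgue. v x = v' x" using assms(1) by (rule AE_completion)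
  have "(LINT x:{a..b}|lebesgue. v x) = (LINT x:{a..b}|lebesgue. v' x)" for a b
    using assms ae by (intro set_lebesgue_integral_cong_AE) auto
  then have 0: "godunov lam d f g v 0 = godunov lam d f g v' 0" by simp
  show "godunov lam d f g v n = godunov lam d f g v' n"
  proof (induction n)
    case (Suc n)
    then show ?case by (simp only: godunov.simps(2))
  qed (rule 0)
qed

lemma TV_on_cong_AE:
  assumes "AE x in lborel. v x = v' x"
  shows "TV_on I v = TV_on I v'"
proof -
  have ae: "AE x in lebesgue. v x = v' x" using assms by (rule AE_completion)
  have "(AE x in lebesgue. x \<in> I \<longrightarrow> w x = v x) \<longleftrightarrow> (AE x in lebesgue. x \<in> I \<longrightarrow> w x = v' x)" for w
  proof
    assume "AE x in lebesgue. x \<in> I \<longrightarrow> w x = v x"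
    with ae show "AE x in lebesgue. x \<in> I \<longrightarrow> w x = v' x" by eventually_elim simp
  next
    assume "AE x in lebesgue. x \<in> I \<longrightarrow> w x = v' x"
    with ae show "AE x in lebesgue. x \<in> I \<longrightarrow> w x = v x" by eventually_elim simp
  qed
  then show ?thesis unfolding TV_on_def by simp
qed

context godunov_scheme
begin

text \<open>The cell of \<open>x\<close> lies within \<open>d\<close> of \<open>x\<close>, so the
  deviation of the cell average is controlled by the translates with \<open>s \<in> {-d..d}\<close>.
  Each costs at most \<open>d * K\<close>; the window of length \<open>2 * d\<close> against the
  normalization \<open>1 / d\<close> gives the factor 2.\<close>

lemma initial_approximation:
  assumes v: "initial_data lo hi X uL uR v" and vb[measurable]: "v \<in> borel_measurable borel"
    and TV: "TV v \<le> ennreal K" and K: "0 \<le> K" and d: "0 < d"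
  shows "(\<integral>\<^sup>+x. ennreal \<bar>ux d v 0 x - v x\<bar> \<partial>lborel) \<le> ennreal (2 * d * K)"
proof -
  define M where "M = max \<bar>lo\<bar> \<bar>hi\<bar>"
  have M: "\<bar>v x\<bar> \<le> M" for x using initial_dataD(2)[OF v, of x] by (auto simp: M_def)
  have pt: "ennreal \<bar>ux d v 0 x - v x\<bar>
      \<le> ennreal (1 / d) * (\<integral>\<^sup>+s. indicator {-d..d} s * ennreal \<bar>v (x + s) - v x\<bar> \<partial>lborel)" for x
  proof -
    define a where "a = (real_of_int (cell_index d x) - 1/2) * d"
    have ab: "(real_of_int (cell_index d x) + 1/2) * d = a + d" by (simp add: a_def algebra_simps)
    have x: "a \<le> x" "x \<le> a + d" using cell_index_bounds[OF d, of x] ab by (auto simp: a_def)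
    have "(LINT y:{a..a+d}|lebesgue. v y) = (\<integral>y. indicator {a..a+d} y * v y \<partial>lborel)"
      unfolding set_lebesgue_integral_def by (subst integral_completion) auto
    then have u: "ux d v 0 x = (\<integral>y. indicator {a..a+d} y * v y \<partial>lborel) / d"
      by (simp add: ux_def ab a_def[symmetric])
    have int: "integrable lborel (\<lambda>y. indicator {a..a+d} y * w y)" if "w \<in> borel_measurable borel" "\<And>y. \<bar>w y\<bar> \<le> M'" for w :: "real \<Rightarrow> real" and M'
      using that order_trans[OF abs_ge_zero that(2)]
      by (intro integrable_bounded_box[of _ M' a "a+d"]) (auto simp: abs_mult split: split_indicator)
    have "(\<integral>y. indicator {a..a+d} y * (v y - v x) \<partial>lborel)
        = (\<integral>y. indicator {a..a+d} y * v y \<partial>lborel) - (\<integral>y. indicator {a..a+d} y * v x \<partial>lborel)"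
    proof -
      have "integrable lborel (\<lambda>y. indicator {a..a+d} y * v x)" by (rule int[of "\<lambda>_. v x" M]) (auto simp: M)
      from Bochner_Integration.integral_diff[OF int[OF vb M] this] show ?thesis
        by (simp only: right_diff_distrib)
    qed
    also have "(\<integral>y. indicator {a..a+d} y * v x \<partial>lborel) = d * v x" using d by (simp add: mult.commute)
    finally have eq: "ux d v 0 x - v x = (1 / d) * (\<integral>y. indicator {a..a+d} y * (v y - v x) \<partial>lborel)"
      unfolding u using d by (simp add: divide_simps)
    have "ennreal \<bar>ux d v 0 x - v x\<bar> = ennreal (1 / d) * ennreal \<bar>\<integral>y. indicator {a..a+d} y * (v y - v x) \<partial>lborel\<bar>"
      unfolding eq abs_mult using d by (subst ennreal_mult) auto
    also have "\<dots> \<le> ennreal (1 / d) * (\<integral>\<^sup>+y. ennreal (norm (indicator {a..a+d} y * (v y - v x))) \<partial>lborel)"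
    proof (rule mult_left_mono)
      have "\<bar>v y - v x\<bar> \<le> M + M" for y using M[of y] M[of x] by linarith
      then have "integrable lborel (\<lambda>y. indicator {a..a+d} y * (v y - v x))"
        by (intro int[of _ "M + M"]) auto
      from integral_norm_bound_ennreal[OF this]
      show "ennreal \<bar>\<integral>y. indicator {a..a+d} y * (v y - v x) \<partial>lborel\<bar>
        \<le> (\<integral>\<^sup>+y. ennreal (norm (indicator {a..a+d} y * (v y - v x))) \<partial>lborel)" by simp
    qed simp
    also have "(\<integral>\<^sup>+y. ennreal (norm (indicator {a..a+d} y * (v y - v x))) \<partial>lborel)
        = (\<integral>\<^sup>+s. ennreal (norm (indicator {a..a+d} (s + x) * (v (s + x) - v x))) \<partial>lborel)"
      by (subst nn_integral_translate[of "\<lambda>y. ennreal (norm (indicator {a..a+d} y * (v y - v x)))" x]) auto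
    also have "\<dots> \<le> (\<integral>\<^sup>+s. indicator {-d..d} s * ennreal \<bar>v (x + s) - v x\<bar> \<partial>lborel)"
      using x by (intro nn_integral_mono) (auto simp: add.commute split: split_indicator)
    finally show ?thesis by (simp add: mult_left_mono)
  qed
  have shift: "(\<integral>\<^sup>+x. ennreal \<bar>v (x + s) - v x\<bar> \<partial>lborel) \<le> ennreal (d * K)" if "\<bar>s\<bar> \<le> d" for s
  proof -
    have "(\<integral>\<^sup>+x. ennreal \<bar>v (x + s) - v x\<bar> \<partial>lborel) \<le> ennreal (\<bar>s\<bar> * K)"
    proof (cases "0 \<le> s")
      case True
      then show ?thesis using translation_estimate_TV[OF vb TV K True] by simp
    next
      case False
      have "(\<integral>\<^sup>+x. ennreal \<bar>v (x + s) - v x\<bar> \<partial>lborel) = (\<integral>\<^sup>+x. ennreal \<bar>v (x + - s + s) - v (x + - s)\<bar> \<partial>lborel)"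
        by (subst nn_integral_translate[of "\<lambda>x. ennreal \<bar>v (x + s) - v x\<bar>" "- s", symmetric]) auto
      also have "\<dots> = (\<integral>\<^sup>+x. ennreal \<bar>v (x + - s) - v x\<bar> \<partial>lborel)" by (simp add: abs_minus_commute)
      also have "\<dots> \<le> ennreal (- s * K)" using False by (intro translation_estimate_TV[OF vb TV K]) simp
      finally show ?thesis using False by simp
    qed
    also have "\<dots> \<le> ennreal (d * K)" using that K by (intro ennreal_leI mult_right_mono)
    finally show ?thesis .
  qed
  have "(\<integral>\<^sup>+x. ennreal \<bar>ux d v 0 x - v x\<bar> \<partial>lborel)
      \<le> (\<integral>\<^sup>+x. ennreal (1 / d) * (\<integral>\<^sup>+s. indicator {-d..d} s * ennreal \<bar>v (x + s) - v x\<bar> \<partial>lborel) \<partial>lborel)"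
    by (intro nn_integral_mono pt)
  also have "\<dots> = ennreal (1 / d) * (\<integral>\<^sup>+x. (\<integral>\<^sup>+s. indicator {-d..d} s * ennreal \<bar>v (x + s) - v x\<bar> \<partial>lborel) \<partial>lborel)"
    by (intro nn_integral_cmult) measurable
  also have "(\<integral>\<^sup>+x. (\<integral>\<^sup>+s. indicator {-d..d} s * ennreal \<bar>v (x + s) - v x\<bar> \<partial>lborel) \<partial>lborel)
      = (\<integral>\<^sup>+s. (\<integral>\<^sup>+x. indicator {-d..d} s * ennreal \<bar>v (x + s) - v x\<bar> \<partial>lborel) \<partial>lborel)"
    by (intro lborel_pair.Fubini') measurable
  also have "\<dots> \<le> (\<integral>\<^sup>+s. ennreal (d * K) * indicator {-d..d} s \<partial>lborel)"
  proof (rule nn_integral_mono)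
    fix s :: real
    show "(\<integral>\<^sup>+x. indicator {-d..d} s * ennreal \<bar>v (x + s) - v x\<bar> \<partial>lborel) \<le> ennreal (d * K) * indicator {-d..d} s"
      using shift[of s] by (cases "s \<in> {-d..d}") auto
  qed
  also have "\<dots> = ennreal (d * K) * ennreal (2 * d)" using d by (simp add: nn_integral_cmult)
  also have "ennreal (1 / d) * (ennreal (d * K) * ennreal (2 * d)) = ennreal (2 * d * K)"
    using d K by (simp add: ennreal_mult[symmetric])
  finally show ?thesis by (simp add: mult_left_mono)
qed

definition ua :: "real \<Rightarrow> (real \<Rightarrow> real) \<Rightarrow> real \<times> real \<Rightarrow> real"
  where "ua d v p = ux d v (time_level (lam * d) (snd p)) (fst p)"

lemma ua_measurable [measurable]: "ua d v \<in> borel_measurable borel"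
  unfolding ua_def ux_def by measurable

lemma ua_godunov_approx: "godunov_approx lam d f g v x t = ua d v (x, t)"
  by (simp add: ua_def godunov_approx_ux)

lemma ua_range: "initial_data lo hi X uL uR v \<Longrightarrow> 0 < d \<Longrightarrow> ua d v p \<in> {lo..hi}"
  unfolding ua_def by (rule ux_range)

text \<open>Numerical information travels one cell of width \<open>d\<close> per time
  \<open>lam * d\<close>, that is at speed \<open>1 / lam\<close>. This crude bound serves
  compactness; the sharper speed \<open>2 * L\<close> holds only in the limit.\<close>

lemma ua_far:
  assumes v: "initial_data lo hi X uL uR v" and d: "0 < d" "d \<le> 1" and t: "t \<in> {0..T}"
  shows "x \<le> - (X + T / lam + 1) \<Longrightarrow> ua d v (x, t) = uL"
    and "X + T / lam + 1 \<le> x \<Longrightarrow> ua d v (x, t) = uR"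
proof -
  have tau: "0 < lam * d" using lam_pos d by simp
  have "real (time_level (lam * d) t) * (lam * d) \<le> T"
    using time_level_bounds(1)[OF tau, of t] t by auto
  then have "real (time_level (lam * d) t) * d \<le> T / lam"
    using lam_pos by (simp add: pos_le_divide_eq mult_ac)
  then have *: "(real (time_level (lam * d) t) + 1) * d \<le> T / lam + 1"
    using d by (simp add: algebra_simps)
  show "x \<le> - (X + T / lam + 1) \<Longrightarrow> ua d v (x, t) = uL"
    unfolding ua_def using * by (intro ux_far_left[OF v d(1)]) auto
  show "X + T / lam + 1 \<le> x \<Longrightarrow> ua d v (x, t) = uR"
    unfolding ua_def using * by (intro ux_far_right[OF v d(1)]) auto
qed

text \<open>Two further extractions follow compactness: numerical fluxes take two neighbouring
  states, so the approximations shifted by one cell must converge to the same limit, and the weak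
  form needs convergence at time zero.\<close>

lemma godunov_limit:
  assumes v: "initial_data lo hi X uL uR v" and vb[measurable]: "v \<in> borel_measurable borel"
    and TV0: "TV v \<le> ennreal K0" "0 \<le> K0" and T: "0 < T" and K: "0 \<le> K"
    and TV: "\<And>d t. 0 < d \<Longrightarrow> t \<in> {0..T} \<Longrightarrow> TV (\<lambda>x. godunov_approx lam d f g v x t) \<le> ennreal K"
    and d: "\<And>n. 0 < d n" "\<And>n. d n \<le> 1" "d \<longlonglongrightarrow> 0"
  obtains r w where "strict_mono r" "w \<in> borel_measurable borel" "\<And>p. w p \<in> {lo..hi}"
    "AE p in lborel. snd p \<in> {0..T} \<longrightarrow> (\<lambda>n. ua (d (r n)) v p) \<longlonglongrightarrow> w p"
    "AE p in lborel. snd p \<in> {0..T} \<longrightarrow> (\<lambda>n. ua (d (r n)) v (fst p + d (r n), snd p)) \<longlonglongrightarrow> w p"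
    "AE x in lborel. (\<lambda>n. ua (d (r n)) v (x, 0)) \<longlonglongrightarrow> v x"
proof -
  define R where "R = X + T / lam + 1"
  have X: "0 < X" by (rule initial_dataD(3)[OF v])
  have R: "0 < R" using X T lam_pos by (simp add: R_def add_pos_pos)
  obtain B where B: "0 \<le> B" "\<And>w. w \<in> {lo..hi} \<Longrightarrow> \<bar>f w\<bar> \<le> B" "\<And>w. w \<in> {lo..hi} \<Longrightarrow> \<bar>g w\<bar> \<le> B"
    using flux_bounded by blast
  obtain r1 w where r1: "strict_mono r1" and w: "w \<in> borel_measurable borel" "\<And>p. w p \<in> {lo..hi}"
    "AE p in lborel. snd p \<in> {0..T} \<longrightarrow> (\<lambda>k. ua (d (r1 k)) v p) \<longlonglongrightarrow> w p"
  proof (rule space_time_compactness[where u="\<lambda>n. ua (d n) v" and lo=lo and hi=hi and R=R and T=T and K=K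
        and C="2 * B" and cl=uL and cr=uR and tau="\<lambda>n. lam * d n"])
    show "ua (d k) v p \<in> {lo..hi}" for k p by (rule ua_range[OF v d(1)])
    show "ua (d k) v (x, t) = uL" if "t \<in> {0..T}" "x \<le> - R" for k x t
      using ua_far(1)[OF v d(1,2) that(1)] that(2) by (simp add: R_def)
    show "ua (d k) v (x, t) = uR" if "t \<in> {0..T}" "R \<le> x" for k x t
      using ua_far(2)[OF v d(1,2) that(1)] that(2) by (simp add: R_def)
    show "TV (\<lambda>x. ua (d k) v (x, t)) \<le> ennreal K" if "t \<in> {0..T}" for k t
      using TV[OF d(1) that] by (simp only: ua_godunov_approx)
    show "\<bar>\<integral>y. indicator {-R..x} y * (ua (d k) v (y, t) - ua (d k) v (y, s)) \<partial>lborel\<bar> \<le> 2 * B * (t - s + lam * d k)"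
      if "0 \<le> s" "s \<le> t" "t \<le> T" for k x s t
      using primitive_time_estimate[OF v d(1) B(2,3) that(1,2), of "-R" x k] by (simp add: ua_def)
    show "(\<lambda>n. lam * d n) \<longlonglongrightarrow> 0" using tendsto_mult_right_zero[OF d(3)] by simp
  qed (use R T K B in auto)
  define M where "M = hi - lo"
  have M: "0 \<le> M" using lo_less_hi by (simp add: M_def)
  have diff_le: "\<bar>a - b\<bar> \<le> M" if "a \<in> {lo..hi}" "b \<in> {lo..hi}" for a b
    using that by (auto simp: M_def)
  \<comment> \<open>The shift by one cell has \<open>L\<^sup>1\<close> norm at most
    \<open>d n * (K * T)\<close> by the variation bound, so a subsequence tends to zero almost
    everywhere.\<close>
  define F where "F n p = indicator {0..T} (snd p) * (ua (d n) v (fst p + d n, snd p) - ua (d n) v p)" for n p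
  have F_bound: "\<bar>F n p\<bar> \<le> M" for n p
    using diff_le[OF ua_range[OF v d(1)] ua_range[OF v d(1)]] M by (auto simp: F_def abs_mult split: split_indicator)
  have [measurable]: "F n \<in> borel_measurable borel" for n unfolding F_def by measurable
  have F_zero: "F n p = 0" if "p \<notin> cbox (-(R+1), -T) (R+1, T)" for n p
  proof (cases "snd p \<in> {0..T}")
    case True
    have far: "x \<le> - R \<Longrightarrow> ua (d n) v (x, snd p) = uL" "R \<le> x \<Longrightarrow> ua (d n) v (x, snd p) = uR" for x
      using ua_far[OF v d(1) d(2) True, of x n] by (auto simp: R_def)
    have "fst p < - (R + 1) \<or> R + 1 < fst p" using True that T by (auto simp: cbox_Pair_iff)
    then have "ua (d n) v (fst p + d n, snd p) = ua (d n) v (fst p, snd p)"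
      using far[of "fst p"] far[of "fst p + d n"] d(1)[of n] d(2)[of n] by auto
    then show ?thesis by (simp add: F_def)
  qed (simp add: F_def)
  have F_int: "integrable lborel (F n)" for n
    by (rule integrable_bounded_box[OF _ F_bound F_zero]) auto
  have F_norm: "(\<integral>p. norm (F n p) \<partial>lborel) \<le> d n * (K * T)" for n
  proof -
    have "ennreal (\<integral>p. norm (F n p) \<partial>lborel) = (\<integral>\<^sup>+p. ennreal (norm (F n p)) \<partial>lborel)"
      using F_int by (intro nn_integral_eq_integral[symmetric]) auto
    also have "\<dots> = (\<integral>\<^sup>+t. (\<integral>\<^sup>+x. ennreal (norm (F n (x, t))) \<partial>lborel) \<partial>lborel)"
      by (rule nn_integral_lborel_prod_swap) auto
    also have "\<dots> \<le> (\<integral>\<^sup>+t. ennreal (d n * K) * indicator {0..T} t \<partial>lborel)"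
    proof (rule nn_integral_mono)
      fix t :: real
      show "(\<integral>\<^sup>+x. ennreal (norm (F n (x, t))) \<partial>lborel) \<le> ennreal (d n * K) * indicator {0..T} t"
      proof (cases "t \<in> {0..T}")
        case True
        have "(\<integral>\<^sup>+x. ennreal \<bar>ua (d n) v (x + d n, t) - ua (d n) v (x, t)\<bar> \<partial>lborel) \<le> ennreal (d n * K)"
          using TV[OF d(1) True, of n] d(1)[of n] K unfolding ua_godunov_approx
          by (intro translation_estimate_TV) auto
        then show ?thesis using True by (simp add: F_def)
      qed (simp add: F_def)
    qed
    also have "\<dots> = ennreal (d n * (K * T))" using d(1)[of n] K T by (simp add: nn_integral_cmult ennreal_mult mult.assoc)
    finally show ?thesis using d(1)[of n] K T by (simp add: less_imp_le)
  qed
  have "(\<lambda>n. \<integral>p. norm (F (r1 n) p) \<partial>lborel) \<longlonglongrightarrow> 0"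
  proof (rule Lim_null_comparison)
    show "\<forall>\<^sub>F n in sequentially. norm (\<integral>p. norm (F (r1 n) p) \<partial>lborel) \<le> d (r1 n) * (K * T)"
      using F_norm by (simp add: integral_nonneg_AE)
    show "(\<lambda>n. d (r1 n) * (K * T)) \<longlonglongrightarrow> 0"
      using tendsto_mult_left_zero[OF LIMSEQ_subseq_LIMSEQ[OF d(3) r1]] by (simp add: o_def)
  qed
  from tendsto_L1_AE_subseq[OF F_int this] obtain r2 where r2: "strict_mono r2"
    "AE p in lborel. (\<lambda>n. F (r1 (r2 n)) p) \<longlonglongrightarrow> 0" by blast
  define G where "G n x = ua (d n) v (x, 0) - v x" for n x
  have [measurable]: "G n \<in> borel_measurable borel" for n unfolding G_def by measurable
  have G_ux: "G n x = ux (d n) v 0 x - v x" for n x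
    using lam_pos d(1)[of n] by (simp add: G_def ua_def time_level_0)
  have G_int: "integrable lborel (G n)" for n
  proof (rule integrable_bounded_box[of _ M "-R" R])
    show "\<bar>G n x\<bar> \<le> M" for x
      unfolding G_def by (intro diff_le ua_range[OF v d(1)] initial_dataD(2)[OF v])
    show "G n x = 0" if "x \<notin> cbox (-R) R" for x
    proof -
      have "0 \<le> T / lam" using T lam_pos by simp
      moreover have "x < - R \<or> R < x" using that by auto
      ultimately show ?thesis
        using ua_far[OF v d(1) d(2), of 0 T x n] T initial_dataD(4,5)[OF v, of x] by (auto simp: G_def R_def)
    qed
  qed measurable
  have "(\<lambda>n. \<integral>x. norm (G (r1 (r2 n)) x) \<partial>lborel) \<longlonglongrightarrow> 0"
  proof (rule Lim_null_comparison)
    have "(\<integral>x. norm (G n x) \<partial>lborel) \<le> 2 * d n * K0" for n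
    proof -
      have "ennreal (\<integral>x. norm (G n x) \<partial>lborel) = (\<integral>\<^sup>+x. ennreal (norm (G n x)) \<partial>lborel)"
        using G_int by (intro nn_integral_eq_integral[symmetric]) auto
      also have "\<dots> \<le> ennreal (2 * d n * K0)"
        using initial_approximation[OF v vb TV0 d(1)] by (simp add: G_ux)
      finally show ?thesis using d(1)[of n] TV0 by (simp add: less_imp_le)
    qed
    then show "\<forall>\<^sub>F n in sequentially. norm (\<integral>x. norm (G (r1 (r2 n)) x) \<partial>lborel) \<le> 2 * d (r1 (r2 n)) * K0"
      by (simp add: integral_nonneg_AE)
    have "(\<lambda>n. d (r1 (r2 n))) \<longlonglongrightarrow> 0"
      using LIMSEQ_subseq_LIMSEQ[OF d(3) strict_mono_o[OF r1 r2(1)]] by (simp add: o_def)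
    from tendsto_mult_left_zero[OF tendsto_mult_right_zero[OF this, of 2], of K0]
    show "(\<lambda>n. 2 * d (r1 (r2 n)) * K0) \<longlonglongrightarrow> 0" by simp
  qed
  from tendsto_L1_AE_subseq[OF G_int this] obtain r3 where r3: "strict_mono r3"
    "AE x in lborel. (\<lambda>n. G (r1 (r2 (r3 n))) x) \<longlonglongrightarrow> 0" by blast
  have sub: "strict_mono (\<lambda>n. r2 (r3 n))" using strict_mono_o[OF r2(1) r3(1)] by (simp add: o_def)
  have conv: "AE p in lborel. snd p \<in> {0..T} \<longrightarrow> (\<lambda>n. ua (d (r1 (r2 (r3 n)))) v p) \<longlonglongrightarrow> w p"
    using w(3)
  proof eventually_elim
    case (elim p)
    then show ?case using LIMSEQ_subseq_LIMSEQ[OF _ sub] by (auto simp: o_def)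
  qed
  show thesis
  proof (rule that[of "\<lambda>n. r1 (r2 (r3 n))" w])
    show "strict_mono (\<lambda>n. r1 (r2 (r3 n)))" using strict_mono_o[OF r1 sub] by (simp add: o_def)
    show "AE p in lborel. snd p \<in> {0..T} \<longrightarrow>
      (\<lambda>n. ua (d (r1 (r2 (r3 n)))) v (fst p + d (r1 (r2 (r3 n))), snd p)) \<longlonglongrightarrow> w p"
      using conv r2(2)
    proof eventually_elim
      case (elim p)
      show ?case
      proof
        assume t: "snd p \<in> {0..T}"
        have "(\<lambda>n. F (r1 (r2 (r3 n))) p) \<longlonglongrightarrow> 0" using LIMSEQ_subseq_LIMSEQ[OF elim(2) r3(1)] by (simp add: o_def)
        from tendsto_add[OF this elim(1)[rule_format, OF t]] t
        show "(\<lambda>n. ua (d (r1 (r2 (r3 n)))) v (fst p + d (r1 (r2 (r3 n))), snd p)) \<longlonglongrightarrow> w p"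
          by (simp add: F_def)
      qed
    qed
    show "AE x in lborel. (\<lambda>n. ua (d (r1 (r2 (r3 n)))) v (x, 0)) \<longlonglongrightarrow> v x"
      using r3(2) by eventually_elim (simp add: G_def LIM_zero_iff)
  qed (use w conv in auto)
qed

end

section \<open>The weak formulation and the Kruzkov inequalities of the limit\<close>

lemma measurable_compose_range:
  fixes q :: "real \<Rightarrow> real"
  assumes q: "continuous_on {lo..hi} q" and [measurable]: "w \<in> borel_measurable M" and w: "\<And>p. w p \<in> {lo..hi}"
  shows "(\<lambda>p. q (w p)) \<in> borel_measurable M"
proof -
  have "lo \<le> hi" using w by force
  then have "continuous_on UNIV (\<lambda>x. q (max lo (min hi x)))"
    by (intro continuous_on_compose2[OF q] continuous_intros) auto
  then have [measurable]: "(\<lambda>x. q (max lo (min hi x))) \<in> borel_measurable borel"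
    by (rule borel_measurable_continuous_onI)
  have "(\<lambda>p. q (max lo (min hi (w p)))) \<in> borel_measurable M" by measurable
  moreover have "max lo (min hi (w p)) = w p" for p using w[of p] by auto
  ultimately show ?thesis by simp
qed

lemma godunov_flux_tendsto:
  assumes q: "L-lipschitz_on {lo..hi} q" and ab: "\<And>n. a n \<in> {lo..hi}" "\<And>n. b n \<in> {lo..hi}" "w \<in> {lo..hi}" "z \<in> {lo..hi}"
    and lim: "a \<longlonglongrightarrow> w" "b \<longlonglongrightarrow> z"
  shows "(\<lambda>n. godunov_flux q (a n) (b n)) \<longlonglongrightarrow> godunov_flux q w z"
proof -
  have "(\<lambda>n. godunov_flux q (a n) (b n) - godunov_flux q w z) \<longlonglongrightarrow> 0"
  proof (rule Lim_null_comparison)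
    show "\<forall>\<^sub>F n in sequentially. norm (godunov_flux q (a n) (b n) - godunov_flux q w z) \<le> L * (\<bar>b n - z\<bar> + \<bar>a n - w\<bar>)"
      using godunov_flux_lipschitz[OF q] ab by simp
    have "(\<lambda>n. L * (\<bar>b n - z\<bar> + \<bar>a n - w\<bar>)) \<longlonglongrightarrow> L * (\<bar>z - z\<bar> + \<bar>w - w\<bar>)"
      by (intro tendsto_intros lim)
    then show "(\<lambda>n. L * (\<bar>b n - z\<bar> + \<bar>a n - w\<bar>)) \<longlonglongrightarrow> 0" by simp
  qed
  then show ?thesis by (simp add: LIM_zero_iff)
qed

lemma max_min_range: "a \<in> {lo..hi} \<Longrightarrow> b \<in> {lo..hi} \<Longrightarrow> max a b \<in> {lo..hi} \<and> min a b \<in> {lo..hi}"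
  for a b lo hi :: real
  by (auto simp: max_def min_def)

lemma entropy_flux_tendsto:
  assumes q: "L-lipschitz_on {lo..hi} q" and ab: "\<And>n. a n \<in> {lo..hi}" "\<And>n. b n \<in> {lo..hi}" "w \<in> {lo..hi}" "k \<in> {lo..hi}"
    and lim: "a \<longlonglongrightarrow> w" "b \<longlonglongrightarrow> w"
  shows "(\<lambda>n. entropy_flux q (a n) (b n) k k) \<longlonglongrightarrow> sgn (w - k) * (q w - q k)"
proof -
  have "(\<lambda>n. entropy_flux q (a n) (b n) k k) \<longlonglongrightarrow> entropy_flux q w w k k"
    unfolding entropy_flux_def
    by (intro tendsto_diff godunov_flux_tendsto[OF q] tendsto_max tendsto_min tendsto_const lim)
      (use max_min_range[OF ab(1) ab(4)] max_min_range[OF ab(2) ab(4)] max_min_range[OF ab(3) ab(4)] in auto)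
  then show ?thesis by (simp only: entropy_flux_consistent)
qed

text \<open>The bound is \<open>- 1\<close> instead of \<open>0\<close> so that the right neighbour
  of the cell also has a negative index and carries the left part of a steady state.\<close>

lemma cell_index_neg_eventually:
  assumes "\<And>n. 0 < d n" "d \<longlonglongrightarrow> 0" "x < 0"
  shows "\<forall>\<^sub>F n in sequentially. cell_index (d n) x < - 1"
proof -
  have "\<forall>\<^sub>F n in sequentially. d n < - x / 2" using assms by (intro order_tendstoD(2)[OF assms(2)]) simp
  then show ?thesis
  proof eventually_elim
    case (elim n)
    have d: "0 < d n" by (rule assms)
    show ?case
    proof (rule ccontr)
      assume "\<not> ?thesis"
      then have "- 3/2 \<le> real_of_int (cell_index (d n) x) - 1/2" by linarith
      then have "- 3/2 * d n \<le> (real_of_int (cell_index (d n) x) - 1/2) * d n" using d by (intro mult_right_mono) auto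
      then show False using cell_index_bounds(1)[OF d, of x] elim assms(3) by linarith
    qed
  qed
qed

lemma cell_index_pos_eventually:
  assumes "\<And>n. 0 < d n" "d \<longlonglongrightarrow> 0" "0 < x"
  shows "\<forall>\<^sub>F n in sequentially. 0 < cell_index (d n) x"
proof -
  have "\<forall>\<^sub>F n in sequentially. d n < x" using assms by (intro order_tendstoD(2)[OF assms(2)]) simp
  then show ?thesis
  proof eventually_elim
    case (elim n)
    have d: "0 < d n" by (rule assms)
    show ?case
    proof (rule ccontr)
      assume "\<not> ?thesis"
      then have "real_of_int (cell_index (d n) x) + 1/2 \<le> 1/2" by linarith
      then have "(real_of_int (cell_index (d n) x) + 1/2) * d n \<le> 1/2 * d n" using d by (intro mult_right_mono) auto
      then show False using cell_index_bounds(2)[OF d, of x] elim assms(3) by linarith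
    qed
  qed
qed

lemma cell_index_0_bound:
  assumes "0 < d" "cell_index d x = 0"
  shows "\<bar>x\<bar> \<le> d"
  using cell_index_bounds[OF assms(1), of x] assms by auto

text \<open>The outcome of \<open>godunov_limit\<close>, with the subsequence already chosen; within
  this locale \<open>w\<close> is shown to be a vanishing viscosity solution.\<close>

locale godunov_convergence = godunov_scheme lo hi L lam f g for lo hi L lam f g +
  fixes X uL uR T K :: real and v :: "real \<Rightarrow> real" and d :: "nat \<Rightarrow> real" and w :: "real \<times> real \<Rightarrow> real"
  assumes data: "initial_data lo hi X uL uR v" and v_borel [measurable]: "v \<in> borel_measurable borel"
    and T_pos: "0 < T" and K_nonneg: "0 \<le> K"
    and TV_le: "\<And>n t. t \<in> {0..T} \<Longrightarrow> TV (\<lambda>x. ua (d n) v (x, t)) \<le> ennreal K"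
    and d_pos: "\<And>n. 0 < d n" and d_le: "\<And>n. d n \<le> 1" and d_lim: "d \<longlonglongrightarrow> 0"
    and w_borel [measurable]: "w \<in> borel_measurable borel" and w_range: "\<And>p. w p \<in> {lo..hi}"
    and conv: "AE p in lborel. snd p \<in> {0..T} \<longrightarrow> (\<lambda>n. ua (d n) v p) \<longlonglongrightarrow> w p"
    and conv_shift: "AE p in lborel. snd p \<in> {0..T} \<longrightarrow> (\<lambda>n. ua (d n) v (fst p + d n, snd p)) \<longlonglongrightarrow> w p"
    and conv_0: "AE x in lborel. (\<lambda>n. ua (d n) v (x, 0)) \<longlonglongrightarrow> v x"
begin

lemma f_borel [measurable]: "(\<lambda>p. f (w p)) \<in> borel_measurable borel"
  by (rule measurable_compose_range[OF lipschitz_on_continuous_on[OF f_lipschitz] w_borel w_range])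

lemma g_borel [measurable]: "(\<lambda>p. g (w p)) \<in> borel_measurable borel"
  by (rule measurable_compose_range[OF lipschitz_on_continuous_on[OF g_lipschitz] w_borel w_range])

lemma tau_pos: "0 < lam * d n" using lam_pos d_pos by simp

abbreviation lv :: "nat \<Rightarrow> real \<Rightarrow> nat" where "lv n \<equiv> time_level (lam * d n)"

lemma lv_add: "0 \<le> t \<Longrightarrow> lv n (t + lam * d n) = Suc (lv n t)"
  by (rule time_level_add[OF tau_pos])

lemma ua_initial: "0 \<le> t \<Longrightarrow> t < lam * d n \<Longrightarrow> ua (d n) v (x, t) = ua (d n) v (x, 0)"
  using time_level_0[OF tau_pos] tau_pos[of n] by (simp add: ua_def)

lemma AE_fst_nonzero: "AE p in lborel. fst (p :: real \<times> real) \<noteq> 0"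
  by (rule AE_lborel_pair_fst) (rule AE_lborel_singleton)

lemma strip_sets [measurable]: "strip T \<in> sets borel"
  unfolding strip_def by (intro borel_open open_Times) auto

lemma LINT_strip:
  fixes F :: "real \<times> real \<Rightarrow> real"
  assumes [measurable]: "F \<in> borel_measurable borel"
  shows "(LINT p:strip T|lebesgue. F p) = (\<integral>p. indicator (strip T) p * F p \<partial>lborel)"
  unfolding set_lebesgue_integral_def real_scaleR_def by (rule integral_completion) measurable

definition ha :: "nat \<Rightarrow> real \<times> real \<Rightarrow> real"
  where "ha n p = hx (d n) v (lv n (snd p)) (fst p)"

definition qa :: "(int \<Rightarrow> real) \<Rightarrow> nat \<Rightarrow> real \<times> real \<Rightarrow> real"
  where "qa k n p = qx k (d n) v (lv n (snd p)) (fst p)"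

lemma ha_borel [measurable]: "ha n \<in> borel_measurable borel"
  unfolding ha_def hx_def ux_def by (simp only: cell_index_add[OF d_pos]) measurable

lemma qa_borel [measurable]: "qa k n \<in> borel_measurable borel"
  unfolding qa_def qx_def ux_def by (simp only: cell_index_add[OF d_pos]) measurable

lemma ha_eq: "ha n p = godunov_flux (face_flux (cell_index (d n) (fst p))) (ua (d n) v (fst p + d n, snd p)) (ua (d n) v p)"
  by (simp add: ha_def hx_def ua_def)

lemma qa_eq: "qa k n p = entropy_flux (face_flux (cell_index (d n) (fst p))) (ua (d n) v (fst p + d n, snd p)) (ua (d n) v p)
    (k (cell_index (d n) (fst p) + 1)) (k (cell_index (d n) (fst p)))"
  by (simp add: qa_def qx_def ua_def)

text \<open>One constant dominating the states, fluxes and entropies, uniformly in the mesh, so that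
  all dominated convergence arguments share it.\<close>

definition Mb :: real where
  "Mb = (SOME M. 0 \<le> M \<and> (\<forall>n p. \<bar>ha n p\<bar> \<le> M) \<and> (\<forall>n p. \<bar>ua (d n) v p\<bar> \<le> M)
    \<and> (\<forall>k n p. (\<forall>j. k j \<in> {lo..hi}) \<longrightarrow> \<bar>qa k n p\<bar> \<le> M)
    \<and> (\<forall>n p. \<forall>c\<in>{lo..hi}. \<bar>ua (d n) v p - c\<bar> \<le> M)
    \<and> (\<forall>a\<in>{lo..hi}. \<forall>c\<in>{lo..hi}. \<bar>sgn (a - c) * (f a - f c)\<bar> \<le> M \<and> \<bar>sgn (a - c) * (g a - g c)\<bar> \<le> M))"

lemma Mb: "0 \<le> Mb" "\<And>n p. \<bar>ha n p\<bar> \<le> Mb" "\<And>n p. \<bar>ua (d n) v p\<bar> \<le> Mb"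
  "\<And>k n p. (\<And>j. k j \<in> {lo..hi}) \<Longrightarrow> \<bar>qa k n p\<bar> \<le> Mb" "\<And>n p c. c \<in> {lo..hi} \<Longrightarrow> \<bar>ua (d n) v p - c\<bar> \<le> Mb"
  "\<And>a c. a \<in> {lo..hi} \<Longrightarrow> c \<in> {lo..hi} \<Longrightarrow> \<bar>sgn (a - c) * (f a - f c)\<bar> \<le> Mb"
  "\<And>a c. a \<in> {lo..hi} \<Longrightarrow> c \<in> {lo..hi} \<Longrightarrow> \<bar>sgn (a - c) * (g a - g c)\<bar> \<le> Mb"
proof -
  obtain B where B: "0 \<le> B" "\<And>w. w \<in> {lo..hi} \<Longrightarrow> \<bar>f w\<bar> \<le> B" "\<And>w. w \<in> {lo..hi} \<Longrightarrow> \<bar>g w\<bar> \<le> B"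
    using flux_bounded by blast
  define M where "M = 2 * B + \<bar>lo\<bar> + \<bar>hi\<bar>"
  have u: "ua (d n) v p \<in> {lo..hi}" for n p by (rule ua_range[OF data d_pos])
  have G: "\<bar>godunov_flux (face_flux j) a b\<bar> \<le> B" if "a \<in> {lo..hi}" "b \<in> {lo..hi}" for a b j
    using face_flux_bounded[OF B(2,3) that] .
  have "\<exists>M. 0 \<le> M \<and> (\<forall>n p. \<bar>ha n p\<bar> \<le> M) \<and> (\<forall>n p. \<bar>ua (d n) v p\<bar> \<le> M)
    \<and> (\<forall>k n p. (\<forall>j. k j \<in> {lo..hi}) \<longrightarrow> \<bar>qa k n p\<bar> \<le> M)
    \<and> (\<forall>n p. \<forall>c\<in>{lo..hi}. \<bar>ua (d n) v p - c\<bar> \<le> M)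
    \<and> (\<forall>a\<in>{lo..hi}. \<forall>c\<in>{lo..hi}. \<bar>sgn (a - c) * (f a - f c)\<bar> \<le> M \<and> \<bar>sgn (a - c) * (g a - g c)\<bar> \<le> M)"
  proof (rule exI[of _ M], intro conjI allI ballI impI)
    show "0 \<le> M" using B by (simp add: M_def)
    show "\<bar>ha n p\<bar> \<le> M" for n p
      using G[OF u u, of "cell_index (d n) (fst p)" n "(fst p + d n, snd p)" n p] B(1) unfolding ha_eq M_def by linarith
    show "\<bar>ua (d n) v p\<bar> \<le> M" for n p using u[of n p] B(1) by (auto simp: M_def)
    show "\<bar>ua (d n) v p - c\<bar> \<le> M" if "c \<in> {lo..hi}" for n p c using u[of n p] B(1) that by (auto simp: M_def)
    show "\<bar>qa k n p\<bar> \<le> M" if "\<forall>j. k j \<in> {lo..hi}" for k :: "int \<Rightarrow> real" and n p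
    proof -
      have k: "k j \<in> {lo..hi}" for j using that by blast
      have "\<bar>entropy_flux (face_flux i) a b (k j) (k j')\<bar> \<le> B + B" if "a \<in> {lo..hi}" "b \<in> {lo..hi}" for a b i j j'
      proof -
        have m: "\<bar>godunov_flux (face_flux i) (max a (k j)) (max b (k j'))\<bar> \<le> B"
          "\<bar>godunov_flux (face_flux i) (min a (k j)) (min b (k j'))\<bar> \<le> B"
          using max_min_range[OF that(1) k] max_min_range[OF that(2) k] by (auto intro!: G)
        show ?thesis
          unfolding entropy_flux_def by (rule order_trans[OF abs_triangle_ineq4 add_mono[OF m]])
      qed
      then have "\<bar>qa k n p\<bar> \<le> B + B" unfolding qa_eq using u by blast
      then show ?thesis by (simp add: M_def)
    qed
    have ent: "\<bar>sgn (a - c) * (q a - q c)\<bar> \<le> M"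
      if "\<bar>q a\<bar> \<le> B" "\<bar>q c\<bar> \<le> B" for a c and q :: "real \<Rightarrow> real"
      using that by (auto simp: sgn_if M_def)
    show "\<bar>sgn (a - c) * (f a - f c)\<bar> \<le> M" if "a \<in> {lo..hi}" "c \<in> {lo..hi}" for a c
      using ent[where q=f, OF B(2)[OF that(1)] B(2)[OF that(2)]] .
    show "\<bar>sgn (a - c) * (g a - g c)\<bar> \<le> M" if "a \<in> {lo..hi}" "c \<in> {lo..hi}" for a c
      using ent[where q=g, OF B(3)[OF that(1)] B(3)[OF that(2)]] .
  qed
  from someI_ex[OF this, folded Mb_def]
  show "0 \<le> Mb" "\<And>n p. \<bar>ha n p\<bar> \<le> Mb" "\<And>n p. \<bar>ua (d n) v p\<bar> \<le> Mb"
    "\<And>k n p. (\<And>j. k j \<in> {lo..hi}) \<Longrightarrow> \<bar>qa k n p\<bar> \<le> Mb" "\<And>n p c. c \<in> {lo..hi} \<Longrightarrow> \<bar>ua (d n) v p - c\<bar> \<le> Mb"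
    "\<And>a c. a \<in> {lo..hi} \<Longrightarrow> c \<in> {lo..hi} \<Longrightarrow> \<bar>sgn (a - c) * (f a - f c)\<bar> \<le> Mb"
    "\<And>a c. a \<in> {lo..hi} \<Longrightarrow> c \<in> {lo..hi} \<Longrightarrow> \<bar>sgn (a - c) * (g a - g c)\<bar> \<le> Mb"
    by (simp_all del: split_paired_All)
qed

lemma limit_is_weak_solution: "weak_solution T f g v (\<lambda>x t. w (x, t))"
  unfolding weak_solution_def
proof (intro allI impI)
  fix \<phi> assume \<phi>: "test_function T \<phi>"
  have lw: "limit_weight T \<phi> (D_x \<phi>) (D_t \<phi>)" by (rule test_function_limit_weight[OF \<phi>])
  then have [measurable]: "\<phi> \<in> borel_measurable borel" "D_x \<phi> \<in> borel_measurable borel" "D_t \<phi> \<in> borel_measurable borel"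
    by (auto simp: limit_weight_def)
  define M where "M = Mb"
  note M = Mb(2,3)[folded M_def]
  define Q' where "Q' p = flux f g (fst p) (w p)" for p
  have [measurable]: "Q' \<in> borel_measurable borel"
    unfolding Q'_def flux_def heaviside_def by measurable
  \<comment> \<open>Off the line \<open>x = 0\<close> the face used at \<open>p\<close> eventually
    carries a single flux. Both of its arguments tend to \<open>w p\<close>, and the Godunov flux is
    consistent and Lipschitz.\<close>
  have Q_lim: "AE p in lborel. snd p \<in> {0..T} \<longrightarrow> (\<lambda>n. ha n p) \<longlonglongrightarrow> Q' p"
    using conv conv_shift AE_fst_nonzero
  proof eventually_elim
    case (elim p)
    show ?case
    proof
      assume t: "snd p \<in> {0..T}"
      have lim: "(\<lambda>n. godunov_flux q (ua (d n) v (fst p + d n, snd p)) (ua (d n) v p)) \<longlonglongrightarrow> q (w p)"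
        if "L-lipschitz_on {lo..hi} q" for q
        using godunov_flux_tendsto[OF that ua_range[OF data d_pos] ua_range[OF data d_pos] w_range w_range
            elim(2)[rule_format, OF t] elim(1)[rule_format, OF t]] by simp
      consider "fst p < 0" | "0 < fst p" using elim(3) by linarith
      then show "(\<lambda>n. ha n p) \<longlonglongrightarrow> Q' p"
      proof cases
        case 1
        have "\<forall>\<^sub>F n in sequentially. godunov_flux g (ua (d n) v (fst p + d n, snd p)) (ua (d n) v p) = ha n p"
          using cell_index_neg_eventually[OF d_pos d_lim 1] by eventually_elim (simp add: ha_eq face_flux_def)
        from Lim_transform_eventually[OF lim[OF g_lipschitz] this] show ?thesis
          using 1 by (simp add: Q'_def flux_def heaviside_def)
      next
        case 2
        have "\<forall>\<^sub>F n in sequentially. godunov_flux f (ua (d n) v (fst p + d n, snd p)) (ua (d n) v p) = ha n p"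
          using cell_index_pos_eventually[OF d_pos d_lim 2] by eventually_elim (simp add: ha_eq face_flux_def)
        from Lim_transform_eventually[OF lim[OF f_lipschitz] this] show ?thesis
          using 2 by (simp add: Q'_def flux_def heaviside_def)
      qed
    qed
  qed
  have res: "indicator {0..} (snd p) * \<phi> p * (ua (d n) v (fst p, snd p + lam * d n) - ua (d n) v p
      + lam * (ha n p - ha n (fst p - d n, snd p))) = 0" for n p
    by (cases "0 \<le> snd p") (simp_all add: ua_def ha_def lv_add ux_Suc[OF d_pos])
  have "(\<lambda>n. (\<integral>p. indicator {0..} (snd p) * \<phi> p * (ua (d n) v (fst p, snd p + lam * d n) - ua (d n) v p
      + lam * (ha n p - ha n (fst p - d n, snd p))) \<partial>lborel) / (lam * d n))
    \<longlonglongrightarrow> - ((\<integral>p. indicator (strip T) p * (w p * D_t \<phi> p + Q' p * D_x \<phi> p) \<partial>lborel) + (\<integral>x. v x * \<phi> (x, 0) \<partial>lborel))"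
    by (rule weak_form_limit[OF lw lam_pos d_pos d_le d_lim ua_measurable ha_borel w_borel \<open>Q' \<in> borel_measurable borel\<close> v_borel
          M(2) M(1) conv Q_lim ua_initial conv_0])
  moreover have "(\<integral>p. indicator {0..} (snd p) * \<phi> p * (ua (d n) v (fst p, snd p + lam * d n) - ua (d n) v p
      + lam * (ha n p - ha n (fst p - d n, snd p))) \<partial>lborel) = (\<integral>p. 0 \<partial>(lborel :: (real \<times> real) measure))" for n
    by (rule Bochner_Integration.integral_cong[OF refl res])
  ultimately have "(\<lambda>n. (\<integral>p. 0 \<partial>(lborel :: (real \<times> real) measure)) / (lam * d n)) \<longlonglongrightarrow> - ((\<integral>p. indicator (strip T) p * (w p * D_t \<phi> p + Q' p * D_x \<phi> p) \<partial>lborel) + (\<integral>x. v x * \<phi> (x, 0) \<partial>lborel))"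
    by simp
  then have "(\<integral>p. indicator (strip T) p * (w p * D_t \<phi> p + Q' p * D_x \<phi> p) \<partial>lborel) + (\<integral>x. v x * \<phi> (x, 0) \<partial>lborel) = 0"
    by (auto dest: LIMSEQ_unique[OF tendsto_const])
  moreover have "(LINT p:strip T|lebesgue. case p of (x, t) \<Rightarrow> w (x, t) * D_t \<phi> (x, t) + flux f g x (w (x, t)) * D_x \<phi> (x, t))
      = (\<integral>p. indicator (strip T) p * (w p * D_t \<phi> p + Q' p * D_x \<phi> p) \<partial>lborel)"
  proof -
    have "(\<lambda>p. case p of (x, t) \<Rightarrow> w (x, t) * D_t \<phi> (x, t) + flux f g x (w (x, t)) * D_x \<phi> (x, t))
        = (\<lambda>p. w p * D_t \<phi> p + Q' p * D_x \<phi> p)"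
      by (rule ext) (simp add: Q'_def split_beta)
    then show ?thesis by (simp only:) (rule LINT_strip, measurable)
  qed
  moreover have "(LINT x|lebesgue. v x * \<phi> (x, 0)) = (\<integral>x. v x * \<phi> (x, 0) \<partial>lborel)"
    by (rule integral_completion) measurable
  ultimately show "(LINT p:strip T|lebesgue. case p of (x, t) \<Rightarrow> w (x, t) * D_t \<phi> (x, t) + flux f g x (w (x, t)) * D_x \<phi> (x, t))
       + (LINT x|lebesgue. v x * \<phi> (x, 0)) = 0" by simp
qed

lemma kato_residual:
  assumes k: "\<And>j. k j \<in> {lo..hi}" and t: "0 \<le> snd p"
    and steady: "step (cell_index (d n) (fst p)) (k (cell_index (d n) (fst p) - 1)) (k (cell_index (d n) (fst p)))
      (k (cell_index (d n) (fst p) + 1)) = k (cell_index (d n) (fst p))"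
  shows "\<bar>ua (d n) v (fst p, snd p + lam * d n) - k (cell_index (d n) (fst p))\<bar>
    - \<bar>ua (d n) v p - k (cell_index (d n) (fst p))\<bar> + lam * (qa k n p - qa k n (fst p - d n, snd p)) \<le> 0"
proof -
  have e: "ua (d n) v (fst p, snd p + lam * d n) = ux (d n) v (Suc (lv n (snd p))) (fst p)"
    "ua (d n) v p = ux (d n) v (lv n (snd p)) (fst p)" "qa k n p = qx k (d n) v (lv n (snd p)) (fst p)"
    "qa k n (fst p - d n, snd p) = qx k (d n) v (lv n (snd p)) (fst p - d n)"
    unfolding ua_def qa_def fst_conv snd_conv lv_add[OF t] by (rule refl)+
  have le: "a - b + c \<le> 0" if "a \<le> b - c" for a b c :: real using that by linarith
  show ?thesis unfolding e by (rule le, rule ux_kato_steady[OF data d_pos k steady])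
qed

lemma qa_tendsto:
  assumes k: "\<And>j. k j \<in> {lo..hi}" and km: "\<And>j. j < 0 \<Longrightarrow> k j = km" and kp: "\<And>j. 0 < j \<Longrightarrow> k j = kp"
  shows "AE p in lborel. snd p \<in> {0..T} \<longrightarrow> (\<lambda>n. qa k n p) \<longlonglongrightarrow>
    (if fst p < 0 then sgn (w p - km) * (g (w p) - g km) else sgn (w p - kp) * (f (w p) - f kp))"
  using conv conv_shift AE_fst_nonzero
proof eventually_elim
  case (elim p)
  show ?case
  proof
    assume t: "snd p \<in> {0..T}"
    have c: "km \<in> {lo..hi}" "kp \<in> {lo..hi}" using k[of "-1"] k[of 1] km[of "-1"] kp[of 1] by auto
    have lim: "(\<lambda>n. entropy_flux q (ua (d n) v (fst p + d n, snd p)) (ua (d n) v p) c c) \<longlonglongrightarrow> sgn (w p - c) * (q (w p) - q c)"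
      if "L-lipschitz_on {lo..hi} q" "c \<in> {lo..hi}" for q c
      using entropy_flux_tendsto[OF that(1) ua_range[OF data d_pos] ua_range[OF data d_pos] w_range that(2)
          elim(2)[rule_format, OF t] elim(1)[rule_format, OF t]] .
    consider "fst p < 0" | "0 < fst p" using elim(3) by linarith
    then show "(\<lambda>n. qa k n p) \<longlonglongrightarrow>
      (if fst p < 0 then sgn (w p - km) * (g (w p) - g km) else sgn (w p - kp) * (f (w p) - f kp))"
    proof cases
      case 1
      have "\<forall>\<^sub>F n in sequentially. entropy_flux g (ua (d n) v (fst p + d n, snd p)) (ua (d n) v p) km km = qa k n p"
        using cell_index_neg_eventually[OF d_pos d_lim 1] by eventually_elim (simp add: qa_eq face_flux_def km)
      from Lim_transform_eventually[OF lim[OF g_lipschitz c(1)] this] show ?thesis using 1 by simp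
    next
      case 2
      have "\<forall>\<^sub>F n in sequentially. entropy_flux f (ua (d n) v (fst p + d n, snd p)) (ua (d n) v p) kp kp = qa k n p"
        using cell_index_pos_eventually[OF d_pos d_lim 2] by eventually_elim (simp add: qa_eq face_flux_def kp)
      from Lim_transform_eventually[OF lim[OF f_lipschitz c(2)] this] show ?thesis using 2 by simp
    qed
  qed
qed

text \<open>In every cell except cell \<open>0\<close> the constant \<open>c\<close> is steady and
  the Kato residual is nonpositive. In cell \<open>0\<close> the residual is merely bounded, but
  \<phi> vanishes at \<open>x = 0\<close> and is Lipschitz, hence of order \<open>d\<close> there.
  As the cell has width \<open>d\<close>, its contribution is still of order \<open>d\<close> after
  division by the time step.\<close>

lemma limit_kruzkov_aux:
  assumes \<phi>: "nonneg_test_function T \<phi>" and c: "c \<in> {lo..hi}" and \<phi>0: "\<And>t. 0 \<le> t \<Longrightarrow> \<phi> (0, t) = 0"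
  shows "0 \<le> (\<integral>p. indicator (strip T) p * (\<bar>w p - c\<bar> * D_t \<phi> p
      + (if fst p < 0 then sgn (w p - c) * (g (w p) - g c) else sgn (w p - c) * (f (w p) - f c)) * D_x \<phi> p) \<partial>lborel)
    + (\<integral>x. \<bar>v x - c\<bar> * \<phi> (x, 0) \<partial>lborel)"
proof -
  have lw: "limit_weight T \<phi> (D_x \<phi>) (D_t \<phi>)"
    using \<phi> by (auto simp: nonneg_test_function_def intro: test_function_limit_weight)
  have pos: "0 \<le> \<phi> p" if "0 \<le> snd p" for p
    using \<phi> that unfolding nonneg_test_function_def by (metis prod.collapse)
  from lw have [measurable]: "\<phi> \<in> borel_measurable borel" "D_x \<phi> \<in> borel_measurable borel" "D_t \<phi> \<in> borel_measurable borel"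
    by (auto simp: limit_weight_def)
  from lw obtain N B where B: "0 \<le> B" and N: "\<And>p. \<bar>\<phi> p\<bar> \<le> N"
    and supp: "\<And>p. p \<notin> cbox (-B, -B) (B, B) \<Longrightarrow> \<phi> p = 0"
    and lip_x: "\<And>x x' t. \<bar>\<phi> (x, t) - \<phi> (x', t)\<bar> \<le> N * \<bar>x - x'\<bar>"
    unfolding limit_weight_def by blast
  have N0: "0 \<le> N" using N[of 0] by linarith
  define M where "M = Mb"
  have M: "0 \<le> M" "\<And>n p. \<bar>ua (d n) v p - c\<bar> \<le> M" "\<And>n p. \<bar>qa (\<lambda>_. c) n p\<bar> \<le> M"
    using Mb c by (simp_all add: M_def)
  define Q' where "Q' p = (if fst p < 0 then sgn (w p - c) * (g (w p) - g c) else sgn (w p - c) * (f (w p) - f c))" for p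
  have [measurable]: "Q' \<in> borel_measurable borel" unfolding Q'_def by measurable
  define E where "E n p = \<bar>ua (d n) v p - c\<bar>" for n p
  have [measurable]: "E n \<in> borel_measurable borel" for n unfolding E_def by measurable
  define rs where "rs n p = E n (fst p, snd p + lam * d n) - E n p + lam * (qa (\<lambda>_. c) n p - qa (\<lambda>_. c) n (fst p - d n, snd p))" for n p
  have [measurable]: "rs n \<in> borel_measurable borel" for n unfolding rs_def by measurable
  have rs_bound: "\<bar>rs n p\<bar> \<le> 2 * M + lam * (2 * M)" for n p
  proof -
    have "\<bar>qa (\<lambda>_. c) n p - qa (\<lambda>_. c) n (fst p - d n, snd p)\<bar> \<le> 2 * M"
      using M(3)[of n p] M(3)[of n "(fst p - d n, snd p)"] by linarith
    then have "\<bar>lam * (qa (\<lambda>_. c) n p - qa (\<lambda>_. c) n (fst p - d n, snd p))\<bar> \<le> lam * (2 * M)"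
      using lam_pos by (simp only: abs_mult) (intro mult_mono, auto)
    moreover have "\<bar>a - b + e\<bar> \<le> 2 * M + k" if "0 \<le> a" "a \<le> M" "0 \<le> b" "b \<le> M" "\<bar>e\<bar> \<le> k" for a b e k :: real
      using that by linarith
    ultimately show ?thesis
      using M(2) unfolding rs_def E_def by simp
  qed
  define C where "C = 2 * M + lam * (2 * M)"
  have C: "0 \<le> C" using M lam_pos by (simp add: C_def)
  have le: "(\<integral>p. indicator {0..} (snd p) * \<phi> p * rs n p \<partial>lborel) / (lam * d n) \<le> (N * C * (2 * B) * 2 / lam) * d n" for n
  proof -
    have dn: "0 < d n" by (rule d_pos)
    define Z where "Z p = (N * d n * C * indicator {- d n..d n} (fst p)) * indicator {-B..B} (snd p)" for p :: "real \<times> real"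
    have [measurable]: "Z \<in> borel_measurable borel" unfolding Z_def by measurable
    have Z0: "0 \<le> Z p" for p using N0 C dn by (simp add: Z_def)
    have Z_int: "integrable lborel Z"
      by (rule integrable_bounded_box[of _ "N * d n * C" "(-d n, -B)" "(d n, B)"])
        (use N0 C dn in \<open>auto simp: Z_def cbox_Pair_iff abs_mult split: split_indicator\<close>)
    have pt: "indicator {0..} (snd p) * \<phi> p * rs n p \<le> Z p" for p
    proof (cases "0 \<le> snd p")
      case t: True
      show ?thesis
      proof (cases "cell_index (d n) (fst p) = 0")
        case False
        have "rs n p \<le> 0"
          using kato_residual[of "\<lambda>_. c" p n] c t step_const[OF False] unfolding rs_def E_def by simp
        then have "\<phi> p * rs n p \<le> 0" using pos[OF t] by (simp add: mult_nonneg_nonpos)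
        then show ?thesis using t Z0[of p] by simp
      next
        case True
        then have x: "\<bar>fst p\<bar> \<le> d n" by (rule cell_index_0_bound[OF dn])
        show ?thesis
        proof (cases "p \<in> cbox (-B, -B) (B, B)")
          case box: True
          have "\<bar>\<phi> p\<bar> \<le> N * \<bar>fst p\<bar>"
            using lip_x[of "fst p" "snd p" 0] \<phi>0[OF t] by simp
          also have "\<dots> \<le> N * d n" using x N0 by (intro mult_left_mono)
          finally have "\<bar>\<phi> p\<bar> * \<bar>rs n p\<bar> \<le> (N * d n) * C"
            using rs_bound[of n p] N0 dn unfolding C_def by (intro mult_mono) auto
          then have "\<phi> p * rs n p \<le> N * d n * C"
            by (metis abs_ge_self abs_mult order_trans)
          then show ?thesis using t x box by (auto simp: Z_def cbox_Pair_iff abs_le_iff)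
        next
          case False
          then show ?thesis using supp Z0[of p] by simp
        qed
      qed
    qed (use Z0 in simp)
    have int: "integrable lborel (\<lambda>p. indicator {0..} (snd p) * \<phi> p * rs n p)"
    proof (rule integrable_bounded_box[of _ "N * C" "(-B, -B)" "(B, B)"])
      show "\<bar>indicator {0..} (snd p) * \<phi> p * rs n p\<bar> \<le> N * C" for p
      proof -
        have "\<bar>\<phi> p * rs n p\<bar> \<le> N * C" unfolding abs_mult C_def using N rs_bound N0 by (intro mult_mono) auto
        moreover have "0 \<le> N * C" using N0 C by simp
        ultimately show ?thesis by (auto split: split_indicator)
      qed
    qed (use supp in auto)
    have "(\<integral>p. indicator {0..} (snd p) * \<phi> p * rs n p \<partial>lborel) \<le> (\<integral>p. Z p \<partial>lborel)"
      by (intro integral_mono int Z_int pt)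
    also have "\<dots> = (N * d n * C * (2 * d n)) * (2 * B)"
      using integral_lborel_product[OF Z_int[unfolded Z_def]] dn B unfolding Z_def by simp
    finally have "(\<integral>p. indicator {0..} (snd p) * \<phi> p * rs n p \<partial>lborel) / (lam * d n)
        \<le> (N * d n * C * (2 * d n)) * (2 * B) / (lam * d n)"
      using lam_pos dn by (intro divide_right_mono) auto
    also have "\<dots> = (N * C * (2 * B) * 2 / lam) * d n" using dn lam_pos by (simp add: field_simps)
    finally show ?thesis .
  qed
  have e_lim: "AE x in lborel. (\<lambda>n. E n (x, 0)) \<longlonglongrightarrow> \<bar>v x - c\<bar>"
    using conv_0 unfolding E_def by eventually_elim (intro tendsto_intros)
  have E_lim: "AE p in lborel. snd p \<in> {0..T} \<longrightarrow> (\<lambda>n. E n p) \<longlonglongrightarrow> \<bar>w p - c\<bar>"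
    using conv unfolding E_def by eventually_elim (auto intro!: tendsto_intros)
  have Q_lim: "AE p in lborel. snd p \<in> {0..T} \<longrightarrow> (\<lambda>n. qa (\<lambda>_. c) n p) \<longlonglongrightarrow> Q' p"
    unfolding Q'_def using c by (intro qa_tendsto) auto
  have E0: "E n (x, t) = E n (x, 0)" if "0 \<le> t" "t < lam * d n" for n x t
    using ua_initial[OF that] by (simp add: E_def)
  have EM: "\<bar>E n p\<bar> \<le> M" for n p using M(2) by (simp add: E_def)
  have "(\<lambda>n. (\<integral>p. indicator {0..} (snd p) * \<phi> p * rs n p \<partial>lborel) / (lam * d n))
    \<longlonglongrightarrow> - ((\<integral>p. indicator (strip T) p * (\<bar>w p - c\<bar> * D_t \<phi> p + Q' p * D_x \<phi> p) \<partial>lborel) + (\<integral>x. \<bar>v x - c\<bar> * \<phi> (x, 0) \<partial>lborel))"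
    unfolding rs_def
    by (rule weak_form_limit[OF lw lam_pos d_pos d_le d_lim \<open>\<And>n. E n \<in> borel_measurable borel\<close> qa_borel _ \<open>Q' \<in> borel_measurable borel\<close> _
          EM M(3) E_lim Q_lim E0 e_lim]) measurable
  moreover have "(\<lambda>n. (N * C * (2 * B) * 2 / lam) * d n) \<longlonglongrightarrow> 0"
    by (rule tendsto_mult_right_zero[OF d_lim])
  ultimately have "- ((\<integral>p. indicator (strip T) p * (\<bar>w p - c\<bar> * D_t \<phi> p + Q' p * D_x \<phi> p) \<partial>lborel) + (\<integral>x. \<bar>v x - c\<bar> * \<phi> (x, 0) \<partial>lborel)) \<le> 0"
    by (rule LIMSEQ_le) (intro exI[of _ 0] allI impI le)
  then show ?thesis unfolding Q'_def by simp
qed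

end

section \<open>The interface condition of the limit\<close>

text \<open>Lebesgue differentiation: at almost every \<open>t\<close> the value \<open>D t\<close>
  is the limit of the means over \<open>{t..t+h}\<close>, which are nonnegative.\<close>

lemma AE_nonneg_from_intervals:
  fixes D :: "real \<Rightarrow> real"
  assumes [measurable]: "D \<in> borel_measurable borel" and M: "\<And>t. \<bar>D t\<bar> \<le> M"
    and nn: "\<And>a b. 0 \<le> a \<Longrightarrow> a < b \<Longrightarrow> b \<le> T \<Longrightarrow> 0 \<le> (\<integral>t. indicator {a..<b} t * D t \<partial>lborel)"
  shows "AE t in lborel. t \<in> {0<..<T} \<longrightarrow> 0 \<le> D t"
proof -
  have M0: "0 \<le> M" using M[of 0] by linarith
  have si: "set_integrable lborel {a..b} D" for a b
    unfolding set_integrable_def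
    by (rule integrable_bounded_box[of _ M a b]) (use M M0 in \<open>auto simp: abs_mult split: split_indicator\<close>)
  have "D integrable_on cbox a b" for a b :: real
    using set_borel_integral_eq_integral(1)[OF si] by (simp add: cbox_interval)
  from integrable_ccontinuous_explicit[OF this] obtain N where N: "negligible N"
    and lim: "\<And>x e. x \<notin> N \<Longrightarrow> 0 < e \<Longrightarrow> \<exists>d>0. \<forall>h. 0 < h \<and> h < d \<longrightarrow>
      norm (integral (cbox x (x + h *\<^sub>R One)) D /\<^sub>R h ^ DIM(real) - D x) < e" by blast
  have key: "0 \<le> D t" if t: "t \<in> {0<..<T}" "t \<notin> N" for t
  proof (rule ccontr)
    assume neg: "\<not> 0 \<le> D t"
    then obtain d where d: "d > 0" "\<And>h. 0 < h \<Longrightarrow> h < d \<Longrightarrow>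
      norm (integral (cbox t (t + h *\<^sub>R One)) D /\<^sub>R h ^ DIM(real) - D t) < - D t"
      using lim[OF t(2), of "- D t"] by auto
    define h where "h = min (d / 2) ((T - t) / 2)"
    have h: "0 < h" "h < d" "t + h \<le> T" using d(1) t(1) by (auto simp: h_def field_simps min_def)
    have "AE s in lborel. s \<noteq> t + h" by (rule AE_lborel_singleton)
    then have "AE s in lborel. indicator {t..t+h} s *\<^sub>R D s = indicator {t..<t+h} s * D s"
      by eventually_elim (auto split: split_indicator)
    then have "(LINT s:{t..t+h}|lborel. D s) = (\<integral>s. indicator {t..<t+h} s * D s \<partial>lborel)"
      unfolding set_lebesgue_integral_def by (intro integral_cong_AE) auto
    also have "0 \<le> \<dots>" using t h by (intro nn) auto
    finally have "0 \<le> integral {t..t+h} D" using set_borel_integral_eq_integral(2)[OF si] by simp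
    then have "0 \<le> integral {t..t+h} D / h" using h by simp
    moreover have "\<bar>integral {t..t+h} D / h - D t\<bar> < - D t" using d(2)[OF h(1,2)] by (simp add: divide_inverse_commute)
    ultimately show False by linarith
  qed
  have "AE t in lebesgue. t \<notin> N"
    using N by (auto simp: negligible_iff_null_sets intro: AE_not_in)
  then have "AE t in lborel. t \<notin> N" by (simp add: AE_completion_iff)
  then show ?thesis by eventually_elim (use key in auto)
qed

lemma ess_lim_left_range:
  assumes "ess_lim_left_0 z um" "\<And>x. z x \<in> {lo..hi}"
  shows "um \<in> {lo..hi}"
proof (rule ccontr)
  assume "um \<notin> {lo..hi}"
  then have e: "0 < max (lo - um) (um - hi)" by auto
  then obtain d where d: "d > 0" "AE x in lebesgue. x \<in> {- d<..<0} \<longrightarrow> \<bar>z x - um\<bar> < max (lo - um) (um - hi)"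
    using assms(1) unfolding ess_lim_left_0_def by blast
  have ae: "AE x in lborel. x \<in> {- d<..<0} \<longrightarrow> \<bar>z x - um\<bar> < max (lo - um) (um - hi)"
    using d(2) by (simp only: AE_completion_iff)
  obtain x where "- d < x" "x < 0" "x \<in> {- d<..<0} \<longrightarrow> \<bar>z x - um\<bar> < max (lo - um) (um - hi)"
    using AE_lborel_dense[OF ae, of "-d" 0] d(1) by auto
  then show False using assms(2)[of x] by auto
qed

lemma ess_lim_right_range:
  assumes "ess_lim_right_0 z up" "\<And>x. z x \<in> {lo..hi}"
  shows "up \<in> {lo..hi}"
proof (rule ccontr)
  assume "up \<notin> {lo..hi}"
  then have e: "0 < max (lo - up) (up - hi)" by auto
  then obtain d where d: "d > 0" "AE x in lebesgue. x \<in> {0<..<d} \<longrightarrow> \<bar>z x - up\<bar> < max (lo - up) (up - hi)"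
    using assms(1) unfolding ess_lim_right_0_def by blast
  have ae: "AE x in lborel. x \<in> {0<..<d} \<longrightarrow> \<bar>z x - up\<bar> < max (lo - up) (up - hi)"
    using d(2) by (simp only: AE_completion_iff)
  obtain x where "0 < x" "x < d" "x \<in> {0<..<d} \<longrightarrow> \<bar>z x - up\<bar> < max (lo - up) (up - hi)"
    using AE_lborel_dense[OF ae, of 0 d] d(1) by auto
  then show False using assms(2)[of x] by auto
qed

text \<open>\<open>J d\<close> are one-sided neighbourhoods of the origin and \<open>S r\<close> the
  averaging windows inside them, so one proof covers both traces. The essential limit suffices
  because averages ignore null sets.\<close>

lemma average_tendsto:
  fixes Z :: "real \<Rightarrow> real"
  assumes [measurable]: "Z \<in> borel_measurable borel" and M: "\<And>x. \<bar>Z x\<bar> \<le> M"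
    and h: "\<And>n. 0 < h n" "h \<longlonglongrightarrow> 0"
    and J: "\<And>e. (0::real) < e \<Longrightarrow> \<exists>d>0. AE x in lborel. x \<in> J d \<longrightarrow> \<bar>Z x - l\<bar> < e"
    and S: "\<And>r. 0 < r \<Longrightarrow> \<exists>a. S r = {a<..<a+r} \<and> a \<in> {-r..0}" "\<And>r d. r < d \<Longrightarrow> S r \<subseteq> J d"
  shows "(\<lambda>n. \<integral>x. Z x * (indicator (S (h n)) x / h n) \<partial>lborel) \<longlonglongrightarrow> l"
proof (rule LIMSEQ_I)
  fix e :: real assume e: "0 < e"
  then obtain d where d: "d > 0" "AE x in lborel. x \<in> J d \<longrightarrow> \<bar>Z x - l\<bar> < e / 2" using J[of "e / 2"] by auto
  have "\<forall>\<^sub>F n in sequentially. h n < d" using d(1) by (intro order_tendstoD(2)[OF h(2)])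
  then obtain N where N: "\<And>n. n \<ge> N \<Longrightarrow> h n < d" by (auto simp: eventually_sequentially)
  have "norm ((\<integral>x. Z x * (indicator (S (h n)) x / h n) \<partial>lborel) - l) < e" if n: "n \<ge> N" for n
  proof -
    have hn: "0 < h n" by (rule h)
    obtain a where a: "S (h n) = {a<..<a + h n}" "a \<in> {- h n..0}" using S(1)[OF hn] by blast
    have sub: "S (h n) \<subseteq> J d" using S(2) N[OF n] by blast
    have int: "integrable lborel (\<lambda>x. W x * (indicator (S (h n)) x / h n))"
      if "W \<in> borel_measurable borel" "\<And>x. \<bar>W x\<bar> \<le> M'" for W :: "real \<Rightarrow> real" and M'
    proof (rule integrable_bounded_box[of _ "M' / h n" a "a + h n"])
      have "0 \<le> M'" using that(2)[of 0] by linarith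
      then show "\<bar>W x * (indicator (S (h n)) x / h n)\<bar> \<le> M' / h n" for x
        using that(2)[of x] hn by (auto simp: abs_mult divide_right_mono split: split_indicator)
      show "(\<lambda>x. W x * (indicator (S (h n)) x / h n)) \<in> borel_measurable borel"
        using that(1) unfolding a by measurable
    qed (auto simp: a)
    have c: "(\<integral>x. c * (indicator (S (h n)) x / h n) \<partial>lborel) = c" for c
      using hn unfolding a by simp
    have i1: "integrable lborel (\<lambda>x. Z x * (indicator (S (h n)) x / h n))" by (rule int[OF assms(1) M])
    have i2: "integrable lborel (\<lambda>x. l * (indicator (S (h n)) x / h n))" by (rule int[of _ "\<bar>l\<bar>"]) auto
    have i3: "integrable lborel (\<lambda>x. e / 2 * (indicator (S (h n)) x / h n))" by (rule int[of _ "\<bar>e / 2\<bar>"]) auto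
    have "(\<integral>x. Z x * (indicator (S (h n)) x / h n) \<partial>lborel) - l
        = (\<integral>x. Z x * (indicator (S (h n)) x / h n) - l * (indicator (S (h n)) x / h n) \<partial>lborel)"
      by (subst Bochner_Integration.integral_diff[OF i1 i2]) (simp only: c)
    also have "\<bar>\<dots>\<bar> \<le> (\<integral>x. \<bar>Z x * (indicator (S (h n)) x / h n) - l * (indicator (S (h n)) x / h n)\<bar> \<partial>lborel)"
      by (rule integral_abs_bound)
    also have "\<dots> \<le> (\<integral>x. e / 2 * (indicator (S (h n)) x / h n) \<partial>lborel)"
    proof (rule integral_mono_AE)
      show "integrable lborel (\<lambda>x. \<bar>Z x * (indicator (S (h n)) x / h n) - l * (indicator (S (h n)) x / h n)\<bar>)"
        using Bochner_Integration.integrable_diff[OF i1 i2] by (rule integrable_abs)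
      show "AE x in lborel. \<bar>Z x * (indicator (S (h n)) x / h n) - l * (indicator (S (h n)) x / h n)\<bar>
          \<le> e / 2 * (indicator (S (h n)) x / h n)"
        using d(2)
      proof eventually_elim
        case (elim x)
        show ?case
        proof (cases "x \<in> S (h n)")
          case True
          then have "\<bar>Z x - l\<bar> / h n \<le> e / 2 / h n" using elim sub hn by (intro divide_right_mono) auto
          then show ?thesis using True hn by (simp add: diff_divide_distrib[symmetric])
        qed simp
      qed
    qed (rule i3)
    also have "\<dots> = e / 2" by (rule c)
    finally show ?thesis using e by simp
  qed
  then show "\<exists>no. \<forall>n\<ge>no. norm ((\<integral>x. Z x * (indicator (S (h n)) x / h n) \<partial>lborel) - l) < e" by blast
qed

text \<open>If the \<open>\<Gamma>\<close> condition fails, the value \<open>k\<close> at which the two interface fluxes balance yields a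
  steady state violating its inequality.\<close>

lemma gamma_from_entropy:
  assumes f: "continuous_on {lo..hi} f" "L-lipschitz_on {lo..hi} f" and g: "continuous_on {lo..hi} g" "L-lipschitz_on {lo..hi} g"
    and bd: "lo \<le> hi" "f lo = g lo" "f hi = g hi" and u: "um \<in> {lo..hi}" "up \<in> {lo..hi}"
    and ent: "\<And>km k0 kp. {km, k0, kp} \<subseteq> {lo..hi} \<Longrightarrow> godunov_flux g k0 km = g km \<Longrightarrow>
      godunov_flux f kp k0 = f kp \<Longrightarrow> g km = f kp \<Longrightarrow>
      sgn (up - kp) * (f up - f kp) \<le> sgn (um - km) * (g um - g km)"
  shows "Gamma_condition f g um up"
proof -
  \<comment> \<open>The constant triples at \<open>lo\<close> and \<open>hi\<close> are steady
    because the fluxes agree there. They give the two opposite inequalities between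
    \<open>f up\<close> and \<open>g um\<close>, that is the Rankine-Hugoniot condition.\<close>
  have "sgn (up - lo) * (f up - f lo) \<le> sgn (um - lo) * (g um - g lo)"
    by (rule ent[of lo lo lo]) (use bd in auto)
  moreover have "sgn (up - hi) * (f up - f hi) \<le> sgn (um - hi) * (g um - g hi)"
    by (rule ent[of hi hi hi]) (use bd in auto)
  ultimately have rh: "g um = f up"
    using u bd by (auto simp: sgn_if split: if_splits)
  \<comment> \<open>The flux out of a middle state \<open>k\<close> towards \<open>up\<close> minus
    the flux into it from \<open>um\<close>. A zero is a middle state that balances the
    interface.\<close>
  define Df where "Df k = godunov_flux f up k - godunov_flux g k um" for k
  have contD: "continuous_on {lo..hi} Df"
    unfolding Df_def
  proof (rule continuous_on_diff)
    have L: "0 \<le> L" by (rule lipschitz_on_nonneg[OF f(2)])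
    have 1: "L-lipschitz_on {lo..hi} (\<lambda>k. godunov_flux f up k)"
    proof (rule lipschitz_onI[OF _ L])
      fix a b assume "a \<in> {lo..hi}" "b \<in> {lo..hi}"
      then show "dist (godunov_flux f up a) (godunov_flux f up b) \<le> L * dist a b"
        using godunov_flux_lipschitz[OF f(2), of a up b up] u by (simp add: dist_real_def)
    qed
    have 2: "L-lipschitz_on {lo..hi} (\<lambda>k. godunov_flux g k um)"
    proof (rule lipschitz_onI[OF _ L])
      fix a b assume "a \<in> {lo..hi}" "b \<in> {lo..hi}"
      then show "dist (godunov_flux g a um) (godunov_flux g b um) \<le> L * dist a b"
        using godunov_flux_lipschitz[OF g(2), of um a um b] u by (simp add: dist_real_def)
    qed
    show "continuous_on {lo..hi} (\<lambda>k. godunov_flux f up k)" "continuous_on {lo..hi} (\<lambda>k. godunov_flux g k um)"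
      using lipschitz_on_continuous_on[OF 1] lipschitz_on_continuous_on[OF 2] by simp_all
  qed
  \<comment> \<open>For \<open>k = lo\<close> the right flux is a minimum and the left flux a
    maximum, both over intervals containing \<open>lo\<close>; the common value
    \<open>f lo = g lo\<close> separates them. At \<open>hi\<close> the roles are reversed.\<close>
  have "Df lo \<le> 0"
  proof -
    obtain w1 where w1: "godunov_flux f up lo = f w1" "\<And>z. z \<in> {lo..up} \<Longrightarrow> f w1 \<le> f z"
      using godunov_flux_min[OF f(1), of lo up] u by auto
    obtain w2 where w2: "godunov_flux g lo um = g w2" "\<And>z. z \<in> {lo..um} \<Longrightarrow> g z \<le> g w2"
      using godunov_flux_max[OF g(1), of lo um] u by auto
    show ?thesis unfolding Df_def using w1(1) w2(1) w1(2)[of lo] w2(2)[of lo] u bd by auto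
  qed
  moreover have "0 \<le> Df hi"
  proof -
    obtain w1 where w1: "godunov_flux f up hi = f w1" "\<And>z. z \<in> {up..hi} \<Longrightarrow> f z \<le> f w1"
      using godunov_flux_max[OF f(1), of up hi] u by auto
    obtain w2 where w2: "godunov_flux g hi um = g w2" "\<And>z. z \<in> {um..hi} \<Longrightarrow> g w2 \<le> g z"
      using godunov_flux_min[OF g(1), of um hi] u by auto
    show ?thesis unfolding Df_def using w1(1) w2(1) w1(2)[of hi] w2(2)[of hi] u bd by auto
  qed
  ultimately obtain k where k: "lo \<le> k" "k \<le> hi" "Df k = 0"
    using IVT'[of Df lo 0 hi] contD bd by blast
  define s where "s = godunov_flux f up k"
  have s: "godunov_flux f up k = s" "godunov_flux g k um = s" using k(3) by (auto simp: s_def Df_def)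
  have kin: "k \<in> {lo..hi}" using k by auto
  have fmono: "godunov_flux f up a \<le> godunov_flux f up b" if "a \<in> {lo..hi}" "b \<in> {lo..hi}" "a \<le> b" for a b
    using godunov_flux_mono_left[OF f(1)] u that by auto
  have ganti: "godunov_flux g b um \<le> godunov_flux g a um" if "a \<in> {lo..hi}" "b \<in> {lo..hi}" "a \<le> b" for a b
    using godunov_flux_antimono_right[OF g(1)] u that by auto
  have "s = f up"
  proof (rule ccontr)
    assume ne: "s \<noteq> f up"
    show False
    proof (cases "f up < s")
      case True
      \<comment> \<open>Both interface fluxes are now maxima, attained at
        \<open>kp \<in> {up..k}\<close> and \<open>km \<in> {k..um}\<close> with common value
        \<open>s\<close>. Then \<open>(km, k, kp)\<close> is a steady triple whose entropy
        inequality reads \<open>s - f up \<le> f up - s\<close>, contradicting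
        \<open>f up < s\<close>. The other case mirrors this with minima.\<close>
      have "up < k" using fmono[of k up] kin u s True by (metis godunov_flux_same linorder_not_less)
      have "k < um" using ganti[of um k] kin u s True rh by (metis godunov_flux_same linorder_not_less)
      obtain kp where kp: "kp \<in> {up..k}" "s = f kp" "\<And>z. z \<in> {up..k} \<Longrightarrow> f z \<le> f kp"
        using godunov_flux_max[OF f(1), of up k] u kin \<open>up < k\<close> s by auto
      obtain km where km: "km \<in> {k..um}" "s = g km" "\<And>z. z \<in> {k..um} \<Longrightarrow> g z \<le> g km"
        using godunov_flux_max[OF g(1), of k um] u kin \<open>k < um\<close> s by auto
      obtain w1 where w1: "w1 \<in> {kp..k}" "godunov_flux f kp k = f w1" "\<And>z. z \<in> {kp..k} \<Longrightarrow> f z \<le> f w1"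
        using godunov_flux_max[OF f(1), of kp k] u kin kp(1) by auto
      have 1: "godunov_flux f kp k = f kp"
        using w1(2) w1(3)[of kp] kp(3)[of w1] w1(1) kp(1) by auto
      obtain w2 where w2: "w2 \<in> {k..km}" "godunov_flux g k km = g w2" "\<And>z. z \<in> {k..km} \<Longrightarrow> g z \<le> g w2"
        using godunov_flux_max[OF g(1), of k km] u kin km(1) by auto
      have 2: "godunov_flux g k km = g km"
        using w2(2) w2(3)[of km] km(3)[of w2] w2(1) km(1) by auto
      have "sgn (up - kp) * (f up - f kp) \<le> sgn (um - km) * (g um - g km)"
        by (rule ent[of km k kp]) (use 1 2 kp km kin u in auto)
      moreover have "up < kp" using kp True by (cases "up = kp") auto
      moreover have "km < um" using km True rh by (cases "um = km") auto
      ultimately show False using kp(2) km(2) True rh by simp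
    next
      case False
      then have lt: "s < f up" using ne by simp
      have "k < up" using fmono[of up k] kin u s lt by (metis godunov_flux_same linorder_not_less)
      have "um < k" using ganti[of k um] kin u s lt rh by (metis godunov_flux_same linorder_not_less)
      obtain kp where kp: "kp \<in> {k..up}" "s = f kp" "\<And>z. z \<in> {k..up} \<Longrightarrow> f kp \<le> f z"
        using godunov_flux_min[OF f(1), of k up] u kin \<open>k < up\<close> s by auto
      obtain km where km: "km \<in> {um..k}" "s = g km" "\<And>z. z \<in> {um..k} \<Longrightarrow> g km \<le> g z"
        using godunov_flux_min[OF g(1), of um k] u kin \<open>um < k\<close> s by auto
      obtain w1 where w1: "w1 \<in> {k..kp}" "godunov_flux f kp k = f w1" "\<And>z. z \<in> {k..kp} \<Longrightarrow> f w1 \<le> f z"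
        using godunov_flux_min[OF f(1), of k kp] u kin kp(1) by auto
      have 1: "godunov_flux f kp k = f kp"
        using w1(2) w1(3)[of kp] kp(3)[of w1] w1(1) kp(1) by auto
      obtain w2 where w2: "w2 \<in> {km..k}" "godunov_flux g k km = g w2" "\<And>z. z \<in> {km..k} \<Longrightarrow> g w2 \<le> g z"
        using godunov_flux_min[OF g(1), of km k] u kin km(1) by auto
      have 2: "godunov_flux g k km = g km"
        using w2(2) w2(3)[of km] km(3)[of w2] w2(1) km(1) by auto
      have "sgn (up - kp) * (f up - f kp) \<le> sgn (um - km) * (g um - g km)"
        by (rule ent[of km k kp]) (use 1 2 kp km kin u in auto)
      moreover have "kp < up" using kp lt by (cases "up = kp") auto
      moreover have "um < km" using km lt rh by (cases "um = km") auto
      ultimately show False using kp(2) km(2) lt rh by simp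
    qed
  qed
  then have sF: "godunov_flux f up k = f up" and sG: "godunov_flux g k um = g um" using s rh by auto
  text \<open>Clamping \<open>k\<close> to the interval between the traces keeps both flux identities.\<close>
  define uG where "uG = max (min um up) (min (max um up) k)"
  have uG: "uG \<in> closed_segment um up" by (auto simp: uG_def closed_segment_eq_real_ivl)
  have uin: "uG \<in> {lo..hi}" using u kin by (auto simp: uG_def)
  have F': "godunov_flux f up uG = f up"
  proof (cases "k \<le> up")
    case True
    then have "k \<le> uG" "uG \<le> up" by (auto simp: uG_def)
    then show ?thesis using fmono[of k uG] fmono[of uG up] sF kin uin u by simp
  next
    case False
    then have "uG \<le> k" "up \<le> uG" by (auto simp: uG_def)
    then show ?thesis using fmono[of uG k] fmono[of up uG] sF kin uin u by simp
  qed
  have G': "godunov_flux g uG um = g um"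
  proof (cases "k \<le> um")
    case True
    then have "k \<le> uG" "uG \<le> um" by (auto simp: uG_def)
    then show ?thesis using ganti[of k uG] ganti[of uG um] sG kin uin u by simp
  next
    case False
    then have "uG \<le> k" "um \<le> uG" by (auto simp: uG_def)
    then show ?thesis using ganti[of uG k] ganti[of um uG] sG kin uin u by simp
  qed
  have c1: "(up - uG) * (f z - f up) \<ge> 0" if z: "z \<in> closed_segment up uG" for z
  proof (cases "uG \<le> up")
    case True
    obtain w1 where "godunov_flux f up uG = f w1" "\<And>z. z \<in> {uG..up} \<Longrightarrow> f w1 \<le> f z"
      using godunov_flux_min[OF f(1), of uG up] u uin True by auto
    then have "f up \<le> f z" using F' z True by (auto simp: closed_segment_eq_real_ivl split: if_splits)
    then show ?thesis using True by simp
  next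
    case False
    obtain w1 where "godunov_flux f up uG = f w1" "\<And>z. z \<in> {up..uG} \<Longrightarrow> f z \<le> f w1"
      using godunov_flux_max[OF f(1), of up uG] u uin False by auto
    then have "f z \<le> f up" using F' z False by (auto simp: closed_segment_eq_real_ivl split: if_splits)
    then show ?thesis using False by (simp add: mult_nonpos_nonpos)
  qed
  have c2: "(uG - um) * (g z - g um) \<ge> 0" if z: "z \<in> closed_segment um uG" for z
  proof (cases "um \<le> uG")
    case True
    obtain w1 where "godunov_flux g uG um = g w1" "\<And>z. z \<in> {um..uG} \<Longrightarrow> g w1 \<le> g z"
      using godunov_flux_min[OF g(1), of um uG] u uin True by auto
    then have "g um \<le> g z" using G' z True by (auto simp: closed_segment_eq_real_ivl split: if_splits)
    then show ?thesis using True by simp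
  next
    case False
    obtain w1 where "godunov_flux g uG um = g w1" "\<And>z. z \<in> {uG..um} \<Longrightarrow> g z \<le> g w1"
      using godunov_flux_max[OF g(1), of uG um] u uin False by auto
    then have "g z \<le> g um" using G' z False by (auto simp: closed_segment_eq_real_ivl split: if_splits)
    then show ?thesis using False by (simp add: mult_nonpos_nonpos)
  qed
  show ?thesis unfolding Gamma_condition_def using rh uG c1 c2 by blast
qed

lemma D_x_locally_zero:
  assumes "open S" "p \<in> S" "\<And>q. q \<in> S \<Longrightarrow> \<phi> q = 0"
  shows "D_x \<phi> p = 0" "D_t \<phi> p = 0"
proof -
  obtain x t where p: "p = (x, t)" by (cases p)
  have "open ((\<lambda>y. (y, t)) -` S)" by (intro open_vimage assms continuous_intros)
  then have "((\<lambda>y. \<phi> (y, t)) has_field_derivative 0) (at x)"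
    by (rule has_field_derivative_transform_within_open[OF DERIV_const[of 0]]) (use assms p in auto)
  then show "D_x \<phi> p = 0" by (simp add: D_x_def p DERIV_imp_deriv)
  have "open ((\<lambda>s. (x, s)) -` S)" by (intro open_vimage assms continuous_intros)
  then have "((\<lambda>s. \<phi> (x, s)) has_field_derivative 0) (at t)"
    by (rule has_field_derivative_transform_within_open[OF DERIV_const[of 0]]) (use assms p in auto)
  then show "D_t \<phi> p = 0" by (simp add: D_t_def p DERIV_imp_deriv)
qed

section \<open>The entropy inequality across the interface\<close>

definition tent :: "real \<Rightarrow> real \<Rightarrow> real"
  where "tent h x = max 0 (1 - \<bar>x\<bar> / h)"

text \<open>Testing with this slope gives the mean over the left window minus the mean over the
  right window, whose limit is the jump of the entropy flux at the origin.\<close>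

definition tent_slope :: "real \<Rightarrow> real \<Rightarrow> real"
  where "tent_slope h x = indicator {-h<..<0} x / h - indicator {0<..<h} x / h"

lemma tent_measurable [measurable]: "tent h \<in> borel_measurable borel" "tent_slope h \<in> borel_measurable borel"
  unfolding tent_def tent_slope_def by measurable

lemma tent_bounds:
  assumes "0 < h"
  shows "0 \<le> tent h x" "tent h x \<le> 1" "x \<notin> {-h..h} \<Longrightarrow> tent h x = 0" "\<bar>tent h x - tent h y\<bar> \<le> \<bar>x - y\<bar> / h"
proof -
  show "0 \<le> tent h x" "tent h x \<le> 1" using assms by (auto simp: tent_def)
  show "x \<notin> {-h..h} \<Longrightarrow> tent h x = 0" using assms by (auto simp: tent_def field_simps)
  have "\<bar>\<bar>x\<bar> / h - \<bar>y\<bar> / h\<bar> \<le> \<bar>x - y\<bar> / h"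
    using assms by (simp add: diff_divide_distrib[symmetric] divide_right_mono)
  then show "\<bar>tent h x - tent h y\<bar> \<le> \<bar>x - y\<bar> / h" unfolding tent_def by linarith
qed

text \<open>\<open>r\<close> is the distance of \<open>x\<close> to the nearest kink of the tent;
  once \<open>d n < r\<close> the quotient equals the slope exactly.\<close>

lemma tent_quotient_tendsto:
  assumes h: "0 < h" and d: "\<And>n. 0 < d n" "d \<longlonglongrightarrow> 0" and x: "x \<noteq> - h" "x \<noteq> 0" "x \<noteq> h"
  shows "(\<lambda>n. (tent h (x + d n) - tent h x) / d n) \<longlonglongrightarrow> tent_slope h x"
proof -
  define r where "r = min \<bar>x + h\<bar> (min \<bar>x\<bar> \<bar>x - h\<bar>)"
  have "0 < r" using x by (auto simp: r_def)
  then have "\<forall>\<^sub>F n in sequentially. d n < r" by (intro order_tendstoD(2)[OF d(2)])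
  then have "\<forall>\<^sub>F n in sequentially. (tent h (x + d n) - tent h x) / d n = tent_slope h x"
  proof eventually_elim
    case (elim n)
    have dn: "0 < d n" by (rule d)
    have near: "d n < \<bar>x + h\<bar>" "d n < \<bar>x\<bar>" "d n < \<bar>x - h\<bar>" using elim by (auto simp: r_def)
    consider "x < - h" | "- h < x" "x < 0" | "0 < x" "x < h" | "h < x" using x h by linarith
    then show ?case
    proof cases
      case 1
      then have "x + d n < - h" using near by linarith
      then show ?thesis using 1 h tent_bounds(3)[OF h, of x] tent_bounds(3)[OF h, of "x + d n"]
        by (simp add: tent_slope_def)
    next
      case 2
      then have "x + d n < 0" using near by linarith
      then have "tent h (x + d n) = 1 + (x + d n) / h" "tent h x = 1 + x / h"
        using 2 h dn by (auto simp: tent_def field_simps)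
      then show ?thesis using 2 h dn by (simp add: tent_slope_def field_simps)
    next
      case 3
      then have "x + d n < h" using near by linarith
      then have "tent h (x + d n) = 1 - (x + d n) / h" "tent h x = 1 - x / h"
        using 3 h dn by (auto simp: tent_def field_simps)
      then show ?thesis using 3 h dn by (simp add: tent_slope_def field_simps)
    next
      case 4
      then show ?thesis using h dn tent_bounds(3)[OF h, of x] tent_bounds(3)[OF h, of "x + d n"]
        by (simp add: tent_slope_def)
    qed
  qed
  then show ?thesis by (rule tendsto_eventually)
qed

context godunov_convergence
begin

text \<open>Where \<phi> vanishes on a half plane, so does \<open>D_x \<phi>\<close> at positive
  times in its interior. Hence the flux of that side can be replaced by that of the other side and
  the two-flux inequality becomes a one-flux inequality.\<close>

lemma limit_kruzkov:
  assumes \<phi>: "nonneg_test_function T \<phi>" and c: "c \<in> {lo..hi}"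
  shows "(\<forall>x t. 0 \<le> x \<and> 0 \<le> t \<longrightarrow> \<phi> (x, t) = 0) \<Longrightarrow> kruzkov_inequality T g v (\<lambda>x t. w (x, t)) c \<phi>"
    and "(\<forall>x t. x \<le> 0 \<and> 0 \<le> t \<longrightarrow> \<phi> (x, t) = 0) \<Longrightarrow> kruzkov_inequality T f v (\<lambda>x t. w (x, t)) c \<phi>"
proof -
  have lw: "limit_weight T \<phi> (D_x \<phi>) (D_t \<phi>)"
    using \<phi> by (auto simp: nonneg_test_function_def intro: test_function_limit_weight)
  then have [measurable]: "\<phi> \<in> borel_measurable borel" "D_x \<phi> \<in> borel_measurable borel" "D_t \<phi> \<in> borel_measurable borel"
    by (auto simp: limit_weight_def)
  have main: "kruzkov_inequality T q v (\<lambda>x t. w (x, t)) c \<phi>"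
    if \<phi>0: "\<And>t. 0 \<le> t \<Longrightarrow> \<phi> (0, t) = 0" and [measurable]: "(\<lambda>p. q (w p)) \<in> borel_measurable borel"
      and eq: "\<And>p. p \<in> strip T \<Longrightarrow> fst p \<noteq> 0 \<Longrightarrow>
        (if fst p < 0 then sgn (w p - c) * (g (w p) - g c) else sgn (w p - c) * (f (w p) - f c)) * D_x \<phi> p
        = sgn (w p - c) * (q (w p) - q c) * D_x \<phi> p" for q
  proof -
    have "(\<lambda>p. case p of (x, t) \<Rightarrow> \<bar>w (x, t) - c\<bar> * D_t \<phi> (x, t) + sgn (w (x, t) - c) * (q (w (x, t)) - q c) * D_x \<phi> (x, t))
        = (\<lambda>p. \<bar>w p - c\<bar> * D_t \<phi> p + sgn (w p - c) * (q (w p) - q c) * D_x \<phi> p)"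
      by (rule ext) (simp add: split_beta)
    then have "(LINT p:strip T|lebesgue. case p of (x, t) \<Rightarrow> \<bar>w (x, t) - c\<bar> * D_t \<phi> (x, t) + sgn (w (x, t) - c) * (q (w (x, t)) - q c) * D_x \<phi> (x, t))
        = (\<integral>p. indicator (strip T) p * (\<bar>w p - c\<bar> * D_t \<phi> p + sgn (w p - c) * (q (w p) - q c) * D_x \<phi> p) \<partial>lborel)"
      by (simp only:) (rule LINT_strip, measurable)
    also have "\<dots> = (\<integral>p. indicator (strip T) p * (\<bar>w p - c\<bar> * D_t \<phi> p
      + (if fst p < 0 then sgn (w p - c) * (g (w p) - g c) else sgn (w p - c) * (f (w p) - f c)) * D_x \<phi> p) \<partial>lborel)"
    proof (rule integral_cong_AE)
      show "AE p in lborel. indicator (strip T) p * (\<bar>w p - c\<bar> * D_t \<phi> p + sgn (w p - c) * (q (w p) - q c) * D_x \<phi> p)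
        = indicator (strip T) p * (\<bar>w p - c\<bar> * D_t \<phi> p
          + (if fst p < 0 then sgn (w p - c) * (g (w p) - g c) else sgn (w p - c) * (f (w p) - f c)) * D_x \<phi> p)"
        using AE_fst_nonzero
      proof eventually_elim
        case (elim p)
        show ?case
        proof (cases "p \<in> strip T")
          case True
          show ?thesis by (simp only: eq[OF True elim])
        qed simp
      qed
    qed measurable
    finally have 1: "(LINT p:strip T|lebesgue. case p of (x, t) \<Rightarrow> \<bar>w (x, t) - c\<bar> * D_t \<phi> (x, t) + sgn (w (x, t) - c) * (q (w (x, t)) - q c) * D_x \<phi> (x, t))
        = (\<integral>p. indicator (strip T) p * (\<bar>w p - c\<bar> * D_t \<phi> p
      + (if fst p < 0 then sgn (w p - c) * (g (w p) - g c) else sgn (w p - c) * (f (w p) - f c)) * D_x \<phi> p) \<partial>lborel)" .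
    have 2: "(LINT x|lebesgue. \<bar>v x - c\<bar> * \<phi> (x, 0)) = (\<integral>x. \<bar>v x - c\<bar> * \<phi> (x, 0) \<partial>lborel)"
      by (rule integral_completion) measurable
    show ?thesis
      unfolding kruzkov_inequality_def 1 2 by (rule limit_kruzkov_aux[OF \<phi> c \<phi>0])
  qed
  show "kruzkov_inequality T g v (\<lambda>x t. w (x, t)) c \<phi>" if z: "\<forall>x t. 0 \<le> x \<and> 0 \<le> t \<longrightarrow> \<phi> (x, t) = 0"
  proof (rule main)
    fix p assume p: "p \<in> strip T" "fst p \<noteq> 0"
    have "D_x \<phi> p = 0" if "0 < fst p"
    proof (rule D_x_locally_zero(1)[of "{0<..} \<times> {0<..}"])
      show "p \<in> {0<..} \<times> {0<..}" using p that by (auto simp: strip_def)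
    qed (use z in \<open>auto intro!: open_Times\<close>)
    then show "(if fst p < 0 then sgn (w p - c) * (g (w p) - g c) else sgn (w p - c) * (f (w p) - f c)) * D_x \<phi> p
        = sgn (w p - c) * (g (w p) - g c) * D_x \<phi> p"
      using p(2) by (cases "fst p < 0") auto
  qed (use z in auto)
  show "kruzkov_inequality T f v (\<lambda>x t. w (x, t)) c \<phi>" if z: "\<forall>x t. x \<le> 0 \<and> 0 \<le> t \<longrightarrow> \<phi> (x, t) = 0"
  proof (rule main)
    fix p assume p: "p \<in> strip T" "fst p \<noteq> 0"
    have "D_x \<phi> p = 0" if "fst p < 0"
    proof (rule D_x_locally_zero(1)[of "{..<0} \<times> {0<..}"])
      show "p \<in> {..<0} \<times> {0<..}" using p that by (auto simp: strip_def)
    qed (use z in \<open>auto intro!: open_Times\<close>)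
    then show "(if fst p < 0 then sgn (w p - c) * (g (w p) - g c) else sgn (w p - c) * (f (w p) - f c)) * D_x \<phi> p
        = sgn (w p - c) * (f (w p) - f c) * D_x \<phi> p"
      by (cases "fst p < 0") auto
  qed (use z in auto)
qed

text \<open>The profile \<open>km\<close> left of the origin, \<open>k0\<close> in cell
  \<open>0\<close> and \<open>kp\<close> right of it is left unchanged by the scheme;
  \<open>k0\<close> occupies a single cell and disappears in the limit.\<close>

definition steady :: "real \<Rightarrow> real \<Rightarrow> real \<Rightarrow> bool"
  where "steady km k0 kp \<longleftrightarrow> {km, k0, kp} \<subseteq> {lo..hi} \<and>
    godunov_flux g k0 km = g km \<and> godunov_flux f kp k0 = f kp \<and> g km = f kp"

definition interface_entropy :: "real \<Rightarrow> real \<Rightarrow> real \<times> real \<Rightarrow> real"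
  where "interface_entropy km kp p =
    (if fst p < 0 then sgn (w p - km) * (g (w p) - g km) else sgn (w p - kp) * (f (w p) - f kp))"

lemma interface_entropy_borel [measurable]: "interface_entropy km kp \<in> borel_measurable borel"
  unfolding interface_entropy_def by measurable

lemma interface_entropy_bound: "km \<in> {lo..hi} \<Longrightarrow> kp \<in> {lo..hi} \<Longrightarrow> \<bar>interface_entropy km kp p\<bar> \<le> Mb"
  using Mb(6)[OF w_range] Mb(7)[OF w_range] by (simp add: interface_entropy_def)

text \<open>The Kato inequality against a steady profile has no defect in cell \<open>0\<close>, so
  the weight need not vanish at the origin: it is the tent in space times the indicator of a time
  interval. The two jumps in time cost at most \<open>Mb\<close> times the width
  \<open>2 * h\<close> each, hence the error \<open>4 * h * Mb\<close>, which vanishes with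
  \<open>h\<close>.\<close>

lemma interface_inequality:
  assumes st: "steady km k0 kp" and ab: "0 \<le> a" "a < b" "b \<le> T" and h: "0 < h"
  shows "- (4 * h * Mb) \<le> (\<integral>p. indicator {a..<b} (snd p) * (interface_entropy km kp p * tent_slope h (fst p)) \<partial>lborel)"
proof -
  define k where "k j = (if j < 0 then km else if j = 0 then k0 else kp)" for j :: int
  have k: "k j \<in> {lo..hi}" for j using st by (auto simp: k_def steady_def)
  have steady_step: "step j (k (j - 1)) (k j) (k (j + 1)) = k j" for j
  proof -
    consider "j < - 1" | "j = - 1" | "j = 0" | "j = 1" | "1 < j" by linarith
    then show ?thesis
      using st by cases (auto simp: k_def cell_update_def face_flux_def steady_def)
  qed
  define \<phi> where "\<phi> p = indicator {a..<b} (snd p) * tent h (fst p)" for p :: "real \<times> real"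
  have [measurable]: "\<phi> \<in> borel_measurable borel" unfolding \<phi>_def by measurable
  have \<phi>_pos: "0 \<le> \<phi> p" "\<bar>\<phi> p\<bar> \<le> 1" for p using tent_bounds[OF h] by (auto simp: \<phi>_def split: split_indicator)
  define B where "B = h + T + 1"
  have supp: "\<phi> p = 0" if "p \<notin> cbox (-B, -B) (B, B)" for p
  proof (cases "snd p \<in> {a..<b}")
    case True
    then have "fst p \<notin> {-h..h}" using that ab h T_pos by (auto simp: cbox_Pair_iff B_def)
    then show ?thesis using tent_bounds(3)[OF h] by (simp add: \<phi>_def)
  qed (simp add: \<phi>_def)
  define E where "E n p = \<bar>ua (d n) v p - k (cell_index (d n) (fst p))\<bar>" for n p
  have [measurable]: "E n \<in> borel_measurable borel" for n unfolding E_def by measurable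
  have E_bound: "\<bar>E n p\<bar> \<le> Mb" for n p using Mb(5)[OF k] by (simp add: E_def)
  have Q_bound: "\<bar>qa k n p\<bar> \<le> Mb" for n p by (rule Mb(4)[OF k])
  define I1 where "I1 n = (\<integral>p. indicator {0..} (snd p) * (E n p * (\<phi> p - \<phi> (fst p, snd p - lam * d n))) \<partial>lborel)" for n
  define F where "F n p = indicator {0..} (snd p) * (qa k n p * ((\<phi> (fst p + d n, snd p) - \<phi> p) / d n))" for n p
  have F_lim: "(\<lambda>n. \<integral>p. F n p \<partial>lborel) \<longlonglongrightarrow>
      (\<integral>p. indicator {a..<b} (snd p) * (interface_entropy km kp p * tent_slope h (fst p)) \<partial>lborel)"
  proof (rule dominated_box_convergence[where M="Mb / h" and a="(-(B+1), -B)" and b="(B+1, B)"])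
    show "F n \<in> borel_measurable borel" for n unfolding F_def by measurable
    show "\<bar>F n p\<bar> \<le> Mb / h" for n p
    proof -
      have "\<bar>\<phi> (fst p + d n, snd p) - \<phi> p\<bar> \<le> d n / h"
        using tent_bounds(4)[OF h, of "fst p + d n" "fst p"] d_pos[of n] h by (auto simp: \<phi>_def split: split_indicator)
      then have "\<bar>(\<phi> (fst p + d n, snd p) - \<phi> p) / d n\<bar> \<le> 1 / h"
        using d_pos[of n] by (simp add: divide_le_eq mult.commute)
      then have "\<bar>qa k n p * ((\<phi> (fst p + d n, snd p) - \<phi> p) / d n)\<bar> \<le> Mb * (1 / h)"
        unfolding abs_mult[of "qa k n p"] using Q_bound Mb(1) by (intro mult_mono) auto
      moreover have "0 \<le> Mb / h" using Mb(1) h by simp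
      ultimately show ?thesis unfolding F_def by (auto split: split_indicator)
    qed
    show "F n p = 0" if p: "p \<notin> cbox (-(B+1), -B) (B+1, B)" for n p
    proof -
      have "p \<notin> cbox (-B, -B) (B, B)" "(fst p + d n, snd p) \<notin> cbox (-B, -B) (B, B)"
        using p d_pos[of n] d_le[of n] unfolding cbox_Pair_iff by auto
      then show ?thesis by (simp add: F_def supp)
    qed
    have ne: "AE p in lborel. fst (p :: real \<times> real) \<noteq> y" for y
      by (rule AE_lborel_pair_fst) (rule AE_lborel_singleton)
    have "AE p in lborel. snd p \<in> {0..T} \<longrightarrow> (\<lambda>n. qa k n p) \<longlonglongrightarrow> interface_entropy km kp p"
      unfolding interface_entropy_def by (rule qa_tendsto[OF k]) (auto simp: k_def)
    then show "AE p in lborel. (\<lambda>n. F n p) \<longlonglongrightarrow> indicator {a..<b} (snd p) * (interface_entropy km kp p * tent_slope h (fst p))"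
      using ne[of "-h"] ne[of 0] ne[of h]
    proof eventually_elim
      case (elim p)
      show ?case
      proof (cases "snd p \<in> {a..<b}")
        case True
        then have t: "snd p \<in> {0..T}" "0 \<le> snd p" using ab by auto
        have "(\<lambda>n. qa k n p * ((tent h (fst p + d n) - tent h (fst p)) / d n)) \<longlonglongrightarrow> interface_entropy km kp p * tent_slope h (fst p)"
          by (intro tendsto_mult elim(1)[rule_format, OF t(1)] tent_quotient_tendsto[OF h d_pos d_lim elim(2-4)])
        then show ?thesis using True t by (simp add: F_def \<phi>_def)
      qed (simp add: F_def \<phi>_def)
    qed
  qed measurable
  have I1_bound: "I1 n \<le> (4 * h * Mb) * (lam * d n)" for n
  proof -
    define tau where "tau = lam * d n"
    have tau: "0 < tau" using tau_pos by (simp add: tau_def)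
    \<comment> \<open>The backward time difference of the weight is nonzero only within one time
      step after \<open>a\<close> and after \<open>b\<close>; \<open>Z1\<close> and
      \<open>Z2\<close> dominate these two layers.\<close>
    define Z1 where "Z1 p = (Mb * indicator {-h..h} (fst p)) * indicator {a..<a+tau} (snd p)" for p :: "real \<times> real"
    define Z2 where "Z2 p = (Mb * indicator {-h..h} (fst p)) * indicator {b..<b+tau} (snd p)" for p :: "real \<times> real"
    have [measurable]: "Z1 \<in> borel_measurable borel" "Z2 \<in> borel_measurable borel"
      unfolding Z1_def Z2_def by measurable
    have Z_int: "integrable lborel Z1" "integrable lborel Z2"
      by (rule integrable_bounded_box[of _ Mb "(-h, a)" "(h, a + tau)"],
          use Mb(1) in \<open>auto simp: Z1_def cbox_Pair_iff abs_mult split: split_indicator\<close>)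
        (rule integrable_bounded_box[of _ Mb "(-h, b)" "(h, b + tau)"],
          use Mb(1) in \<open>auto simp: Z2_def cbox_Pair_iff abs_mult split: split_indicator\<close>)
    have Z0: "0 \<le> Z1 p" "0 \<le> Z2 p" for p using Mb(1) by (auto simp: Z1_def Z2_def)
    have pt: "indicator {0..} (snd p) * (E n p * (\<phi> p - \<phi> (fst p, snd p - tau))) \<le> Z1 p + Z2 p" for p
    proof (cases "fst p \<in> {-h..h} \<and> snd p \<in> {a..<a+tau} \<union> {b..<b+tau}")
      case True
      have "\<bar>\<phi> p - \<phi> (fst p, snd p - tau)\<bar> \<le> 1"
        using \<phi>_pos[of p] \<phi>_pos[of "(fst p, snd p - tau)"] by linarith
      then have "\<bar>E n p * (\<phi> p - \<phi> (fst p, snd p - tau))\<bar> \<le> Mb * 1"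
        unfolding abs_mult using E_bound Mb(1) by (intro mult_mono) auto
      then have "E n p * (\<phi> p - \<phi> (fst p, snd p - tau)) \<le> Mb" by linarith
      then have "indicator {0..} (snd p) * (E n p * (\<phi> p - \<phi> (fst p, snd p - tau))) \<le> Mb"
        using Mb(1) by (auto split: split_indicator)
      also have "Mb \<le> Z1 p + Z2 p" using True Mb(1) Z0[of p] by (auto simp: Z1_def Z2_def)
      finally show ?thesis .
    next
      case False
      have "\<phi> p - \<phi> (fst p, snd p - tau) = 0"
        using False tent_bounds(3)[OF h, of "fst p"] tau ab by (auto simp: \<phi>_def split: split_indicator)
      then show ?thesis using Z0[of p] by simp
    qed
    have "I1 n \<le> (\<integral>p. Z1 p + Z2 p \<partial>lborel)"
      unfolding I1_def tau_def[symmetric]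
    proof (rule integral_mono)
      show "integrable lborel (\<lambda>p. Z1 p + Z2 p)" using Z_int by (rule Bochner_Integration.integrable_add)
      show "integrable lborel (\<lambda>p. indicator {0..} (snd p) * (E n p * (\<phi> p - \<phi> (fst p, snd p - tau))))"
      proof (rule integrable_bounded_box[of _ "Mb * 2" "(-(B+tau), -(B+tau))" "(B+tau, B+tau)"])
        fix p
        have "\<bar>\<phi> p - \<phi> (fst p, snd p - tau)\<bar> \<le> 2"
          using \<phi>_pos[of p] \<phi>_pos[of "(fst p, snd p - tau)"] by linarith
        then have "\<bar>E n p * (\<phi> p - \<phi> (fst p, snd p - tau))\<bar> \<le> Mb * 2"
          unfolding abs_mult using E_bound Mb(1) by (intro mult_mono) auto
        then show "\<bar>indicator {0..} (snd p) * (E n p * (\<phi> p - \<phi> (fst p, snd p - tau)))\<bar> \<le> Mb * 2"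
          using Mb(1) by (auto split: split_indicator)
        assume p: "p \<notin> cbox (-(B+tau), -(B+tau)) (B+tau, B+tau)"
        have "p \<notin> cbox (-B, -B) (B, B)" "(fst p, snd p - tau) \<notin> cbox (-B, -B) (B, B)"
          using p tau unfolding cbox_Pair_iff by auto
        then show "indicator {0..} (snd p) * (E n p * (\<phi> p - \<phi> (fst p, snd p - tau))) = 0"
          by (simp add: supp)
      qed measurable
    qed (rule pt)
    also have "\<dots> = (\<integral>p. Z1 p \<partial>lborel) + (\<integral>p. Z2 p \<partial>lborel)" using Z_int by simp
    also have "(\<integral>p. Z1 p \<partial>lborel) = Mb * (2 * h) * tau"
      using integral_lborel_product[OF Z_int(1)[unfolded Z1_def]] h tau unfolding Z1_def by simp
    also have "(\<integral>p. Z2 p \<partial>lborel) = Mb * (2 * h) * tau"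
      using integral_lborel_product[OF Z_int(2)[unfolded Z2_def]] h tau unfolding Z2_def by simp
    finally show ?thesis unfolding tau_def by (simp add: algebra_simps)
  qed
  have ineq: "- (4 * h * Mb) \<le> (\<integral>p. F n p \<partial>lborel)" for n
  proof -
    let ?tau = "lam * d n"
    have "(\<integral>p. indicator {0..} (snd p) * \<phi> p *
        (E n (fst p, snd p + ?tau) - E n p + lam * (qa k n p - qa k n (fst p - d n, snd p))) \<partial>lborel) \<le> (\<integral>p. 0 \<partial>(lborel :: (real \<times> real) measure))"
    proof (rule integral_mono')
      show "indicator {0..} (snd p) * \<phi> p *
        (E n (fst p, snd p + ?tau) - E n p + lam * (qa k n p - qa k n (fst p - d n, snd p))) \<le> 0" for p
      proof (cases "0 \<le> snd p")
        case True
        have "E n (fst p, snd p + ?tau) - E n p + lam * (qa k n p - qa k n (fst p - d n, snd p)) \<le> 0"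
          unfolding E_def fst_conv by (rule kato_residual[OF k True steady_step])
        then show ?thesis using \<phi>_pos(1)[of p] True by (simp add: mult_nonneg_nonpos)
      qed simp
    qed auto
    \<comment> \<open>There is no initial term: in the first time step the shifted time is negative,
      hence below \<open>a\<close>, where the weight vanishes.\<close>
    moreover have "(\<integral>p. indicator {0..<?tau} (snd p) * (E n p * \<phi> (fst p, snd p - ?tau)) \<partial>lborel) = (\<integral>p. 0 \<partial>(lborel :: (real \<times> real) measure))"
      using ab by (intro Bochner_Integration.integral_cong) (auto simp: \<phi>_def split: split_indicator)
    moreover have "(\<integral>p. indicator {0..} (snd p) * (E n p * (\<phi> p - \<phi> (fst p, snd p - ?tau)) + lam * (qa k n p * (\<phi> (fst p + d n, snd p) - \<phi> p))) \<partial>lborel)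
        = I1 n + ?tau * (\<integral>p. F n p \<partial>lborel)"
    proof -
      have i1: "integrable lborel (\<lambda>p. indicator {0..} (snd p) * (E n p * (\<phi> p - \<phi> (fst p, snd p - ?tau))))"
      proof (rule integrable_bounded_box[of _ "Mb * 2" "(-(B+?tau), -(B+?tau))" "(B+?tau, B+?tau)"])
        fix p
        have "\<bar>\<phi> p - \<phi> (fst p, snd p - ?tau)\<bar> \<le> 2"
          using \<phi>_pos[of p] \<phi>_pos[of "(fst p, snd p - ?tau)"] by linarith
        then have "\<bar>E n p * (\<phi> p - \<phi> (fst p, snd p - ?tau))\<bar> \<le> Mb * 2"
          unfolding abs_mult using E_bound Mb(1) by (intro mult_mono) auto
        then show "\<bar>indicator {0..} (snd p) * (E n p * (\<phi> p - \<phi> (fst p, snd p - ?tau)))\<bar> \<le> Mb * 2"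
          using Mb(1) by (auto split: split_indicator)
        assume p: "p \<notin> cbox (-(B+?tau), -(B+?tau)) (B+?tau, B+?tau)"
        have "p \<notin> cbox (-B, -B) (B, B)" "(fst p, snd p - ?tau) \<notin> cbox (-B, -B) (B, B)"
          using p tau_pos[of n] unfolding cbox_Pair_iff by auto
        then show "indicator {0..} (snd p) * (E n p * (\<phi> p - \<phi> (fst p, snd p - ?tau))) = 0"
          by (simp add: supp)
      qed measurable
      have [measurable]: "F n \<in> borel_measurable borel" unfolding F_def by measurable
      have i2: "integrable lborel (F n)"
      proof (rule integrable_bounded_box[of _ "Mb * (2 / d n)" "(-(B+1), -B)" "(B+1, B)"])
        fix p
        have "\<bar>\<phi> (fst p + d n, snd p) - \<phi> p\<bar> \<le> 2"
          using \<phi>_pos[of p] \<phi>_pos[of "(fst p + d n, snd p)"] by linarith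
        then have "\<bar>(\<phi> (fst p + d n, snd p) - \<phi> p) / d n\<bar> \<le> 2 / d n"
          using d_pos[of n] by (simp add: divide_right_mono)
        then have "\<bar>qa k n p * ((\<phi> (fst p + d n, snd p) - \<phi> p) / d n)\<bar> \<le> Mb * (2 / d n)"
          unfolding abs_mult[of "qa k n p"] using Q_bound Mb(1) by (intro mult_mono) auto
        moreover have "0 \<le> Mb * (2 / d n)" using Mb(1) d_pos[of n] by (simp add: less_imp_le)
        ultimately show "\<bar>F n p\<bar> \<le> Mb * (2 / d n)" unfolding F_def by (auto split: split_indicator)
        assume p: "p \<notin> cbox (-(B+1), -B) (B+1, B)"
        have "p \<notin> cbox (-B, -B) (B, B)" "(fst p + d n, snd p) \<notin> cbox (-B, -B) (B, B)"
          using p d_pos[of n] d_le[of n] unfolding cbox_Pair_iff by auto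
        then show "F n p = 0" by (simp add: F_def supp)
      qed measurable
      have "(\<integral>p. indicator {0..} (snd p) * (E n p * (\<phi> p - \<phi> (fst p, snd p - ?tau)) + lam * (qa k n p * (\<phi> (fst p + d n, snd p) - \<phi> p))) \<partial>lborel)
        = (\<integral>p. indicator {0..} (snd p) * (E n p * (\<phi> p - \<phi> (fst p, snd p - ?tau))) + ?tau * F n p \<partial>lborel)"
        using d_pos[of n] by (intro Bochner_Integration.integral_cong) (auto simp: F_def distrib_left)
      also have "\<dots> = I1 n + ?tau * (\<integral>p. F n p \<partial>lborel)"
        unfolding I1_def using i1 i2 by simp
      finally show ?thesis .
    qed
    ultimately have "0 \<le> I1 n + ?tau * (\<integral>p. F n p \<partial>lborel)"
      using summation_by_parts[of "E n" "qa k n" \<phi> Mb 1 B "d n" ?tau lam] E_bound Q_bound \<phi>_pos(2) supp d_pos[of n] tau_pos[of n]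
      by simp
    then have "0 \<le> ?tau * ((4 * h * Mb) + (\<integral>p. F n p \<partial>lborel))"
      using I1_bound[of n] by (simp add: algebra_simps)
    then show ?thesis using tau_pos[of n] by (simp add: zero_le_mult_iff)
  qed
  show ?thesis using F_lim ineq by (intro LIMSEQ_le_const[OF F_lim]) auto
qed

end

lemma entropy_lipschitz:
  assumes q: "L-lipschitz_on {lo..hi} q" and "y \<in> {lo..hi}" "y' \<in> {lo..hi}" "k \<in> {lo..hi}"
  shows "\<bar>sgn (y - k) * (q y - q k) - sgn (y' - k) * (q y' - q k)\<bar> \<le> 2 * L * \<bar>y - y'\<bar>"
proof -
  have L: "0 \<le> L" by (rule lipschitz_on_nonneg[OF q])
  have eq: "sgn (z - k) * (q z - q k) = q (max z k) - q (min z k)" for z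
    by (auto simp: sgn_if max_def min_def)
  have "dist (q (max y k)) (q (max y' k)) \<le> L * dist (max y k) (max y' k)"
    "dist (q (min y k)) (q (min y' k)) \<le> L * dist (min y k) (min y' k)"
    using assms by (auto intro!: lipschitz_onD[OF q] simp: max_def min_def)
  moreover have "L * dist (max y k) (max y' k) \<le> L * \<bar>y - y'\<bar>" "L * dist (min y k) (min y' k) \<le> L * \<bar>y - y'\<bar>"
    using L by (auto intro!: mult_left_mono simp: dist_real_def max_def min_def)
  ultimately have "\<bar>q (max y k) - q (max y' k)\<bar> \<le> L * \<bar>y - y'\<bar>" "\<bar>q (min y k) - q (min y' k)\<bar> \<le> L * \<bar>y - y'\<bar>"
    unfolding dist_real_def by linarith+
  moreover have "\<bar>(a - b) - (a' - b')\<bar> \<le> 2 * c" if "\<bar>a - a'\<bar> \<le> c" "\<bar>b - b'\<bar> \<le> c" for a b a' b' c :: real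
    using that by linarith
  ultimately show ?thesis unfolding eq by (simp add: mult.assoc)
qed

lemma entropy_sym: "sgn (y - k) * (q y - q k) = sgn (k - y) * (q k - q y :: real)" for y k :: real
  by (auto simp: sgn_if)

lemma vv_solution_cong_AE:
  assumes vv: "vv_solution lo hi T f g v' u" and ae: "AE x in lborel. v x = v' x"
    and [measurable]: "v \<in> borel_measurable lebesgue" "v' \<in> borel_measurable lebesgue"
  shows "vv_solution lo hi T f g v u"
proof -
  have ae': "AE x in lebesgue. v x = v' x" using ae by (rule AE_completion)
  have meas: "(\<lambda>x. \<phi> (x, 0)) \<in> borel_measurable lebesgue" if "test_function T \<phi>" for \<phi>
  proof -
    have "\<phi> \<in> borel_measurable borel"
      using test_function_limit_weight[OF that] by (simp add: limit_weight_def)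
    then have "(\<lambda>x. \<phi> (x, 0)) \<in> borel_measurable borel" by measurable
    then show ?thesis by (intro measurable_completion) simp
  qed
  have 1: "(LINT x|lebesgue. v x * \<phi> (x, 0)) = (LINT x|lebesgue. v' x * \<phi> (x, 0))" if "test_function T \<phi>" for \<phi>
    using ae' meas[OF that] by (intro integral_cong_AE) (auto elim!: eventually_mono)
  have 2: "(LINT x|lebesgue. \<bar>v x - c\<bar> * \<phi> (x, 0)) = (LINT x|lebesgue. \<bar>v' x - c\<bar> * \<phi> (x, 0))" if "test_function T \<phi>" for \<phi> c
    using ae' meas[OF that] by (intro integral_cong_AE) (auto elim!: eventually_mono)
  have "weak_solution T f g v u" if "weak_solution T f g v' u"
    using that 1 unfolding weak_solution_def by simp
  moreover have "kruzkov_inequality T q v u c \<phi>" if "kruzkov_inequality T q v' u c \<phi>" "nonneg_test_function T \<phi>" for q c \<phi>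
    using that 2 unfolding kruzkov_inequality_def nonneg_test_function_def by simp
  ultimately show ?thesis using vv unfolding vv_solution_def by simp
qed

section \<open>Traces and the \<Gamma> condition of the limit\<close>

context godunov_convergence
begin

lemma section_conv: "AE t in lborel. t \<in> {0..T} \<longrightarrow> (AE x in lborel. (\<lambda>n. ua (d n) v (x, t)) \<longlonglongrightarrow> w (x, t))"
proof -
  have "AE p in lborel. snd p \<in> {0..T} \<longrightarrow> (\<lambda>n. ua (d n) v (fst p, snd p)) \<longlonglongrightarrow> w (fst p, snd p)"
    using conv by simp
  from AE_lborel_prod_swap[OF this, of ]
  have "AE t in lborel. AE x in lborel. t \<in> {0..T} \<longrightarrow> (\<lambda>n. ua (d n) v (x, t)) \<longlonglongrightarrow> w (x, t)" by simp
  then show ?thesis by (rule eventually_mono) auto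
qed

text \<open>At almost every time the approximations converge almost everywhere in space, so their
  variation bound is inherited on a set of full measure, which yields one-sided essential
  limits.\<close>

lemma traces_exist:
  "AE t in lborel. t \<in> {0..T} \<longrightarrow> (\<exists>um up. ess_lim_left_0 (\<lambda>x. w (x, t)) um \<and> ess_lim_right_0 (\<lambda>x. w (x, t)) up)"
  using section_conv
proof (rule eventually_mono, intro impI)
  fix t assume *: "t \<in> {0..T} \<longrightarrow> (AE x in lborel. (\<lambda>n. ua (d n) v (x, t)) \<longlonglongrightarrow> w (x, t))" and t: "t \<in> {0..T}"
  obtain E where "AE x in lborel. x \<in> E" "variation_le E (\<lambda>x. w (x, t)) (K + 1)"
    using variation_le_AE_limit[of "\<lambda>n x. ua (d n) v (x, t)" "\<lambda>x. w (x, t)" K] * t TV_le[OF t] K_nonneg by blast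
  from variation_le_ess_lims[OF this]
  show "\<exists>um up. ess_lim_left_0 (\<lambda>x. w (x, t)) um \<and> ess_lim_right_0 (\<lambda>x. w (x, t)) up" by metis
qed

lemma entropy_average:
  assumes q: "L-lipschitz_on {lo..hi} q" and k: "k \<in> {lo..hi}" and l: "l \<in> {lo..hi}"
    and qw: "(\<lambda>p. q (w p)) \<in> borel_measurable borel" and h: "\<And>n. 0 < h n" "h \<longlonglongrightarrow> 0"
    and J: "\<And>e. (0::real) < e \<Longrightarrow> \<exists>d>0. AE x in lebesgue. x \<in> J d \<longrightarrow> \<bar>w (x, t) - l\<bar> < e"
    and S: "\<And>r. 0 < r \<Longrightarrow> \<exists>a. S r = {a<..<a+r} \<and> a \<in> {-r..0}" "\<And>r d. r < d \<Longrightarrow> S r \<subseteq> J d"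
  shows "(\<lambda>n. \<integral>x. (sgn (w (x, t) - k) * (q (w (x, t)) - q k)) * (indicator (S (h n)) x / h n) \<partial>lborel)
    \<longlonglongrightarrow> sgn (l - k) * (q l - q k)"
proof (rule average_tendsto[where J=J and S=S, OF _ _ h _ S])
  have [measurable]: "(\<lambda>x. q (w (x, t))) \<in> borel_measurable borel"
    using measurable_compose[OF _ qw, of "\<lambda>x. (x, t)" borel] by simp
  show "(\<lambda>x. sgn (w (x, t) - k) * (q (w (x, t)) - q k)) \<in> borel_measurable borel" by measurable
  have L: "0 \<le> L" by (rule L_nonneg)
  show "\<bar>sgn (w (x, t) - k) * (q (w (x, t)) - q k)\<bar> \<le> 2 * L * (hi - lo)" for x
  proof -
    have "\<bar>sgn (w (x, t) - k) * (q (w (x, t)) - q k) - sgn (k - k) * (q k - q k)\<bar> \<le> 2 * L * \<bar>w (x, t) - k\<bar>"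
      by (rule entropy_lipschitz[OF q w_range k k])
    also have "\<dots> \<le> 2 * L * (hi - lo)"
      using w_range[of "(x, t)"] k L by (intro mult_left_mono) auto
    finally show ?thesis by simp
  qed
  fix e :: real assume e: "0 < e"
  then have "0 < e / (2 * L + 1)" using L by simp
  then obtain dd where dd: "dd > 0" "AE x in lebesgue. x \<in> J dd \<longrightarrow> \<bar>w (x, t) - l\<bar> < e / (2 * L + 1)" using J by blast
  have "AE x in lborel. x \<in> J dd \<longrightarrow> \<bar>w (x, t) - l\<bar> < e / (2 * L + 1)"
    using dd(2) by (simp only: AE_completion_iff)
  then have "AE x in lborel. x \<in> J dd \<longrightarrow> \<bar>sgn (w (x, t) - k) * (q (w (x, t)) - q k) - sgn (l - k) * (q l - q k)\<bar> < e"
  proof (rule eventually_mono, intro impI)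
    fix x assume *: "x \<in> J dd \<longrightarrow> \<bar>w (x, t) - l\<bar> < e / (2 * L + 1)" and x: "x \<in> J dd"
    have "\<bar>sgn (w (x, t) - k) * (q (w (x, t)) - q k) - sgn (l - k) * (q l - q k)\<bar> \<le> 2 * L * \<bar>w (x, t) - l\<bar>"
      by (rule entropy_lipschitz[OF q w_range l k])
    also have "\<dots> \<le> (2 * L + 1) * \<bar>w (x, t) - l\<bar>" by (intro mult_right_mono) auto
    also have "\<dots> < (2 * L + 1) * (e / (2 * L + 1))" using * x L by (intro mult_strict_left_mono) auto
    also have "\<dots> = e" using L by simp
    finally show "\<bar>sgn (w (x, t) - k) * (q (w (x, t)) - q k) - sgn (l - k) * (q l - q k)\<bar> < e" .
  qed
  then show "\<exists>d>0. AE x in lborel. x \<in> J d \<longrightarrow> \<bar>sgn (w (x, t) - k) * (q (w (x, t)) - q k) - sgn (l - k) * (q l - q k)\<bar> < e"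
    using dd(1) by blast
qed

text \<open>The tent slope splits the integral into means over \<open>{- h n<..<0}\<close> and
  \<open>{0<..<h n}\<close>; the entropies are Lipschitz in the state, so these means converge to
  the entropies of the traces.\<close>

lemma interface_entropy_average:
  assumes k: "km \<in> {lo..hi}" "kp \<in> {lo..hi}" and h: "\<And>n. 0 < h n" "h \<longlonglongrightarrow> 0"
    and tr: "ess_lim_left_0 (\<lambda>x. w (x, t)) um" "ess_lim_right_0 (\<lambda>x. w (x, t)) up"
  shows "(\<lambda>n. \<integral>x. interface_entropy km kp (x, t) * tent_slope (h n) x \<partial>lborel)
    \<longlonglongrightarrow> sgn (um - km) * (g um - g km) - sgn (up - kp) * (f up - f kp)"
proof -
  have um: "um \<in> {lo..hi}" and up: "up \<in> {lo..hi}"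
    using ess_lim_left_range[OF tr(1) w_range] ess_lim_right_range[OF tr(2) w_range] by auto
  have [measurable]: "(\<lambda>x. g (w (x, t))) \<in> borel_measurable borel" "(\<lambda>x. f (w (x, t))) \<in> borel_measurable borel"
    using measurable_compose[OF _ g_borel, of "\<lambda>x. (x, t)" borel] measurable_compose[OF _ f_borel, of "\<lambda>x. (x, t)" borel] by simp_all
  have Jl: "\<exists>d>0. AE x in lebesgue. x \<in> {-d<..<0} \<longrightarrow> \<bar>w (x, t) - um\<bar> < e" if "0 < e" for e
    using tr(1) that unfolding ess_lim_left_0_def by blast
  have Jr: "\<exists>d>0. AE x in lebesgue. x \<in> {0<..<d} \<longrightarrow> \<bar>w (x, t) - up\<bar> < e" if "0 < e" for e
    using tr(2) that unfolding ess_lim_right_0_def by blast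
  define l where "l n = (\<integral>x. (sgn (w (x, t) - km) * (g (w (x, t)) - g km)) * (indicator {- h n<..<0} x / h n) \<partial>lborel)" for n
  define r where "r n = (\<integral>x. (sgn (w (x, t) - kp) * (f (w (x, t)) - f kp)) * (indicator {0<..<h n} x / h n) \<partial>lborel)" for n
  have l_lim: "l \<longlonglongrightarrow> sgn (um - km) * (g um - g km)"
    unfolding l_def
  proof (rule entropy_average[where J="\<lambda>d. {-d<..<0}" and S="\<lambda>r. {-r<..<0}", OF g_lipschitz k(1) um g_borel h Jl])
    show "\<exists>a. {- r<..<0} = {a<..<a + r} \<and> a \<in> {- r..0}" if "0 < r" for r :: real
      by (rule exI[of _ "- r"]) (use that in simp)
  qed auto
  have r_lim: "r \<longlonglongrightarrow> sgn (up - kp) * (f up - f kp)"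
    unfolding r_def
  proof (rule entropy_average[where J="\<lambda>d. {0<..<d}" and S="\<lambda>r. {0<..<r}", OF f_lipschitz k(2) up f_borel h Jr])
    show "\<exists>a. {0<..<r} = {a<..<a + r} \<and> a \<in> {- r..0}" if "0 < r" for r :: real
      by (rule exI[of _ 0]) (use that in simp)
  qed auto
  have "(\<integral>x. interface_entropy km kp (x, t) * tent_slope (h n) x \<partial>lborel) = l n - r n" for n
  proof -
    have hn: "0 < h n" by (rule h)
    have i1: "integrable lborel (\<lambda>x. (sgn (w (x, t) - km) * (g (w (x, t)) - g km)) * (indicator {- h n<..<0} x / h n))"
    proof (rule integrable_bounded_box[of _ "Mb / h n" "- h n" 0])
      show "\<bar>(sgn (w (x, t) - km) * (g (w (x, t)) - g km)) * (indicator {- h n<..<0} x / h n)\<bar> \<le> Mb / h n" for x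
        using Mb(7)[OF w_range[of "(x, t)"] k(1)] Mb(1) hn by (auto simp: divide_right_mono abs_mult[of _ "_ / _"] split: split_indicator)
    qed (measurable, auto split: split_indicator)
    have i2: "integrable lborel (\<lambda>x. (sgn (w (x, t) - kp) * (f (w (x, t)) - f kp)) * (indicator {0<..<h n} x / h n))"
    proof (rule integrable_bounded_box[of _ "Mb / h n" 0 "h n"])
      show "\<bar>(sgn (w (x, t) - kp) * (f (w (x, t)) - f kp)) * (indicator {0<..<h n} x / h n)\<bar> \<le> Mb / h n" for x
        using Mb(6)[OF w_range[of "(x, t)"] k(2)] Mb(1) hn by (auto simp: divide_right_mono abs_mult[of _ "_ / _"] split: split_indicator)
    qed (measurable, auto split: split_indicator)
    have "l n - r n = (\<integral>x. (sgn (w (x, t) - km) * (g (w (x, t)) - g km)) * (indicator {- h n<..<0} x / h n)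
        - (sgn (w (x, t) - kp) * (f (w (x, t)) - f kp)) * (indicator {0<..<h n} x / h n) \<partial>lborel)"
      unfolding l_def r_def by (rule Bochner_Integration.integral_diff[OF i1 i2, symmetric])
    also have "\<dots> = (\<integral>x. interface_entropy km kp (x, t) * tent_slope (h n) x \<partial>lborel)"
      by (intro Bochner_Integration.integral_cong) (auto simp: interface_entropy_def tent_slope_def split: split_indicator)
    finally show ?thesis by simp
  qed
  then show ?thesis using tendsto_diff[OF l_lim r_lim] by simp
qed

text \<open>With \<open>h\<close> tending to zero, \<open>interface_inequality\<close> makes the
  integral of the entropy jump over every time interval nonnegative. Lebesgue differentiation turns
  this into an inequality at almost every time, with a null set depending on the steady
  state.\<close>

lemma interface_entropy_AE:
  assumes st: "steady km k0 kp"
  shows "AE t in lborel. t \<in> {0<..<T} \<longrightarrow> (\<forall>um up. ess_lim_left_0 (\<lambda>x. w (x, t)) um \<longrightarrow> ess_lim_right_0 (\<lambda>x. w (x, t)) up \<longrightarrow>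
    sgn (up - kp) * (f up - f kp) \<le> sgn (um - km) * (g um - g km))"
proof -
  have k: "km \<in> {lo..hi}" "kp \<in> {lo..hi}" using st by (auto simp: steady_def)
  define h where "h n = 1 / real (Suc n)" for n
  have h: "\<And>n. 0 < h n" "h \<longlonglongrightarrow> 0" unfolding h_def by simp (rule LIMSEQ_Suc, rule lim_1_over_n)
  have Mb0: "0 \<le> Mb" by (rule Mb(1))
  define Dn where "Dn n t = (\<integral>x. interface_entropy km kp (x, t) * tent_slope (h n) x \<partial>lborel)" for n t
  have [measurable]: "Dn n \<in> borel_measurable borel" for n
  proof -
    have "(\<lambda>(t, x). interface_entropy km kp (x, t) * tent_slope (h n) x) \<in> borel_measurable ((borel :: real measure) \<Otimes>\<^sub>M lborel)"
      by measurable
    from lborel.borel_measurable_lebesgue_integral[OF this] show ?thesis unfolding Dn_def by simp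
  qed
  have slope_bound: "\<bar>tent_slope (h n) x\<bar> \<le> 1 / h n" for n x
    using h(1)[of n] by (auto simp: tent_slope_def split: split_indicator)
  have Dn_bound: "\<bar>Dn n t\<bar> \<le> 2 * Mb" for n t
  proof -
    have hn: "0 < h n" by (rule h)
    have le: "\<bar>interface_entropy km kp (x, t) * tent_slope (h n) x\<bar> \<le> indicator {- h n..h n} x * (Mb / h n)" for x
    proof (cases "x \<in> {- h n..h n}")
      case True
      have "\<bar>interface_entropy km kp (x, t)\<bar> * \<bar>tent_slope (h n) x\<bar> \<le> Mb * (1 / h n)"
        using interface_entropy_bound[OF k] slope_bound Mb0 by (intro mult_mono) auto
      then show ?thesis using True by (simp add: abs_mult)
    next
      case False
      then have "tent_slope (h n) x = 0" using hn by (auto simp: tent_slope_def split: split_indicator)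
      then show ?thesis using False by simp
    qed
    have "\<bar>Dn n t\<bar> \<le> (\<integral>x. indicator {- h n..h n} x * (Mb / h n) \<partial>lborel)"
      unfolding Dn_def
    proof (rule integral_abs_bound_integral)
      show "integrable lborel (\<lambda>x. indicator {- h n..h n} x * (Mb / h n))"
        by (rule integrable_bounded_box[of _ "Mb / h n" "- h n" "h n"])
          (use Mb0 hn in \<open>auto split: split_indicator\<close>)
      show "integrable lborel (\<lambda>x. interface_entropy km kp (x, t) * tent_slope (h n) x)"
      proof (rule integrable_bounded_box[of _ "Mb / h n" "- h n" "h n"])
        have nn: "0 \<le> Mb / h n" using Mb0 hn by simp
        show "\<bar>interface_entropy km kp (x, t) * tent_slope (h n) x\<bar> \<le> Mb / h n" for x
          using le[of x] nn by (auto split: split_indicator_asm)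
        show "interface_entropy km kp (x, t) * tent_slope (h n) x = 0" if "x \<notin> cbox (- h n) (h n)" for x
          using le[of x] that by auto
      qed measurable
    qed (rule le)
    also have "\<dots> = 2 * Mb" using hn by simp
    finally show ?thesis .
  qed
  \<comment> \<open>Taking \<open>lim\<close> makes the jump measurable in \<open>t\<close> without
    selecting traces measurably; the truncation bounds it also at times where the limit fails to
    exist.\<close>
  define D where "D t = max (- 2 * Mb) (min (2 * Mb) (lim (\<lambda>n. Dn n t)))" for t
  have [measurable]: "D \<in> borel_measurable borel" unfolding D_def by measurable
  have D_bound: "\<bar>D t\<bar> \<le> 2 * Mb" for t using Mb0 by (auto simp: D_def)
  have lim: "(\<lambda>n. Dn n t) \<longlonglongrightarrow> sgn (um - km) * (g um - g km) - sgn (up - kp) * (f up - f kp)"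
    if "ess_lim_left_0 (\<lambda>x. w (x, t)) um" "ess_lim_right_0 (\<lambda>x. w (x, t)) up" for t um up
    unfolding Dn_def by (rule interface_entropy_average[OF k h that])
  have D_lim: "(\<lambda>n. Dn n t) \<longlonglongrightarrow> D t" "D t = sgn (um - km) * (g um - g km) - sgn (up - kp) * (f up - f kp)"
    if tr: "ess_lim_left_0 (\<lambda>x. w (x, t)) um" "ess_lim_right_0 (\<lambda>x. w (x, t)) up" for t um up
  proof -
    let ?l = "sgn (um - km) * (g um - g km) - sgn (up - kp) * (f up - f kp)"
    have "\<bar>?l\<bar> \<le> 2 * Mb" using tendsto_rabs[OF lim[OF tr]] Dn_bound by (intro LIMSEQ_le_const2) auto
    then show "D t = ?l" using limI[OF lim[OF tr]] by (auto simp: D_def)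
    then show "(\<lambda>n. Dn n t) \<longlonglongrightarrow> D t" using lim[OF tr] by simp
  qed
  have "AE t in lborel. t \<in> {0<..<T} \<longrightarrow> 0 \<le> D t"
  proof (rule AE_nonneg_from_intervals)
    fix a b :: real assume ab: "0 \<le> a" "a < b" "b \<le> T"
    have l: "(\<lambda>n. \<integral>t. indicator {a..<b} t * Dn n t \<partial>lborel) \<longlonglongrightarrow> (\<integral>t. indicator {a..<b} t * D t \<partial>lborel)"
    proof (rule dominated_box_convergence[where M="2 * Mb" and a=a and b=b])
      show "AE t in lborel. (\<lambda>n. indicator {a..<b} t * Dn n t) \<longlonglongrightarrow> indicator {a..<b} t * D t"
        using traces_exist
      proof (rule eventually_mono)
        fix t assume *: "t \<in> {0..T} \<longrightarrow> (\<exists>um up. ess_lim_left_0 (\<lambda>x. w (x, t)) um \<and> ess_lim_right_0 (\<lambda>x. w (x, t)) up)"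
        show "(\<lambda>n. indicator {a..<b} t * Dn n t) \<longlonglongrightarrow> indicator {a..<b} t * D t"
        proof (cases "t \<in> {a..<b}")
          case True
          then have "t \<in> {0..T}" using ab by auto
          then obtain um up where "ess_lim_left_0 (\<lambda>x. w (x, t)) um" "ess_lim_right_0 (\<lambda>x. w (x, t)) up" using * by blast
          from D_lim(1)[OF this] show ?thesis using True by simp
        qed simp
      qed
      show "\<bar>indicator {a..<b} t * Dn n t\<bar> \<le> 2 * Mb" for n t
        using Dn_bound[of n t] Mb0 by (auto split: split_indicator)
    qed (measurable, auto split: split_indicator)
    have "- (4 * h n * Mb) \<le> (\<integral>t. indicator {a..<b} t * Dn n t \<partial>lborel)" for n
    proof -
      have hn: "0 < h n" by (rule h)
      define G where "G p = indicator {a..<b} (snd p) * (interface_entropy km kp p * tent_slope (h n) (fst p))" for p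
      have "integrable lborel G"
      proof (rule integrable_bounded_box[of _ "Mb / h n" "(- h n, a)" "(h n, b)"])
        show "\<bar>G p\<bar> \<le> Mb / h n" for p
        proof -
          have "\<bar>interface_entropy km kp p\<bar> * \<bar>tent_slope (h n) (fst p)\<bar> \<le> Mb * (1 / h n)"
            using interface_entropy_bound[OF k] slope_bound Mb0 by (intro mult_mono) auto
          moreover have "0 \<le> Mb / h n" using Mb0 hn by simp
          ultimately show ?thesis by (auto simp: G_def abs_mult split: split_indicator)
        qed
        show "G p = 0" if "p \<notin> cbox (- h n, a) (h n, b)" for p
          using that hn by (auto simp: G_def tent_slope_def cbox_Pair_iff split: split_indicator)
        show "G \<in> borel_measurable borel" unfolding G_def by measurable
      qed
      then have "integrable (lborel \<Otimes>\<^sub>M lborel) (case_prod (\<lambda>x t. G (x, t)))" by (simp add: lborel_prod)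
      from lborel_pair.integral_snd[OF this]
      have "(\<integral>p. G p \<partial>lborel) = (\<integral>t. (\<integral>x. G (x, t) \<partial>lborel) \<partial>lborel)" by (simp add: lborel_prod)
      also have "\<dots> = (\<integral>t. indicator {a..<b} t * Dn n t \<partial>lborel)" by (simp add: G_def Dn_def)
      finally show ?thesis using interface_inequality[OF st ab hn] by (simp add: G_def)
    qed
    moreover have "(\<lambda>n. - (4 * h n * Mb)) \<longlonglongrightarrow> - (4 * 0 * Mb)" by (intro tendsto_intros h)
    ultimately show "0 \<le> (\<integral>t. indicator {a..<b} t * D t \<partial>lborel)"
      using LIMSEQ_le[OF _ l, of "\<lambda>n. - (4 * h n * Mb)"] by auto
  qed (use D_bound in auto)
  then show ?thesis
  proof (rule eventually_mono, intro impI allI)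
    fix t um up assume "t \<in> {0<..<T} \<longrightarrow> 0 \<le> D t" "t \<in> {0<..<T}"
      and tr: "ess_lim_left_0 (\<lambda>x. w (x, t)) um" "ess_lim_right_0 (\<lambda>x. w (x, t)) up"
    then have "0 \<le> D t" by simp
    then show "sgn (up - kp) * (f up - f kp) \<le> sgn (um - km) * (g um - g km)" using D_lim(2)[OF tr] by simp
  qed
qed

text \<open>The exceptional null sets depend on the steady state, so only countably many can be
  handled at once. A countable dense subset of the pairs \<open>(km, kp)\<close> is used, and
  continuity of both entropies in these pairs covers the rest; \<open>k0\<close> does not occur in
  the inequality.\<close>

lemma limit_gamma:
  "AE t in lborel. t \<in> {0<..<T} \<longrightarrow> (\<exists>um up. ess_lim_left_0 (\<lambda>x. w (x, t)) um \<and> ess_lim_right_0 (\<lambda>x. w (x, t)) up \<and> Gamma_condition f g um up)"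
proof -
  define S where "S = {(km, kp). \<exists>k0. steady km k0 kp}"
  obtain S' where S': "countable S'" "S' \<subseteq> S" "S \<subseteq> closure S'" by (rule separable)
  have "AE t in lborel. \<forall>k\<in>S'. t \<in> {0<..<T} \<longrightarrow> (\<forall>um up. ess_lim_left_0 (\<lambda>x. w (x, t)) um \<longrightarrow> ess_lim_right_0 (\<lambda>x. w (x, t)) up \<longrightarrow>
    sgn (up - snd k) * (f up - f (snd k)) \<le> sgn (um - fst k) * (g um - g (fst k)))"
    unfolding AE_ball_countable[OF S'(1)]
  proof
    fix k assume "k \<in> S'"
    then obtain k0 where "steady (fst k) k0 (snd k)" using S'(2) unfolding S_def by fastforce
    from interface_entropy_AE[OF this] show "AE t in lborel. t \<in> {0<..<T} \<longrightarrow> (\<forall>um up. ess_lim_left_0 (\<lambda>x. w (x, t)) um \<longrightarrow> ess_lim_right_0 (\<lambda>x. w (x, t)) up \<longrightarrow>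
      sgn (up - snd k) * (f up - f (snd k)) \<le> sgn (um - fst k) * (g um - g (fst k)))" .
  qed
  then show ?thesis using traces_exist
  proof eventually_elim
    case (elim t)
    show ?case
    proof
      assume t: "t \<in> {0<..<T}"
      then obtain um up where tr: "ess_lim_left_0 (\<lambda>x. w (x, t)) um" "ess_lim_right_0 (\<lambda>x. w (x, t)) up"
        using elim(2) by auto
      have um: "um \<in> {lo..hi}" and up: "up \<in> {lo..hi}"
        using ess_lim_left_range[OF tr(1) w_range] ess_lim_right_range[OF tr(2) w_range] by auto
      have "Gamma_condition f g um up"
      proof (rule gamma_from_entropy[OF lipschitz_on_continuous_on[OF f_lipschitz] f_lipschitz
            lipschitz_on_continuous_on[OF g_lipschitz] g_lipschitz _ f_lo f_hi um up])
        fix km k0 kp assume "{km, k0, kp} \<subseteq> {lo..hi}" "godunov_flux g k0 km = g km" "godunov_flux f kp k0 = f kp" "g km = f kp"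
        then have st: "steady km k0 kp" by (simp add: steady_def)
        then have "(km, kp) \<in> closure S'" using S'(3) by (auto simp: S_def)
        then obtain x where x: "\<And>n. x n \<in> S'" "x \<longlonglongrightarrow> (km, kp)" unfolding closure_sequential by blast
        have x_range: "fst (x n) \<in> {lo..hi}" "snd (x n) \<in> {lo..hi}" for n
          using x(1)[of n] S'(2) unfolding S_def steady_def by fastforce+
        have k: "km \<in> {lo..hi}" "kp \<in> {lo..hi}" using st by (auto simp: steady_def)
        have fst_lim: "(\<lambda>n. fst (x n)) \<longlonglongrightarrow> km" and snd_lim: "(\<lambda>n. snd (x n)) \<longlonglongrightarrow> kp"
          using tendsto_fst[OF x(2)] tendsto_snd[OF x(2)] by simp_all
        have cont: "(\<lambda>n. sgn (u - y n) * (q u - q (y n))) \<longlonglongrightarrow> sgn (u - z) * (q u - q z)"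
          if q: "L-lipschitz_on {lo..hi} q" and u: "u \<in> {lo..hi}" and y: "\<And>n. y n \<in> {lo..hi}" "y \<longlonglongrightarrow> z" and z: "z \<in> {lo..hi}" for q u y z
        proof -
          have "(\<lambda>n. sgn (u - y n) * (q u - q (y n)) - sgn (u - z) * (q u - q z)) \<longlonglongrightarrow> 0"
          proof (rule Lim_null_comparison)
            show "\<forall>\<^sub>F n in sequentially. norm (sgn (u - y n) * (q u - q (y n)) - sgn (u - z) * (q u - q z)) \<le> 2 * L * \<bar>y n - z\<bar>"
              using entropy_lipschitz[OF q y(1) z u] by (simp add: entropy_sym[of u])
            show "(\<lambda>n. 2 * L * \<bar>y n - z\<bar>) \<longlonglongrightarrow> 0"
              using tendsto_mult_right_zero[OF tendsto_rabs_zero[OF LIM_zero[OF y(2)]], of "2 * L"] by simp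
          qed
          then show ?thesis by (rule LIM_zero_cancel)
        qed
        show "sgn (up - kp) * (f up - f kp) \<le> sgn (um - km) * (g um - g km)"
        proof (rule LIMSEQ_le)
          show "(\<lambda>n. sgn (up - snd (x n)) * (f up - f (snd (x n)))) \<longlonglongrightarrow> sgn (up - kp) * (f up - f kp)"
            by (rule cont[OF f_lipschitz up x_range(2) snd_lim k(2)])
          show "(\<lambda>n. sgn (um - fst (x n)) * (g um - g (fst (x n)))) \<longlonglongrightarrow> sgn (um - km) * (g um - g km)"
            by (rule cont[OF g_lipschitz um x_range(1) fst_lim k(1)])
          show "\<exists>N. \<forall>n\<ge>N. sgn (up - snd (x n)) * (f up - f (snd (x n))) \<le> sgn (um - fst (x n)) * (g um - g (fst (x n)))"
            using elim(1) x(1) t tr by blast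
        qed
      qed (use lo_less_hi in simp)
      then show "\<exists>um up. ess_lim_left_0 (\<lambda>x. w (x, t)) um \<and> ess_lim_right_0 (\<lambda>x. w (x, t)) up \<and> Gamma_condition f g um up"
        using tr by blast
    qed
  qed
qed

lemma limit_is_vv_solution: "vv_solution lo hi T f g v (\<lambda>x t. w (x, t))"
  unfolding vv_solution_def
proof (intro conjI allI impI)
  have "w \<in> borel_measurable lebesgue" by (intro measurable_completion) simp
  then show "(\<lambda>(x, t). w (x, t)) \<in> borel_measurable (lebesgue_on (strip T))"
    by (simp add: measurable_restrict_space1)
  show "AE (x, t) in lebesgue. (x, t) \<in> strip T \<longrightarrow> w (x, t) \<in> {lo..hi}"
    using w_range by (intro AE_I2) (auto simp del: atLeastAtMost_iff)
  show "weak_solution T f g v (\<lambda>x t. w (x, t))" by (rule limit_is_weak_solution)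
  show "AE t in lebesgue. t \<in> {0<..<T} \<longrightarrow> (\<exists>um up. ess_lim_left_0 (\<lambda>x. w (x, t)) um \<and> ess_lim_right_0 (\<lambda>x. w (x, t)) up \<and> Gamma_condition f g um up)"
    by (rule AE_completion[OF limit_gamma])
qed (use limit_kruzkov in auto)

end

section \<open>Convergence of the approximations to the solution\<close>

context godunov_scheme
begin

text \<open>The scheme, the variation and the notion of solution see only the class of the data, so
  a Borel version may be used. Uniqueness identifies the limit with \<open>u\<close> almost
  everywhere in the strip, hence on almost every time slice.\<close>

theorem godunov_converges_to_solution:
  assumes v: "initial_data lo hi X uL uR v" and TV0: "TV v \<le> ennreal K0" "0 \<le> K0" and T: "0 < T" and K: "0 \<le> K"
    and TV: "\<And>d t. 0 < d \<Longrightarrow> t \<in> {0..T} \<Longrightarrow> TV (\<lambda>x. godunov_approx lam d f g v x t) \<le> ennreal K"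
    and d: "\<And>n. 0 < d n" "\<And>n. d n \<le> 1" "d \<longlonglongrightarrow> 0"
    and u: "the_vv_solution lo hi T f g v u"
  obtains r where "strict_mono (r :: nat \<Rightarrow> nat)"
    "AE t in lborel. t \<in> {0<..<T} \<longrightarrow> (AE x in lborel. (\<lambda>n. godunov_approx lam (d (r n)) f g v x t) \<longlonglongrightarrow> u x t)"
proof -
  obtain v' where v': "v' \<in> borel_measurable borel" "initial_data lo hi X uL uR v'" "AE x in lborel. v x = v' x"
    by (rule initial_data_borel[OF v])
  have god: "godunov lam e f g v = godunov lam e f g v'" for e
    by (rule godunov_cong_AE[OF v'(3) initial_dataD(1)[OF v] initial_dataD(1)[OF v'(2)]])
  have ga: "godunov_approx lam e f g v x t = ua e v' (x, t)" for e x t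
    by (simp add: ua_godunov_approx[symmetric] godunov_approx_def god)
  have TV': "TV (\<lambda>x. godunov_approx lam e f g v' x t) \<le> ennreal K" if "0 < e" "t \<in> {0..T}" for e t
    using TV[OF that] unfolding ga unfolding ua_godunov_approx .
  have TV0': "TV v' \<le> ennreal K0" using TV0(1) TV_on_cong_AE[OF v'(3)] by simp
  obtain r w where r: "strict_mono r" and w: "w \<in> borel_measurable borel" "\<And>p. w p \<in> {lo..hi}"
    "AE p in lborel. snd p \<in> {0..T} \<longrightarrow> (\<lambda>n. ua (d (r n)) v' p) \<longlonglongrightarrow> w p"
    "AE p in lborel. snd p \<in> {0..T} \<longrightarrow> (\<lambda>n. ua (d (r n)) v' (fst p + d (r n), snd p)) \<longlonglongrightarrow> w p"
    "AE x in lborel. (\<lambda>n. ua (d (r n)) v' (x, 0)) \<longlonglongrightarrow> v' x"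
  proof (rule godunov_limit[OF v'(2,1) TV0' TV0(2) T K _ d])
    show "TV (\<lambda>x. godunov_approx lam e f g v' x t) \<le> ennreal K" if "0 < e" "t \<in> {0..T}" for e t
      by (rule TV'[OF that])
  qed (rule that; simp)
  have dr: "(\<lambda>n. d (r n)) \<longlonglongrightarrow> 0" using LIMSEQ_subseq_LIMSEQ[OF d(3) r] by (simp add: o_def)
  interpret C: godunov_convergence lo hi L lam f g X uL uR T K v' "\<lambda>n. d (r n)" w
  proof unfold_locales
    show "TV (\<lambda>x. ua (d (r n)) v' (x, t)) \<le> ennreal K" if "t \<in> {0..T}" for n t
      using TV[OF d(1) that] by (simp add: ga)
  qed (use v' T K d dr w in auto)
  have "vv_solution lo hi T f g v (\<lambda>x t. w (x, t))"
    by (rule vv_solution_cong_AE[OF C.limit_is_vv_solution v'(3) initial_dataD(1)[OF v] initial_dataD(1)[OF v'(2)]])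
  then have "AE (x, t) in lebesgue. (x, t) \<in> strip T \<longrightarrow> w (x, t) = u x t"
    using u unfolding the_vv_solution_def by blast
  then have "AE p in lborel. p \<in> strip T \<longrightarrow> w p = u (fst p) (snd p)"
    by (simp add: AE_completion_iff split_beta)
  then have "AE p in lborel. (fst p, snd p) \<in> strip T \<longrightarrow> (\<lambda>n. ua (d (r n)) v' (fst p, snd p)) \<longlonglongrightarrow> u (fst p) (snd p)"
    using w(3) by eventually_elim (auto simp: strip_def)
  from AE_lborel_prod_swap[OF this]
  have "AE t in lborel. AE x in lborel. (x, t) \<in> strip T \<longrightarrow> (\<lambda>n. ua (d (r n)) v' (x, t)) \<longlonglongrightarrow> u x t" .
  then have "AE t in lborel. t \<in> {0<..<T} \<longrightarrow> (AE x in lborel. (\<lambda>n. godunov_approx lam (d (r n)) f g v x t) \<longlonglongrightarrow> u x t)"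
    by (rule eventually_mono) (simp add: ga strip_def)
  then show thesis using r that by blast
qed

section \<open>Comparison of two schemes\<close>

definition qd :: "real \<Rightarrow> (real \<Rightarrow> real) \<Rightarrow> (real \<Rightarrow> real) \<Rightarrow> nat \<Rightarrow> real \<Rightarrow> real"
  where "qd d v v' n x = entropy_flux (face_flux (cell_index d x)) (ux d v n (x + d)) (ux d v n x)
    (ux d v' n (x + d)) (ux d v' n x)"

lemma qd_measurable [measurable]: "0 < d \<Longrightarrow> qd d v v' n \<in> borel_measurable borel"
  unfolding qd_def ux_def by (simp only: cell_index_add) measurable

lemma ux_kato_pair:
  assumes v: "initial_data lo hi X uL uR v" and v': "initial_data lo hi X uL uR v'" and d: "0 < d"
  shows "\<bar>ux d v (Suc n) x - ux d v' (Suc n) x\<bar>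
    \<le> \<bar>ux d v n x - ux d v' n x\<bar> - lam * (qd d v v' n x - qd d v v' n (x - d))"
proof -
  define j where "j = cell_index d x"
  have "\<bar>step j (U d v n (j - 1)) (U d v n j) (U d v n (j + 1)) - step j (U d v' n (j - 1)) (U d v' n j) (U d v' n (j + 1))\<bar>
     \<le> \<bar>U d v n j - U d v' n j\<bar> - lam * (entropy_flux (face_flux j) (U d v n (j + 1)) (U d v n j) (U d v' n (j + 1)) (U d v' n j)
        - entropy_flux (face_flux (j - 1)) (U d v n j) (U d v n (j - 1)) (U d v' n j) (U d v' n (j - 1)))"
    using lam_pos cfl godunov_range[OF v d] godunov_range[OF v' d]
    by (intro cell_update_kato[OF face_flux_lipschitz face_flux_lipschitz]) auto
  then show ?thesis
    by (simp add: ux_def qd_def godunov_Suc[OF d] cell_index_add[OF d] cell_index_diff[OF d] j_def)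
qed

lemma ux_diff_zero:
  assumes v: "initial_data lo hi X uL uR v" and v': "initial_data lo hi X uL uR v'" and d: "0 < d"
    and x: "X + (real n + 1) * d \<le> \<bar>x\<bar>"
  shows "ux d v n x - ux d v' n x = 0"
proof (cases "x < 0")
  case True
  then have "x \<le> - X - (real n + 1) * d" using x by simp
  then show ?thesis using ux_far_left[OF v d] ux_far_left[OF v' d] by simp
next
  case False
  then have "X + (real n + 1) * d \<le> x" using x by simp
  then show ?thesis using ux_far_right[OF v d] ux_far_right[OF v' d] by simp
qed

lemma ux_diff_integrable:
  assumes v: "initial_data lo hi X uL uR v" and v': "initial_data lo hi X uL uR v'" and d: "0 < d"
  shows "integrable lborel (\<lambda>x. ux d v n x - ux d v' n x)"
proof (rule integrable_bounded_box[of _ "hi - lo" "- (X + (real n + 1) * d)" "X + (real n + 1) * d"])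
  show "\<bar>ux d v n x - ux d v' n x\<bar> \<le> hi - lo" for x
    using ux_range[OF v d, of n x] ux_range[OF v' d, of n x] by auto
  show "ux d v n x - ux d v' n x = 0" if "x \<notin> cbox (- (X + (real n + 1) * d)) (X + (real n + 1) * d)" for x
    using that by (intro ux_diff_zero[OF v v' d]) auto
qed measurable

text \<open>Both functions obey the same scheme, so the Kato inequality holds in every cell
  including cell \<open>0\<close>. The entropy flux and its translate by \<open>d\<close> have the
  same integral and cancel.\<close>

lemma l1_contraction_step:
  assumes v: "initial_data lo hi X uL uR v" and v': "initial_data lo hi X uL uR v'" and d: "0 < d"
  shows "(\<integral>x. \<bar>ux d v (Suc n) x - ux d v' (Suc n) x\<bar> \<partial>lborel) \<le> (\<integral>x. \<bar>ux d v n x - ux d v' n x\<bar> \<partial>lborel)"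
proof -
  have [measurable]: "qd d v v' n \<in> borel_measurable borel" using d by measurable
  have q_int: "integrable lborel (qd d v v' n)"
  proof (rule integrable_bounded_box[of _ "L * ((hi - lo) + (hi - lo))" "- (X + (real n + 2) * d)" "X + (real n + 2) * d"])
    have le: "\<bar>qd d v v' n x\<bar> \<le> L * (\<bar>ux d v n x - ux d v' n x\<bar> + \<bar>ux d v n (x + d) - ux d v' n (x + d)\<bar>)" for x
      unfolding qd_def using ux_range[OF v d] ux_range[OF v' d]
      by (intro entropy_flux_abs_le[OF face_flux_lipschitz]) auto
    show "\<bar>qd d v v' n x\<bar> \<le> L * ((hi - lo) + (hi - lo))" for x
    proof (rule order_trans[OF le mult_left_mono[OF _ L_nonneg]])
      show "\<bar>ux d v n x - ux d v' n x\<bar> + \<bar>ux d v n (x + d) - ux d v' n (x + d)\<bar> \<le> (hi - lo) + (hi - lo)"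
        using ux_range[OF v d, of n x] ux_range[OF v' d, of n x] ux_range[OF v d, of n "x + d"] ux_range[OF v' d, of n "x + d"]
        by auto
    qed
    show "qd d v v' n x = 0" if "x \<notin> cbox (- (X + (real n + 2) * d)) (X + (real n + 2) * d)" for x
    proof -
      have "(real n + 2) * d = (real n + 1) * d + d" by (simp add: algebra_simps)
      moreover have "x < - (X + (real n + 2) * d) \<or> X + (real n + 2) * d < x" using that by auto
      ultimately have "X + (real n + 1) * d \<le> \<bar>x\<bar>" "X + (real n + 1) * d \<le> \<bar>x + d\<bar>" using d by linarith+
      then show ?thesis using le[of x] ux_diff_zero[OF v v' d] by simp
    qed
  qed measurable
  have q_int': "integrable lborel (\<lambda>x. qd d v v' n (x - d))"
    using integrable_translate[OF q_int, of "-d"] by simp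
  have q_eq: "(\<integral>x. qd d v v' n (x - d) \<partial>lborel) = (\<integral>x. qd d v v' n x \<partial>lborel)"
    using integral_translate[of "qd d v v' n" "-d"] by simp
  have i: "integrable lborel (\<lambda>x. \<bar>ux d v m x - ux d v' m x\<bar>)" for m
    using ux_diff_integrable[OF v v' d] by (rule integrable_abs)
  have "(\<integral>x. \<bar>ux d v (Suc n) x - ux d v' (Suc n) x\<bar> \<partial>lborel)
      \<le> (\<integral>x. \<bar>ux d v n x - ux d v' n x\<bar> - lam * (qd d v v' n x - qd d v v' n (x - d)) \<partial>lborel)"
    using i q_int q_int' by (intro integral_mono ux_kato_pair[OF v v' d]) auto
  also have "\<dots> = (\<integral>x. \<bar>ux d v n x - ux d v' n x\<bar> \<partial>lborel)"
    using i q_int q_int' by (simp add: q_eq)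
  finally show ?thesis .
qed

lemma l1_contraction:
  assumes v: "initial_data lo hi X uL uR v" and v': "initial_data lo hi X uL uR v'" and d: "0 < d"
  shows "(\<integral>x. \<bar>ux d v n x - ux d v' n x\<bar> \<partial>lborel) \<le> (\<integral>x. \<bar>ux d v 0 x - ux d v' 0 x\<bar> \<partial>lborel)"
  using l1_contraction_step[OF assms] by (induction n) (auto intro: order_trans)

lemma emeasure_cell:
  assumes "0 < d"
  shows "emeasure lborel {x. cell_index d x = j} = ennreal d"
proof -
  have "{x. cell_index d x = j} = {(real_of_int j - 1/2) * d<..(real_of_int j + 1/2) * d}"
  proof (rule set_eqI)
    fix x
    have "cell_index d x = j \<longleftrightarrow> real_of_int j - 1 < x / d - 1/2 \<and> x / d - 1/2 \<le> real_of_int j"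
      unfolding cell_index_def by (rule ceiling_eq_iff)
    also have "\<dots> \<longleftrightarrow> real_of_int j - 1/2 < x / d \<and> x / d \<le> real_of_int j + 1/2" by linarith
    also have "\<dots> \<longleftrightarrow> (real_of_int j - 1/2) * d < x \<and> x \<le> (real_of_int j + 1/2) * d"
      using assms by (simp only: pos_less_divide_eq pos_divide_le_eq)
    finally show "x \<in> {x. cell_index d x = j} \<longleftrightarrow> x \<in> {(real_of_int j - 1/2) * d<..(real_of_int j + 1/2) * d}" by simp
  qed
  moreover have "(real_of_int j + 1/2) * d - (real_of_int j - 1/2) * d = d" by (simp add: algebra_simps)
  ultimately show ?thesis using assms by simp
qed

text \<open>Averaging over cells is integration against a symmetric kernel with mass
  \<open>d\<close> in each variable, normalized by \<open>1 / d\<close>, hence an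
  \<open>L\<^sup>1\<close> contraction.\<close>

lemma initial_l1_contraction:
  assumes v: "initial_data lo hi X uL uR v" and v': "initial_data lo hi X uL uR v'" and d: "0 < d"
    and [measurable]: "v \<in> borel_measurable borel" "v' \<in> borel_measurable borel"
  shows "(\<integral>\<^sup>+x. ennreal \<bar>ux d v 0 x - ux d v' 0 x\<bar> \<partial>lborel) \<le> (\<integral>\<^sup>+x. ennreal \<bar>v x - v' x\<bar> \<partial>lborel)"
proof -
  define k where "k x y = (if cell_index d x = cell_index d y then 1 else 0 :: ennreal)" for x y
  have [measurable]: "case_prod k \<in> borel_measurable (borel \<Otimes>\<^sub>M borel)"
    unfolding k_def by measurable
  have pt: "ennreal \<bar>ux d v 0 x - ux d v' 0 x\<bar> \<le> ennreal (1 / d) * (\<integral>\<^sup>+y. k x y * ennreal \<bar>v y - v' y\<bar> \<partial>lborel)" for x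
  proof -
    define a where "a = (real_of_int (cell_index d x) - 1/2) * d"
    define b where "b = (real_of_int (cell_index d x) + 1/2) * d"
    have int: "integrable lborel (\<lambda>y. indicator {a..b} y * z y)"
      if z: "initial_data lo hi X uL uR z" and [measurable]: "z \<in> borel_measurable borel" for z
    proof (rule integrable_bounded_box[of _ "max \<bar>lo\<bar> \<bar>hi\<bar>" a b])
      show "\<bar>indicator {a..b} y * z y\<bar> \<le> max \<bar>lo\<bar> \<bar>hi\<bar>" for y
        using initial_dataD(2)[OF z, of y] by (auto split: split_indicator)
    qed auto
    have u: "ux d z 0 x = (\<integral>y. indicator {a..b} y * z y \<partial>lborel) / d"
      if [measurable]: "z \<in> borel_measurable borel" for z
    proof -
      have "(LINT y:{a..b}|lebesgue. z y) = (\<integral>y. indicator {a..b} y * z y \<partial>lborel)"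
        unfolding set_lebesgue_integral_def real_scaleR_def by (rule integral_completion) measurable
      then show ?thesis by (simp add: ux_def a_def b_def)
    qed
    have "ux d v 0 x - ux d v' 0 x = (1 / d) * (\<integral>y. indicator {a..b} y * v y - indicator {a..b} y * v' y \<partial>lborel)"
      by (simp add: u Bochner_Integration.integral_diff[OF int[OF v] int[OF v']] diff_divide_distrib)
    then have "ennreal \<bar>ux d v 0 x - ux d v' 0 x\<bar> = ennreal (1 / d) * ennreal \<bar>\<integral>y. indicator {a..b} y * v y - indicator {a..b} y * v' y \<partial>lborel\<bar>"
      using d by (simp only: abs_mult) (subst ennreal_mult, auto)
    also have "\<dots> \<le> ennreal (1 / d) * (\<integral>\<^sup>+y. ennreal (norm (indicator {a..b} y * v y - indicator {a..b} y * v' y)) \<partial>lborel)"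
      using integral_norm_bound_ennreal[OF Bochner_Integration.integrable_diff[OF int[OF v] int[OF v']]]
      by (intro mult_left_mono) auto
    also have "(\<integral>\<^sup>+y. ennreal (norm (indicator {a..b} y * v y - indicator {a..b} y * v' y)) \<partial>lborel)
        \<le> (\<integral>\<^sup>+y. k x y * ennreal \<bar>v y - v' y\<bar> \<partial>lborel)"
    proof (rule nn_integral_mono_AE)
      have "AE y in lborel. y \<noteq> a" by (rule AE_lborel_singleton)
      then show "AE y in lborel. ennreal (norm (indicator {a..b} y * v y - indicator {a..b} y * v' y)) \<le> k x y * ennreal \<bar>v y - v' y\<bar>"
      proof eventually_elim
        case (elim y)
        show ?case
        proof (cases "y \<in> {a..b}")
          case True
          have "real_of_int (cell_index d x) - 1/2 < y / d" "y / d \<le> real_of_int (cell_index d x) + 1/2"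
            using True elim d by (auto simp: a_def b_def pos_less_divide_eq pos_divide_le_eq)
          then have "cell_index d y = cell_index d x"
            unfolding cell_index_def[of d y] by (intro ceiling_unique) linarith+
          then show ?thesis using True by (simp add: k_def)
        qed simp
      qed
    qed
    finally show ?thesis by (simp add: mult_left_mono)
  qed
  have "(\<integral>\<^sup>+x. ennreal \<bar>ux d v 0 x - ux d v' 0 x\<bar> \<partial>lborel)
      \<le> (\<integral>\<^sup>+x. ennreal (1 / d) * (\<integral>\<^sup>+y. k x y * ennreal \<bar>v y - v' y\<bar> \<partial>lborel) \<partial>lborel)"
    by (intro nn_integral_mono pt)
  also have "\<dots> = ennreal (1 / d) * (\<integral>\<^sup>+x. (\<integral>\<^sup>+y. k x y * ennreal \<bar>v y - v' y\<bar> \<partial>lborel) \<partial>lborel)"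
    by (intro nn_integral_cmult) measurable
  also have "(\<integral>\<^sup>+x. (\<integral>\<^sup>+y. k x y * ennreal \<bar>v y - v' y\<bar> \<partial>lborel) \<partial>lborel)
      = (\<integral>\<^sup>+y. (\<integral>\<^sup>+x. k x y * ennreal \<bar>v y - v' y\<bar> \<partial>lborel) \<partial>lborel)"
    by (intro lborel_pair.Fubini') measurable
  also have "\<dots> = (\<integral>\<^sup>+y. ennreal d * ennreal \<bar>v y - v' y\<bar> \<partial>lborel)"
  proof (rule nn_integral_cong)
    fix y
    have "(\<integral>\<^sup>+x. k x y * ennreal \<bar>v y - v' y\<bar> \<partial>lborel) = (\<integral>\<^sup>+x. ennreal \<bar>v y - v' y\<bar> * indicator {x. cell_index d x = cell_index d y} x \<partial>lborel)"
      by (intro nn_integral_cong) (auto simp: k_def)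
    also have "\<dots> = ennreal \<bar>v y - v' y\<bar> * emeasure lborel {x. cell_index d x = cell_index d y}"
      by (rule nn_integral_cmult_indicator) measurable
    finally show "(\<integral>\<^sup>+x. k x y * ennreal \<bar>v y - v' y\<bar> \<partial>lborel) = ennreal d * ennreal \<bar>v y - v' y\<bar>"
      using emeasure_cell[OF d] by (simp add: mult.commute)
  qed
  also have "\<dots> = ennreal d * (\<integral>\<^sup>+y. ennreal \<bar>v y - v' y\<bar> \<partial>lborel)"
    by (intro nn_integral_cmult) measurable
  also have "ennreal (1 / d) * (ennreal d * (\<integral>\<^sup>+y. ennreal \<bar>v y - v' y\<bar> \<partial>lborel)) = (\<integral>\<^sup>+y. ennreal \<bar>v y - v' y\<bar> \<partial>lborel)"
    using d by (simp add: mult.assoc[symmetric] ennreal_mult[symmetric])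
  finally show ?thesis .
qed

end

lemma convex_three_bound:
  fixes a b p q r M :: real
  assumes "0 \<le> a" "0 \<le> b" "a + b \<le> 1" "\<bar>p\<bar> \<le> M" "\<bar>q\<bar> \<le> M" "\<bar>r\<bar> \<le> M"
  shows "\<bar>p + a * (q - p) + b * (r - p)\<bar> \<le> M"
proof -
  have "p + a * (q - p) + b * (r - p) = (1 - a - b) * p + a * q + b * r" by (simp add: algebra_simps)
  also have "\<bar>\<dots>\<bar> \<le> \<bar>(1 - a - b) * p\<bar> + \<bar>a * q\<bar> + \<bar>b * r\<bar>" by linarith
  also have "\<dots> \<le> (1 - a - b) * M + a * M + b * M"
    unfolding abs_mult using assms by (intro add_mono mult_mono) auto
  also have "\<dots> = M" by (simp add: algebra_simps)
  finally show ?thesis .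
qed

section \<open>The primitive of the difference of two approximations\<close>

locale godunov_pair = A: godunov_scheme lo hi L lam f g + B: godunov_scheme lo hi L lam f' g'
  for lo hi L lam f g f' g' +
  fixes e :: real
  assumes flux_close: "\<And>y. y \<in> {lo..hi} \<Longrightarrow> \<bar>f y - f' y\<bar> \<le> e" "\<And>y. y \<in> {lo..hi} \<Longrightarrow> \<bar>g y - g' y\<bar> \<le> e"
begin

text \<open>The discrete primitive of the difference of the approximations satisfies the difference of two
  monotone schemes for Hamilton-Jacobi equations, so its sup norm grows at most by the distance
  of the fluxes.\<close>

primrec HJ :: "real \<Rightarrow> (real \<Rightarrow> real) \<Rightarrow> (real \<Rightarrow> real) \<Rightarrow> nat \<Rightarrow> int \<Rightarrow> real"
  where
    "HJ d v v' 0 = (\<lambda>j. \<integral>y. indicator {..(real_of_int j + 1/2) * d} y * (v y - v' y) \<partial>lborel)"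
  | "HJ d v v' (Suc n) = (\<lambda>j. HJ d v v' n j - lam * d *
      (godunov_flux (A.face_flux j) (A.U d v n (j + 1)) (A.U d v n j)
       - godunov_flux (B.face_flux j) (B.U d v' n (j + 1)) (B.U d v' n j)))"

text \<open>Only the initial layer of \<open>HJ\<close> is defined as an integral. Differencing the
  recursion in \<open>j\<close> reproduces both schemes, so \<open>HJ\<close> remains a primitive at
  later steps.\<close>

lemma HJ_diff:
  assumes v: "initial_data lo hi X uL uR v" and v': "initial_data lo hi X uL uR v'" and d: "0 < d"
    and [measurable]: "v \<in> borel_measurable borel" "v' \<in> borel_measurable borel"
  shows "HJ d v v' n j - HJ d v v' n (j - 1) = d * (A.U d v n j - B.U d v' n j)"
proof (induction n arbitrary: j)
  case 0
  define a where "a = (real_of_int j - 1/2) * d"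
  define b where "b = (real_of_int j + 1/2) * d"
  have ab: "a \<le> b" using d by (simp add: a_def b_def)
  have a_eq: "(real_of_int (j - 1) + 1/2) * d = a" by (simp add: a_def)
  have D: "\<bar>v y - v' y\<bar> \<le> hi - lo" for y
    using initial_dataD(2)[OF v, of y] initial_dataD(2)[OF v', of y] by auto
  have D0: "v y - v' y = 0" if "y \<notin> {-X..X}" for y
    using that initial_dataD(4,5)[OF v, of y] initial_dataD(4,5)[OF v', of y] by (cases "y < -X") auto
  have lh: "0 \<le> hi - lo" using D[of 0] by linarith
  have int: "integrable lborel (\<lambda>y. indicator S y * (v y - v' y))" if [measurable]: "S \<in> sets borel" for S
  proof (rule integrable_bounded_box[of _ "hi - lo" "-X" X])
    show "\<bar>indicator S y * (v y - v' y)\<bar> \<le> hi - lo" for y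
      using D[of y] lh by (auto split: split_indicator)
    show "indicator S y * (v y - v' y) = 0" if "y \<notin> cbox (-X) X" for y
      using D0[of y] that by simp
  qed measurable
  have intv: "integrable lborel (\<lambda>y. indicator {a..b} y * z y)"
    if z: "initial_data lo hi X uL uR z" and [measurable]: "z \<in> borel_measurable borel" for z
  proof (rule integrable_bounded_box[of _ "max \<bar>lo\<bar> \<bar>hi\<bar>" a b])
    show "\<bar>indicator {a..b} y * z y\<bar> \<le> max \<bar>lo\<bar> \<bar>hi\<bar>" for y
      using initial_dataD(2)[OF z, of y] by (auto split: split_indicator)
  qed auto
  have u: "godunov lam d F G z 0 j = (\<integral>y. indicator {a..b} y * z y \<partial>lborel) / d"
    if [measurable]: "z \<in> borel_measurable borel" for z F G
  proof -
    have "(LINT y:{a..b}|lebesgue. z y) = (\<integral>y. indicator {a..b} y * z y \<partial>lborel)"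
      unfolding set_lebesgue_integral_def real_scaleR_def by (rule integral_completion) measurable
    then show ?thesis by (simp add: a_def b_def)
  qed
  have "HJ d v v' 0 j - HJ d v v' 0 (j - 1)
      = (\<integral>y. indicator {..b} y * (v y - v' y) - indicator {..a} y * (v y - v' y) \<partial>lborel)"
    by (subst Bochner_Integration.integral_diff[OF int int]) (simp_all only: HJ.simps a_eq b_def[symmetric], simp_all)
  also have "\<dots> = (\<integral>y. indicator {a..b} y * v y - indicator {a..b} y * v' y \<partial>lborel)"
  proof (rule integral_cong_AE)
    have "AE y in lborel. y \<noteq> a" by (rule AE_lborel_singleton)
    then show "AE y in lborel. indicator {..b} y * (v y - v' y) - indicator {..a} y * (v y - v' y)
        = indicator {a..b} y * v y - indicator {a..b} y * v' y"
      by eventually_elim (use ab in \<open>auto split: split_indicator\<close>)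
  qed measurable
  also have "\<dots> = d * (A.U d v 0 j - B.U d v' 0 j)"
    unfolding u[OF assms(4)] u[OF assms(5)]
    using d by (simp add: Bochner_Integration.integral_diff[OF intv[OF v] intv[OF v']] right_diff_distrib)
  finally show ?case .
next
  case (Suc n)
  show ?case
    using Suc[of j] by (simp add: A.godunov_Suc[OF d] B.godunov_Suc[OF d] cell_update_def algebra_simps)
qed

text \<open>The flux difference is split at the pair \<open>A.face_flux\<close> with the states of
  the second scheme. The part with equal fluxes is linear in the increments of \<open>HJ\<close>
  with weights \<open>lam * a\<close> and \<open>lam * b\<close>, at most one half each, so it forms
  a convex combination of three neighbouring values. The part with equal states adds at most
  \<open>lam * d * e\<close> per step.\<close>

lemma HJ_bound:
  assumes v: "initial_data lo hi X uL uR v" and v': "initial_data lo hi X uL uR v'" and d: "0 < d"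
    and m: "v \<in> borel_measurable borel" "v' \<in> borel_measurable borel"
    and init: "\<And>x. \<bar>\<integral>y. indicator {..x} y * (v y - v' y) \<partial>lborel\<bar> \<le> e0"
  shows "\<bar>HJ d v v' n j\<bar> \<le> e0 + real n * (lam * d) * e"
proof (induction n arbitrary: j)
  case 0
  then show ?case using init by simp
next
  case (Suc n)
  define W where "W = HJ d v v' n"
  have UA: "A.U d v n i \<in> {lo..hi}" and UB: "B.U d v' n i \<in> {lo..hi}" for i
    using A.godunov_range[OF v d] B.godunov_range[OF v' d] by auto
  obtain a b where ab: "a \<in> {0..L}" "b \<in> {0..L}"
    "godunov_flux (A.face_flux j) (A.U d v n (j + 1)) (A.U d v n j) - godunov_flux (A.face_flux j) (B.U d v' n (j + 1)) (B.U d v' n j)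
      = b * (A.U d v n j - B.U d v' n j) - a * (A.U d v n (j + 1) - B.U d v' n (j + 1))"
    using godunov_flux_increment[OF A.face_flux_lipschitz UA UA UB UB] .
  define r where "r = godunov_flux (A.face_flux j) (B.U d v' n (j + 1)) (B.U d v' n j)
    - godunov_flux (B.face_flux j) (B.U d v' n (j + 1)) (B.U d v' n j)"
  have r: "\<bar>r\<bar> \<le> e"
    unfolding r_def
    by (rule godunov_flux_perturb[OF A.face_flux_continuous B.face_flux_continuous UB UB])
      (use flux_close in \<open>auto simp: A.face_flux_def B.face_flux_def\<close>)
  have dj: "W j - W (j - 1) = d * (A.U d v n j - B.U d v' n j)"
    "W (j + 1) - W j = d * (A.U d v n (j + 1) - B.U d v' n (j + 1))"
    using HJ_diff[OF v v' d m, of n j] HJ_diff[OF v v' d m, of n "j + 1"] by (simp_all add: W_def)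
  have "HJ d v v' (Suc n) j = W j - lam * d * ((b * (A.U d v n j - B.U d v' n j) - a * (A.U d v n (j + 1) - B.U d v' n (j + 1))) + r)"
    unfolding ab(3)[symmetric] r_def by (simp add: W_def)
  also have "\<dots> = W j - lam * b * (d * (A.U d v n j - B.U d v' n j)) + lam * a * (d * (A.U d v n (j + 1) - B.U d v' n (j + 1))) - lam * d * r"
    by (simp add: algebra_simps)
  also have "\<dots> = (W j + (lam * b) * (W (j - 1) - W j) + (lam * a) * (W (j + 1) - W j)) - lam * d * r"
    unfolding dj[symmetric] by (simp add: algebra_simps)
  finally have eq: "HJ d v v' (Suc n) j = (W j + (lam * b) * (W (j - 1) - W j) + (lam * a) * (W (j + 1) - W j)) - lam * d * r" .
  have la: "0 \<le> lam * a" "0 \<le> lam * b" "lam * a \<le> lam * L" "lam * b \<le> lam * L"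
    using ab(1,2) A.lam_pos by auto
  have "\<bar>W j + (lam * b) * (W (j - 1) - W j) + (lam * a) * (W (j + 1) - W j)\<bar> \<le> e0 + real n * (lam * d) * e"
    using la A.cfl Suc unfolding W_def by (intro convex_three_bound) auto
  moreover have "\<bar>lam * d * r\<bar> \<le> lam * d * e"
    unfolding abs_mult[of "lam * d"] using r d A.lam_pos by (simp add: mult_left_mono)
  ultimately have "\<bar>HJ d v v' (Suc n) j\<bar> \<le> (e0 + real n * (lam * d) * e) + lam * d * e"
    unfolding eq using abs_triangle_ineq4 order_trans add_mono by metis
  then show ?case by (simp add: algebra_simps)
qed

text \<open>The difference of the approximations is the difference quotient of \<open>W\<close>. The
  quotient is moved onto \<phi>, whose translate by \<open>d\<close> differs from it by at most
  \<open>d * V\<close> in \<open>L\<^sup>1\<close>; this cancels the denominator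
  \<open>d\<close>.\<close>

lemma pairing_bound:
  assumes v: "initial_data lo hi X uL uR v" and v': "initial_data lo hi X uL uR v'" and d: "0 < d"
    and m: "v \<in> borel_measurable borel" "v' \<in> borel_measurable borel"
    and init: "\<And>x. \<bar>\<integral>y. indicator {..x} y * (v y - v' y) \<partial>lborel\<bar> \<le> e0"
    and \<phi>[measurable]: "\<phi> \<in> borel_measurable borel" and \<phi>b: "\<And>x. \<bar>\<phi> x\<bar> \<le> 1" and \<phi>0: "\<And>x. x \<notin> {-R..R} \<Longrightarrow> \<phi> x = 0"
    and \<phi>V: "AE x in lborel. \<psi> x = \<phi> x" "variation_le UNIV \<psi> V"
  shows "(\<integral>x. (A.ux d v n x - B.ux d v' n x) * \<phi> x \<partial>lborel) \<le> (e0 + real n * (lam * d) * e) * V"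
proof -
  define W where "W x = HJ d v v' n (cell_index d x)" for x
  define C where "C = e0 + real n * (lam * d) * e"
  have [measurable]: "W \<in> borel_measurable borel" unfolding W_def by measurable
  have W: "\<bar>W x\<bar> \<le> C" for x unfolding W_def C_def by (rule HJ_bound[OF v v' d m init])
  have C0: "0 \<le> C" using W[of 0] by linarith
  have V0: "0 \<le> V" by (rule variation_le_nonneg[OF \<phi>V(2)])
  have diff: "A.ux d v n x - B.ux d v' n x = (W x - W (x - d)) / d" for x
    using HJ_diff[OF v v' d m, of n "cell_index d x"] d
    by (simp add: W_def cell_index_diff A.ux_def B.ux_def)
  have int: "integrable lborel (\<lambda>x. W (x - a) * \<phi> (x + b))" for a b
  proof (rule integrable_bounded_box[of _ "C * 1" "-R - b" "R - b"])
    show "\<bar>W (x - a) * \<phi> (x + b)\<bar> \<le> C * 1" for x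
      unfolding abs_mult using W \<phi>b C0 by (intro mult_mono) auto
    show "W (x - a) * \<phi> (x + b) = 0" if "x \<notin> cbox (-R - b) (R - b)" for x
      using \<phi>0[of "x + b"] that by auto
  qed measurable
  have s: "(\<integral>x. W (x - d) * \<phi> x \<partial>lborel) = (\<integral>x. W x * \<phi> (x + d) \<partial>lborel)"
    using integral_translate[of "\<lambda>x. W (x - d) * \<phi> x" d] by simp
  have "(\<integral>x. (A.ux d v n x - B.ux d v' n x) * \<phi> x \<partial>lborel)
      = (\<integral>x. (W x * \<phi> x - W (x - d) * \<phi> x) / d \<partial>lborel)"
    unfolding diff by (intro Bochner_Integration.integral_cong) (auto simp: algebra_simps)
  also have "\<dots> = ((\<integral>x. W x * \<phi> x \<partial>lborel) - (\<integral>x. W x * \<phi> (x + d) \<partial>lborel)) / d"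
    using int[of 0 0] int[of d 0] s by simp
  also have "\<dots> = (\<integral>x. W x * (\<phi> x - \<phi> (x + d)) \<partial>lborel) / d"
    using int[of 0 0] int[of 0 d] by (subst Bochner_Integration.integral_diff[symmetric]) (auto simp: right_diff_distrib)
  also have "\<dots> \<le> (C * (d * V)) / d"
  proof (rule divide_right_mono)
    have int1: "integrable lborel (\<lambda>x. \<phi> (x + d) - \<phi> x)"
    proof (rule integrable_bounded_box[of _ 2 "-R - d" "R"])
      show "\<bar>\<phi> (x + d) - \<phi> x\<bar> \<le> 2" for x using \<phi>b[of x] \<phi>b[of "x + d"] by linarith
      show "\<phi> (x + d) - \<phi> x = 0" if "x \<notin> cbox (-R - d) R" for x
        using \<phi>0[of "x + d"] \<phi>0[of x] that d by auto
    qed measurable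
    have int2: "integrable lborel (\<lambda>x. W x * (\<phi> x - \<phi> (x + d)))"
      using Bochner_Integration.integrable_diff[OF int[of 0 0] int[of 0 d]] by (simp add: right_diff_distrib)
    have "ennreal (\<integral>x. \<bar>\<phi> (x + d) - \<phi> x\<bar> \<partial>lborel) = (\<integral>\<^sup>+x. ennreal \<bar>\<phi> (x + d) - \<phi> x\<bar> \<partial>lborel)"
      using int1 by (intro nn_integral_eq_integral[symmetric]) auto
    also have "\<dots> \<le> ennreal (d * V)" by (rule translation_estimate[OF \<phi> \<phi>V d])
    finally have tr: "(\<integral>x. \<bar>\<phi> (x + d) - \<phi> x\<bar> \<partial>lborel) \<le> d * V" using d V0 by simp
    have "(\<integral>x. W x * (\<phi> x - \<phi> (x + d)) \<partial>lborel) \<le> (\<integral>x. C * \<bar>\<phi> (x + d) - \<phi> x\<bar> \<partial>lborel)"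
    proof (rule integral_mono[OF int2])
      show "integrable lborel (\<lambda>x. C * \<bar>\<phi> (x + d) - \<phi> x\<bar>)" using int1 by auto
      show "W x * (\<phi> x - \<phi> (x + d)) \<le> C * \<bar>\<phi> (x + d) - \<phi> x\<bar>" for x
      proof -
        have "\<bar>W x\<bar> * \<bar>\<phi> x - \<phi> (x + d)\<bar> \<le> C * \<bar>\<phi> x - \<phi> (x + d)\<bar>" using W by (intro mult_right_mono) auto
        then show ?thesis using abs_ge_self[of "W x * (\<phi> x - \<phi> (x + d))"] by (simp add: abs_mult abs_minus_commute)
      qed
    qed
    also have "\<dots> = C * (\<integral>x. \<bar>\<phi> (x + d) - \<phi> x\<bar> \<partial>lborel)" by simp
    also have "\<dots> \<le> C * (d * V)" using tr C0 by (rule mult_left_mono)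
    finally show "(\<integral>x. W x * (\<phi> x - \<phi> (x + d)) \<partial>lborel) \<le> C * (d * V)" .
  qed (use d in simp)
  finally show ?thesis using d by (simp add: C_def)
qed

end

section \<open>Finite speed of propagation in the limit\<close>

text \<open>The scheme propagates at speed \<open>1 / lam\<close>, which may exceed \<open>2 * L\<close>.  With this weight, which is
  \<open>O(d\<^sup>2)\<close> within distance \<open>d\<close> of the cone, the mass outside the cone of speed \<open>2 * L\<close> vanishes in
  the limit.\<close>

definition cone_weight :: "real \<Rightarrow> real"
  where "cone_weight y = (max 0 y)\<^sup>2"

lemma cone_weight_measurable [measurable]: "cone_weight \<in> borel_measurable borel"
  unfolding cone_weight_def by measurable

lemma cone_weight_mono: "x \<le> y \<Longrightarrow> cone_weight x \<le> cone_weight y"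
  unfolding cone_weight_def by (intro power_mono) auto

lemma cone_weight_nonneg: "0 \<le> cone_weight y"
  by (simp add: cone_weight_def)

text \<open>For \<open>d < y\<close> the weight is quadratic and the centred difference is dominated
  by a shift of length \<open>2 * m * d\<close>, the remainder \<open>(2 * m * d)\<^sup>2\<close>
  having the good sign. Near the kink the difference is at most
  \<open>1/2 * (2 * d)\<^sup>2\<close>, which is the error \<open>2 * d\<^sup>2\<close>.\<close>

lemma cone_weight_step:
  assumes m: "0 \<le> m" "m \<le> 1/2" and d: "0 < d"
  shows "cone_weight y + m * (cone_weight (y + d) - cone_weight (y - d))
    \<le> cone_weight (y + 2 * m * d) + 2 * d\<^sup>2 * indicator {- d..d} y"
proof -
  consider "y < - d" | "- d \<le> y" "y \<le> d" | "d < y" by linarith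
  then show ?thesis
  proof cases
    case 1
    then have "max 0 y = 0" "max 0 (y + d) = 0" "max 0 (y - d) = 0" using d by auto
    then show ?thesis using cone_weight_nonneg by (simp add: cone_weight_def)
  next
    case 2
    have "cone_weight y \<le> cone_weight (y + 2 * m * d)" using m d by (intro cone_weight_mono) simp
    moreover have "m * (cone_weight (y + d) - cone_weight (y - d)) \<le> 1/2 * (2 * d)\<^sup>2"
    proof (rule mult_mono)
      have "cone_weight (y + d) \<le> cone_weight (2 * d)" using 2 by (intro cone_weight_mono) simp
      moreover have "cone_weight (2 * d) = (2 * d)\<^sup>2" using d by (simp add: cone_weight_def)
      ultimately show "cone_weight (y + d) - cone_weight (y - d) \<le> (2 * d)\<^sup>2"
        using cone_weight_nonneg[of "y - d"] by linarith
      show "0 \<le> cone_weight (y + d) - cone_weight (y - d)"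
        using cone_weight_mono[of "y - d" "y + d"] d by simp
    qed (use m in auto)
    ultimately show ?thesis using 2 by (simp add: power2_eq_square)
  next
    case 3
    have "cone_weight y = y\<^sup>2" "cone_weight (y + d) = (y + d)\<^sup>2" "cone_weight (y - d) = (y - d)\<^sup>2"
      "cone_weight (y + 2 * m * d) = (y + 2 * m * d)\<^sup>2"
      using 3 d m by (auto simp: cone_weight_def)
    moreover have "y\<^sup>2 + m * ((y + d)\<^sup>2 - (y - d)\<^sup>2) \<le> (y + 2 * m * d)\<^sup>2"
    proof -
      have "(y + 2 * m * d)\<^sup>2 = y\<^sup>2 + m * ((y + d)\<^sup>2 - (y - d)\<^sup>2) + (2 * m * d)\<^sup>2"
        by (simp add: power2_eq_square algebra_simps)
      then show ?thesis using zero_le_power2[of "2 * m * d"] by linarith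
    qed
    ultimately show ?thesis using 3 by simp
  qed
qed

context godunov_scheme
begin

text \<open>The outer states extended up to the origin. The profile is steady away from the origin,
  and the cone weight vanishes near it.\<close>

definition far :: "real \<Rightarrow> real \<Rightarrow> int \<Rightarrow> real"
  where "far uL uR j = (if j < 0 then uL else uR)"

definition dev :: "real \<Rightarrow> real \<Rightarrow> real \<Rightarrow> (real \<Rightarrow> real) \<Rightarrow> nat \<Rightarrow> real \<Rightarrow> real"
  where "dev uL uR d v n x = ux d v n x - far uL uR (cell_index d x)"

lemma dev_measurable [measurable]: "dev uL uR d v n \<in> borel_measurable borel"
  unfolding dev_def by measurable

lemma initial_data_far_range:
  assumes "initial_data lo hi X uL uR v"
  shows "far uL uR j \<in> {lo..hi}"
  using initial_dataD(2,4)[OF assms, of "- X - 1"] initial_dataD(2,5)[OF assms, of X] by (auto simp: far_def)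

lemma cell_index_sign:
  assumes "0 < d"
  shows "x \<le> - 2 * d \<Longrightarrow> cell_index d x < - 1" "2 * d \<le> x \<Longrightarrow> 1 < cell_index d x"
proof -
  assume x: "x \<le> - 2 * d"
  show "cell_index d x < - 1"
  proof (rule ccontr)
    assume "\<not> ?thesis"
    then have "- 3/2 \<le> real_of_int (cell_index d x) - 1/2" by linarith
    then have "- 3/2 * d \<le> (real_of_int (cell_index d x) - 1/2) * d" using assms by (intro mult_right_mono) auto
    then show False using cell_index_bounds(1)[OF assms, of x] x assms by linarith
  qed
next
  assume x: "2 * d \<le> x"
  show "1 < cell_index d x"
  proof (rule ccontr)
    assume "\<not> ?thesis"
    then have "real_of_int (cell_index d x) + 1/2 \<le> 3/2" by linarith
    then have "(real_of_int (cell_index d x) + 1/2) * d \<le> 3/2 * d" using assms by (intro mult_right_mono) auto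
    then show False using cell_index_bounds(2)[OF assms, of x] x assms by linarith
  qed
qed

lemma dev_bound:
  assumes "initial_data lo hi X uL uR v" "0 < d"
  shows "\<bar>dev uL uR d v n x\<bar> \<le> hi - lo"
  using ux_range[OF assms, of n x] initial_data_far_range[OF assms(1), of "cell_index d x"] by (auto simp: dev_def)

lemma dev_zero:
  assumes v: "initial_data lo hi X uL uR v" and d: "0 < d" "2 * d \<le> X" and x: "X + (real n + 1) * d \<le> \<bar>x\<bar>"
  shows "dev uL uR d v n x = 0"
proof -
  have "0 \<le> (real n + 1) * d" using d by simp
  then have big: "2 * d \<le> \<bar>x\<bar>" using x d by linarith
  show ?thesis
  proof (cases "x < 0")
    case True
    then have "x \<le> - X - (real n + 1) * d" "x \<le> - 2 * d" using x big by auto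
    then show ?thesis using ux_far_left[OF v d(1)] cell_index_sign(1)[OF d(1), of x] by (simp add: dev_def far_def)
  next
    case False
    then have "X + (real n + 1) * d \<le> x" "2 * d \<le> x" using x big by auto
    then show ?thesis using ux_far_right[OF v d(1)] cell_index_sign(2)[OF d(1), of x] by (simp add: dev_def far_def)
  qed
qed

text \<open>The Kato inequality against the outer states is tested with the weight. The entropy flux
  is at most \<open>L\<close> times the deviations in the two adjacent cells, so moving differences
  onto the weight adds \<open>lam * L\<close> times its two increments at each point. By
  \<open>cone_weight_step\<close> this amounts to enlarging the cone by \<open>2 * L\<close> times
  the time step, up to the error at the kink.\<close>

lemma cone_step:
  assumes v: "initial_data lo hi X uL uR v" and d: "0 < d" "4 * d \<le> X" and s: "X \<le> s - 2 * L * (lam * d)"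
  shows "(\<integral>x. cone_weight (\<bar>x\<bar> - s) * \<bar>dev uL uR d v (Suc n) x\<bar> \<partial>lborel)
    \<le> (\<integral>x. cone_weight (\<bar>x\<bar> - (s - 2 * L * (lam * d))) * \<bar>dev uL uR d v n x\<bar> \<partial>lborel) + 16 * d ^ 3 * (hi - lo)"
proof -
  define k where "k = far uL uR"
  define a where "a x = cone_weight (\<bar>x\<bar> - s)" for x
  define a' where "a' x = cone_weight (\<bar>x\<bar> - (s - 2 * L * (lam * d)))" for x
  define D where "D n x = \<bar>dev uL uR d v n x\<bar>" for n x
  define q where "q = qx k d v n"
  have k: "k j \<in> {lo..hi}" for j unfolding k_def by (rule initial_data_far_range[OF v])
  have [measurable]: "a \<in> borel_measurable borel" "a' \<in> borel_measurable borel" "D m \<in> borel_measurable borel"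
    "q \<in> borel_measurable borel" for m
    unfolding a_def a'_def D_def q_def using d(1) by measurable
  have D_eq: "D m x = \<bar>ux d v m x - k (cell_index d x)\<bar>" for m x by (simp add: D_def dev_def k_def)
  have D_bound: "0 \<le> D m x" "D m x \<le> hi - lo" for m x using dev_bound[OF v d(1)] by (auto simp: D_def)
  have D_zero: "D m x = 0" if "X + (real m + 1) * d \<le> \<bar>x\<bar>" for m x
    using dev_zero[OF v d(1) _ that] d by (simp add: D_def)
  have "0 \<le> 2 * L * (lam * d)" using L_nonneg lam_pos d(1) by simp
  then have sX: "X \<le> s" using s by linarith
  have a_zero: "a x = 0" if "\<bar>x\<bar> \<le> X" for x using that sX by (simp add: a_def cone_weight_def)
  have a0: "0 \<le> a x" for x by (simp add: a_def cone_weight_nonneg)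
  have kato: "a x * D (Suc n) x \<le> a x * (D n x - lam * (q x - q (x - d)))" for x
  proof (cases "\<bar>x\<bar> \<le> X")
    case True
    then show ?thesis using a_zero by simp
  next
    case False
    have "x \<le> - 2 * d \<or> 2 * d \<le> x" using False d by linarith
    then have "cell_index d x < - 1 \<or> 1 < cell_index d x" using cell_index_sign[OF d(1)] by blast
    then have "k (cell_index d x - 1) = k (cell_index d x)" "k (cell_index d x + 1) = k (cell_index d x)" "cell_index d x \<noteq> 0"
      by (auto simp: k_def far_def)
    then have "step (cell_index d x) (k (cell_index d x - 1)) (k (cell_index d x)) (k (cell_index d x + 1)) = k (cell_index d x)"
      using step_const by simp
    from ux_kato_steady[OF v d(1) k this, of n]
    have "D (Suc n) x \<le> D n x - lam * (q x - q (x - d))" by (simp only: D_eq q_def)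
    then show ?thesis using a0 by (intro mult_left_mono)
  qed
  have q_le: "\<bar>q x\<bar> \<le> L * (D n x + D n (x + d))" for x
    unfolding q_def qx_def D_eq cell_index_add[OF d(1)] using k ux_range[OF v d(1)]
    by (intro entropy_flux_abs_le[OF face_flux_lipschitz]) auto
  define R where "R = X + (real n + 3) * d"
  have q_zero: "q x = 0" if "R - d \<le> \<bar>x\<bar>" for x
  proof -
    have "X + (real n + 1) * d = R - 2 * d" by (simp add: R_def algebra_simps)
    then have "X + (real n + 1) * d \<le> \<bar>x\<bar>" "X + (real n + 1) * d \<le> \<bar>x + d\<bar>" using that d(1) by linarith+
    then show ?thesis using q_le[of x] D_zero by simp
  qed
  define C where "C = cone_weight (R + 2 * d)"
  have q_bound: "\<bar>q x\<bar> \<le> L * (2 * (hi - lo))" for x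
    by (rule order_trans[OF q_le mult_left_mono[OF _ L_nonneg]]) (use add_mono[OF D_bound(2) D_bound(2)] in simp)
  have X0: "0 < X" by (rule initial_dataD(3)[OF v])
  have wb: "cone_weight (\<bar>x\<bar> - s') \<le> C" if "\<bar>x\<bar> \<le> R + 2 * d" "0 \<le> s'" for x s'
    unfolding C_def using that by (intro cone_weight_mono) linarith
  have s0: "0 \<le> s" "0 \<le> s - 2 * L * (lam * d)" using s sX X0 by linarith+
  have C0: "0 \<le> C" by (simp add: C_def cone_weight_nonneg)
  have int_aD: "integrable lborel (\<lambda>x. cone_weight (\<bar>x + b\<bar> - s') * D m x)"
    if "m = n \<or> m = Suc n" "\<bar>b\<bar> \<le> d" "0 \<le> s'" for b s' m
  proof (rule integrable_bounded_box[of _ "C * (hi - lo)" "- R" R])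
    have z: "D m x = 0" if "R < \<bar>x\<bar>" for x
    proof (rule D_zero)
      have "(real m + 1) * d \<le> (real n + 2) * d" using \<open>m = n \<or> m = Suc n\<close> d by (intro mult_right_mono) auto
      moreover have "X + (real n + 2) * d \<le> R" using d(1) by (simp add: R_def algebra_simps)
      ultimately show "X + (real m + 1) * d \<le> \<bar>x\<bar>" using \<open>R < \<bar>x\<bar>\<close> by linarith
    qed
    show "\<bar>cone_weight (\<bar>x + b\<bar> - s') * D m x\<bar> \<le> C * (hi - lo)" for x
    proof (cases "\<bar>x\<bar> \<le> R")
      case True
      then have "cone_weight (\<bar>x + b\<bar> - s') \<le> C" using that d by (intro wb) linarith+
      then have "cone_weight (\<bar>x + b\<bar> - s') * D m x \<le> C * (hi - lo)"
        using D_bound[of m x] C0 by (intro mult_mono) auto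
      then show ?thesis using D_bound[of m x] cone_weight_nonneg[of "\<bar>x + b\<bar> - s'"] by simp
    next
      case False
      then show ?thesis using z[of x] C0 lo_less_hi by simp
    qed
    show "cone_weight (\<bar>x + b\<bar> - s') * D m x = 0" if "x \<notin> cbox (- R) R" for x
    proof -
      have "R < \<bar>x\<bar>" using that by auto
      then show ?thesis by (simp add: z)
    qed
  qed measurable
  have int_aq: "integrable lborel (\<lambda>x. a (x + b) * q (x + c))" if "\<bar>b\<bar> \<le> d" "\<bar>c\<bar> \<le> d" for b c
  proof (rule integrable_bounded_box[of _ "C * (L * (2 * (hi - lo)))" "- R" R])
    show "\<bar>a (x + b) * q (x + c)\<bar> \<le> C * (L * (2 * (hi - lo)))" for x
    proof (cases "\<bar>x\<bar> \<le> R")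
      case True
      then have "a (x + b) \<le> C" unfolding a_def using that d s0 by (intro wb) linarith+
      then show ?thesis unfolding abs_mult using q_bound[of "x + c"] C0 a0[of "x + b"] by (intro mult_mono) auto
    next
      case False
      then have "R - d \<le> \<bar>x + c\<bar>" using that by linarith
      moreover have "0 \<le> C * (L * (2 * (hi - lo)))" using C0 L_nonneg lo_less_hi by simp
      ultimately show ?thesis using q_zero by simp
    qed
    show "a (x + b) * q (x + c) = 0" if "x \<notin> cbox (- R) R" for x
    proof -
      have "R < \<bar>x\<bar>" using that by auto
      then have "R - d \<le> \<bar>x + c\<bar>" using \<open>\<bar>c\<bar> \<le> d\<close> by linarith
      then show ?thesis using q_zero by simp
    qed
  qed measurable
  have iaD: "integrable lborel (\<lambda>x. a x * D n x)" "integrable lborel (\<lambda>x. a x * D (Suc n) x)"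
    and ia'D: "integrable lborel (\<lambda>x. a' x * D n x)"
    unfolding a_def a'_def using int_aD[of _ 0 s] int_aD[of _ 0 "s - 2 * L * (lam * d)"] d s0 by auto
  have iaq: "integrable lborel (\<lambda>x. a x * q x)" "integrable lborel (\<lambda>x. a x * q (x - d))" "integrable lborel (\<lambda>x. a (x + d) * q x)"
    using int_aq[of 0 0] int_aq[of 0 "-d"] int_aq[of d 0] d by auto
  have sq: "(\<integral>x. a x * q (x - d) \<partial>lborel) = (\<integral>x. a (x + d) * q x \<partial>lborel)"
    using integral_translate[of "\<lambda>x. a x * q (x - d)" d] by simp
  have iab: "integrable lborel (\<lambda>x. \<bar>a (x + b) - a x\<bar> * D n x)" if "\<bar>b\<bar> \<le> d" for b
  proof -
    have 1: "integrable lborel (\<lambda>x. a (x + b) * D n x)" unfolding a_def using int_aD[of n b s] that s0 by auto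
    have "integrable lborel (\<lambda>x. \<bar>a (x + b) * D n x - a x * D n x\<bar>)"
      using Bochner_Integration.integrable_diff[OF 1 iaD(1)] by (rule integrable_abs)
    then show ?thesis using D_bound by (simp add: left_diff_distrib[symmetric] abs_mult)
  qed
  have iab2: "integrable lborel (\<lambda>x. \<bar>a (x + d) - a x\<bar> * D n (x + d))"
    using integrable_translate[OF iab[of "-d"], of d] d by (simp add: abs_minus_commute)
  \<comment> \<open>The entropy flux at a face involves the deviation in the right cell as well;
    translation turns it into a backward increment of the weight against the deviation at
    \<open>x\<close>.\<close>
  have sab: "(\<integral>x. \<bar>a (x + d) - a x\<bar> * D n (x + d) \<partial>lborel) = (\<integral>x. \<bar>a x - a (x - d)\<bar> * D n x \<partial>lborel)"
    using integral_translate[of "\<lambda>x. \<bar>a x - a (x - d)\<bar> * D n x" d] by simp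
  have qterm: "(\<integral>x. (a (x + d) - a x) * q x \<partial>lborel)
      \<le> L * ((\<integral>x. \<bar>a (x + d) - a x\<bar> * D n x \<partial>lborel) + (\<integral>x. \<bar>a x - a (x - d)\<bar> * D n x \<partial>lborel))"
  proof -
    have "(\<integral>x. (a (x + d) - a x) * q x \<partial>lborel) \<le> (\<integral>x. L * (\<bar>a (x + d) - a x\<bar> * D n x + \<bar>a (x + d) - a x\<bar> * D n (x + d)) \<partial>lborel)"
    proof (rule integral_mono)
      show "integrable lborel (\<lambda>x. (a (x + d) - a x) * q x)"
        using Bochner_Integration.integrable_diff[OF iaq(3) iaq(1)] by (simp add: left_diff_distrib)
      show "integrable lborel (\<lambda>x. L * (\<bar>a (x + d) - a x\<bar> * D n x + \<bar>a (x + d) - a x\<bar> * D n (x + d)))"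
        using iab[of d] iab2 d by auto
      show "(a (x + d) - a x) * q x \<le> L * (\<bar>a (x + d) - a x\<bar> * D n x + \<bar>a (x + d) - a x\<bar> * D n (x + d))" for x
      proof -
        have "(a (x + d) - a x) * q x \<le> \<bar>a (x + d) - a x\<bar> * \<bar>q x\<bar>" by (simp add: abs_mult[symmetric])
        also have "\<dots> \<le> \<bar>a (x + d) - a x\<bar> * (L * (D n x + D n (x + d)))" using q_le by (intro mult_left_mono) auto
        finally show ?thesis by (simp add: algebra_simps)
      qed
    qed
    also have "\<dots> = L * ((\<integral>x. \<bar>a (x + d) - a x\<bar> * D n x \<partial>lborel) + (\<integral>x. \<bar>a x - a (x - d)\<bar> * D n x \<partial>lborel))"
      using iab[of d] iab2 d by (simp add: sab)
    finally show ?thesis .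
  qed
  have "(\<integral>x. a x * D (Suc n) x \<partial>lborel) \<le> (\<integral>x. (a x * D n x) - lam * (a x * q x - a x * q (x - d)) \<partial>lborel)"
    using kato by (intro integral_mono iaD Bochner_Integration.integrable_diff integrable_mult_right iaq) (simp_all add: algebra_simps)
  also have "\<dots> = (\<integral>x. a x * D n x \<partial>lborel) + lam * ((\<integral>x. a (x + d) * q x \<partial>lborel) - (\<integral>x. a x * q x \<partial>lborel))"
    using iaD iaq by (simp add: sq algebra_simps)
  also have "(\<integral>x. a (x + d) * q x \<partial>lborel) - (\<integral>x. a x * q x \<partial>lborel) = (\<integral>x. (a (x + d) - a x) * q x \<partial>lborel)"
    using iaq by (simp add: left_diff_distrib)
  also have "(\<integral>x. a x * D n x \<partial>lborel) + lam * (\<integral>x. (a (x + d) - a x) * q x \<partial>lborel)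
      \<le> (\<integral>x. a x * D n x \<partial>lborel) + lam * (L * ((\<integral>x. \<bar>a (x + d) - a x\<bar> * D n x \<partial>lborel) + (\<integral>x. \<bar>a x - a (x - d)\<bar> * D n x \<partial>lborel)))"
    using qterm lam_pos by (intro add_left_mono mult_left_mono) auto
  also have "\<dots> = (\<integral>x. a x * D n x + (lam * L) * (\<bar>a (x + d) - a x\<bar> * D n x + \<bar>a x - a (x - d)\<bar> * D n x) \<partial>lborel)"
    using iaD iab[of d] iab[of "-d"] d by (simp add: abs_minus_commute)
  \<comment> \<open>The kink error is confined to neighbourhoods of the two edges \<open>s\<close>
    and \<open>- s\<close>, each of length \<open>4 * d\<close>; the total \<open>8 * d\<close>
    times \<open>2 * d\<^sup>2\<close> is the \<open>16 * d ^ 3\<close> of the statement.\<close>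
  also have "\<dots> \<le> (\<integral>x. a' x * D n x + (2 * d\<^sup>2 * (hi - lo)) * (indicator {s - 2 * d..s + 2 * d} x + indicator {- s - 2 * d..- s + 2 * d} x) \<partial>lborel)"
  proof (rule integral_mono)
    show "integrable lborel (\<lambda>x. a x * D n x + (lam * L) * (\<bar>a (x + d) - a x\<bar> * D n x + \<bar>a x - a (x - d)\<bar> * D n x))"
      using iaD iab[of d] iab[of "-d"] d by (auto simp: abs_minus_commute)
    have "integrable lborel (\<lambda>x. indicator {p..r} x :: real)" for p r :: real
      by (rule integrable_bounded_box[of _ 1 p r]) (auto split: split_indicator)
    then show "integrable lborel (\<lambda>x. a' x * D n x + (2 * d\<^sup>2 * (hi - lo)) * (indicator {s - 2 * d..s + 2 * d} x + indicator {- s - 2 * d..- s + 2 * d} x))"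
      using ia'D by auto
    fix x
    have fin: "a x * D n x + (lam * L) * (\<bar>a (x + d) - a x\<bar> * D n x + \<bar>a x - a (x - d)\<bar> * D n x)
        \<le> a' x * D n x + (2 * d\<^sup>2 * (hi - lo)) * i"
      if "a x + (lam * L) * (\<bar>a (x + d) - a x\<bar> + \<bar>a x - a (x - d)\<bar>) \<le> a' x + 2 * d\<^sup>2 * i" "0 \<le> i" for i
    proof -
      have "a x * D n x + (lam * L) * (\<bar>a (x + d) - a x\<bar> * D n x + \<bar>a x - a (x - d)\<bar> * D n x)
          = (a x + (lam * L) * (\<bar>a (x + d) - a x\<bar> + \<bar>a x - a (x - d)\<bar>)) * D n x" by (simp add: algebra_simps)
      also have "\<dots> \<le> (a' x + 2 * d\<^sup>2 * i) * D n x" using that D_bound by (intro mult_right_mono) auto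
      also have "\<dots> = a' x * D n x + (2 * d\<^sup>2 * i) * D n x" by (simp add: algebra_simps)
      also have "(2 * d\<^sup>2 * i) * D n x \<le> (2 * d\<^sup>2 * i) * (hi - lo)" using that D_bound by (intro mult_left_mono) auto
      finally show ?thesis by (simp add: mult_ac)
    qed
    show "a x * D n x + (lam * L) * (\<bar>a (x + d) - a x\<bar> * D n x + \<bar>a x - a (x - d)\<bar> * D n x)
        \<le> a' x * D n x + (2 * d\<^sup>2 * (hi - lo)) * (indicator {s - 2 * d..s + 2 * d} x + indicator {- s - 2 * d..- s + 2 * d} x)"
    proof (rule fin)
      let ?i = "indicator {s - 2 * d..s + 2 * d} x + indicator {- s - 2 * d..- s + 2 * d} x :: real"
      show "a x + (lam * L) * (\<bar>a (x + d) - a x\<bar> + \<bar>a x - a (x - d)\<bar>) \<le> a' x + 2 * d\<^sup>2 * ?i"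
      \<comment> \<open>Close to the origin \<open>x\<close> and its translates may lie on opposite
        sides, but since \<open>4 * d \<le> X\<close> all three weights vanish there.\<close>
      proof (cases "\<bar>x\<bar> < 2 * d")
        case True
        then have "a x = 0" "a (x + d) = 0" "a (x - d) = 0" using d by (auto intro!: a_zero)
        then show ?thesis by (simp add: a'_def cone_weight_nonneg)
      next
        case False
        define y where "y = \<bar>x\<bar> - s"
        have m: "0 \<le> lam * L" using lam_pos L_nonneg by simp
        have "\<bar>a (x + d) - a x\<bar> + \<bar>a x - a (x - d)\<bar> = cone_weight (y + d) - cone_weight (y - d)"
        proof (cases "0 \<le> x")
          case True
          then have "a (x + d) = cone_weight (y + d)" "a (x - d) = cone_weight (y - d)" "a x = cone_weight y"
            using False d by (auto simp: a_def y_def algebra_simps)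
          then show ?thesis using cone_weight_mono[of "y - d" y] cone_weight_mono[of y "y + d"] d by simp
        next
          case F: False
          then have "\<bar>x + d\<bar> - s = y - d" "\<bar>x - d\<bar> - s = y + d" using False d by (auto simp: y_def)
          then have "a (x + d) = cone_weight (y - d)" "a (x - d) = cone_weight (y + d)" "a x = cone_weight y"
            unfolding a_def by (simp_all only: y_def)
          then show ?thesis using cone_weight_mono[of "y - d" y] cone_weight_mono[of y "y + d"] d by simp
        qed
        then have "a x + (lam * L) * (\<bar>a (x + d) - a x\<bar> + \<bar>a x - a (x - d)\<bar>)
            = cone_weight y + (lam * L) * (cone_weight (y + d) - cone_weight (y - d))"
          by (simp add: a_def y_def)
        also have "\<dots> \<le> cone_weight (y + 2 * (lam * L) * d) + 2 * d\<^sup>2 * indicator {- d..d} y"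
          by (rule cone_weight_step[OF m cfl d(1)])
        also have "cone_weight (y + 2 * (lam * L) * d) = a' x" by (simp add: a'_def y_def algebra_simps)
        also have "2 * d\<^sup>2 * indicator {- d..d} y \<le> 2 * d\<^sup>2 * ?i"
          using d by (intro mult_left_mono) (auto simp: y_def split: split_indicator)
        finally show ?thesis by simp
      qed
    qed auto
  qed
  also have "\<dots> = (\<integral>x. a' x * D n x \<partial>lborel) + (2 * d\<^sup>2 * (hi - lo)) * (4 * d + 4 * d)"
  proof -
    have i: "integrable lborel (\<lambda>x. indicator {p..r} x :: real)" for p r :: real
      by (rule integrable_bounded_box[of _ 1 p r]) (auto split: split_indicator)
    show ?thesis using ia'D i d by simp
  qed
  finally have "(\<integral>x. a x * D (Suc n) x \<partial>lborel) \<le> (\<integral>x. a' x * D n x \<partial>lborel) + (2 * d\<^sup>2 * (hi - lo)) * (4 * d + 4 * d)" .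
  then show ?thesis unfolding a_def a'_def D_def by (simp add: power2_eq_square power3_eq_cube algebra_simps)
qed

text \<open>At the start the deviation lives in \<open>\<bar>x\<bar> < X + d\<close>, where the
  weight is at most \<open>d\<^sup>2\<close>. Each step adds an error of order \<open>d ^ 3\<close>;
  over a bounded time there are of order \<open>1 / d\<close> steps, so the total stays of order
  \<open>d\<^sup>2\<close>.\<close>

lemma cone_bound:
  assumes v: "initial_data lo hi X uL uR v" and d: "0 < d" "d \<le> 1" "4 * d \<le> X"
  shows "(\<integral>x. cone_weight (\<bar>x\<bar> - (X + 2 * L * (lam * d) * real n)) * \<bar>dev uL uR d v n x\<bar> \<partial>lborel)
    \<le> d\<^sup>2 * (hi - lo) * (2 * (X + 1)) + real n * (16 * d ^ 3 * (hi - lo))"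
proof (induction n)
  case 0
  have X: "0 < X" by (rule initial_dataD(3)[OF v])
  have le: "cone_weight (\<bar>x\<bar> - X) * \<bar>dev uL uR d v 0 x\<bar> \<le> indicator {- (X + 1)..X + 1} x * (d\<^sup>2 * (hi - lo))" for x
  proof (cases "\<bar>x\<bar> < X + d")
    case True
    then have "cone_weight (\<bar>x\<bar> - X) \<le> cone_weight d" by (intro cone_weight_mono) simp
    then have "cone_weight (\<bar>x\<bar> - X) * \<bar>dev uL uR d v 0 x\<bar> \<le> d\<^sup>2 * (hi - lo)"
      using dev_bound[OF v d(1), of 0 x] d by (intro mult_mono) (auto simp: cone_weight_def)
    moreover have "x \<in> {- (X + 1)..X + 1}" using True d(2) by auto
    ultimately show ?thesis by simp
  next
    case False
    then have "dev uL uR d v 0 x = 0" using d by (intro dev_zero[OF v d(1)]) auto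
    then show ?thesis using lo_less_hi by simp
  qed
  have i: "integrable lborel (\<lambda>x. indicator {- (X + 1)..X + 1} x * (d\<^sup>2 * (hi - lo)))"
    by (rule integrable_bounded_box[of _ "d\<^sup>2 * (hi - lo)" "- (X + 1)" "X + 1"])
      (use lo_less_hi in \<open>auto split: split_indicator\<close>)
  have "(\<integral>x. cone_weight (\<bar>x\<bar> - X) * \<bar>dev uL uR d v 0 x\<bar> \<partial>lborel) \<le> (\<integral>x. indicator {- (X + 1)..X + 1} x * (d\<^sup>2 * (hi - lo)) \<partial>lborel)"
    using i by (rule integral_mono') (use le lo_less_hi in auto)
  also have "\<dots> = (2 * (X + 1)) * (d\<^sup>2 * (hi - lo))" using X by simp
  finally show ?case by (simp add: mult_ac)
next
  case (Suc n)
  have "0 \<le> 2 * L * (lam * d) * real n" using L_nonneg lam_pos d by simp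
  then have "(\<integral>x. cone_weight (\<bar>x\<bar> - (X + 2 * L * (lam * d) * real (Suc n))) * \<bar>dev uL uR d v (Suc n) x\<bar> \<partial>lborel)
    \<le> (\<integral>x. cone_weight (\<bar>x\<bar> - (X + 2 * L * (lam * d) * real (Suc n) - 2 * L * (lam * d))) * \<bar>dev uL uR d v n x\<bar> \<partial>lborel) + 16 * d ^ 3 * (hi - lo)"
    by (intro cone_step[OF v d(1,3)]) (simp add: algebra_simps)
  also have "X + 2 * L * (lam * d) * real (Suc n) - 2 * L * (lam * d) = X + 2 * L * (lam * d) * real n"
    by (simp add: algebra_simps)
  finally show ?case using Suc by (simp add: algebra_simps)
qed

text \<open>The weighted deviations tend to zero in \<open>L\<^sup>1\<close>, while the weight for
  the limiting cone is a fixed positive number at each point outside it. There the pointwise limit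
  must be the outer state.\<close>

lemma cone_limit:
  assumes v: "initial_data lo hi X uL uR v" and d: "\<And>n. 0 < d n" "\<And>n. d n \<le> 1" "\<And>n. 4 * d n \<le> X" "d \<longlonglongrightarrow> 0"
    and t: "0 \<le> t" and z: "AE x in lborel. (\<lambda>n. godunov_approx lam (d n) f g v x t) \<longlonglongrightarrow> z x"
  shows "AE x in lborel. X + 2 * L * t < \<bar>x\<bar> \<longrightarrow> z x = (if x < 0 then uL else uR)"
proof -
  have X: "0 < X" by (rule initial_dataD(3)[OF v])
  define N where "N n = time_level (lam * d n) t" for n
  have tau: "0 < lam * d n" for n using lam_pos d by simp
  have Nt: "real (N n) * (lam * d n) \<le> t" for n unfolding N_def using time_level_bounds(1)[OF tau t] .
  define F where "F n x = cone_weight (\<bar>x\<bar> - (X + 2 * L * t)) * dev uL uR (d n) v (N n) x" for n x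
  have [measurable]: "F n \<in> borel_measurable borel" for n unfolding F_def by measurable
  define R where "R n = X + (real (N n) + 1) * d n" for n
  have wi: "integrable lborel (\<lambda>x. cone_weight (\<bar>x\<bar> - s) * \<bar>dev uL uR (d n) v (N n) x\<bar>)" if "0 \<le> s" for n s
  proof (rule integrable_bounded_box[of _ "cone_weight (R n) * (hi - lo)" "- R n" "R n"])
    have zero: "dev uL uR (d n) v (N n) x = 0" if "R n \<le> \<bar>x\<bar>" for x
    proof (rule dev_zero[OF v d(1)])
      show "2 * d n \<le> X" using d(1)[of n] d(3)[of n] by linarith
    qed (use that in \<open>simp add: R_def\<close>)
    show "\<bar>cone_weight (\<bar>x\<bar> - s) * \<bar>dev uL uR (d n) v (N n) x\<bar>\<bar> \<le> cone_weight (R n) * (hi - lo)" for x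
    proof (cases "R n \<le> \<bar>x\<bar>")
      case True
      then show ?thesis using zero lo_less_hi cone_weight_nonneg by simp
    next
      case False
      then show ?thesis unfolding abs_mult abs_idempotent abs_of_nonneg[OF cone_weight_nonneg]
        using that by (intro mult_mono cone_weight_mono dev_bound[OF v d(1)] cone_weight_nonneg) auto
    qed
    show "cone_weight (\<bar>x\<bar> - s) * \<bar>dev uL uR (d n) v (N n) x\<bar> = 0" if "x \<notin> cbox (- R n) (R n)" for x
    proof -
      have "R n \<le> \<bar>x\<bar>" using that by auto
      then show ?thesis using zero by simp
    qed
  qed measurable
  have s0: "0 \<le> X + 2 * L * t" using X L_nonneg t by simp
  have F_abs: "\<bar>F n x\<bar> = cone_weight (\<bar>x\<bar> - (X + 2 * L * t)) * \<bar>dev uL uR (d n) v (N n) x\<bar>" for n x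
    using cone_weight_nonneg by (simp add: F_def abs_mult)
  have F_int: "integrable lborel (F n)" for n
  proof -
    have "integrable lborel (\<lambda>x. \<bar>F n x\<bar>)" unfolding F_abs by (rule wi[OF s0])
    then show ?thesis by (subst (asm) integrable_abs_iff) auto
  qed
  define C where "C = (hi - lo) * (2 * (X + 1)) + 16 * (hi - lo) * (t / lam)"
  have F_le: "(\<integral>x. norm (F n x) \<partial>lborel) \<le> C * (d n)\<^sup>2" for n
  proof -
    \<comment> \<open>The discrete time is rounded down, so the discrete cone lies inside the
      limiting one and its weight is the larger of the two.\<close>
    have sn: "2 * L * (lam * d n) * real (N n) \<le> 2 * L * t"
    proof -
      have "2 * L * (real (N n) * (lam * d n)) \<le> 2 * L * t" using Nt L_nonneg by (intro mult_left_mono) auto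
      then show ?thesis by (simp add: mult_ac)
    qed
    have "0 \<le> 2 * L * (lam * d n) * real (N n)" using L_nonneg tau[of n] by simp
    then have s0': "0 \<le> X + 2 * L * (lam * d n) * real (N n)" using X by linarith
    have "(\<integral>x. norm (F n x) \<partial>lborel) \<le> (\<integral>x. cone_weight (\<bar>x\<bar> - (X + 2 * L * (lam * d n) * real (N n))) * \<bar>dev uL uR (d n) v (N n) x\<bar> \<partial>lborel)"
      unfolding real_norm_def F_abs using sn
      by (intro integral_mono wi s0 s0' mult_right_mono cone_weight_mono) auto
    also have "\<dots> \<le> (d n)\<^sup>2 * (hi - lo) * (2 * (X + 1)) + real (N n) * (16 * d n ^ 3 * (hi - lo))"
      by (rule cone_bound[OF v d(1-3)])
    also have "real (N n) * (16 * d n ^ 3 * (hi - lo)) = (16 * (hi - lo) * (d n)\<^sup>2) * (real (N n) * d n)"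
      by (simp add: power2_eq_square power3_eq_cube)
    also have "\<dots> \<le> (16 * (hi - lo) * (d n)\<^sup>2) * (t / lam)"
    proof (rule mult_left_mono)
      show "real (N n) * d n \<le> t / lam" using Nt[of n] lam_pos by (simp add: pos_le_divide_eq mult_ac)
    qed (use lo_less_hi in simp)
    finally show ?thesis by (simp add: C_def algebra_simps)
  qed
  have "(\<lambda>n. \<integral>x. norm (F n x) \<partial>lborel) \<longlonglongrightarrow> 0"
  proof (rule Lim_null_comparison)
    show "\<forall>\<^sub>F n in sequentially. norm (\<integral>x. norm (F n x) \<partial>lborel) \<le> C * (d n)\<^sup>2"
      using F_le by (simp add: integral_nonneg_AE)
    have "(\<lambda>n. C * (d n)\<^sup>2) \<longlonglongrightarrow> C * 0\<^sup>2" by (intro tendsto_intros d)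
    then show "(\<lambda>n. C * (d n)\<^sup>2) \<longlonglongrightarrow> 0" by simp
  qed
  from tendsto_L1_AE_subseq[OF F_int this] obtain r where r: "strict_mono r" "AE x in lborel. (\<lambda>n. F (r n) x) \<longlonglongrightarrow> 0" by blast
  show ?thesis using r(2) z
  proof eventually_elim
    case (elim x)
    show ?case
    proof
      assume x: "X + 2 * L * t < \<bar>x\<bar>"
      define c where "c = (if x < 0 then uL else uR)"
      have "0 \<le> 2 * L * t" using L_nonneg t by simp
      then have xX: "X < \<bar>x\<bar>" using x by linarith
      have far: "far uL uR (cell_index (d n) x) = c" for n
      proof -
        have "2 * d n \<le> \<bar>x\<bar>" using xX d(1)[of n] d(3)[of n] by linarith
        then show ?thesis using cell_index_sign[where d="d n" and x=x, OF d(1)] by (cases "x < 0") (auto simp: far_def c_def)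
      qed
      have "(\<lambda>n. cone_weight (\<bar>x\<bar> - (X + 2 * L * t)) * (godunov_approx lam (d (r n)) f g v x t - c))
          \<longlonglongrightarrow> cone_weight (\<bar>x\<bar> - (X + 2 * L * t)) * (z x - c)"
        using LIMSEQ_subseq_LIMSEQ[OF elim(2) r(1)] by (intro tendsto_intros) (simp add: o_def)
      moreover have "F (r n) x = cone_weight (\<bar>x\<bar> - (X + 2 * L * t)) * (godunov_approx lam (d (r n)) f g v x t - c)" for n
        by (simp add: F_def dev_def far godunov_approx_ux N_def)
      ultimately have "(\<lambda>n. F (r n) x) \<longlonglongrightarrow> cone_weight (\<bar>x\<bar> - (X + 2 * L * t)) * (z x - c)" by simp
      from LIMSEQ_unique[OF this elim(1)] have "cone_weight (\<bar>x\<bar> - (X + 2 * L * t)) * (z x - c) = 0" .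
      moreover have "cone_weight (\<bar>x\<bar> - (X + 2 * L * t)) \<noteq> 0" using x by (simp add: cone_weight_def)
      ultimately show "z x = (if x < 0 then uL else uR)" by (simp add: c_def)
    qed
  qed
qed

end

section \<open>Piecewise linear interpolation\<close>

lemma breakpoints_mono:
  assumes "breakpoints lo hi \<delta> K b" "i \<le> j" "j \<le> K"
  shows "b i \<le> b j"
  using assms(2,3)
proof (induction j rule: dec_induct)
  case (step n)
  then have "b i \<le> b n" by simp
  also have "b n < b (Suc n)" using assms(1) step.prems by (simp add: breakpoints_def)
  finally show ?case by simp
qed simp

lemma breakpoints_range:
  assumes "breakpoints lo hi \<delta> K b" "k \<le> K"
  shows "b k \<in> {lo..hi}"
  using breakpoints_mono[OF assms(1), of 0 k] breakpoints_mono[OF assms(1), of k K] assms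
  by (auto simp: breakpoints_def)

text \<open>At an interior breakpoint \<open>LEAST\<close> selects the cell to the left; there the
  formulas of both adjacent cells give the value of \<open>q\<close>.\<close>

lemma pl_interpolant_cell:
  assumes bp: "breakpoints lo hi \<delta> K b" and k: "k < K" and w: "w \<in> {b k..b (Suc k)}"
  shows "pl_interpolant b q w = q (b k) + (q (b (Suc k)) - q (b k)) / (b (Suc k) - b k) * (w - b k)"
proof -
  define j where "j = (LEAST k. w \<le> b (Suc k))"
  have "w \<le> b (Suc k)" using w by simp
  then have jk: "j \<le> k" and wj: "w \<le> b (Suc j)" unfolding j_def by (auto intro: Least_le LeastI)
  have lt: "b i < b (Suc i)" if "i < K" for i using bp that by (simp add: breakpoints_def)
  have pl: "pl_interpolant b q w = q (b j) + (q (b (Suc j)) - q (b j)) / (b (Suc j) - b j) * (w - b j)"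
    by (simp add: pl_interpolant_def Let_def j_def)
  show ?thesis
  proof (cases "j = k")
    case False
    then have "Suc j \<le> k" using jk by simp
    then have "b (Suc j) \<le> b k" using breakpoints_mono[OF bp, of "Suc j" k] k by simp
    then have "w = b k" "w = b (Suc j)" using w wj by auto
    then show ?thesis unfolding pl using lt[of j] False jk k by simp
  qed (simp add: pl)
qed

lemma breakpoints_cell:
  assumes bp: "breakpoints lo hi \<delta> K b" and w: "w \<in> {lo..hi}" and "lo < hi"
  obtains k where "k < K" "w \<in> {b k..b (Suc k)}"
proof -
  have K: "0 < K" using bp \<open>lo < hi\<close> by (cases K) (auto simp: breakpoints_def)
  define j where "j = (LEAST k. w \<le> b (Suc k))"
  have "w \<le> b (Suc (K - 1))" using bp w K by (simp add: breakpoints_def)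
  then have j: "j \<le> K - 1" "w \<le> b (Suc j)" unfolding j_def by (auto intro: Least_le LeastI)
  have "b j \<le> w"
  proof (cases j)
    case 0
    then show ?thesis using bp w by (simp add: breakpoints_def)
  next
    case (Suc i)
    then have "\<not> w \<le> b (Suc i)" using not_less_Least[of i "\<lambda>k. w \<le> b (Suc k)"] by (simp add: j_def)
    then show ?thesis using Suc by simp
  qed
  then show thesis using that[of j] j K by auto
qed

lemma pl_interpolant_endpoints:
  assumes bp: "breakpoints lo hi \<delta> K b" and "lo < hi"
  shows "pl_interpolant b q lo = q lo" "pl_interpolant b q hi = q hi"
proof -
  have K: "0 < K" using bp \<open>lo < hi\<close> by (cases K) (auto simp: breakpoints_def)
  have b: "b 0 = lo" "b K = hi" "\<And>k. k < K \<Longrightarrow> b k < b (Suc k)" using bp by (auto simp: breakpoints_def)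
  show "pl_interpolant b q lo = q lo"
    using pl_interpolant_cell[OF bp, of 0 lo q] K b(1) b(3)[of 0] by simp
  have "Suc (K - 1) = K" using K by simp
  then show "pl_interpolant b q hi = q hi"
    using pl_interpolant_cell[OF bp, of "K - 1" hi q] K b(2) b(3)[of "K - 1"] by simp
qed

text \<open>Chord slopes of an \<open>L\<close>-Lipschitz function are at most \<open>L\<close>, and
  the constant is kept when adjacent cells are glued. So the interpolated fluxes share the CFL bound
  and the cone of the original ones.\<close>

lemma pl_interpolant_lipschitz:
  assumes bp: "breakpoints lo hi \<delta> K b" and q: "L-lipschitz_on {lo..hi} q"
  shows "L-lipschitz_on {lo..hi} (pl_interpolant b q)"
proof -
  have L: "0 \<le> L" by (rule lipschitz_on_nonneg[OF q])
  have "L-lipschitz_on {b 0..b m} (pl_interpolant b q)" if "m \<le> K" for m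
    using that
  proof (induction m)
    case 0
    then show ?case using L by (simp add: lipschitz_on_def)
  next
    case (Suc m)
    have lt: "b m < b (Suc m)" using bp Suc.prems by (simp add: breakpoints_def)
    define s where "s = (q (b (Suc m)) - q (b m)) / (b (Suc m) - b m)"
    have "\<bar>q (b (Suc m)) - q (b m)\<bar> \<le> L * (b (Suc m) - b m)"
      using lipschitz_onD[OF q breakpoints_range[OF bp, of "Suc m"] breakpoints_range[OF bp, of m]] Suc.prems lt
      by (simp add: dist_real_def)
    then have s: "\<bar>s\<bar> \<le> L" using lt by (simp add: s_def divide_le_eq)
    have cell: "L-lipschitz_on {b m..b (Suc m)} (pl_interpolant b q)"
    proof (rule lipschitz_onI[OF _ L])
      fix x y assume xy: "x \<in> {b m..b (Suc m)}" "y \<in> {b m..b (Suc m)}"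
      have "pl_interpolant b q x - pl_interpolant b q y = s * (x - y)"
      proof -
        have "pl_interpolant b q z = q (b m) + s * (z - b m)" if "z \<in> {b m..b (Suc m)}" for z
          unfolding s_def by (rule pl_interpolant_cell[OF bp _ that]) (use Suc.prems in simp)
        then show ?thesis using xy by (simp add: right_diff_distrib)
      qed
      then show "dist (pl_interpolant b q x) (pl_interpolant b q y) \<le> L * dist x y"
        using s by (simp add: dist_real_def abs_mult mult_right_mono)
    qed
    from lipschitz_on_concat[OF Suc.IH cell] Suc.prems show ?case by simp
  qed
  from this[of K] show ?thesis using bp by (simp add: breakpoints_def)
qed

lemma C2_on_derivatives:
  assumes "C2_on {lo..hi} q" "t \<in> {lo<..<hi}"
  shows "(q has_real_derivative deriv_on {lo..hi} q t) (at t)"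
    and "(deriv_on {lo..hi} q has_real_derivative deriv_on {lo..hi} (deriv_on {lo..hi} q) t) (at t)"
proof -
  have D: "(p has_real_derivative deriv_on {lo..hi} p t) (at t)" if "p differentiable_on {lo..hi}" for p
  proof -
    have "p differentiable (at t within {lo..hi})" using that assms(2) by (auto simp: differentiable_on_def)
    then have "(p has_vector_derivative deriv_on {lo..hi} p t) (at t within {lo..hi})"
      unfolding deriv_on_def by (simp add: vector_derivative_works)
    moreover have "at t within {lo..hi} = at t" using assms(2) by (intro at_within_interior) simp
    ultimately show ?thesis by (simp add: has_real_derivative_iff_has_vector_derivative)
  qed
  show "(q has_real_derivative deriv_on {lo..hi} q t) (at t)"
    "(deriv_on {lo..hi} q has_real_derivative deriv_on {lo..hi} (deriv_on {lo..hi} q) t) (at t)"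
    using assms(1) D unfolding C2_on_def by blast+
qed

text \<open>\<open>k\<close> is chosen such that the interpolation error minus
  \<open>k * ((t - a) * (t - c))\<close> vanishes at \<open>a\<close>, \<open>w\<close> and
  \<open>c\<close>. Rolle's theorem gives two zeros of the first derivative and one of the second,
  whence \<open>\<bar>k\<bar> \<le> M / 2\<close>. Together with
  \<open>(w - a) * (c - w) \<le> (c - a)\<^sup>2 / 4\<close> this is the factor one eighth in
  \<open>C1\<close>.\<close>

lemma linear_interpolation_error:
  assumes q: "C2_on {lo..hi} q" and ac: "lo \<le> a" "a < c" "c \<le> hi" and w: "w \<in> {a..c}"
    and M: "\<And>t. t \<in> {lo..hi} \<Longrightarrow> \<bar>deriv_on {lo..hi} (deriv_on {lo..hi} q) t\<bar> \<le> M"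
  shows "\<bar>q w - (q a + (q c - q a) / (c - a) * (w - a))\<bar> \<le> M * (c - a)\<^sup>2 / 8"
proof -
  define q1 where "q1 = deriv_on {lo..hi} q"
  define q2 where "q2 = deriv_on {lo..hi} q1"
  have D1: "(q has_real_derivative q1 t) (at t)" and D2: "(q1 has_real_derivative q2 t) (at t)" if "t \<in> {a<..<c}" for t
    using C2_on_derivatives[OF q, of t] that ac by (auto simp: q1_def q2_def)
  define s where "s = (q c - q a) / (c - a)"
  have sc: "q a + s * (c - a) = q c" using ac by (simp add: s_def)
  have M0: "0 \<le> M" using M[of a] ac by force
  show ?thesis
  proof (cases "w = a \<or> w = c")
    case True
    then show ?thesis using sc M0 by (auto simp: s_def[symmetric])
  next
    case False
    then have w': "a < w" "w < c" using w by auto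
    define k where "k = (q w - (q a + s * (w - a))) / ((w - a) * (w - c))"
    define p where "p t = q t - (q a + s * (t - a)) - k * ((t - a) * (t - c))" for t
    define p1 where "p1 t = q1 t - s - k * (2 * t - a - c)" for t
    have pz: "p a = 0" "p c = 0" "p w = 0" using sc w' by (auto simp: p_def k_def)
    have cont_q: "continuous_on {a..c} q"
      using q ac unfolding C2_on_def by (auto intro: continuous_on_subset differentiable_imp_continuous_on)
    have cont_p: "continuous_on {x..y} p" if "a \<le> x" "y \<le> c" for x y
      unfolding p_def using that by (intro continuous_intros continuous_on_subset[OF cont_q]) auto
    have Dp: "(p has_real_derivative p1 t) (at t)" if "t \<in> {a<..<c}" for t
      unfolding p_def p1_def by (rule derivative_eq_intros D1[OF that] refl)+ (simp add: algebra_simps)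
    have Dp1: "(p1 has_real_derivative q2 t - 2 * k) (at t)" if "t \<in> {a<..<c}" for t
      unfolding p1_def by (rule derivative_eq_intros D2[OF that] refl)+ simp
    obtain x1 where x1: "a < x1" "x1 < w" "p1 x1 = 0"
    proof -
      have "\<exists>z. a < z \<and> z < w \<and> DERIV p z :> 0"
      proof (rule Rolle[OF w'(1) _ cont_p])
        show "p differentiable at t" if "a < t" "t < w" for t
          using Dp[of t] that w' by (auto simp: real_differentiable_def)
      qed (use pz w' in simp_all)
      then obtain z where "a < z" "z < w" "DERIV p z :> 0" by blast
      moreover from this have "p1 z = 0" using w' by (intro DERIV_unique[OF Dp]) auto
      ultimately show ?thesis using that[of z] by simp
    qed
    obtain x2 where x2: "w < x2" "x2 < c" "p1 x2 = 0"
    proof -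
      have "\<exists>z. w < z \<and> z < c \<and> DERIV p z :> 0"
      proof (rule Rolle[OF w'(2) _ cont_p])
        show "p differentiable at t" if "w < t" "t < c" for t
          using Dp[of t] that w' by (auto simp: real_differentiable_def)
      qed (use pz w' in simp_all)
      then obtain z where "w < z" "z < c" "DERIV p z :> 0" by blast
      moreover from this have "p1 z = 0" using w' by (intro DERIV_unique[OF Dp]) auto
      ultimately show ?thesis using that[of z] by simp
    qed
    have x12: "x1 < x2" using x1 x2 by linarith
    obtain x3 where x3: "x1 < x3" "x3 < x2" "q2 x3 - 2 * k = 0"
    proof -
      have c1: "continuous_on {x1..x2} p1"
      proof (intro continuous_at_imp_continuous_on ballI)
        fix t assume "t \<in> {x1..x2}"
        then show "isCont p1 t" using x1 x2 by (intro DERIV_isCont[OF Dp1]) auto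
      qed
      have "\<exists>z. x1 < z \<and> z < x2 \<and> DERIV p1 z :> 0"
      proof (rule Rolle[OF x12 _ c1])
        show "p1 differentiable at t" if "x1 < t" "t < x2" for t
          using Dp1[of t] that x1 x2 by (auto simp: real_differentiable_def)
      qed (use x1 x2 in simp)
      then obtain z where "x1 < z" "z < x2" "DERIV p1 z :> 0" by blast
      moreover from this have "q2 z - 2 * k = 0" using x1 x2 by (intro DERIV_unique[OF Dp1]) auto
      ultimately show ?thesis using that[of z] by simp
    qed
    have "\<bar>q2 x3\<bar> \<le> M" unfolding q2_def q1_def using x1 x2 x3 ac w' by (intro M) auto
    then have k: "\<bar>k\<bar> \<le> M / 2" using x3 by linarith
    have wn: "(w - a) * (w - c) \<noteq> 0" using w' by simp
    then have "q w - (q a + s * (w - a)) = k * ((w - a) * (w - c))"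
      using nonzero_mult_div_cancel_right[OF wn, of "q w - (q a + s * (w - a))"]
      unfolding k_def by (simp only: times_divide_eq_left)
    then have "\<bar>q w - (q a + s * (w - a))\<bar> = \<bar>k\<bar> * ((w - a) * (c - w))"
      using w' by (simp add: abs_mult)
    also have "\<dots> \<le> M / 2 * ((c - a)\<^sup>2 / 4)"
    proof (rule mult_mono[OF k])
      have "0 \<le> ((w - a) - (c - w))\<^sup>2" by simp
      then show "(w - a) * (c - w) \<le> (c - a)\<^sup>2 / 4" by (simp add: power2_eq_square algebra_simps)
    qed (use M0 w' in auto)
    finally show ?thesis by (simp add: s_def)
  qed
qed

lemma C2_on_sup_norm:
  assumes "C2_on {lo..hi} q" "t \<in> {lo..hi}"
  shows "\<bar>deriv_on {lo..hi} (deriv_on {lo..hi} q) t\<bar> \<le> sup_norm_on {lo..hi} (deriv_on {lo..hi} (deriv_on {lo..hi} q))"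
proof -
  let ?q = "deriv_on {lo..hi} (deriv_on {lo..hi} q)"
  have "continuous_on {lo..hi} (\<lambda>x. \<bar>?q x\<bar>)" using assms(1) by (auto simp: C2_on_def intro: continuous_intros)
  then have "bdd_above ((\<lambda>x. \<bar>?q x\<bar>) ` {lo..hi})"
    by (intro bounded_imp_bdd_above compact_imp_bounded compact_continuous_image) auto
  then show ?thesis unfolding sup_norm_on_def using assms(2) by (intro cSUP_upper) auto
qed

lemma pl_interpolant_error:
  assumes bp: "breakpoints lo hi \<delta> K b" and q: "C2_on {lo..hi} q" and w: "w \<in> {lo..hi}" and "lo < hi"
  shows "\<bar>q w - pl_interpolant b q w\<bar> \<le> sup_norm_on {lo..hi} (deriv_on {lo..hi} (deriv_on {lo..hi} q)) * \<delta>\<^sup>2 / 8"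
proof -
  let ?M = "sup_norm_on {lo..hi} (deriv_on {lo..hi} (deriv_on {lo..hi} q))"
  obtain k where k: "k < K" "w \<in> {b k..b (Suc k)}" using breakpoints_cell[OF bp w \<open>lo < hi\<close>] .
  have b: "lo \<le> b k" "b k < b (Suc k)" "b (Suc k) \<le> hi" "b (Suc k) - b k \<le> \<delta>"
    using breakpoints_range[OF bp, of k] breakpoints_range[OF bp, of "Suc k"] bp k(1) by (auto simp: breakpoints_def)
  have M0: "0 \<le> ?M" using order_trans[OF abs_ge_zero C2_on_sup_norm[OF q w]] .
  have "\<bar>q w - pl_interpolant b q w\<bar> \<le> ?M * (b (Suc k) - b k)\<^sup>2 / 8"
    unfolding pl_interpolant_cell[OF bp k] by (rule linear_interpolation_error[OF q b(1-3) k(2) C2_on_sup_norm[OF q]])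
  also have "\<dots> \<le> ?M * \<delta>\<^sup>2 / 8"
    using b M0 by (intro divide_right_mono mult_left_mono power_mono) auto
  finally show ?thesis .
qed

section \<open>The error estimate\<close>

text \<open>Averages preserve the mass of each cell, so the primitive of the error vanishes at all
  cell ends. Inside a cell the integrand is at most the oscillation of \<open>v\<close>, which is at
  most \<delta>, on a length of at most \<delta>. This \<open>\<delta>\<^sup>2\<close> is the
  summand 1 in \<open>C1\<close>.\<close>

lemma cell_average_primitive_bound:
  fixes v v' :: "real \<Rightarrow> real"
  assumes v: "initial_data lo hi X uL uR v" and v': "initial_data lo hi X uL uR v'"
    and [measurable]: "v \<in> borel_measurable borel" "v' \<in> borel_measurable borel"
    and \<delta>: "0 < \<delta>" and z: "z 0 = - X" "z N = X"
    and cell: "\<And>i. i < N \<Longrightarrow> z i < z (Suc i)" "\<And>i. i < N \<Longrightarrow> z (Suc i) - z i \<le> \<delta>"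
    and TV: "\<And>i. i < N \<Longrightarrow> TV_on {z i<..<z (Suc i)} v \<le> ennreal \<delta>"
    and avg: "\<And>i. i < N \<Longrightarrow> AE x in lborel. x \<in> {z i<..<z (Suc i)} \<longrightarrow>
      v' x = (\<integral>y. indicator {z i..z (Suc i)} y * v y \<partial>lborel) / (z (Suc i) - z i)"
  shows "\<bar>\<integral>y. indicator {..x} y * (v y - v' y) \<partial>lborel\<bar> \<le> \<delta>\<^sup>2"
proof -
  define P where "P x = (\<integral>y. indicator {..x} y * (v y - v' y) \<partial>lborel)" for x
  define M where "M = max \<bar>lo\<bar> \<bar>hi\<bar>"
  have M: "\<bar>v y\<bar> \<le> M" "\<bar>v' y\<bar> \<le> M" for y
    using initial_dataD(2)[OF v, of y] initial_dataD(2)[OF v', of y] by (auto simp: M_def)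
  have M0: "0 \<le> M" by (simp add: M_def)
  have D0: "v y - v' y = 0" if "y \<notin> {-X..X}" for y
    using that initial_dataD(4,5)[OF v, of y] initial_dataD(4,5)[OF v', of y] by (cases "y < -X") auto
  have Db: "\<bar>v y - v' y\<bar> \<le> 2 * M" for y using M[of y] by linarith
  have int: "integrable lborel (\<lambda>y. indicator S y * (v y - v' y))" if [measurable]: "S \<in> sets borel" for S
  proof (rule integrable_bounded_box[of _ "2 * M" "-X" X])
    show "\<bar>indicator S y * (v y - v' y)\<bar> \<le> 2 * M" for y
      using Db[of y] M0 by (auto split: split_indicator)
    show "indicator S y * (v y - v' y) = 0" if "y \<notin> cbox (-X) X" for y using D0[of y] that by simp
  qed measurable
  have intb: "integrable lborel (\<lambda>y. indicator {a..b} y * w y)"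
    if "w \<in> borel_measurable borel" "\<And>y. \<bar>w y\<bar> \<le> M'" for w :: "real \<Rightarrow> real" and a b M'
  proof (rule integrable_bounded_box[of _ M' a b])
    have "0 \<le> M'" using that(2)[of 0] by linarith
    then show "\<bar>indicator {a..b} y * w y\<bar> \<le> M'" for y using that(2)[of y] by (auto split: split_indicator)
    show "(\<lambda>y. indicator {a..b} y * w y) \<in> borel_measurable borel" using that(1) by measurable
  qed auto
  have step: "P b = P a + (\<integral>y. indicator {a..b} y * (v y - v' y) \<partial>lborel)" if "a \<le> b" for a b
  proof -
    have "AE y in lborel. y \<noteq> a" by (rule AE_lborel_singleton)
    then have "AE y in lborel. indicator {..b} y * (v y - v' y) = indicator {..a} y * (v y - v' y) + indicator {a..b} y * (v y - v' y)"
      by eventually_elim (use that in \<open>auto split: split_indicator\<close>)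
    then have "P b = (\<integral>y. indicator {..a} y * (v y - v' y) + indicator {a..b} y * (v y - v' y) \<partial>lborel)"
      unfolding P_def by (intro integral_cong_AE) auto
    also have "\<dots> = P a + (\<integral>y. indicator {a..b} y * (v y - v' y) \<partial>lborel)"
      unfolding P_def by (rule Bochner_Integration.integral_add[OF int int]) auto
    finally show ?thesis .
  qed
  define A where "A i = (\<integral>y. indicator {z i..z (Suc i)} y * v y \<partial>lborel) / (z (Suc i) - z i)" for i
  have part: "(\<integral>y. indicator {a..b} y * (v y - v' y) \<partial>lborel) = (\<integral>y. indicator {a..b} y * (v y - A i) \<partial>lborel)"
    if i: "i < N" and ab: "z i \<le> a" "b \<le> z (Suc i)" for i a b
  proof (rule integral_cong_AE)
    have "AE y in lborel. y \<noteq> z i" "AE y in lborel. y \<noteq> z (Suc i)" by (rule AE_lborel_singleton)+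
    then show "AE y in lborel. indicator {a..b} y * (v y - v' y) = indicator {a..b} y * (v y - A i)"
      using avg[OF i] by eventually_elim (use ab in \<open>auto simp: A_def split: split_indicator\<close>)
  qed auto
  have Pz: "P (z i) = 0" if "i \<le> N" for i
    using that
  proof (induction i)
    case 0
    have "AE y in lborel. y \<noteq> - X" by (rule AE_lborel_singleton)
    then have "AE y in lborel. indicator {..- X} y * (v y - v' y) = 0"
      by eventually_elim (use D0 in \<open>auto split: split_indicator\<close>)
    then show ?case unfolding P_def z(1) by (intro integral_eq_zero_AE)
  next
    case (Suc i)
    then have i: "i < N" by simp
    have i1: "integrable lborel (\<lambda>y. indicator {z i..z (Suc i)} y * v y)" by (rule intb[OF _ M(1)]) auto
    have i2: "integrable lborel (\<lambda>y. indicator {z i..z (Suc i)} y * A i)" by (rule intb[of "\<lambda>_. A i" "\<bar>A i\<bar>"]) auto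
    have "(\<integral>y. indicator {z i..z (Suc i)} y * (v y - A i) \<partial>lborel)
        = (\<integral>y. indicator {z i..z (Suc i)} y * v y \<partial>lborel) - (\<integral>y. indicator {z i..z (Suc i)} y * A i \<partial>lborel)"
      unfolding right_diff_distrib by (rule Bochner_Integration.integral_diff[OF i1 i2])
    also have "\<dots> = 0" using cell(1)[OF i] by (simp add: A_def)
    finally show ?case
      using step[of "z i" "z (Suc i)"] part[OF i, of "z i" "z (Suc i)"] cell(1)[OF i] Suc by simp
  qed
  have osc: "\<bar>P x\<bar> \<le> \<delta>\<^sup>2" if i: "i < N" and x: "x \<in> {z i..z (Suc i)}" for i x
  proof (rule field_le_epsilon)
    fix e :: real assume e: "0 < e"
    define l where "l = z (Suc i) - z i"
    have l: "0 < l" "l \<le> \<delta>" using cell[OF i] by (auto simp: l_def)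
    \<comment> \<open>The slack \<open>e / \<delta>\<close> is multiplied by a cell length of at
      most \<delta>, which leaves \<open>e\<close>. Two-point lists turn the variation bound into an
      oscillation bound on the open cell.\<close>
    obtain w where w: "AE y in lborel. y \<in> {z i<..<z (Suc i)} \<longrightarrow> w y = v y" "variation_le {z i<..<z (Suc i)} w (\<delta> + e / \<delta>)"
      using TV_on_representative[OF TV[OF i], of "e / \<delta>"] \<delta> e by auto
    have w_osc: "\<bar>w y - w y'\<bar> \<le> \<delta> + e / \<delta>" if "y \<in> {z i<..<z (Suc i)}" "y' \<in> {z i<..<z (Suc i)}" for y y'
    proof (cases "y \<le> y'")
      case True
      then show ?thesis using variation_leD[OF w(2), of "[y, y']"] that by (simp add: abs_minus_commute)
    next
      case False
      then show ?thesis using variation_leD[OF w(2), of "[y', y]"] that by simp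
    qed
    have ae: "AE y in lborel. y \<noteq> z i \<and> y \<noteq> z (Suc i)"
      using AE_lborel_singleton[of "z i"] AE_lborel_singleton[of "z (Suc i)"] by eventually_elim simp
    have dev: "\<bar>v y - A i\<bar> \<le> \<delta> + e / \<delta>" if y: "y \<in> {z i<..<z (Suc i)}" "w y = v y" for y
    proof -
      have i1: "integrable lborel (\<lambda>y. indicator {z i..z (Suc i)} y * v y)" by (rule intb[OF _ M(1)]) auto
      have i2: "integrable lborel (\<lambda>s. indicator {z i..z (Suc i)} s * v y)" by (rule intb[of "\<lambda>_. v y" "\<bar>v y\<bar>"]) auto
      have i3: "integrable lborel (\<lambda>s. indicator {z i..z (Suc i)} s * (\<delta> + e / \<delta>))"
        by (rule intb[of "\<lambda>_. \<delta> + e / \<delta>" "\<bar>\<delta> + e / \<delta>\<bar>"]) auto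
      have "l * (v y - A i) = (\<integral>s. indicator {z i..z (Suc i)} s * v y \<partial>lborel) - (\<integral>s. indicator {z i..z (Suc i)} s * v s \<partial>lborel)"
      proof -
        have "(\<integral>s. indicator {z i..z (Suc i)} s * v y \<partial>lborel) = l * v y" using cell(1)[OF i] by (simp add: l_def less_imp_le)
        moreover have "l * A i = (\<integral>s. indicator {z i..z (Suc i)} s * v s \<partial>lborel)"
          using l by (simp add: A_def l_def[symmetric])
        ultimately show ?thesis by (simp only: right_diff_distrib)
      qed
      also have "\<dots> = (\<integral>s. indicator {z i..z (Suc i)} s * v y - indicator {z i..z (Suc i)} s * v s \<partial>lborel)"
        by (rule Bochner_Integration.integral_diff[OF i2 i1, symmetric])
      finally have "\<bar>l * (v y - A i)\<bar> \<le> (\<integral>s. \<bar>indicator {z i..z (Suc i)} s * v y - indicator {z i..z (Suc i)} s * v s\<bar> \<partial>lborel)"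
        by (simp only: integral_abs_bound)
      also have "\<dots> \<le> (\<integral>s. indicator {z i..z (Suc i)} s * (\<delta> + e / \<delta>) \<partial>lborel)"
      proof (rule integral_mono_AE)
        show "integrable lborel (\<lambda>s. \<bar>indicator {z i..z (Suc i)} s * v y - indicator {z i..z (Suc i)} s * v s\<bar>)"
          using Bochner_Integration.integrable_diff[OF i2 i1] by (rule integrable_abs)
        show "AE s in lborel. \<bar>indicator {z i..z (Suc i)} s * v y - indicator {z i..z (Suc i)} s * v s\<bar> \<le> indicator {z i..z (Suc i)} s * (\<delta> + e / \<delta>)"
          using w(1) ae
        proof eventually_elim
          case (elim s)
          show ?case
          proof (cases "s \<in> {z i..z (Suc i)}")
            case True
            then have "s \<in> {z i<..<z (Suc i)}" using elim(2) by auto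
            then show ?thesis using w_osc[OF y(1), of s] elim(1) y(2) True by simp
          qed simp
        qed
      qed (rule i3)
      also have "\<dots> = l * (\<delta> + e / \<delta>)" using l by (simp add: l_def)
      finally show ?thesis using l by (simp add: abs_mult)
    qed
    have i4: "integrable lborel (\<lambda>y. indicator {z i..x} y * (v y - A i))"
    proof (rule intb)
      show "\<bar>v y - A i\<bar> \<le> M + \<bar>A i\<bar>" for y using M(1)[of y] by linarith
    qed measurable
    have i5: "integrable lborel (\<lambda>y. indicator {z i..x} y * (\<delta> + e / \<delta>))"
      by (rule intb[of "\<lambda>_. \<delta> + e / \<delta>" "\<bar>\<delta> + e / \<delta>\<bar>"]) auto
    have "P x = (\<integral>y. indicator {z i..x} y * (v y - A i) \<partial>lborel)"
      using step[of "z i" x] part[OF i, of "z i" x] Pz[of i] i x by simp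
    then have "\<bar>P x\<bar> \<le> (\<integral>y. \<bar>indicator {z i..x} y * (v y - A i)\<bar> \<partial>lborel)" by (simp only: integral_abs_bound)
    also have "\<dots> \<le> (\<integral>y. indicator {z i..x} y * (\<delta> + e / \<delta>) \<partial>lborel)"
    proof (rule integral_mono_AE)
      show "integrable lborel (\<lambda>y. \<bar>indicator {z i..x} y * (v y - A i)\<bar>)" using i4 by (rule integrable_abs)
      show "AE y in lborel. \<bar>indicator {z i..x} y * (v y - A i)\<bar> \<le> indicator {z i..x} y * (\<delta> + e / \<delta>)"
        using w(1) ae
      proof eventually_elim
        case (elim y)
        show ?case
        proof (cases "y \<in> {z i..x}")
          case True
          then have "y \<in> {z i<..<z (Suc i)}" using elim(2) x by auto
          then show ?thesis using dev[of y] elim(1) True by simp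
        qed simp
      qed
    qed (rule i5)
    also have "\<dots> = (x - z i) * (\<delta> + e / \<delta>)" using x by simp
    also have "\<dots> \<le> \<delta> * (\<delta> + e / \<delta>)" using x l \<delta> e by (intro mult_right_mono) (auto simp: l_def)
    also have "\<dots> = \<delta>\<^sup>2 + e" using \<delta> by (simp add: power2_eq_square distrib_left)
    finally show "\<bar>P x\<bar> \<le> \<delta>\<^sup>2 + e" .
  qed
  have "\<bar>P x\<bar> \<le> \<delta>\<^sup>2" for x
  proof -
    consider "x < - X" | "X < x" | "x \<in> {-X..X}" by fastforce
    then show ?thesis
    proof cases
      case 1
      have "P x = (\<integral>y. 0 \<partial>(lborel::real measure))"
        unfolding P_def using 1 D0 by (intro Bochner_Integration.integral_cong) (auto split: split_indicator)
      then show ?thesis by simp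
    next
      case 2
      have "AE y in lborel. y \<noteq> X" by (rule AE_lborel_singleton)
      then have "AE y in lborel. indicator {X..x} y * (v y - v' y) = 0"
        by eventually_elim (use D0 in \<open>auto split: split_indicator\<close>)
      then have "(\<integral>y. indicator {X..x} y * (v y - v' y) \<partial>lborel) = 0" by (intro integral_eq_zero_AE)
      then show ?thesis using step[of X x] Pz[of N] z 2 by simp
    next
      case 3
      have "\<exists>i<N. x \<in> {z i..z (Suc i)}"
      proof -
        have "x \<le> z m \<longrightarrow> (\<exists>i<m. x \<in> {z i..z (Suc i)}) \<or> x = z 0" if "m \<le> N" for m
          using that
        proof (induction m)
          case 0
          then show ?case using 3 z by auto
        next
          case (Suc m)
          show ?case
          proof (cases "x \<le> z m")
            case True
            then show ?thesis using Suc by (auto intro: less_SucI)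
          next
            case False
            then show ?thesis by (auto intro!: exI[of _ m])
          qed
        qed
        from this[of N] have "(\<exists>i<N. x \<in> {z i..z (Suc i)}) \<or> x = z 0" using 3 z by auto
        moreover have "0 < N" using z initial_dataD(3)[OF v] by (cases N) auto
        moreover have "z 0 \<in> {z 0..z (Suc 0)}" using cell(1)[of 0] \<open>0 < N\<close> by simp
        ultimately show ?thesis by blast
      qed
      then show ?thesis using osc by blast
    qed
  qed
  then show ?thesis by (simp add: P_def)
qed

text \<open>The choice \<open>s = sqrt (p / q)\<close> makes both terms equal to
  \<open>sqrt (p * q)\<close>. For \<open>p = 0\<close> this \<open>s\<close> would be zero, so
  \<open>s\<close> is sent to zero instead.\<close>

lemma optimize_parameter:
  fixes I p q c :: real
  assumes "\<And>s. 0 < s \<Longrightarrow> I \<le> p / s + q * s + c" "0 \<le> p" "0 < q"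
  shows "I \<le> 2 * sqrt (p * q) + c"
proof (cases "p = 0")
  case True
  have "I \<le> c + e" if "0 < e" for e
    using assms(1)[of "e / q"] that assms(3) True by simp
  then show ?thesis using True by (simp add: field_le_epsilon)
next
  case False
  then have p: "0 < p" using assms(2) by simp
  define s where "s = sqrt (p / q)"
  have s: "0 < s" using p assms(3) by (simp add: s_def)
  have "s * s = p / q" using p assms(3) by (simp add: s_def)
  have "q * s = sqrt (p * q)"
  proof -
    have "q * s = sqrt (q\<^sup>2) * sqrt (p / q)" using assms(3) by (simp add: s_def)
    also have "\<dots> = sqrt (q\<^sup>2 * (p / q))" by (rule real_sqrt_mult[symmetric])
    also have "q\<^sup>2 * (p / q) = p * q" using assms(3) by (simp add: power2_eq_square)
    finally show ?thesis .
  qed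
  moreover have "p / s = q * s" using \<open>s * s = p / q\<close> s assms(3) by (simp add: field_simps)
  ultimately show ?thesis using assms(1)[OF s] by simp
qed

text \<open>Below the level \<open>s\<close> the pairing is \<open>w\<^sup>2 / s\<close>, and
  \<open>(2 * \<bar>w\<bar> - s)\<^sup>2 \<ge> 0\<close> bounds the loss by \<open>s / 4\<close>;
  from the level on there is no loss.\<close>

lemma clamp_pairing:
  fixes w s :: real
  assumes "0 < s"
  shows "\<bar>w\<bar> \<le> w * max (-1) (min 1 (w / s)) + s / 4"
proof -
  consider "s \<le> w" | "w \<le> - s" | "- s < w" "w < s" by linarith
  then show ?thesis
  proof cases
    case 1
    then have "1 \<le> w / s" using assms by simp
    then show ?thesis using 1 assms by simp
  next
    case 2
    then have "w / s \<le> - 1" using assms by (simp add: divide_le_eq)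
    then have "max (-1) (min 1 (w / s)) = - 1" by simp
    then show ?thesis using 2 assms by simp
  next
    case 3
    then have "-1 \<le> w / s" "w / s \<le> 1" using assms by (auto simp: field_simps)
    then have "max (-1) (min 1 (w / s)) = w / s" by simp
    moreover have "0 \<le> (2 * \<bar>w\<bar> - s)\<^sup>2" by simp
    then have "4 * (s * \<bar>w\<bar>) \<le> 4 * (w * w) + s * s" by (simp add: power2_eq_square algebra_simps)
    then have "\<bar>w\<bar> \<le> w * (w / s) + s / 4" using assms by (simp add: field_simps)
    ultimately show ?thesis by simp
  qed
qed

context godunov_pair
begin

text \<open>The difference of the limits is tested with its own truncation at level \<open>s\<close>, whose variation is
  at most that of the difference divided by \<open>s\<close>; optimizing over \<open>s\<close> gives the square root.\<close>

lemma limit_difference_estimate: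
  assumes v1: "initial_data lo hi X uL uR v1" "v1 \<in> borel_measurable borel"
    and v2: "initial_data lo hi X uL uR v2" "v2 \<in> borel_measurable borel"
    and v3: "initial_data lo hi X uL uR v3" "v3 \<in> borel_measurable borel"
    and e0: "0 \<le> e0" "\<And>x. \<bar>\<integral>y. indicator {..x} y * (v1 y - v2 y) \<partial>lborel\<bar> \<le> e0"
    and e1: "0 \<le> e1" "(\<integral>\<^sup>+x. ennreal \<bar>v2 x - v3 x\<bar> \<partial>lborel) \<le> ennreal e1"
    and d: "\<And>n. 0 < d n" "\<And>n. d n \<le> 1" "\<And>n. 4 * d n \<le> X" "d \<longlonglongrightarrow> 0"
    and t: "0 \<le> t" "t \<le> T" and K: "0 \<le> K"
    and z: "AE x in lborel. (\<lambda>n. godunov_approx lam (d n) f g v1 x t) \<longlonglongrightarrow> z x" "TV z \<le> ennreal K"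
    and z': "AE x in lborel. (\<lambda>n. godunov_approx lam (d n) f' g' v3 x t) \<longlonglongrightarrow> z' x" "TV z' \<le> ennreal K"
  shows "(\<integral>\<^sup>+x. ennreal \<bar>z x - z' x\<bar> \<partial>lebesgue) \<le> ennreal (2 * sqrt ((X + 2 * L * T) * K * (e0 + T * e)) + e1)"
proof -
  define Y where "Y = X + 2 * L * T"
  have X: "0 < X" by (rule initial_dataD(3)[OF v1(1)])
  have Lt: "2 * L * t \<le> 2 * L * T" using A.L_nonneg t by (intro mult_left_mono) auto
  have LT: "0 \<le> 2 * L * T" using A.L_nonneg t by simp
  have Y: "0 < Y" using X LT by (simp add: Y_def)
  have e_nonneg: "0 \<le> e" using flux_close(1)[of lo] A.lo_less_hi by force
  define N where "N n = time_level (lam * d n) t" for n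
  define G1 where "G1 n = A.ux (d n) v1 (N n)" for n
  \<comment> \<open>An intermediate approximation: \<open>G1\<close> and \<open>G2\<close> differ in
    the fluxes and, up to \<open>e0\<close> in the primitive, in the data; \<open>G2\<close> and
    \<open>G3\<close> have the same fluxes and differ by \<open>e1\<close> in
    \<open>L\<^sup>1\<close>.\<close>
  define G2 where "G2 n = B.ux (d n) v2 (N n)" for n
  define G3 where "G3 n = B.ux (d n) v3 (N n)" for n
  have [measurable]: "G1 n \<in> borel_measurable borel" "G2 n \<in> borel_measurable borel" "G3 n \<in> borel_measurable borel" for n
    unfolding G1_def G2_def G3_def by measurable
  have z_lim: "AE x in lborel. (\<lambda>n. G1 n x) \<longlonglongrightarrow> z x" using z(1) unfolding A.godunov_approx_ux G1_def N_def .
  have z'_lim: "AE x in lborel. (\<lambda>n. G3 n x) \<longlonglongrightarrow> z' x" using z'(1) unfolding B.godunov_approx_ux G3_def N_def .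
  define H where "H = hi - lo"
  have H: "0 < H" using A.lo_less_hi by (simp add: H_def)
  have range: "G1 n x \<in> {lo..hi}" "G2 n x \<in> {lo..hi}" "G3 n x \<in> {lo..hi}" for n x
    unfolding G1_def G2_def G3_def
    using A.ux_range[OF v1(1) d(1)] B.ux_range[OF v2(1) d(1)] B.ux_range[OF v3(1) d(1)] by blast+
  have Hle: "\<bar>a - b\<bar> \<le> H" if "a \<in> {lo..hi}" "b \<in> {lo..hi}" for a b using that by (auto simp: H_def)
  \<comment> \<open>A Borel version of \<open>z - z'\<close> that is bounded and supported in
    \<open>{-Y..Y}\<close> at every point; agreement almost everywhere comes from the cone and the
    range of the scheme.\<close>
  define w where "w x = indicator {-Y..Y} x * max (- H) (min H (lim (\<lambda>n. G1 n x) - lim (\<lambda>n. G3 n x)))" for x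
  have w_meas [measurable]: "w \<in> borel_measurable borel" unfolding w_def by measurable
  have w_ae: "AE x in lborel. z x - z' x = w x"
    using A.cone_limit[OF v1(1) d t(1) z(1)] B.cone_limit[OF v3(1) d t(1) z'(1)] z_lim z'_lim
  proof eventually_elim
    case (elim x)
    have "\<bar>z x - z' x\<bar> \<le> H"
    proof (rule LIMSEQ_le_const2)
      show "(\<lambda>n. \<bar>G1 n x - G3 n x\<bar>) \<longlonglongrightarrow> \<bar>z x - z' x\<bar>" by (intro tendsto_intros elim)
    qed (use Hle range in blast)
    moreover have "z x - z' x = 0" if "x \<notin> {-Y..Y}"
    proof -
      have "Y < \<bar>x\<bar>" using that by auto
      then have "X + 2 * L * t < \<bar>x\<bar>" using Lt by (simp add: Y_def)
      then show ?thesis using elim(1,2) by simp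
    qed
    ultimately show ?case
      using limI[OF elim(3)] limI[OF elim(4)] by (cases "x \<in> {-Y..Y}") (auto simp: w_def)
  qed
  have w_bound: "\<bar>w x\<bar> \<le> H" "x \<notin> {-Y..Y} \<Longrightarrow> w x = 0" for x
    using H by (auto simp: w_def split: split_indicator)
  have w_int: "integrable lborel w"
    by (rule integrable_bounded_box[of _ H "-Y" Y]) (use w_bound in auto)
  have main: "(\<integral>x. \<bar>w x\<bar> \<partial>lborel) \<le> ((e0 + T * e) * (2 * K)) / s + (Y / 2) * s + e1" if s: "0 < s" for s
  proof (rule field_le_epsilon)
    fix ep :: real assume ep: "0 < ep"
    define E where "E = e0 + T * e"
    have E: "0 \<le> E" using e0 e_nonneg t by (simp add: E_def)
    \<comment> \<open>The slack of the two representatives enters the bound as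
      \<open>2 * E * et / s\<close>; this choice keeps it below \<open>ep\<close>, also for
      \<open>E = 0\<close>.\<close>
    define et where "et = ep * s / (2 * E + 1)"
    have et: "0 < et" using ep s E by (simp add: et_def)
    define V where "V = (1 / s) * ((K + et) + (K + et))"
    have EV: "E * V \<le> (E * (2 * K)) / s + ep"
    proof -
      have "E * V = (E * (2 * K)) / s + (2 * E / (2 * E + 1)) * ep"
      proof -
        have "et / s = ep / (2 * E + 1)" using s by (simp add: et_def)
        moreover have "V = (2 * K) / s + 2 * (et / s)" by (simp add: V_def add_divide_distrib)
        ultimately have "E * V = E * ((2 * K) / s + 2 * (ep / (2 * E + 1)))" by simp
        then show ?thesis by (simp add: distrib_left)
      qed
      also have "(2 * E / (2 * E + 1)) * ep \<le> 1 * ep" using E ep by (intro mult_right_mono) auto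
      finally show ?thesis by simp
    qed
    obtain r where r: "AE x in lborel. x \<in> UNIV \<longrightarrow> r x = z x" "variation_le UNIV r (K + et)"
      by (rule TV_on_representative[OF z(2) K et])
    obtain r' where r': "AE x in lborel. x \<in> UNIV \<longrightarrow> r' x = z' x" "variation_le UNIV r' (K + et)"
      by (rule TV_on_representative[OF z'(2) K et])
    define cl where "cl y = max (-1) (min 1 (y / s))" for y :: real
    define \<phi> where "\<phi> x = cl (w x)" for x
    \<comment> \<open>The test function has to be the truncation of \<open>w\<close> for the
      pairing, but its variation is controlled only for the truncated difference of the
      representatives; the two agree almost everywhere.\<close>
    define \<psi> where "\<psi> x = cl (r x - r' x)" for x
    have \<phi>_meas: "\<phi> \<in> borel_measurable borel" unfolding \<phi>_def cl_def by measurable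
    note \<phi>_meas [measurable]
    have \<phi>_bound: "\<bar>\<phi> x\<bar> \<le> 1" "x \<notin> {-Y..Y} \<Longrightarrow> \<phi> x = 0" for x
      using w_bound(2)[of x] by (auto simp: \<phi>_def cl_def)
    have \<psi>\<phi>: "AE x in lborel. \<psi> x = \<phi> x"
      using r(1) r'(1) w_ae by eventually_elim (simp add: \<psi>_def \<phi>_def)
    have "\<bar>cl x - cl y\<bar> \<le> (1 / s) * \<bar>x - y\<bar>" for x y
    proof -
      have "\<bar>x / s - y / s\<bar> = (1 / s) * \<bar>x - y\<bar>" using s by (simp add: diff_divide_distrib[symmetric])
      then show ?thesis unfolding cl_def by linarith
    qed
    then have \<psi>_var: "variation_le UNIV \<psi> V"
      unfolding \<psi>_def V_def using s by (intro variation_le_compose variation_le_diff r(2) r'(2)) auto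
    have V0: "0 \<le> V" by (rule variation_le_nonneg[OF \<psi>_var])
    have int_\<phi>: "integrable lborel (\<lambda>x. (a x - b x) * \<phi> x)"
      if [measurable]: "a \<in> borel_measurable borel" "b \<in> borel_measurable borel" and ab: "\<And>x. a x \<in> {lo..hi}" "\<And>x. b x \<in> {lo..hi}" for a b
    proof (rule integrable_bounded_box[of _ "H * 1" "-Y" Y])
      show "\<bar>(a x - b x) * \<phi> x\<bar> \<le> H * 1" for x
        unfolding abs_mult using Hle[OF ab] \<phi>_bound(1) H by (intro mult_mono) auto
      show "(a x - b x) * \<phi> x = 0" if "x \<notin> cbox (-Y) Y" for x using \<phi>_bound(2)[of x] that by simp
    qed measurable
    have bound_n: "(\<integral>x. (G1 n x - G3 n x) * \<phi> x \<partial>lborel) \<le> E * V + e1" for n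
    proof -
      have tau: "0 < lam * d n" using A.lam_pos d by simp
      have Nt: "real (N n) * (lam * d n) \<le> T"
        using time_level_bounds(1)[OF tau t(1)] t(2) unfolding N_def by linarith
      have "(\<integral>x. (G1 n x - G2 n x) * \<phi> x \<partial>lborel) \<le> (e0 + real (N n) * (lam * d n) * e) * V"
        unfolding G1_def G2_def
        by (rule pairing_bound[OF v1(1) v2(1) d(1) v1(2) v2(2) e0(2) \<phi>_meas \<phi>_bound \<psi>\<phi> \<psi>_var])
      also have "\<dots> \<le> E * V"
        unfolding E_def using Nt e_nonneg V0 by (intro mult_right_mono add_left_mono) auto
      finally have 1: "(\<integral>x. (G1 n x - G2 n x) * \<phi> x \<partial>lborel) \<le> E * V" .
      have int23: "integrable lborel (\<lambda>x. \<bar>G2 n x - G3 n x\<bar>)"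
        unfolding G2_def G3_def using B.ux_diff_integrable[OF v2(1) v3(1) d(1)] by (rule integrable_abs)
      have int23': "integrable lborel (\<lambda>x. \<bar>B.ux (d n) v2 0 x - B.ux (d n) v3 0 x\<bar>)"
        using B.ux_diff_integrable[OF v2(1) v3(1) d(1)] by (rule integrable_abs)
      have "(\<integral>x. (G2 n x - G3 n x) * \<phi> x \<partial>lborel) \<le> (\<integral>x. \<bar>G2 n x - G3 n x\<bar> \<partial>lborel)"
      proof (rule integral_mono[OF _ int23])
        show "integrable lborel (\<lambda>x. (G2 n x - G3 n x) * \<phi> x)" by (rule int_\<phi>) (use range in auto)
        show "(G2 n x - G3 n x) * \<phi> x \<le> \<bar>G2 n x - G3 n x\<bar>" for x
        proof -
          have "\<bar>G2 n x - G3 n x\<bar> * \<bar>\<phi> x\<bar> \<le> \<bar>G2 n x - G3 n x\<bar> * 1" using \<phi>_bound(1) by (intro mult_left_mono) auto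
          then show ?thesis using abs_ge_self[of "(G2 n x - G3 n x) * \<phi> x"] by (simp add: abs_mult)
        qed
      qed
      also have "\<dots> \<le> (\<integral>x. \<bar>B.ux (d n) v2 0 x - B.ux (d n) v3 0 x\<bar> \<partial>lborel)"
        unfolding G2_def G3_def by (rule B.l1_contraction[OF v2(1) v3(1) d(1)])
      also have "\<dots> \<le> e1"
      proof -
        have "ennreal (\<integral>x. \<bar>B.ux (d n) v2 0 x - B.ux (d n) v3 0 x\<bar> \<partial>lborel) = (\<integral>\<^sup>+x. ennreal \<bar>B.ux (d n) v2 0 x - B.ux (d n) v3 0 x\<bar> \<partial>lborel)"
          using int23' by (intro nn_integral_eq_integral[symmetric]) auto
        also have "\<dots> \<le> ennreal e1"
          using B.initial_l1_contraction[OF v2(1) v3(1) d(1) v2(2) v3(2)] e1(2) by (rule order_trans)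
        finally show ?thesis using e1(1) by simp
      qed
      finally have 2: "(\<integral>x. (G2 n x - G3 n x) * \<phi> x \<partial>lborel) \<le> e1" .
      have i12: "integrable lborel (\<lambda>x. (G1 n x - G2 n x) * \<phi> x)" and i23: "integrable lborel (\<lambda>x. (G2 n x - G3 n x) * \<phi> x)"
        using range by (auto intro!: int_\<phi>)
      have "(\<integral>x. (G1 n x - G3 n x) * \<phi> x \<partial>lborel) = (\<integral>x. (G1 n x - G2 n x) * \<phi> x + (G2 n x - G3 n x) * \<phi> x \<partial>lborel)"
        by (intro Bochner_Integration.integral_cong) (auto simp: algebra_simps)
      also have "\<dots> = (\<integral>x. (G1 n x - G2 n x) * \<phi> x \<partial>lborel) + (\<integral>x. (G2 n x - G3 n x) * \<phi> x \<partial>lborel)"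
        by (rule Bochner_Integration.integral_add[OF i12 i23])
      finally show ?thesis using 1 2 by linarith
    qed
    have lim: "(\<lambda>n. \<integral>x. (G1 n x - G3 n x) * \<phi> x \<partial>lborel) \<longlonglongrightarrow> (\<integral>x. w x * \<phi> x \<partial>lborel)"
    proof (rule dominated_box_convergence[where M="H * 1" and a="-Y" and b=Y])
      show "AE x in lborel. (\<lambda>n. (G1 n x - G3 n x) * \<phi> x) \<longlonglongrightarrow> w x * \<phi> x"
        using z_lim z'_lim w_ae
      proof eventually_elim
        case (elim x)
        have "(\<lambda>n. (G1 n x - G3 n x) * \<phi> x) \<longlonglongrightarrow> (z x - z' x) * \<phi> x" by (intro tendsto_intros elim)
        then show ?case by (simp only: elim(3))
      qed
      show "\<bar>(G1 n x - G3 n x) * \<phi> x\<bar> \<le> H * 1" for n x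
        unfolding abs_mult using Hle[OF range(1,3)] \<phi>_bound(1) H by (intro mult_mono) auto
      show "(G1 n x - G3 n x) * \<phi> x = 0" if "x \<notin> cbox (-Y) Y" for n x using \<phi>_bound(2)[of x] that by simp
    qed measurable
    have le: "(\<integral>x. w x * \<phi> x \<partial>lborel) \<le> E * V + e1"
      by (rule LIMSEQ_le_const2[OF lim]) (use bound_n in blast)
    have i1: "integrable lborel (\<lambda>x. w x * \<phi> x)"
    proof (rule integrable_bounded_box[of _ "H * 1" "-Y" Y])
      show "\<bar>w x * \<phi> x\<bar> \<le> H * 1" for x
        unfolding abs_mult using w_bound(1) \<phi>_bound(1) H by (intro mult_mono) auto
      show "w x * \<phi> x = 0" if "x \<notin> cbox (-Y) Y" for x using w_bound(2)[of x] that by simp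
    qed measurable
    have i2: "integrable lborel (\<lambda>x. indicator {-Y..Y} x * (s / 4))"
      by (rule integrable_bounded_box[of _ "s / 4" "-Y" Y]) (use s in \<open>auto split: split_indicator\<close>)
    have "(\<integral>x. \<bar>w x\<bar> \<partial>lborel) \<le> (\<integral>x. w x * \<phi> x + indicator {-Y..Y} x * (s / 4) \<partial>lborel)"
    proof (rule integral_mono)
      show "integrable lborel (\<lambda>x. \<bar>w x\<bar>)" using w_int by (rule integrable_abs)
      show "integrable lborel (\<lambda>x. w x * \<phi> x + indicator {-Y..Y} x * (s / 4))" using i1 i2 by (rule Bochner_Integration.integrable_add)
      show "\<bar>w x\<bar> \<le> w x * \<phi> x + indicator {-Y..Y} x * (s / 4)" for x
        using clamp_pairing[OF s, of "w x"] w_bound(2)[of x] by (cases "x \<in> {-Y..Y}") (auto simp: \<phi>_def cl_def)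
    qed
    \<comment> \<open>The pointwise loss \<open>s / 4\<close> is integrated over an interval of
      length \<open>2 * Y\<close>.\<close>
    also have "\<dots> = (\<integral>x. w x * \<phi> x \<partial>lborel) + (Y / 2) * s"
      using i1 i2 Y by simp
    finally show "(\<integral>x. \<bar>w x\<bar> \<partial>lborel) \<le> ((e0 + T * e) * (2 * K)) / s + (Y / 2) * s + e1 + ep"
      using le EV unfolding E_def by linarith
  qed
  have "0 \<le> (e0 + T * e) * (2 * K)" using e0(1) e_nonneg t K by simp
  then have "(\<integral>x. \<bar>w x\<bar> \<partial>lborel) \<le> 2 * sqrt (((e0 + T * e) * (2 * K)) * (Y / 2)) + e1"
    using Y by (intro optimize_parameter main) auto
  also have "((e0 + T * e) * (2 * K)) * (Y / 2) = (X + 2 * L * T) * K * (e0 + T * e)" unfolding Y_def[symmetric] by simp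
  finally have fin: "(\<integral>x. \<bar>w x\<bar> \<partial>lborel) \<le> 2 * sqrt ((X + 2 * L * T) * K * (e0 + T * e)) + e1" .
  have "AE x in lebesgue. z x - z' x = w x" using w_ae by (rule AE_completion)
  then have "(\<integral>\<^sup>+x. ennreal \<bar>z x - z' x\<bar> \<partial>lebesgue) = (\<integral>\<^sup>+x. ennreal \<bar>w x\<bar> \<partial>lebesgue)"
    by (intro nn_integral_cong_AE) (auto elim!: eventually_mono)
  also have "\<dots> = (\<integral>\<^sup>+x. ennreal \<bar>w x\<bar> \<partial>lborel)" by (rule nn_integral_completion)
  also have "\<dots> = ennreal (\<integral>x. \<bar>w x\<bar> \<partial>lborel)"
    using w_int by (intro nn_integral_eq_integral) auto
  also have "\<dots> \<le> ennreal (2 * sqrt ((X + 2 * L * T) * K * (e0 + T * e)) + e1)" using fin by (rule ennreal_leI)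
  finally show ?thesis .
qed

end

text \<open>Off the finite set \<open>S\<close> the function is locally constant, hence continuous
  there, and finitely many exceptional points do not affect Borel measurability.\<close>

lemma piecewise_constant_borel:
  assumes "piecewise_constant v"
  shows "v \<in> borel_measurable borel"
proof -
  obtain S where S: "finite S" "\<And>x y. x < y \<Longrightarrow> {x..y} \<inter> S = {} \<Longrightarrow> v x = v y"
    using assms unfolding piecewise_constant_def by blast
  have "continuous_on (- S) v"
  proof (rule continuous_on_open_UN[of "- S" "\<lambda>x. ball x (SOME e. 0 < e \<and> ball x e \<subseteq> - S)", THEN continuous_on_subset])
    have *: "\<exists>e. 0 < e \<and> ball x e \<subseteq> - S" if "x \<in> - S" for x
      using that finite_imp_closed[OF S(1)] by (meson open_Compl openE)
    have e: "0 < (SOME e. 0 < e \<and> ball x e \<subseteq> - S) \<and> ball x (SOME e. 0 < e \<and> ball x e \<subseteq> - S) \<subseteq> - S"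
      if "x \<in> - S" for x by (rule someI_ex[OF *[OF that]])
    show "- S \<subseteq> (\<Union>x\<in>- S. ball x (SOME e. 0 < e \<and> ball x e \<subseteq> - S))" using e by force
    show "continuous_on (ball x (SOME e. 0 < e \<and> ball x e \<subseteq> - S)) v" if x: "x \<in> - S" for x
    proof -
      define B where "B = ball x (SOME e. 0 < e \<and> ball x e \<subseteq> - S)"
      have eq: "v a = v b" if "a \<in> B" "b \<in> B" for a b
      proof -
        have "v a = v b" if "a \<in> B" "b \<in> B" "a < b" for a b
        proof (rule S(2)[OF that(3)])
          have "{a..b} \<subseteq> B" using that unfolding B_def by (auto simp: dist_real_def)
          then show "{a..b} \<inter> S = {}" using e[OF x] unfolding B_def by blast
        qed
        then show ?thesis using that by (metis linorder_neqE)
      qed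
      have "x \<in> B" using e[OF x] by (simp add: B_def)
      then have "continuous_on B v" by (intro continuous_on_eq[OF continuous_on_const[of B "v x"]] eq)
      then show ?thesis by (simp add: B_def)
    qed
  qed auto
  then show ?thesis using borel_measurable_continuous_countable_exceptions[OF countable_finite[OF S(1)]] by blast
qed

text \<open>Continuity in time is only local in space and global integrability of the difference is
  not yet known. So the bound is carried from nearby good times to \<open>t\<close> on each window
  \<open>{-R..R}\<close>, and the windows are then exhausted by monotone convergence.\<close>

lemma L1_bound_all_times:
  assumes T: "0 < T" and u: "continuous_L1_loc T u" and u': "continuous_L1_loc T u'" and b: "0 \<le> b"
    and ae: "AE s in lborel. s \<in> {0<..<T} \<longrightarrow> L1_norm (\<lambda>x. u x s - u' x s) \<le> ennreal b"
    and t: "t \<in> {0..T}"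
  shows "L1_norm (\<lambda>x. u x t - u' x t) \<le> ennreal b"
proof -
  define w where "w x = u x t - u' x t" for x
  have int: "integrable lebesgue (\<lambda>x. indicator {-R..R} x *\<^sub>R u x s)" "integrable lebesgue (\<lambda>x. indicator {-R..R} x *\<^sub>R u' x s)"
    if "0 < R" "s \<in> {0..T}" for R s
    using u u' that unfolding continuous_L1_loc_def set_integrable_def by auto
  have nn: "(\<integral>\<^sup>+x. ennreal (indicator {-R..R} x *\<^sub>R \<bar>q x\<bar>) \<partial>lebesgue) = ennreal (LINT x:{-R..R}|lebesgue. \<bar>q x\<bar>)"
    if "set_integrable lebesgue {-R..R} q" for R and q :: "real \<Rightarrow> real"
    unfolding set_lebesgue_integral_def
    using set_integrable_abs[OF that] by (intro nn_integral_eq_integral) (auto simp: set_integrable_def)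
  have si: "set_integrable lebesgue {-R..R} (\<lambda>x. p x - q x)"
    if "set_integrable lebesgue {-R..R} p" "set_integrable lebesgue {-R..R} q" for R and p q :: "real \<Rightarrow> real"
    using set_integral_diff(1)[OF that] .
  have bd: "(LINT x:{-R..R}|lebesgue. \<bar>w x\<bar>) \<le> b" if R: "0 < R" for R
  proof (rule field_le_epsilon)
    fix e :: real assume e: "0 < e"
    have ut: "set_integrable lebesgue {-R..R} (\<lambda>x. u x s)" "set_integrable lebesgue {-R..R} (\<lambda>x. u' x s)" if "s \<in> {0..T}" for s
      using int[OF R that] by (auto simp: set_integrable_def)
    have "\<forall>\<^sub>F s in at t within {0..T}. (LINT x:{-R..R}|lebesgue. \<bar>u x s - u x t\<bar>) < e / 2"
      using u R t e unfolding continuous_L1_loc_def by (intro order_tendstoD(2)[where y=0]) auto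
    moreover have "\<forall>\<^sub>F s in at t within {0..T}. (LINT x:{-R..R}|lebesgue. \<bar>u' x s - u' x t\<bar>) < e / 2"
      using u' R t e unfolding continuous_L1_loc_def by (intro order_tendstoD(2)[where y=0]) auto
    ultimately have "\<forall>\<^sub>F s in at t within {0..T}. (LINT x:{-R..R}|lebesgue. \<bar>u x s - u x t\<bar>) < e / 2
        \<and> (LINT x:{-R..R}|lebesgue. \<bar>u' x s - u' x t\<bar>) < e / 2" by (rule eventually_conj)
    then obtain \<eta> where \<eta>: "0 < \<eta>" "\<And>s. s \<in> {0..T} \<Longrightarrow> s \<noteq> t \<Longrightarrow> \<bar>s - t\<bar> < \<eta> \<Longrightarrow>
        (LINT x:{-R..R}|lebesgue. \<bar>u x s - u x t\<bar>) < e / 2 \<and> (LINT x:{-R..R}|lebesgue. \<bar>u' x s - u' x t\<bar>) < e / 2"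
      by (auto simp: eventually_at dist_real_def)
    obtain s where s: "s \<in> {0<..<T}" "s \<noteq> t" "\<bar>s - t\<bar> < \<eta>" "L1_norm (\<lambda>x. u x s - u' x s) \<le> ennreal b"
    \<comment> \<open>A good time close to \<open>t\<close> is taken to the right of
      \<open>t\<close>, except at the final time, where it must be taken to the left.\<close>
    proof (cases "t < T")
      case True
      obtain s where "t < s" "s < min T (t + \<eta>)" "s \<in> {0<..<T} \<longrightarrow> L1_norm (\<lambda>x. u x s - u' x s) \<le> ennreal b"
        by (rule AE_lborel_dense[OF ae, of t "min T (t + \<eta>)"]) (use True \<eta>(1) in auto)
      then show ?thesis using t by (intro that[of s]) auto
    next
      case False
      obtain s where "max 0 (T - \<eta>) < s" "s < T" "s \<in> {0<..<T} \<longrightarrow> L1_norm (\<lambda>x. u x s - u' x s) \<le> ennreal b"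
        by (rule AE_lborel_dense[OF ae, of "max 0 (T - \<eta>)" T]) (use T \<eta>(1) in auto)
      then show ?thesis using t False by (intro that[of s]) auto
    qed
    have sT: "s \<in> {0..T}" using s(1) by auto
    note I = si[OF ut(1)[OF sT] ut(1)[OF t]] si[OF ut(1)[OF sT] ut(2)[OF sT]] si[OF ut(2)[OF sT] ut(2)[OF t]]
    note A = I[THEN set_integrable_abs]
    have "ennreal (LINT x:{-R..R}|lebesgue. \<bar>u x s - u' x s\<bar>) \<le> L1_norm (\<lambda>x. u x s - u' x s)"
      unfolding nn[OF I(2), symmetric] L1_norm_def by (intro nn_integral_mono) (auto split: split_indicator)
    then have "ennreal (LINT x:{-R..R}|lebesgue. \<bar>u x s - u' x s\<bar>) \<le> ennreal b" using s(4) by (rule order_trans)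
    then have 1: "(LINT x:{-R..R}|lebesgue. \<bar>u x s - u' x s\<bar>) \<le> b" using b by simp
    have "(LINT x:{-R..R}|lebesgue. \<bar>w x\<bar>) \<le> (LINT x:{-R..R}|lebesgue. \<bar>u x s - u x t\<bar> + \<bar>u x s - u' x s\<bar> + \<bar>u' x s - u' x t\<bar>)"
    proof (rule set_integral_mono)
      show "set_integrable lebesgue {-R..R} (\<lambda>x. \<bar>w x\<bar>)"
        unfolding w_def using si[OF ut(1)[OF t] ut(2)[OF t]] by (rule set_integrable_abs)
      show "set_integrable lebesgue {-R..R} (\<lambda>x. \<bar>u x s - u x t\<bar> + \<bar>u x s - u' x s\<bar> + \<bar>u' x s - u' x t\<bar>)"
        by (intro set_integral_add(1) A)
      show "\<bar>w x\<bar> \<le> \<bar>u x s - u x t\<bar> + \<bar>u x s - u' x s\<bar> + \<bar>u' x s - u' x t\<bar>" for x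
        unfolding w_def by linarith
    qed
    also have "\<dots> = (LINT x:{-R..R}|lebesgue. \<bar>u x s - u x t\<bar>) + (LINT x:{-R..R}|lebesgue. \<bar>u x s - u' x s\<bar>)
        + (LINT x:{-R..R}|lebesgue. \<bar>u' x s - u' x t\<bar>)"
      by (simp only: set_integral_add(2)[OF set_integral_add(1)[OF A(1,2)] A(3)] set_integral_add(2)[OF A(1,2)])
    also have "\<dots> \<le> b + e" using \<eta>(2)[OF sT s(2,3)] 1 by linarith
    finally show "(LINT x:{-R..R}|lebesgue. \<bar>w x\<bar>) \<le> b + e" .
  qed
  have wI: "set_integrable lebesgue {-R..R} w" if "0 < R" for R
    unfolding w_def using int[OF that t] by (intro si) (auto simp: set_integrable_def)
  \<comment> \<open>\<open>Suc n\<close> keeps the radius positive for every index, as the window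
    bound requires.\<close>
  define W where "W n x = ennreal (indicator {- real (Suc n)..real (Suc n)} x *\<^sub>R \<bar>w x\<bar>)" for n x
  have "(SUP n. W n x) = ennreal \<bar>w x\<bar>" for x
  proof (rule antisym)
    show "(SUP n. W n x) \<le> ennreal \<bar>w x\<bar>" by (rule SUP_least) (auto simp: W_def split: split_indicator)
    obtain n where n: "\<bar>x\<bar> \<le> real n" using real_arch_simple by blast
    then have "W n x = ennreal \<bar>w x\<bar>" by (auto simp: W_def split: split_indicator)
    then show "ennreal \<bar>w x\<bar> \<le> (SUP n. W n x)" by (metis SUP_upper UNIV_I)
  qed
  then have "L1_norm (\<lambda>x. u x t - u' x t) = (\<integral>\<^sup>+x. (SUP n. W n x) \<partial>lebesgue)" unfolding L1_norm_def w_def by simp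
  also have "\<dots> = (SUP n. \<integral>\<^sup>+x. W n x \<partial>lebesgue)"
  proof (rule nn_integral_monotone_convergence_SUP)
    show "incseq W" by (auto simp: incseq_def le_fun_def W_def split: split_indicator)
    show "W n \<in> borel_measurable lebesgue" for n
    proof -
      have "(\<lambda>x. indicator {- real (Suc n)..real (Suc n)} x *\<^sub>R \<bar>w x\<bar>) \<in> borel_measurable lebesgue"
        using set_integrable_abs[OF wI[of "real (Suc n)"]] unfolding set_integrable_def by (intro borel_measurable_integrable) simp
      then show ?thesis unfolding W_def by (intro measurable_compose[OF _ measurable_ennreal])
    qed
  qed
  also have "\<dots> \<le> ennreal b"
  proof (rule SUP_least)
    fix n
    have R: "0 < real (Suc n)" by simp
    show "(\<integral>\<^sup>+x. W n x \<partial>lebesgue) \<le> ennreal b"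
      unfolding W_def nn[OF wI[OF R]] by (intro ennreal_leI bd R)
  qed
  finally show ?thesis .
qed

text \<open>\<open>v1\<close> and \<open>v3\<close> are Borel versions of the two data and
  \<open>v2\<close> is a datum in between: \<open>e0\<close> measures the first gap in the
  primitive, \<open>e1\<close> the second in \<open>L\<^sup>1\<close>. How \<open>v2\<close> is
  chosen is what separates general data from cell averages.\<close>

lemma (in godunov_pair) solution_difference_estimate:
  assumes v: "initial_data lo hi X uL uR v" and v': "initial_data lo hi X uL uR v'"
    and TV0: "TV v \<le> ennreal K0" "TV v' \<le> ennreal K0" "0 \<le> K0" and T: "0 < T" and K: "0 \<le> K"
    and TVA: "\<And>d t. 0 < d \<Longrightarrow> t \<in> {0..T} \<Longrightarrow> TV (\<lambda>x. godunov_approx lam d f g v x t) \<le> ennreal K"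
    and TVB: "\<And>d t. 0 < d \<Longrightarrow> t \<in> {0..T} \<Longrightarrow> TV (\<lambda>x. godunov_approx lam d f' g' v' x t) \<le> ennreal K"
    and u: "the_vv_solution lo hi T f g v u" and u': "the_vv_solution lo hi T f' g' v' u'"
    and TVu: "\<And>t. t \<in> {0..T} \<Longrightarrow> TV (\<lambda>x. u x t) \<le> ennreal K"
    and TVu': "\<And>t. t \<in> {0..T} \<Longrightarrow> TV (\<lambda>x. u' x t) \<le> ennreal K"
    and v1: "initial_data lo hi X uL uR v1" "v1 \<in> borel_measurable borel" "AE x in lborel. v x = v1 x"
    and v2: "initial_data lo hi X uL uR v2" "v2 \<in> borel_measurable borel"
    and v3: "initial_data lo hi X uL uR v3" "v3 \<in> borel_measurable borel" "AE x in lborel. v' x = v3 x"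
    and e0: "0 \<le> e0" "\<And>x. \<bar>\<integral>y. indicator {..x} y * (v1 y - v2 y) \<partial>lborel\<bar> \<le> e0"
    and e1: "0 \<le> e1" "(\<integral>\<^sup>+x. ennreal \<bar>v2 x - v3 x\<bar> \<partial>lborel) \<le> ennreal e1"
    and t: "t \<in> {0..T}"
  shows "L1_norm (\<lambda>x. u x t - u' x t) \<le> ennreal (2 * sqrt ((X + 2 * L * T) * K * (e0 + T * e)) + e1)"
proof -
  have X: "0 < X" by (rule initial_dataD(3)[OF v])
  \<comment> \<open>Mesh sizes tending to zero that meet \<open>d n \<le> 1\<close> and the
    condition \<open>4 * d n \<le> X\<close> of the cone estimate from the first index on.\<close>
  define d where "d n = min 1 (X / 4) / real (Suc n)" for n
  have d_le: "d n \<le> min 1 (X / 4)" for n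
  proof -
    have "min 1 (X / 4) * 1 \<le> min 1 (X / 4) * real (Suc n)" using X by (intro mult_left_mono) auto
    then show ?thesis unfolding d_def by (simp only: pos_divide_le_eq of_nat_0_less_iff zero_less_Suc mult_1_right)
  qed
  have d: "0 < d n" "d n \<le> 1" "4 * d n \<le> X" for n
    using X d_le[of n] by (auto simp: d_def)
  have d0: "d \<longlonglongrightarrow> 0" unfolding d_def by (intro LIMSEQ_Suc lim_const_over_n)
  obtain r where r: "strict_mono r" and A_lim: "AE t in lborel. t \<in> {0<..<T} \<longrightarrow>
      (AE x in lborel. (\<lambda>n. godunov_approx lam (d (r n)) f g v x t) \<longlonglongrightarrow> u x t)"
    by (rule A.godunov_converges_to_solution[OF v TV0(1,3) T K TVA d(1,2) d0 u]) blast+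
  have dr0: "(\<lambda>n. d (r n)) \<longlonglongrightarrow> 0" using LIMSEQ_subseq_LIMSEQ[OF d0 r] by (simp add: o_def)
  \<comment> \<open>The second subsequence is extracted from the first, so that both schemes
    converge along the same meshes and can be compared mesh by mesh.\<close>
  obtain r' where r': "strict_mono r'" and B_lim: "AE t in lborel. t \<in> {0<..<T} \<longrightarrow>
      (AE x in lborel. (\<lambda>n. godunov_approx lam (d (r (r' n))) f' g' v' x t) \<longlonglongrightarrow> u' x t)"
    by (rule B.godunov_converges_to_solution[OF v' TV0(2,3) T K TVB d(1,2) dr0 u']) blast+
  have drr0: "(\<lambda>n. d (r (r' n))) \<longlonglongrightarrow> 0" using LIMSEQ_subseq_LIMSEQ[OF dr0 r'] by (simp add: o_def)
  have gA: "godunov_approx lam c f g v = godunov_approx lam c f g v1" for c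
    using godunov_cong_AE[OF v1(3) initial_dataD(1)[OF v] initial_dataD(1)[OF v1(1)]]
    by (intro ext) (simp add: godunov_approx_def)
  have gB: "godunov_approx lam c f' g' v' = godunov_approx lam c f' g' v3" for c
    using godunov_cong_AE[OF v3(3) initial_dataD(1)[OF v'] initial_dataD(1)[OF v3(1)]]
    by (intro ext) (simp add: godunov_approx_def)
  have e_nonneg: "0 \<le> e" using flux_close(1)[of lo] A.lo_less_hi by force
  have pos: "0 \<le> 2 * sqrt ((X + 2 * L * T) * K * (e0 + T * e)) + e1"
    using X A.L_nonneg T K e0(1) e_nonneg e1(1) by (intro add_nonneg_nonneg mult_nonneg_nonneg) auto
  show ?thesis
  proof (rule L1_bound_all_times[OF T _ _ pos _ t])
    show "continuous_L1_loc T u" "continuous_L1_loc T u'" using u u' by (auto simp: the_vv_solution_def)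
    show "AE s in lborel. s \<in> {0<..<T} \<longrightarrow>
        L1_norm (\<lambda>x. u x s - u' x s) \<le> ennreal (2 * sqrt ((X + 2 * L * T) * K * (e0 + T * e)) + e1)"
      using A_lim B_lim
    proof eventually_elim
      case (elim s)
      show ?case
      proof
        assume s: "s \<in> {0<..<T}"
        then have sT: "s \<in> {0..T}" "0 \<le> s" "s \<le> T" by auto
        have "AE x in lborel. (\<lambda>n. godunov_approx lam (d (r n)) f g v1 x s) \<longlonglongrightarrow> u x s"
          using elim(1) s unfolding gA by blast
        then have 1: "AE x in lborel. (\<lambda>n. godunov_approx lam (d (r (r' n))) f g v1 x s) \<longlonglongrightarrow> u x s"
        proof eventually_elim
          case (elim x)
          show ?case using LIMSEQ_subseq_LIMSEQ[OF elim r'] by (simp add: o_def)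
        qed
        have 2: "AE x in lborel. (\<lambda>n. godunov_approx lam (d (r (r' n))) f' g' v3 x s) \<longlonglongrightarrow> u' x s"
          using elim(2) s unfolding gB by blast
        show "L1_norm (\<lambda>x. u x s - u' x s) \<le> ennreal (2 * sqrt ((X + 2 * L * T) * K * (e0 + T * e)) + e1)"
          unfolding L1_norm_def
          by (rule limit_difference_estimate[OF v1(1,2) v2 v3(1,2) e0 e1 d(1) d(2) d(3) drr0 sT(2,3) K 1 TVu[OF sT(1)] 2 TVu'[OF sT(1)]])
      qed
    qed
  qed
qed

theorem theorem4p1:
  fixes lo hi T X uL uR Lf Lg lam K3 Y C1 :: real
    and f g u0 :: "real \<Rightarrow> real"
    and u :: "real \<Rightarrow> real \<Rightarrow> real"
    and K :: "real \<Rightarrow> nat" and b :: "real \<Rightarrow> nat \<Rightarrow> real"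
    and fd gd u0d :: "real \<Rightarrow> real \<Rightarrow> real"
    and ud :: "real \<Rightarrow> real \<Rightarrow> real \<Rightarrow> real"
  assumes "lo < hi" and "T > 0"
    and "admissible_fluxes lo hi f g"
    and "admissible_initial_data lo hi X uL uR u0"
    and "Lf-lipschitz_on {lo..hi} f" and "Lg-lipschitz_on {lo..hi} g"
    and "the_vv_solution lo hi T f g u0 u"
    and "\<And>\<delta>. \<delta> > 0 \<Longrightarrow> breakpoints lo hi \<delta> (K \<delta>) (b \<delta>)"
    and fd: "\<And>\<delta>. fd \<delta> = pl_interpolant (b \<delta>) f"
    and gd: "\<And>\<delta>. gd \<delta> = pl_interpolant (b \<delta>) g"
    and "\<And>\<delta>. \<delta> > 0 \<Longrightarrow> front_tracking_initial_data lo hi X uL uR u0 (u0d \<delta>)"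
    and "\<exists>C. \<forall>\<^sub>F \<delta> in at_right 0. L1_norm (\<lambda>x. u0d \<delta> x - u0 x) \<le> ennreal (C * \<delta>)"
    and "\<And>\<delta>. \<delta> > 0 \<Longrightarrow> the_vv_solution lo hi T (fd \<delta>) (gd \<delta>) (u0d \<delta>) (ud \<delta>)"
    and "\<And>\<delta> t. \<delta> > 0 \<Longrightarrow> t \<in> {0..T} \<Longrightarrow>
           \<exists>v. piecewise_constant v \<and> (AE x in lebesgue. ud \<delta> x t = v x)"
    and "lam > 0" and "lam * max Lf Lg \<le> 1/2"
    and "K3 \<ge> 0"
    and "\<And>\<Delta>x t. \<Delta>x > 0 \<Longrightarrow> t \<in> {0..T} \<Longrightarrow>
           TV (\<lambda>x. godunov_approx lam \<Delta>x f g u0 x t) \<le> ennreal K3"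
    and "\<And>\<delta> \<Delta>x t. \<delta> > 0 \<Longrightarrow> \<Delta>x > 0 \<Longrightarrow> t \<in> {0..T} \<Longrightarrow>
           TV (\<lambda>x. godunov_approx lam \<Delta>x (fd \<delta>) (gd \<delta>) (u0d \<delta>) x t) \<le> ennreal K3"
    and "\<And>t. t \<in> {0..T} \<Longrightarrow> TV (\<lambda>x. u x t) \<le> ennreal K3"
    and "\<And>\<delta> t. \<delta> > 0 \<Longrightarrow> t \<in> {0..T} \<Longrightarrow> TV (\<lambda>x. ud \<delta> x t) \<le> ennreal K3"
    and Y: "Y = X + 2 * T * max Lf Lg"
    and C1: "C1 = 1 + 1/8 * T *
          max (sup_norm_on {lo..hi} (deriv_on {lo..hi} (deriv_on {lo..hi} f)))
              (sup_norm_on {lo..hi} (deriv_on {lo..hi} (deriv_on {lo..hi} g)))"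
  shows "\<forall>\<delta>>0. \<forall>t\<in>{0..T}.
      L1_norm (\<lambda>x. u x t - ud \<delta> x t)
        \<le> ennreal (2 * sqrt (Y * K3 * C1) * \<delta>) + ennreal \<delta> * TV u0
            + L1_norm (\<lambda>x. u0 x - u0d \<delta> x) \<and>
      (cell_average_data X uL uR u0 \<delta> (u0d \<delta>) \<longrightarrow>
         L1_norm (\<lambda>x. u x t - ud \<delta> x t) \<le> ennreal (2 * sqrt (Y * K3 * C1) * \<delta>))"
proof (intro allI impI ballI)
  fix \<delta> t :: real assume \<delta>: "0 < \<delta>" and t: "t \<in> {0..T}"
  note lohi = assms(1) and T = assms(2) and bp = assms(8)[OF \<delta>] and ft = assms(11)[OF \<delta>]
  have fx: "g lo = f lo" "g hi = f hi" "C2_on {lo..hi} f" "C2_on {lo..hi} g"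
    using assms(3) by (auto simp: admissible_fluxes_def)
  define L where "L = max Lf Lg"
  define Mf where "Mf = sup_norm_on {lo..hi} (deriv_on {lo..hi} (deriv_on {lo..hi} f))"
  define Mg where "Mg = sup_norm_on {lo..hi} (deriv_on {lo..hi} (deriv_on {lo..hi} g))"
  define e where "e = max Mf Mg * \<delta>\<^sup>2 / 8"
  have "0 \<le> Mf" using order_trans[OF abs_ge_zero C2_on_sup_norm[OF fx(3), of lo]] lohi by (simp add: Mf_def)
  then have M: "0 \<le> max Mf Mg" by simp
  have lip: "L-lipschitz_on {lo..hi} f" "L-lipschitz_on {lo..hi} g"
    using assms(5,6) by (auto simp: L_def intro: lipschitz_on_le)
  interpret P: godunov_pair lo hi L lam f g "fd \<delta>" "gd \<delta>" e
  proof unfold_locales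
    show "f lo = g lo" "f hi = g hi" using fx by simp_all
    \<comment> \<open>The end points are breakpoints, so the interpolants inherit the agreement of
      the fluxes there.\<close>
    show "fd \<delta> lo = gd \<delta> lo" "fd \<delta> hi = gd \<delta> hi"
      using fx pl_interpolant_endpoints[OF bp lohi] by (simp_all add: fd gd)
    show "L-lipschitz_on {lo..hi} (fd \<delta>)" "L-lipschitz_on {lo..hi} (gd \<delta>)"
      unfolding fd gd by (intro pl_interpolant_lipschitz[OF bp] lip)+
    show "lam * L \<le> 1 / 2" using assms(16) by (simp add: L_def)
    fix y assume y: "y \<in> {lo..hi}"
    have "Mf * \<delta>\<^sup>2 / 8 \<le> e" "Mg * \<delta>\<^sup>2 / 8 \<le> e"
      unfolding e_def by (intro divide_right_mono mult_right_mono; simp)+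
    then show "\<bar>f y - fd \<delta> y\<bar> \<le> e" "\<bar>g y - gd \<delta> y\<bar> \<le> e"
      using pl_interpolant_error[OF bp fx(3) y lohi] pl_interpolant_error[OF bp fx(4) y lohi]
      unfolding fd gd Mf_def Mg_def by linarith+
  qed (use lohi lip assms(15) in auto)
  have u0: "initial_data lo hi X uL uR u0"
    using assms(4) by (auto simp: admissible_initial_data_def initial_data_def)
  then have X: "0 < X" by (rule initial_dataD(3))
  have u0d: "initial_data lo hi X uL uR (u0d \<delta>)"
  proof -
    have "u0d \<delta> \<in> borel_measurable borel"
      using ft by (intro piecewise_constant_borel) (simp add: front_tracking_initial_data_def)
    then have "u0d \<delta> \<in> borel_measurable lebesgue" by (intro measurable_completion) simp
    then show ?thesis using ft X by (auto simp: front_tracking_initial_data_def initial_data_def)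
  qed
  define K0 where "K0 = enn2real (TV u0)"
  have "TV u0 \<noteq> \<infinity>" using assms(4) by (auto simp: admissible_initial_data_def)
  then have K0: "TV u0 \<le> ennreal K0" by (simp add: K0_def less_top)
  have K0': "TV (u0d \<delta>) \<le> ennreal K0"
    using ft by (intro order_trans[OF _ K0]) (simp add: front_tracking_initial_data_def)
  obtain v where v: "v \<in> borel_measurable borel" "initial_data lo hi X uL uR v" "AE x in lborel. u0 x = v x"
    by (rule initial_data_borel[OF u0])
  obtain v' where v': "v' \<in> borel_measurable borel" "initial_data lo hi X uL uR v'" "AE x in lborel. u0d \<delta> x = v' x"
    by (rule initial_data_borel[OF u0d])
  have est: "L1_norm (\<lambda>x. u x t - ud \<delta> x t) \<le> ennreal (2 * sqrt ((X + 2 * L * T) * K3 * (e0 + T * e)) + e1)"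
    if w: "initial_data lo hi X uL uR w" "w \<in> borel_measurable borel"
      and e0: "0 \<le> e0" "\<And>x. \<bar>\<integral>y. indicator {..x} y * (v y - w y) \<partial>lborel\<bar> \<le> e0"
      and e1: "0 \<le> e1" "(\<integral>\<^sup>+x. ennreal \<bar>w x - v' x\<bar> \<partial>lborel) \<le> ennreal e1"
    for w e0 e1
    using assms(17,18,20) assms(19)[OF \<delta>] assms(21)[OF \<delta>]
    by (intro P.solution_difference_estimate[OF u0 u0d K0 K0' _ T _ _ _ assms(7) assms(13)[OF \<delta>]
          _ _ v(2,1,3) w v'(2,1,3) e0 e1 t]) (simp_all add: K0_def)
  have Y_eq: "X + 2 * L * T = Y" by (simp add: Y L_def)
  have Y0: "0 \<le> Y" unfolding Y_eq[symmetric] using X P.A.L_nonneg T by simp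
  \<comment> \<open>The error in the primitive for cell averages: \<open>\<delta>\<^sup>2\<close>
    from the data and the flux error accumulated over the time \<open>T\<close>.\<close>
  have C1_e: "\<delta>\<^sup>2 + T * e = C1 * \<delta>\<^sup>2"
    unfolding C1 e_def Mf_def[symmetric] Mg_def[symmetric] by (simp add: distrib_right)
  have C1_nonneg: "0 \<le> C1"
    unfolding C1 Mf_def[symmetric] Mg_def[symmetric] by (intro add_nonneg_nonneg mult_nonneg_nonneg M) (use T in simp_all)
  have sqrt_C1: "sqrt (Y * K3 * (C1 * \<delta>\<^sup>2)) = sqrt (Y * K3 * C1) * \<delta>"
    using \<delta> by (simp add: real_sqrt_mult)
  have D: "(\<integral>\<^sup>+x. ennreal \<bar>v x - v' x\<bar> \<partial>lborel) = L1_norm (\<lambda>x. u0 x - u0d \<delta> x)"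
  proof -
    have "AE x in lebesgue. u0 x = v x" "AE x in lebesgue. u0d \<delta> x = v' x"
      using v(3) v'(3) by (auto intro: AE_completion)
    then have "AE x in lebesgue. ennreal \<bar>u0 x - u0d \<delta> x\<bar> = ennreal \<bar>v x - v' x\<bar>"
      by eventually_elim simp
    then have "(\<integral>\<^sup>+x. ennreal \<bar>u0 x - u0d \<delta> x\<bar> \<partial>lebesgue) = (\<integral>\<^sup>+x. ennreal \<bar>v x - v' x\<bar> \<partial>lebesgue)"
      by (rule nn_integral_cong_AE)
    then show ?thesis unfolding L1_norm_def by (simp add: nn_integral_completion)
  qed
  show "L1_norm (\<lambda>x. u x t - ud \<delta> x t)
        \<le> ennreal (2 * sqrt (Y * K3 * C1) * \<delta>) + ennreal \<delta> * TV u0 + L1_norm (\<lambda>x. u0 x - u0d \<delta> x) \<and>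
      (cell_average_data X uL uR u0 \<delta> (u0d \<delta>) \<longrightarrow>
         L1_norm (\<lambda>x. u x t - ud \<delta> x t) \<le> ennreal (2 * sqrt (Y * K3 * C1) * \<delta>))"
  proof (intro conjI impI)
    show "L1_norm (\<lambda>x. u x t - ud \<delta> x t)
        \<le> ennreal (2 * sqrt (Y * K3 * C1) * \<delta>) + ennreal \<delta> * TV u0 + L1_norm (\<lambda>x. u0 x - u0d \<delta> x)"
    proof (cases "L1_norm (\<lambda>x. u0 x - u0d \<delta> x) = \<infinity>")
      case False
      define e1 where "e1 = enn2real (L1_norm (\<lambda>x. u0 x - u0d \<delta> x))"
      have e1: "0 \<le> e1" "ennreal e1 = L1_norm (\<lambda>x. u0 x - u0d \<delta> x)"
        using False by (simp_all add: e1_def less_top)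
      \<comment> \<open>The middle datum is \<open>u0\<close> itself: the primitives of the data
        coincide, so \<open>e0 = 0\<close>, and the whole change of data is paid in
        \<open>L\<^sup>1\<close> by contraction of the scheme with interpolated fluxes.\<close>
      have "L1_norm (\<lambda>x. u x t - ud \<delta> x t) \<le> ennreal (2 * sqrt ((X + 2 * L * T) * K3 * (0 + T * e)) + e1)"
        by (rule est[OF v(2,1) _ _ e1(1)]) (use D e1(2) in auto)
      also have "\<dots> \<le> ennreal (2 * sqrt (Y * K3 * C1) * \<delta> + e1)"
      proof (rule ennreal_leI)
        have "0 + T * e \<le> C1 * \<delta>\<^sup>2" unfolding C1_e[symmetric] by simp
        then have "sqrt (Y * K3 * (0 + T * e)) \<le> sqrt (Y * K3 * C1) * \<delta>"
          unfolding sqrt_C1[symmetric] using Y0 assms(17) by (intro real_sqrt_le_mono mult_left_mono) auto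
        then show "2 * sqrt ((X + 2 * L * T) * K3 * (0 + T * e)) + e1 \<le> 2 * sqrt (Y * K3 * C1) * \<delta> + e1"
          by (simp only: Y_eq)
      qed
      also have "\<dots> \<le> ennreal (2 * sqrt (Y * K3 * C1) * \<delta>) + ennreal e1"
        using Y0 C1_nonneg assms(17) \<delta> e1(1) by (simp add: ennreal_plus)
      also have "\<dots> \<le> ennreal (2 * sqrt (Y * K3 * C1) * \<delta>) + ennreal \<delta> * TV u0 + ennreal e1"
        by (intro add_right_mono) simp
      finally show ?thesis by (simp only: e1(2))
    qed simp
  next
    assume "cell_average_data X uL uR u0 \<delta> (u0d \<delta>)"
    then obtain N z where z: "z 0 = - X" "z N = X"
      and cell: "\<forall>i<N. z i < z (Suc i) \<and> z (Suc i) - z i \<le> \<delta> \<and> TV_on {z i<..<z (Suc i)} u0 \<le> ennreal \<delta> \<and>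
          (\<forall>x\<in>{z i..<z (Suc i)}. u0d \<delta> x = 1 / (z (Suc i) - z i) * (LINT y:{z i..z (Suc i)}|lebesgue. u0 y))"
      unfolding cell_average_data_def by blast
    have prim: "\<bar>\<integral>y. indicator {..x} y * (v y - v' y) \<partial>lborel\<bar> \<le> \<delta>\<^sup>2" for x
    proof (rule cell_average_primitive_bound[OF v(2) v'(2) v(1) v'(1) \<delta> z])
      fix i assume i: "i < N"
      show "z i < z (Suc i)" "z (Suc i) - z i \<le> \<delta>" using cell i by auto
      show "TV_on {z i<..<z (Suc i)} v \<le> ennreal \<delta>" using cell i TV_on_cong_AE[OF v(3)] by simp
      have "(LINT y:{z i..z (Suc i)}|lebesgue. u0 y) = (LINT y:{z i..z (Suc i)}|lebesgue. v y)"
        unfolding set_lebesgue_integral_def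
      proof (rule integral_cong_AE)
        show "AE y in lebesgue. indicator {z i..z (Suc i)} y *\<^sub>R u0 y = indicator {z i..z (Suc i)} y *\<^sub>R v y"
          using AE_completion[OF v(3)] by eventually_elim simp
      qed (intro borel_measurable_scaleR borel_measurable_indicator initial_dataD(1)[OF u0] initial_dataD(1)[OF v(2)]; simp)+
      also have "\<dots> = (\<integral>y. indicator {z i..z (Suc i)} y * v y \<partial>lborel)"
        unfolding set_lebesgue_integral_def real_scaleR_def using v(1) by (intro integral_completion) measurable
      finally have avg: "u0d \<delta> x = (\<integral>y. indicator {z i..z (Suc i)} y * v y \<partial>lborel) / (z (Suc i) - z i)"
        if "x \<in> {z i..<z (Suc i)}" for x using cell i that by simp
      show "AE x in lborel. x \<in> {z i<..<z (Suc i)} \<longrightarrow>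
          v' x = (\<integral>y. indicator {z i..z (Suc i)} y * v y \<partial>lborel) / (z (Suc i) - z i)"
        using v'(3) by eventually_elim (use avg in auto)
    qed
    \<comment> \<open>The middle datum is now the averaged one: the change of data is paid in the
      primitive, where it is quadratic in \<delta>, and nothing remains for the
      \<open>L\<^sup>1\<close> gap.\<close>
    have "L1_norm (\<lambda>x. u x t - ud \<delta> x t) \<le> ennreal (2 * sqrt ((X + 2 * L * T) * K3 * (\<delta>\<^sup>2 + T * e)) + 0)"
      by (rule est[OF v'(2,1) _ prim]) auto
    also have "\<dots> = ennreal (2 * sqrt (Y * K3 * C1) * \<delta>)" unfolding Y_eq C1_e sqrt_C1 by (simp add: mult.assoc)
    finally show "L1_norm (\<lambda>x. u x t - ud \<delta> x t) \<le> ennreal (2 * sqrt (Y * K3 * C1) * \<delta>)" .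
  qed
qed

end
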